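(* For every $\varepsilon > 0$ there exists $\delta > 0$ such that the following holds, where $m = m(n)$ is a function of $n$ and $G$ is a graph chosen uniformly at random from $\mathcal{F}^{\mathrm{ind}}_{n,m}(C_4)$. (a) If $n \ll m \le \delta n^{4/3}$, then asymptotically almost surely $G$ is $\varepsilon$-quasirandom. (b) If $n \ll m \le \delta n^{4/3} (\log n)^{1/3}$, then asymptotically almost surely $G$ is not $1/4$-close to a split graph. (c) If $n^{4/3} (\log n)^4 \le m \le \delta n^2$, then asymptotically almost surely $G$ is $\varepsilon$-close to a split graph.
   Context: $\mathcal{F}^{\mathrm{ind}}_{n,m}(C_4)$ denotes the family of all graphs on vertex set $\{1,\dots,n\}$ with exactly $m$ edges that contain no induced copy of the $4$-cycle $C_4$. "Asymptotically almost surely" (a.a.s.) means with probability tending to $1$ as $n \to \infty$; $f \ll g$ means $f/g \to 0$ as $n\to\infty$. A graph $G$ with $n$ vertices and $p\binom{n}{2}$ edges is $\varepsilon$-quasirandom if every subset of more than $\varepsilon n$ vertices of $G$ induces a subgraph with density between $(1-\varepsilon)p$ and $(1+\varepsilon)p$. A graph $G$ is $\varepsilon$-close to a split graph if there is a partition $V(G) = A \cup B$ with $e_G(A) \ge (1-\varepsilon)\binom{|A|}{2}$ and $e_G(B) \le \varepsilon\, e(G)$, where $e_G(X)$ is the number of edges of $G$ with both endpoints in $X$. *)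

theory Defs
  imports
    "HOL-Probability.Probability_Mass_Function"
    "HOL-Library.Ramsey"
    "HOL-Library.Landau_Symbols"
begin

text \<open>A simple graph on a vertex set \<open>V\<close> is given by its edge set \<open>E \<subseteq> [V]\<^bsup>2\<^esup>\<close>.\<close>

definition contains_induced :: "'a set \<Rightarrow> 'a set set \<Rightarrow> 'b set \<Rightarrow> 'b set set \<Rightarrow> bool" where
  "contains_induced V E W F \<longleftrightarrow>
     (\<exists>f. inj_on f W \<and> f ` W \<subseteq> V \<and>
          (\<forall>u\<in>W. \<forall>v\<in>W. u \<noteq> v \<longrightarrow> ({u, v} \<in> F \<longleftrightarrow> {f u, f v} \<in> E)))"

definition C4_verts :: "nat set" where
  "C4_verts = {0, 1, 2, 3}"

definition C4_edges :: "nat set set" where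
  "C4_edges = {{0, 1}, {1, 2}, {2, 3}, {3, 0}}"

definition induced_C4_free_graphs :: "nat \<Rightarrow> nat \<Rightarrow> nat set set set" where
  "induced_C4_free_graphs n m =
     {E. E \<subseteq> [{1..n}]\<^bsup>2\<^esup> \<and> card E = m \<and> \<not> contains_induced {1..n} E C4_verts C4_edges}"

definition edges_within :: "'a set set \<Rightarrow> 'a set \<Rightarrow> nat" where
  "edges_within E X = card {e \<in> E. e \<subseteq> X}"

text \<open>The density of a set of at most one vertex is \<open>0 / 0 = 0\<close>. This does not affect asymptotic
  statements about quasirandomness: subsets with more than \<open>\<epsilon> n\<close> vertices have at least two
  vertices once \<open>n \<ge> 1 / \<epsilon>\<close>.\<close>

definition edge_density :: "'a set set \<Rightarrow> 'a set \<Rightarrow> real" where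
  "edge_density E X = real (edges_within E X) / real (card X choose 2)"

definition quasirandom :: "real \<Rightarrow> 'a set \<Rightarrow> 'a set set \<Rightarrow> bool" where
  "quasirandom \<epsilon> V E \<longleftrightarrow>
     (\<forall>X. X \<subseteq> V \<and> real (card X) > \<epsilon> * real (card V) \<longrightarrow>
        (1 - \<epsilon>) * edge_density E V \<le> edge_density E X \<and>
        edge_density E X \<le> (1 + \<epsilon>) * edge_density E V)"

definition close_to_split :: "real \<Rightarrow> 'a set \<Rightarrow> 'a set set \<Rightarrow> bool" where
  "close_to_split \<epsilon> V E \<longleftrightarrow>
     (\<exists>A B. A \<union> B = V \<and> A \<inter> B = {} \<and>
        real (edges_within E A) \<ge> (1 - \<epsilon>) * real (card A choose 2) \<and>
        real (edges_within E B) \<le> \<epsilon> * real (card E))"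

text \<open>The \<open>n\<close>-th random object is drawn uniformly from \<open>S n\<close>. This is meaningful if \<open>S n\<close> is finite
  and nonempty for all large \<open>n\<close>; \<^const>\<open>pmf_of_set\<close> is unspecified on other sets.\<close>

definition asymptotically_almost_surely :: "(nat \<Rightarrow> 'a set) \<Rightarrow> (nat \<Rightarrow> 'a \<Rightarrow> bool) \<Rightarrow> bool" where
  "asymptotically_almost_surely S P \<longleftrightarrow>
     (\<lambda>n. measure_pmf.prob (pmf_of_set (S n)) {G. P n G}) \<longlonglongrightarrow> 1"

end

theory Submission
  imports Defs "HOL-Analysis.Analysis" "HOL-Real_Asymp.Real_Asymp"
begin

text \<open>
  (a) A deletion argument produces so many induced-\<open>C\<^sub>4\<close>-free graphs with \<open>m\<close> edges that the
  hypergeometric tail of a single too dense or too sparse vertex subset is negligible against them.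
  (b) Bipartite graphs of bounded degree without 4-cycles, weighted by \<open>lam\<close> to the number of edges, form a
  hard-core model. As in the theory of locally sparse graphs, its typical number of edges exceeds the deletion
  bound by a logarithmic factor, and the resulting number of graphs beats the number of near-split ones.
  (c) A container algorithm scans a fingerprint of the graph and repeatedly uses supersaturation
  of 4-cycles whose diagonals are known non-edges. The final containers are nearly split by stability, and
  comparing their total with the number of split graphs bounds the remaining graphs.
\<close>

text \<open>In (c) the difficulty is that forbidding an induced 4-cycle is not a monotone condition:
  a 4-cycle of a container contradicts nothing unless its diagonals are absent from the graph. The
  recursion therefore carries, besides the container, confirmed edges \<open>F\<close> and confirmed
  non-edges \<open>N0\<close>. Diagonals shared by too many cycles are queried; every edge found is
  charged a factor \<open>z\<close> of order 1/\<Lambda>, where \<Lambda> = ln (n/sqrt m), and is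
  repaid at the end because it is not chosen again. Three rounds of queries suffice, as two
  diagonals meet at most two of three disjoint query sets. When known edges themselves spoil the
  diagonals, they supply two sides of other 4-cycles. Both final counts have the main exponent m
  (\<Lambda> - ln \<Lambda>/2 + 1/2), that of split graphs with a clique on sqrt (m/\<Lambda>)
  vertices, so precision is needed down to a small multiple of m. In (b) an edge is blocked by
  partner edges at one of its ends; erasing these leaves a factor exp (- c) that may be as small as
  a fixed negative power of n, which is where the extra logarithm comes from.\<close>

abbreviation (input) rcard :: "'a set => real" where "rcard A \<equiv> real (card A)"

abbreviation (input) \<G> where "\<G> \<equiv> induced_C4_free_graphs"

section \<open>Fingerprints and one stage of the container algorithm\<close>

fun scan :: "('s set => 'e => 's set) => ('s set => 'e => bool) => 'e set => 'e list => 's set => 's set \<times> 'e set"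
where
 "scan add go A [] S = (S, {})"
| "scan add go A (e # es) S =
  (if e \<in> A & go S e
   then (fst (scan add go A es (S Un add S e)), insert e (snd (scan add go A es (S Un add S e))))
   else scan add go A es S)"

lemma scan_subset: "snd (scan add go A es S) <= A Int set es"
 by (induction es arbitrary: S) auto

lemma scan_mono: "S <= fst (scan add go A es S)"
proof (induction es arbitrary: S)
 case (Cons e es)
 have "S <= S Un add S e" by blast
 then show ?case using Cons[of "S Un add S e"] Cons[of S] by (auto simp del: Un_subset_iff)
qed simp

lemma scan_cong: "A Int set es = B Int set es ==> scan add go A es S = scan add go B es S"
proof (induction es arbitrary: S)
 case (Cons e es)
 have "A Int set es = B Int set es" "e \<in> A \<longleftrightarrow> e \<in> B" using Cons.prems by auto
 then show ?case using Cons.IH by simp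
qed simp

text \<open>Elements of \<open>A\<close> outside the fingerprint never change the state, so the
  fingerprint alone reproduces the run. This lets \<open>stage\<close> define its output from
  \<open>T\<close> while the graph stays unknown.\<close>

lemma scan_idem:
 "distinct es ==> scan add go (snd (scan add go A es S)) es S = scan add go A es S"
proof (induction es arbitrary: S)
 case (Cons e es)
 show ?case
 proof (cases "e \<in> A & go S e")
  case True
  let ?T = "snd (scan add go A es (S Un add S e))"
  have "insert e ?T Int set es = ?T Int set es" using Cons.prems by auto
  then have "scan add go (insert e ?T) es (S Un add S e) = scan add go ?T es (S Un add S e)"
   by (rule scan_cong)
  then show ?thesis using True Cons by simp
 next
  case False
  have "e ~: snd (scan add go A es S)" if "e ~: set es" using scan_subset[of add go A es S] that by auto
  then show ?thesis using False Cons by auto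
 qed
qed simp

text \<open>\<open>S1\<close> is the state at the moment the scan reaches \<open>e\<close>. For an
  element of \<open>A\<close> that was not taken, the failed test at that moment is all the
  information that the container can use.\<close>

lemma scan_visit:
 assumes "e \<in> A" "e \<in> set es"
 shows "\<exists>S1. S <= S1 & S1 <= fst (scan add go A es S) &
  (\<not> go S1 e \<or> S1 Un add S1 e <= fst (scan add go A es S))"
 using assms(2)
proof (induction es arbitrary: S)
 case (Cons x es)
 show ?case
 proof (cases "x = e")
  case True
  then show ?thesis using scan_mono[of S add go A "x # es"] scan_mono[of "S Un add S e" add go A es] assms
   by (intro exI[of _ S]) (auto simp del: Un_subset_iff)
 next
  case False
  with Cons have "e \<in> set es" by auto
  from Cons.IH[OF this, of S] Cons.IH[OF this, of "S Un add S x"] show ?thesis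
   by (simp del: Un_subset_iff) (metis Un_upper1 order_trans)
 qed
qed simp

lemma scan_invariant:
 assumes "P S" "\<And>S e. P S ==> e \<in> A ==> go S e ==> P (S Un add S e)"
 shows "P (fst (scan add go A es S))"
 using assms(1) by (induction es arbitrary: S) (auto intro: assms(2))

text \<open>Each accepted element adds at least \<open>d\<close> new members to a state still below
  \<open>b\<close>, so all acceptances but the last fit below \<open>b\<close>; hence the
  \<open>- 1\<close>.\<close>

lemma scan_card:
 assumes "finite H" "\<And>S e. add S e <= H - S" "\<And>S e. go S e ==> rcard S < b & d <= rcard (add S e)"
  and "S <= H" "distinct es"
 shows "snd (scan add go A es S) = {} \<or> (rcard (snd (scan add go A es S)) - 1)*d + rcard S < b"
 using assms(4,5)
proof (induction es arbitrary: S)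
 case (Cons e es)
 show ?case
 proof (cases "e \<in> A & go S e")
  case True
  let ?S = "S Un add S e" let ?T = "snd (scan add go A es ?S)"
  have sub: "?S <= H" using assms(2)[of S e] Cons.prems by auto
  have "finite (add S e)" "finite S" "S Int add S e = {}"
   using assms(1) assms(2)[of S e] Cons.prems by (auto intro: finite_subset)
  then have c: "card ?S = card S + card (add S e)" by (simp add: card_Un_disjoint)
  have g: "rcard S < b" "d <= rcard (add S e)" using assms(3)[of S e] True by auto
  have nin: "e ~: ?T" using scan_subset[of add go A es ?S] Cons.prems by auto
  have fT: "finite ?T" using scan_subset[of add go A es ?S] by (auto intro: finite_subset)
  have ins: "snd (scan add go A (e # es) S) = insert e ?T" using True by simp
  show ?thesis
  proof (cases "?T = {}")
   case True then show ?thesis unfolding ins using g by simp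
  next
   case False
   then have "(rcard ?T - 1)*d + rcard ?S < b" using Cons.IH[OF sub] Cons.prems by auto
   then show ?thesis unfolding ins using c g nin fT by (simp add: algebra_simps)
  qed
 next
  case False
  then show ?thesis using Cons by auto
 qed
qed simp

lemma card_UN_fibers:
 assumes "finite H" "finite U" "key ` H <= U"
 shows "card H = (\<Sum>e\<in>U. card {t\<in>H. key t = e})"
proof -
 have "H = (\<Union>e\<in>U. {t\<in>H. key t = e})" using assms(3) by auto
 then have "card H = card (\<Union>e\<in>U. {t\<in>H. key t = e})" by simp
 also have "... = (\<Sum>e\<in>U. card {t\<in>H. key t = e})"
  using assms by (intro card_UN_disjoint) auto
 finally show ?thesis .
qed

text \<open>A pair \<open>(i, z)\<close> is saturated in \<open>S\<close> when \<open>S\<close> has at least \<open>c i\<close> elements with \<open>i\<close>-th feature \<open>z\<close>.\<close>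

definition blocked :: "'i set => ('i \<times> 'k) set => ('i => 't => 'k) => ('i => real) => 't set => 't => bool" where
 "blocked Is Q \<phi> c S t \<longleftrightarrow>
  (\<exists>i\<in>Is. (i, \<phi> i t) \<in> Q & c i <= rcard {s\<in>S. \<phi> i s = \<phi> i t})"

lemma blocked_mono:
 assumes "finite S'" "S <= S'" "blocked Is Q \<phi> c S t"
 shows "blocked Is Q \<phi> c S' t"
proof -
 from assms(3) obtain i where i: "i \<in> Is" "(i, \<phi> i t) \<in> Q" "c i <= rcard {s\<in>S. \<phi> i s = \<phi> i t}"
  unfolding blocked_def by auto
 have "card {s\<in>S. \<phi> i s = \<phi> i t} <= card {s\<in>S'. \<phi> i s = \<phi> i t}"
  using assms by (intro card_mono) auto
 then show ?thesis unfolding blocked_def using i by (intro bexI[of _ i]) auto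
qed

text \<open>A saturated value uses up at least \<open>\<mu>*D i\<close> elements of
  \<open>S\<close>, and it blocks at most \<open>D i\<close> elements of \<open>H\<close>. The caps
  cancel, so the loss depends only on \<open>card S\<close> and the number of features.\<close>

lemma card_blocked:
 fixes D :: "'i => real"
 assumes fin: "finite H" "finite Is" and S: "S <= H" and mu: "\<mu> > 0"
  and Dpos: "\<And>i. i \<in> Is ==> D i > 0"
  and D: "\<And>i z. i \<in> Is ==> (i, z) \<in> Q ==> rcard {t\<in>H. \<phi> i t = z} <= D i"
 shows "rcard {t\<in>H. blocked Is Q \<phi> (%i. \<mu>*D i) S t} <= rcard Is*rcard S/\<mu>"
proof -
 have finS: "finite S" using S fin finite_subset by auto
 define Z where "Z i = {z. (i, z) \<in> Q & \<mu>*D i <= rcard {s\<in>S. \<phi> i s = z}}" for i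
 have Zsub: "Z i <= \<phi> i ` S" if "i \<in> Is" for i
 proof
  fix z assume "z \<in> Z i"
  moreover have "\<mu>*D i > 0" using mu Dpos that by simp
  ultimately have "card {s\<in>S. \<phi> i s = z} > 0" unfolding Z_def by auto
  then show "z \<in> \<phi> i ` S" by (auto simp: card_gt_0_iff)
 qed
 have finZ: "finite (Z i)" if "i \<in> Is" for i using Zsub[OF that] finS finite_subset by blast
 have cZ: "rcard (Z i)*(\<mu>*D i) <= rcard S" if i: "i \<in> Is" for i
 proof -
  have "rcard (Z i)*(\<mu>*D i) = (\<Sum>z\<in>Z i. \<mu>*D i)" by simp
  also have "... <= (\<Sum>z\<in>Z i. rcard {s\<in>S. \<phi> i s = z})" by (intro sum_mono) (auto simp: Z_def)
  also have "... = rcard (\<Union>z\<in>Z i. {s\<in>S. \<phi> i s = z})"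
   using finZ[OF i] finS by (subst card_UN_disjoint) auto
  also have "... <= rcard S" using finS by (intro of_nat_mono card_mono) auto
  finally show ?thesis .
 qed
 have "{t\<in>H. blocked Is Q \<phi> (%i. \<mu>*D i) S t} <= (\<Union>i\<in>Is. \<Union>z\<in>Z i. {t\<in>H. \<phi> i t = z})"
  by (auto simp: blocked_def Z_def)
 then have "card {t\<in>H. blocked Is Q \<phi> (%i. \<mu>*D i) S t} <= card (\<Union>i\<in>Is. \<Union>z\<in>Z i. {t\<in>H. \<phi> i t = z})"
  using fin finZ by (intro card_mono) auto
 also have "... <= (\<Sum>i\<in>Is. card (\<Union>z\<in>Z i. {t\<in>H. \<phi> i t = z}))" by (rule card_UN_le[OF fin(2)])
 also have "... <= (\<Sum>i\<in>Is. \<Sum>z\<in>Z i. card {t\<in>H. \<phi> i t = z})"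
  by (intro sum_mono card_UN_le finZ)
 finally have "rcard {t\<in>H. blocked Is Q \<phi> (%i. \<mu>*D i) S t}
   <= (\<Sum>i\<in>Is. \<Sum>z\<in>Z i. rcard {t\<in>H. \<phi> i t = z})"
  by (metis (mono_tags, lifting) of_nat_le_iff of_nat_sum sum.cong)
 also have "... <= (\<Sum>i\<in>Is. \<Sum>z\<in>Z i. D i)" by (intro sum_mono D) (auto simp: Z_def)
 also have "... = (\<Sum>i\<in>Is. rcard (Z i)*D i)" by simp
 also have "... <= (\<Sum>i\<in>Is. rcard S/\<mu>)"
  using cZ mu by (intro sum_mono) (simp add: field_simps)
 finally show ?thesis by simp
qed

text \<open>If the state reaches the share \<theta> of \<open>H\<close>, it is the wanted subfamily
  with all keys in \<open>A\<close>. Otherwise at most a quarter of \<open>H\<close> is in the state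
  and at most a quarter is blocked. Half of \<open>H\<close> is still addable, and since a key
  carries at most \<open>K\<close> times the average, many keys have a large \<open>add\<close>;
  none of these can belong to \<open>A\<close>.\<close>

lemma stage:
 fixes H :: "'t set" and key :: "'t => 'e" and \<phi> :: "'i => 't => 'k" and D Dk :: "'i => real"
 assumes fin: "finite H" "finite U" "finite Is" and Hne: "H ~= {}" and key: "key ` H <= U"
  and Is: "card Is <= 16" and lam: "0 < \<theta>" "\<theta> <= 1/4"
  and Dpos: "\<And>i. i \<in> Is ==> D i > 0"
  and D: "\<And>i z. i \<in> Is ==> (i, z) \<in> Q ==> rcard {t\<in>H. \<phi> i t = z} <= D i"
  and Dk: "\<And>i z e. i \<in> Is ==> (i, z) \<in> Q ==> rcard {t\<in>H. \<phi> i t = z & key t = e} <= Dk i"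
  and keydeg: "\<And>e. rcard {t\<in>H. key t = e} <= K*rcard H/rcard U"
 shows "\<exists>out :: 'e set => 't set + 'e set. \<forall>A. \<exists>T. T <= A Int U & rcard T <= 4*\<theta>*rcard U + 1 &
  (case out T of
   Inl H' => H' <= H & key ` H' <= A & \<theta>*rcard H <= rcard H' &
     (\<forall>i\<in>Is. \<forall>z. (i, z) \<in> Q --> rcard {t\<in>H'. \<phi> i t = z} <= 64*\<theta>*D i + Dk i)
  | Inr C => A Int U <= C & C <= U & rcard C <= (1 - 1/(4*K))*rcard U)"
proof -
 obtain us where us: "set us = U" "distinct us" using finite_distinct_list[OF fin(2)] by auto
 \<comment> \<open>64 is four times the bound 16 on the number of features, so that
   \<open>card_blocked\<close> loses at most a quarter of \<open>H\<close>.\<close>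
 define c where "c i = 64*\<theta>*D i" for i
 define add where "add S e = {t\<in>H - S. key t = e & \<not> blocked Is Q \<phi> c S t}" for S e
 define d where "d = rcard H/(4*rcard U)"
 define b where "b = \<theta>*rcard H"
 define go where "go S e \<longleftrightarrow> rcard S < b & d <= rcard (add S e)" for S e
 define fin_state where "fin_state A = fst (scan add go A us {})" for A
 define out where "out T = (if b <= rcard (fin_state T) then Inl (fin_state T)
  else Inr {e\<in>U. rcard (add (fin_state T) e) < d})" for T
 have Hpos: "rcard H > 0" using Hne fin by (simp add: card_gt_0_iff)
 have Une: "U ~= {}" using Hne key by auto
 then have Upos: "rcard U > 0" using fin by (simp add: card_gt_0_iff)
 have dpos: "d > 0" using Hpos Upos by (simp add: d_def)
 have inv: "fin_state A <= H & key ` fin_state A <= A &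
   (\<forall>i\<in>Is. \<forall>z. (i, z) \<in> Q --> rcard {t\<in>fin_state A. \<phi> i t = z} <= c i + Dk i)" for A
  unfolding fin_state_def
 proof (rule scan_invariant[where P = "%S. S <= H & key ` S <= A &
   (\<forall>i\<in>Is. \<forall>z. (i, z) \<in> Q --> rcard {t\<in>S. \<phi> i t = z} <= c i + Dk i)"], goal_cases)
  case 1
  have "0 <= Dk i" if "i \<in> Is" "(i, z) \<in> Q" for i z using Dk[OF that] order_trans of_nat_0_le_iff by blast
  moreover have "0 <= c i" if "i \<in> Is" for i using Dpos[OF that] lam by (simp add: c_def)
  ultimately show ?case by simp
 next
  case (2 S e)
  have "rcard {t\<in>S Un add S e. \<phi> i t = z} <= c i + Dk i" if i: "i \<in> Is" "(i, z) \<in> Q" for i z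
  proof (cases "c i <= rcard {t\<in>S. \<phi> i t = z}")
   case True
   then have "{t\<in>S Un add S e. \<phi> i t = z} = {t\<in>S. \<phi> i t = z}"
    using i by (auto simp: add_def blocked_def)
   then show ?thesis using 2 i by auto
  next
   case False
   \<comment> \<open>A value below its threshold can overshoot only in the one batch with key
     \<open>e\<close>, hence by at most \<open>Dk i\<close>.\<close>
   have "{t\<in>S Un add S e. \<phi> i t = z} <= {t\<in>S. \<phi> i t = z} Un {t\<in>H. \<phi> i t = z & key t = e}"
    by (auto simp: add_def)
   then have "card {t\<in>S Un add S e. \<phi> i t = z} <= card ({t\<in>S. \<phi> i t = z} Un {t\<in>H. \<phi> i t = z & key t = e})"
    using fin finite_subset[of S H] 2 by (intro card_mono) auto
   also have "... <= card {t\<in>S. \<phi> i t = z} + card {t\<in>H. \<phi> i t = z & key t = e}" by (rule card_Un_le)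
   finally show ?thesis using False Dk[OF i, of e] by linarith
  qed
  then show ?case using 2 by (auto simp: add_def)
 qed
 show ?thesis
 proof (rule exI[of _ out], rule allI)
  fix A
  define T where "T = snd (scan add go A us {})"
  have T: "T <= A Int U" unfolding T_def using scan_subset us by fastforce
  have eq: "fin_state T = fin_state A" unfolding fin_state_def T_def using scan_idem[OF us(2)] by metis
  let ?S = "fin_state A"
  have SH: "?S <= H" using inv[of A] by auto
  then have finS: "finite ?S" using fin finite_subset by auto
  have "T = {} \<or> (rcard T - 1)*d + rcard ({}::'t set) < b"
   unfolding T_def by (rule scan_card[OF fin(1)]) (auto simp: add_def go_def us)
  then have "rcard T <= b/d + 1"
  proof
   assume "T = {}" then show ?thesis using lam dpos by (simp add: b_def)
  next
   assume "(rcard T - 1)*d + rcard ({}::'t set) < b"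
   then show ?thesis using dpos by (simp add: field_simps)
  qed
  moreover have "b/d = 4*\<theta>*rcard U" using Hpos Upos by (simp add: b_def d_def)
  ultimately have Tc: "rcard T <= 4*\<theta>*rcard U + 1" by simp
  have "case out T of
   Inl H' => H' <= H & key ` H' <= A & \<theta>*rcard H <= rcard H' &
     (\<forall>i\<in>Is. \<forall>z. (i, z) \<in> Q --> rcard {t\<in>H'. \<phi> i t = z} <= 64*\<theta>*D i + Dk i)
  | Inr C => A Int U <= C & C <= U & rcard C <= (1 - 1/(4*K))*rcard U"
  proof (cases "b <= rcard ?S")
   case True
   then show ?thesis using inv[of A] by (simp add: out_def eq b_def c_def)
  next
   case False
   \<comment> \<open>\<open>add\<close> shrinks as the state grows, because more gets blocked. So a
     rejected member of \<open>A\<close> still has few addable elements at the end, and an accepted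
     one has none; both land in \<open>C\<close>.\<close>
   define C where "C = {e\<in>U. rcard (add ?S e) < d}"
   have "e \<in> C" if eA: "e \<in> A" "e \<in> U" for e
   proof -
    obtain S1 where S1: "S1 <= ?S" "\<not> go S1 e \<or> S1 Un add S1 e <= ?S"
     using scan_visit[of e A us "{}" add go] eA us unfolding fin_state_def by metis
    have anti: "add ?S e <= add S1 e"
     using blocked_mono[OF finS S1(1), of Is Q \<phi> c] S1(1) unfolding add_def by blast
    have "finite (add S1 e)" using fin by (simp add: add_def)
    from S1(2) have "rcard (add ?S e) < d"
    proof
     assume "\<not> go S1 e"
     moreover have "card S1 <= card ?S" using S1(1) finS by (rule card_mono[rotated])
     ultimately have "rcard (add S1 e) < d" using False by (auto simp: go_def)
     moreover have "card (add ?S e) <= card (add S1 e)" using anti \<open>finite (add S1 e)\<close> by (rule card_mono[rotated])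
     ultimately show ?thesis by linarith
    next
     assume "S1 Un add S1 e <= ?S"
     then have "add ?S e = {}" using anti by (auto simp: add_def)
     then show ?thesis using dpos by simp
    qed
    then show ?thesis using eA by (simp add: C_def)
   qed
   then have sub: "A Int U <= C" by auto
   let ?B = "{t\<in>H. blocked Is Q \<phi> c ?S t}"
   have "rcard ?B <= rcard Is*rcard ?S/(64*\<theta>)"
    unfolding c_def by (rule card_blocked) (use fin SH lam Dpos D in auto)
   also have "... <= 16*b/(64*\<theta>)"
    using Is False lam by (intro divide_right_mono mult_mono) auto
   also have "... = rcard H/4" using lam by (simp add: b_def)
   finally have cB: "rcard ?B <= rcard H/4" .
   have cS: "rcard ?S <= rcard H/4"
   proof -
    have "rcard ?S <= \<theta>*rcard H" using False by (simp add: b_def)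
    also have "... <= 1/4*rcard H" using lam by (intro mult_right_mono) auto
    finally show ?thesis by simp
   qed
   let ?R = "{t\<in>H - ?S. \<not> blocked Is Q \<phi> c ?S t}"
   have "card H <= card (?R Un (?S Un ?B))" using fin finS by (intro card_mono) auto
   also have "... <= card ?R + (card ?S + card ?B)" by (meson add_left_mono card_Un_le le_trans)
   finally have cR: "rcard H/2 <= rcard ?R" using cB cS by linarith
   have "card ?R = (\<Sum>e\<in>U. card {t\<in>?R. key t = e})" by (rule card_UN_fibers) (use fin key in auto)
   also have "... = (\<Sum>e\<in>U. card (add ?S e))" by (intro sum.cong arg_cong[where f = card]) (auto simp: add_def)
   finally have "rcard ?R = (\<Sum>e\<in>U. rcard (add ?S e))" by simp
   also have "... = (\<Sum>e\<in>C. rcard (add ?S e)) + (\<Sum>e\<in>U - C. rcard (add ?S e))"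
    by (subst add.commute, rule sum.subset_diff) (use fin in \<open>auto simp: C_def\<close>)
   also have "... <= (\<Sum>e\<in>C. d) + (\<Sum>e\<in>U - C. K*rcard H/rcard U)"
   proof (intro add_mono sum_mono)
    fix e assume "e \<in> C" then show "rcard (add ?S e) <= d" by (simp add: C_def)
   next
    fix e assume "e \<in> U - C"
    have "card (add ?S e) <= card {t\<in>H. key t = e}" using fin by (intro card_mono) (auto simp: add_def)
    then show "rcard (add ?S e) <= K*rcard H/rcard U" using keydeg[of e] by linarith
   qed
   also have "... = rcard C*d + rcard (U - C)*(K*rcard H/rcard U)" by simp
   also have "rcard C*d <= rcard U*d"
    using dpos fin by (intro mult_right_mono) (auto simp: C_def intro!: card_mono)
   also have "rcard U*d = rcard H/4" using Upos by (simp add: d_def)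
   finally have k: "rcard H/4 <= rcard (U - C)*(K*rcard H/rcard U)" using cR by linarith
   have Kpos: "K > 0"
   proof (rule ccontr)
    assume "\<not> K > 0"
    then have "rcard (U - C)*(K*rcard H/rcard U) <= 0"
     by (simp add: mult_nonneg_nonpos mult_nonpos_nonneg divide_nonpos_nonneg)
    then show False using k Hpos by linarith
   qed
   have "rcard U/(4*K) <= rcard (U - C)"
    using k Hpos Upos Kpos by (simp add: field_simps)
   moreover have "card (U - C) + card C = card U"
   proof -
    have CU: "C <= U" by (auto simp: C_def)
    then have "finite C" using fin finite_subset by blast
    then show ?thesis using card_Diff_subset[OF _ CU] card_mono[OF fin(2) CU] by linarith
   qed
   ultimately have "rcard C <= (1 - 1/(4*K))*rcard U"
    by (simp add: algebra_simps)
   then show ?thesis using False sub by (auto simp: out_def eq C_def)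
  qed
  then show "\<exists>T. T <= A Int U & rcard T <= 4*\<theta>*rcard U + 1 &
  (case out T of
   Inl H' => H' <= H & key ` H' <= A & \<theta>*rcard H <= rcard H' &
     (\<forall>i\<in>Is. \<forall>z. (i, z) \<in> Q --> rcard {t\<in>H'. \<phi> i t = z} <= 64*\<theta>*D i + Dk i)
  | Inr C => A Int U <= C & C <= U & rcard C <= (1 - 1/(4*K))*rcard U)"
   using T Tc by blast
 qed
qed

section \<open>Several stages on 4-tuples with caps on sub-tuples\<close>

lemma nths_eq_iff:
 "length s = length t ==> nths s I = nths t I \<longleftrightarrow> (\<forall>i\<in>I. i < length s --> s ! i = t ! i)"
proof (induction s t arbitrary: I rule: list_induct2)
 case (Cons x xs y ys)
 have "(\<forall>i\<in>I. i < length (x # xs) --> (x # xs) ! i = (y # ys) ! i) \<longleftrightarrow>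
  (0 \<in> I --> x = y) & (\<forall>i\<in>{j. Suc j \<in> I}. i < length xs --> xs ! i = ys ! i)"
  by (auto simp: less_Suc_eq_0_disj)
 moreover have "nths (x # xs) I = nths (y # ys) I \<longleftrightarrow>
  (0 \<in> I --> x = y) & nths xs {j. Suc j \<in> I} = nths ys {j. Suc j \<in> I}"
  by (auto simp: nths_Cons)
 ultimately show ?case using Cons.IH by simp
qed simp

text \<open>A feature is a set of positions, read off a tuple by \<open>nths\<close>. Closure under
  union is what makes the recursion for the caps work.\<close>

definition Feat :: "nat set set" where "Feat = {I. I <= {..<4} & 2 <= card I}"

lemma finite_Feat: "finite Feat" and card_Feat: "card Feat <= 16"
proof -
 have sub: "Feat <= Pow {..<4}" by (auto simp: Feat_def)
 then show "finite Feat" by (rule finite_subset) simp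
 have "card Feat <= card (Pow {..<4::nat})" using sub by (intro card_mono) auto
 also have "... = 16" by (simp add: card_Pow)
 finally show "card Feat <= 16" .
qed

lemma Feat_Un: "I \<in> Feat ==> J \<in> Feat ==> I Un J \<in> Feat"
proof -
 assume a: "I \<in> Feat" "J \<in> Feat"
 then have "finite (I Un J)" by (auto simp: Feat_def intro: finite_subset)
 then have "card I <= card (I Un J)" by (intro card_mono) auto
 then show ?thesis using a by (auto simp: Feat_def)
qed

text \<open>Fixing the entries at \<open>I\<close> and the key at \<open>J\<close> fixes those at
  \<open>I Un J\<close>. So \<open>D (I Un J)\<close> is the overshoot \<open>Dk\<close> of
  \<open>stage\<close>, and the other summand is its threshold.\<close>

definition Dstep :: "real => nat set => (nat set => real) => nat set => real" where
 "Dstep \<mu> J D I = \<mu>*D I + D (I Un J)"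

text \<open>Secures the hypothesis \<open>keydeg\<close> of \<open>stage\<close> at every stage:
  \<open>N\<close> is a lower bound for the surviving tuples and \<open>u\<close> the number of
  keys, so no key exceeds \<open>K\<close> times the average.\<close>

fun stages_ok :: "real => real => real => nat set list => real => (nat set => real) => bool" where
 "stages_ok K u \<theta> [] N D \<longleftrightarrow> True"
| "stages_ok K u \<theta> (J # Js) N D \<longleftrightarrow>
  D J <= K*N/u & stages_ok K u \<theta> Js (\<theta>*N) (Dstep (64*\<theta>) J D)"

definition num_prints :: "'e set => real => nat" where
 "num_prints U b = card {T. T <= U & rcard T <= b}"

lemma num_prints_ge1: "finite U ==> b >= 0 ==> num_prints U b >= 1"
proof -
 assume a: "finite U" "b >= 0"
 have "card {{}::'a set} <= card {T. T <= U & rcard T <= b}" using a by (intro card_mono) auto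
 then show ?thesis by (simp add: num_prints_def)
qed

text \<open>Values in \<open>Nn I\<close> are exempt: they will be the diagonals known to be
  non-edges, which may lie in arbitrarily many 4-cycles without harm.\<close>

definition caps :: "(nat set => nat list set) => (nat set => real) => nat list set => bool" where
 "caps Nn D H \<longleftrightarrow> (\<forall>I\<in>Feat. \<forall>z. z ~: Nn I --> rcard {t\<in>H. nths t I = z} <= D I)"

definition stage_outcome where
 "stage_outcome U K A Js N H Nn D outc \<longleftrightarrow>
  (case outc of
   Inl H' => H' <= H & (\<forall>t\<in>H'. \<forall>J\<in>set Js. nths t J \<in> A) & N <= rcard H' & caps Nn D H'
  | Inr C => A Int U <= C & C <= U & rcard C <= (1 - 1/(4*K))*rcard U)"

text \<open>The fingerprint of one stage fixes either a container or a smaller family, on which the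
  next key position is scanned. The number of outcomes is multiplied by at most
  \<open>num_prints\<close> per stage.\<close>

lemma stages:
 fixes H :: "nat list set" and U :: "nat list set"
 assumes "finite H" "finite U" and len: "\<And>t. t \<in> H ==> length t = 4"
  and key: "\<And>t J. t \<in> H ==> J \<in> set Js ==> nths t J \<in> U"
  and Js: "\<And>J. J \<in> set Js ==> J \<in> Feat & Nn J = {} "
  and Nn: "\<And>I. card I >= 3 ==> Nn I = {}"
  and theta: "0 < \<theta>" "\<theta> <= 1/4" and K: "K >= 0"
  and Dpos: "\<And>I. I \<in> Feat ==> D I > 0" and caps: "caps Nn D H"
  and N: "0 < N" "N <= rcard H"
  and ok: "stages_ok K (rcard U) \<theta> Js N D"
 shows "\<exists>OC. finite OC & card OC <= num_prints U (4*\<theta>*rcard U + 1)^length Js &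
  (\<forall>A. \<exists>outc\<in>OC. stage_outcome U K A Js (\<theta>^length Js*N) H Nn (fold (Dstep (64*\<theta>)) Js D) outc)"
 using assms(1) len key Js Dpos caps N ok
proof (induction Js arbitrary: H D N)
 case Nil
 then show ?case
  by (intro exI[of _ "{Inl H}"]) (auto simp: stage_outcome_def)
next
 case (Cons J Js)
 let ?b = "4*\<theta>*rcard U + 1"
 let ?P = "num_prints U ?b"
 have P1: "1 <= ?P" using theta by (intro num_prints_ge1 assms) auto
 have JF: "J \<in> Feat" "Nn J = {}" using Cons.prems(4)[of J] by auto
 have Hne: "H ~= {}" using Cons.prems by auto
 have Dk: "rcard {t\<in>H. nths t I = z & nths t J = e} <= D (I Un J)"
  if I: "I \<in> Feat" "(I, z) \<in> {(I, z). z ~: Nn I}" for I z e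
 proof -
  let ?S = "{t\<in>H. nths t I = z & nths t J = e}"
  have IJ: "I Un J \<in> Feat"
   using I JF Feat_Un by auto
  show ?thesis
  proof (cases "?S = {}")
   case True
   then have "rcard ?S = 0" by (metis card.empty of_nat_0)
   then show ?thesis using Cons.prems(5)[OF IJ] by linarith
  next
   case False
   then obtain t0 where t0: "t0 \<in> ?S" by auto
   have sub: "?S <= {t\<in>H. nths t (I Un J) = nths t0 (I Un J)}"
   proof
    fix t assume t: "t \<in> ?S"
    have l: "length t = length t0" using t t0 Cons.prems(2) by auto
    have "nths t I = nths t0 I" "nths t J = nths t0 J" using t t0 by auto
    then have "nths t (I Un J) = nths t0 (I Un J)" unfolding nths_eq_iff[OF l] by auto
    then show "t \<in> {t\<in>H. nths t (I Un J) = nths t0 (I Un J)}" using t by simp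
   qed
   \<comment> \<open>The cap at \<open>I Un J\<close> may be used only for a value that is not
     exempt. If neither set contains the other, the union has at least three positions, where
     nothing is exempt.\<close>
   have tr: "nths t0 (I Un J) ~: Nn (I Un J)"
   proof (cases "J <= I")
    case True
    then have "I Un J = I" by auto
    then show ?thesis using t0 I by auto
   next
    case False
    show ?thesis
    proof (cases "I <= J")
     case True
     then have "I Un J = J" by auto
     then show ?thesis using JF by auto
    next
     case nIJ: False
     then obtain i where i: "i \<in> I" "i ~: J" by auto
     have fJ: "finite J" "2 <= card J" "finite I" using JF I by (auto simp: Feat_def intro: finite_subset)
     have "card (insert i J) <= card (I Un J)" using i fJ by (intro card_mono) auto
     then have "3 <= card (I Un J)" using i fJ by simp
     then show ?thesis using Nn by simp
    qed
   qed
   have "card ?S <= card {t\<in>H. nths t (I Un J) = nths t0 (I Un J)}"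
    using sub Cons.prems(1) by (intro card_mono) auto
   then show ?thesis using Cons.prems(6) IJ tr unfolding caps_def by fastforce
  qed
 qed
 have keydeg: "rcard {t\<in>H. nths t J = e} <= K*rcard H/rcard U" for e
 proof -
  have "rcard {t\<in>H. nths t J = e} <= D J" using Cons.prems(6) JF unfolding caps_def by auto
  also have "... <= K*N/rcard U" using Cons.prems(9) by simp
  also have "... <= K*rcard H/rcard U"
   using Cons.prems(8) K by (intro divide_right_mono mult_left_mono) auto
  finally show ?thesis .
 qed
 have "\<exists>out :: nat list set => nat list set + nat list set. \<forall>A. \<exists>T. T <= A Int U & rcard T <= ?b &
  (case out T of
   Inl H' => H' <= H & (%t. nths t J) ` H' <= A & \<theta>*rcard H <= rcard H' &
     (\<forall>i\<in>Feat. \<forall>z. (i, z) \<in> {(I, z). z ~: Nn I} --> rcard {t\<in>H'. nths t i = z} <= 64*\<theta>*D i + D (i Un J))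
  | Inr C => A Int U <= C & C <= U & rcard C <= (1 - 1/(4*K))*rcard U)"
  by (rule stage[where \<phi> = "%I t. nths t I" and Dk = "%I. D (I Un J)"])
   (use Cons.prems assms(2) finite_Feat Hne card_Feat theta Dk keydeg in \<open>auto simp: caps_def\<close>)
 then obtain out where out0: "\<forall>A. \<exists>T. T <= A Int U & rcard T <= ?b &
  (case out T of
   Inl H' => H' <= H & (%t. nths t J) ` H' <= A & \<theta>*rcard H <= rcard H' &
     (\<forall>i\<in>Feat. \<forall>z. (i, z) \<in> {(I, z). z ~: Nn I} --> rcard {t\<in>H'. nths t i = z} <= 64*\<theta>*D i + D (i Un J))
  | Inr C => A Int U <= C & C <= U & rcard C <= (1 - 1/(4*K))*rcard U)"
  by (rule exE)
 let ?D' = "Dstep (64*\<theta>) J D"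
 define good where "good H' \<longleftrightarrow> H' <= H & \<theta>*N <= rcard H' & caps Nn ?D' H'" for H'
 let ?concl = "%H' OC. finite OC & card OC <= ?P^length Js &
  (\<forall>A. \<exists>outc\<in>OC. stage_outcome U K A Js (\<theta>^length Js*(\<theta>*N)) H' Nn (fold (Dstep (64*\<theta>)) Js ?D') outc)"
 have IJ: "I Un J \<in> Feat" if "I \<in> Feat" for I
  using that JF Feat_Un by auto
 have ex: "\<exists>OC. ?concl H' OC" if "good H'" for H'
 proof (rule Cons.IH)
  show "finite H'" using that Cons.prems(1) finite_subset by (auto simp: good_def)
  show "length t = 4" if "t \<in> H'" for t using that \<open>good H'\<close> Cons.prems(2) by (auto simp: good_def)
  show "nths t J' \<in> U" if "t \<in> H'" "J' \<in> set Js" for t J' using that \<open>good H'\<close> Cons.prems(3) by (auto simp: good_def)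
  show "J' \<in> Feat & Nn J' = {}" if "J' \<in> set Js" for J' using that Cons.prems(4) by auto
  show "0 < Dstep (64*\<theta>) J D I" if "I \<in> Feat" for I
   using Cons.prems(5)[OF that] Cons.prems(5)[OF IJ[OF that]] theta by (auto simp: Dstep_def intro!: add_pos_pos)
  show "caps Nn ?D' H'" using that by (simp add: good_def)
  show "0 < \<theta>*N" using theta Cons.prems by simp
  show "\<theta>*N <= rcard H'" using that by (simp add: good_def)
  show "stages_ok K (rcard U) \<theta> Js (\<theta>*N) ?D'" using Cons.prems by simp
 qed
 \<comment> \<open>The outcomes are chosen for each \<open>H'\<close> before \<open>A\<close> is
   known, so that the final union does not depend on \<open>A\<close>.\<close>
 define OF where "OF H' = (SOME OC. ?concl H' OC)" for H'
 have OF: "?concl H' (OF H')" if "good H'" for H'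
  unfolding OF_def by (rule someI_ex) (rule ex[OF that])
 define PR where "PR = {T. T <= U & rcard T <= ?b}"
 have finPR: "finite PR" unfolding PR_def using assms(2) by simp
 have cPR: "card PR = ?P" by (simp add: PR_def num_prints_def)
 define G where "G T = (case out T of Inl H' => if good H' then OF H' else {} | Inr C => {Inr C})" for T
 have Gfin: "finite (G T)" and Gc: "card (G T) <= ?P^length Js" for T
  using OF P1 by (auto simp: G_def split: sum.splits)
 show ?case
 proof (rule exI[of _ "\<Union>T\<in>PR. G T"], intro conjI allI)
  show "finite (\<Union>T\<in>PR. G T)" using finPR Gfin by auto
  have "card (\<Union>T\<in>PR. G T) <= (\<Sum>T\<in>PR. card (G T))" by (rule card_UN_le[OF finPR])
  also have "... <= (\<Sum>T\<in>PR. ?P^length Js)" by (intro sum_mono Gc)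
  also have "... = ?P^length (J # Js)" by (simp add: cPR)
  finally show "card (\<Union>T\<in>PR. G T) <= ?P^length (J # Js)" .
  fix A
  obtain T where T: "T <= A Int U" "rcard T <= ?b"
   and o: "case out T of
   Inl H' => H' <= H & (%t. nths t J) ` H' <= A & \<theta>*rcard H <= rcard H' &
     (\<forall>i\<in>Feat. \<forall>z. (i, z) \<in> {(I, z). z ~: Nn I} --> rcard {t\<in>H'. nths t i = z} <= 64*\<theta>*D i + D (i Un J))
  | Inr C => A Int U <= C & C <= U & rcard C <= (1 - 1/(4*K))*rcard U"
   using out0 by blast
  have TP: "T \<in> PR" using T by (auto simp: PR_def)
  show "\<exists>outc\<in>\<Union>T\<in>PR. G T. stage_outcome U K A (J # Js) (\<theta>^length (J # Js)*N) H Nn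
    (fold (Dstep (64*\<theta>)) (J # Js) D) outc"
  proof (cases "out T")
   case (Inr C)
   then have "Inr C \<in> G T" "stage_outcome U K A (J # Js) (\<theta>^length (J # Js)*N) H Nn
    (fold (Dstep (64*\<theta>)) (J # Js) D) (Inr C)" using o by (auto simp: G_def stage_outcome_def)
   then show ?thesis using TP by blast
  next
   case (Inl H')
   have g: "good H'"
   proof -
    have "\<theta>*N <= \<theta>*rcard H" using Cons.prems(8) theta by simp
    also have "... <= rcard H'" using o Inl by simp
    finally show ?thesis using o Inl by (simp add: good_def caps_def Dstep_def)
   qed
   from OF[OF g] obtain outc where oc: "outc \<in> OF H'"
    "stage_outcome U K A Js (\<theta>^length Js*(\<theta>*N)) H' Nn (fold (Dstep (64*\<theta>)) Js ?D') outc" by blast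
   have hA: "nths t J \<in> A" if "t \<in> H'" for t using o Inl that by auto
   have "outc \<in> G T" using oc(1) g Inl by (simp add: G_def)
   moreover have "stage_outcome U K A (J # Js) (\<theta>^length (J # Js)*N) H Nn
    (fold (Dstep (64*\<theta>)) (J # Js) D) outc"
    using oc(2) o Inl hA by (auto simp: stage_outcome_def mult.assoc mult.left_commute split: sum.splits)
   ultimately show ?thesis using TP by blast
  qed
 qed
qed

section \<open>Containers of graphs: shrinking by 4-cycles and by quadruples\<close>

definition dire :: "nat set set => nat list set" where
 "dire E = {[a, b] | a b. {a, b} \<in> E}"

lemma dire_mem [simp]: "[a, b] \<in> dire E \<longleftrightarrow> {a, b} \<in> E"
 by (auto simp: dire_def)

lemma dire_mono: "E <= E' ==> dire E <= dire E'"
 by (auto simp: dire_def)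

lemma finite_card_dire:
 assumes "E <= nsets V 2" "finite E"
 shows "finite (dire E)" "card (dire E) = 2*card E"
proof -
 let ?f = "%e. {[a, b] | a b. {a, b} = e}"
 have eq: "dire E = (\<Union>e\<in>E. ?f e)" by (auto simp: dire_def)
 have two: "finite (?f e) & card (?f e) = 2" if e: "e \<in> E" for e
 proof -
  have "card e = 2" using e assms by (auto simp: nsets_def)
  then obtain x y where xy: "e = {x, y}" "x ~= y" by (auto simp: card_2_iff)
  have "?f e = {[x, y], [y, x]}" unfolding xy(1) by (auto simp: doubleton_eq_iff)
  then show ?thesis using xy by simp
 qed
 show "finite (dire E)" unfolding eq using assms two by auto
 have "card (\<Union>e\<in>E. ?f e) = (\<Sum>e\<in>E. card (?f e))"
  using assms two by (intro card_UN_disjoint) auto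
 then show "card (dire E) = 2*card E" unfolding eq using two by simp
qed

text \<open>The hypothesis \<open>imp\<close> excludes the outcome in which all scanned pairs lie in
  \<open>G\<close>, so every \<open>G\<close> gets a container. Edges are stored in both orders
  (\<open>dire\<close>), so that \<open>nths t J\<close> is literally a key; \<open>und\<close>
  keeps an edge only if both orders survive, hence the shrinking factor carries over.\<close>

lemma shrink:
 assumes M: "M <= nsets V 2" "finite M"
  and H: "finite H" "\<And>t. t \<in> H ==> length t = 4"
  and key: "\<And>t J. t \<in> H ==> J \<in> set Js ==> nths t J \<in> dire M"
  and Js: "\<And>J. J \<in> set Js ==> J \<in> Feat & Nn J = {} "
  and Nn: "\<And>I. card I >= 3 ==> Nn I = {}"
  and theta: "0 < \<theta>" "\<theta> <= 1/4" and K: "K >= 0"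
  and D: "\<And>I. I \<in> Feat ==> D I > 0" "caps Nn D H"
  and N: "0 < N" "N <= rcard H"
  and ok: "stages_ok K (2*rcard M) \<theta> Js N D"
  and imp: "\<And>G H'. G \<in> GG ==> H' <= H ==> \<forall>t\<in>H'. \<forall>J\<in>set Js. nths t J \<in> dire G ==>
   \<theta>^length Js*N <= rcard H' ==> caps Nn (fold (Dstep (64*\<theta>)) Js D) H' ==> False"
  and GM: "\<And>G. G \<in> GG ==> G <= M"
 shows "\<exists>MM. finite MM & card MM <= num_prints (dire M) (8*\<theta>*rcard M + 1)^length Js &
  (\<forall>M'\<in>MM. M' <= M & rcard M' <= (1 - 1/(4*K))*rcard M) &
  (\<forall>G\<in>GG. \<exists>M'\<in>MM. G <= M')"
proof -
 note fd = finite_card_dire[OF M]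
 have "\<exists>OC. finite OC & card OC <= num_prints (dire M) (4*\<theta>*rcard (dire M) + 1)^length Js &
  (\<forall>A. \<exists>outc\<in>OC. stage_outcome (dire M) K A Js (\<theta>^length Js*N) H Nn (fold (Dstep (64*\<theta>)) Js D) outc)"
  by (rule stages) (use assms fd in auto)
 moreover have "4*\<theta>*rcard (dire M) + 1 = 8*\<theta>*rcard M + 1" using fd by simp
 ultimately have "\<exists>OC. finite OC & card OC <= num_prints (dire M) (8*\<theta>*rcard M + 1)^length Js &
  (\<forall>A. \<exists>outc\<in>OC. stage_outcome (dire M) K A Js (\<theta>^length Js*N) H Nn (fold (Dstep (64*\<theta>)) Js D) outc)"
  by (simp only: )
 then obtain OC where OC: "finite OC" "card OC <= num_prints (dire M) (8*\<theta>*rcard M + 1)^length Js"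
  "\<And>A. \<exists>outc\<in>OC. stage_outcome (dire M) K A Js (\<theta>^length Js*N) H Nn (fold (Dstep (64*\<theta>)) Js D) outc"
  by blast
 define und where "und C = {e\<in>M. \<forall>a b. e = {a, b} --> [a, b] \<in> C}" for C
 define MM where "MM = {und C | C. Inr C \<in> OC & C <= dire M & rcard C <= (1 - 1/(4*K))*rcard (dire M)}"
 have MMsub: "MM <= (%outc. und (projr outc)) ` OC" by (force simp: MM_def image_iff)
 have 1: "finite MM" using MMsub OC(1) finite_subset by blast
 have "card MM <= card OC" using MMsub OC(1) by (meson card_image_le card_mono finite_imageI le_trans)
 then have 2: "card MM <= num_prints (dire M) (8*\<theta>*rcard M + 1)^length Js" using OC(2) by linarith
 have 3: "M' <= M & rcard M' <= (1 - 1/(4*K))*rcard M" if M': "M' \<in> MM" for M'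
 proof -
  obtain C where C: "M' = und C" "C <= dire M" "rcard C <= (1 - 1/(4*K))*rcard (dire M)"
   using M' unfolding MM_def by auto
  have sub: "M' <= M" by (auto simp: C und_def)
  have "dire M' <= C" by (auto simp: C und_def dire_def)
  moreover have "finite C" using C(2) fd(1) finite_subset by blast
  ultimately have "card (dire M') <= card C" by (rule card_mono[rotated])
  moreover have "card (dire M') = 2*card M'"
   using sub M finite_subset by (intro finite_card_dire(2)[of M' V]) auto
  ultimately have "2*rcard M' <= rcard C" by linarith
  then show ?thesis using sub C(3) fd(2) by simp
 qed
 have 4: "\<exists>M'\<in>MM. G <= M'" if G: "G \<in> GG" for G
 proof -
  obtain outc where o: "outc \<in> OC"
   "stage_outcome (dire M) K (dire G) Js (\<theta>^length Js*N) H Nn (fold (Dstep (64*\<theta>)) Js D) outc"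
   using OC(3) by blast
  show ?thesis
  proof (cases outc)
   case (Inl H')
   then have False using o(2) imp[OF G, of H'] by (auto simp: stage_outcome_def)
   then show ?thesis ..
  next
   case (Inr C)
   then have C: "dire G Int dire M <= C" "C <= dire M" "rcard C <= (1 - 1/(4*K))*rcard (dire M)"
    using o(2) by (auto simp: stage_outcome_def)
   have "G <= und C" using C(1) GM[OF G] by (auto simp: und_def dire_def)
   moreover have "und C \<in> MM" using C o Inr by (auto simp: MM_def)
   ultimately show ?thesis by blast
  qed
 qed
 show ?thesis using 1 2 3 4 by blast
qed

lemma induced_C4D:
 assumes "\<not> contains_induced V E C4_verts C4_edges" "distinct [a, b, c, d]" "{a, b, c, d} <= V"
  and "{a, b} \<in> E" "{b, c} \<in> E" "{c, d} \<in> E" "{a, d} \<in> E"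
 shows "{a, c} \<in> E \<or> {b, d} \<in> E"
proof (rule ccontr)
 assume n: "\<not> ({a, c} \<in> E \<or> {b, d} \<in> E)"
 define f where "f i = (if i = 0 then a else if i = 1 then b else if i = 2 then c else d)" for i :: nat
 have "inj_on f C4_verts" using assms(2) by (auto simp: inj_on_def C4_verts_def f_def)
 moreover have "f ` C4_verts <= V" using assms(3) by (auto simp: C4_verts_def f_def)
 moreover have "{u, v} \<in> C4_edges \<longleftrightarrow> {f u, f v} \<in> E" if "u \<in> C4_verts" "v \<in> C4_verts" "u ~= v" for u v
  using that assms n by (auto simp: C4_verts_def C4_edges_def f_def doubleton_eq_iff insert_commute)
 ultimately have "contains_induced V E C4_verts C4_edges" unfolding contains_induced_def by blast
 then show False using assms(1) by simp
qed

lemma no_C4_imp_no_induced: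
 assumes "\<And>a b c d. distinct [a, b, c, d] ==> {a, b} \<in> E ==> {b, c} \<in> E ==> {c, d} \<in> E ==> {a, d} \<in> E ==> False"
 shows "\<not> contains_induced V E C4_verts C4_edges"
proof
 assume "contains_induced V E C4_verts C4_edges"
 then obtain f where f: "inj_on f C4_verts"
  "\<And>u v. u \<in> C4_verts ==> v \<in> C4_verts ==> u ~= v ==> {u, v} \<in> C4_edges \<longleftrightarrow> {f u, f v} \<in> E"
  unfolding contains_induced_def by blast
 show False
 proof (rule assms[of "f 0" "f 1" "f 2" "f 3"])
  show "distinct [f 0, f 1, f 2, f 3]" using f(1) by (auto simp: inj_on_def C4_verts_def)
  show "{f 0, f 1} \<in> E" "{f 1, f 2} \<in> E" "{f 2, f 3} \<in> E" "{f 0, f 3} \<in> E"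
   using f(2)[of 0 1] f(2)[of 1 2] f(2)[of 2 3] f(2)[of 3 0]
   by (auto simp: C4_verts_def C4_edges_def insert_commute)
 qed
qed

text \<open>Normal forms by which \<open>Dstep\<close> unfolds along a concrete list of stages into
  a polynomial in \<mu>.\<close>

lemma coord_unions:
 "{0, 1} Un {0, 1} = ({0, 1} :: nat set)"
 "{0, 2} Un {0, 1} = ({0, 1, 2} :: nat set)"
 "{0, 3} Un {0, 1} = ({0, 1, 3} :: nat set)"
 "{1, 2} Un {0, 1} = ({0, 1, 2} :: nat set)"
 "{1, 3} Un {0, 1} = ({0, 1, 3} :: nat set)"
 "{2, 3} Un {0, 1} = ({0, 1, 2, 3} :: nat set)"
 "{0, 1, 2} Un {0, 1} = ({0, 1, 2} :: nat set)"
 "{0, 1, 3} Un {0, 1} = ({0, 1, 3} :: nat set)"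
 "{0, 2, 3} Un {0, 1} = ({0, 1, 2, 3} :: nat set)"
 "{1, 2, 3} Un {0, 1} = ({0, 1, 2, 3} :: nat set)"
 "{0, 1, 2, 3} Un {0, 1} = ({0, 1, 2, 3} :: nat set)"
 "{0, 1} Un {1, 2} = ({0, 1, 2} :: nat set)"
 "{0, 2} Un {1, 2} = ({0, 1, 2} :: nat set)"
 "{0, 3} Un {1, 2} = ({0, 1, 2, 3} :: nat set)"
 "{1, 2} Un {1, 2} = ({1, 2} :: nat set)"
 "{1, 3} Un {1, 2} = ({1, 2, 3} :: nat set)"
 "{2, 3} Un {1, 2} = ({1, 2, 3} :: nat set)"
 "{0, 1, 2} Un {1, 2} = ({0, 1, 2} :: nat set)"
 "{0, 1, 3} Un {1, 2} = ({0, 1, 2, 3} :: nat set)"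
 "{0, 2, 3} Un {1, 2} = ({0, 1, 2, 3} :: nat set)"
 "{1, 2, 3} Un {1, 2} = ({1, 2, 3} :: nat set)"
 "{0, 1, 2, 3} Un {1, 2} = ({0, 1, 2, 3} :: nat set)"
 "{0, 1} Un {2, 3} = ({0, 1, 2, 3} :: nat set)"
 "{0, 2} Un {2, 3} = ({0, 2, 3} :: nat set)"
 "{0, 3} Un {2, 3} = ({0, 2, 3} :: nat set)"
 "{1, 2} Un {2, 3} = ({1, 2, 3} :: nat set)"
 "{1, 3} Un {2, 3} = ({1, 2, 3} :: nat set)"
 "{2, 3} Un {2, 3} = ({2, 3} :: nat set)"
 "{0, 1, 2} Un {2, 3} = ({0, 1, 2, 3} :: nat set)"
 "{0, 1, 3} Un {2, 3} = ({0, 1, 2, 3} :: nat set)"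
 "{0, 2, 3} Un {2, 3} = ({0, 2, 3} :: nat set)"
 "{1, 2, 3} Un {2, 3} = ({1, 2, 3} :: nat set)"
 "{0, 1, 2, 3} Un {2, 3} = ({0, 1, 2, 3} :: nat set)"
 "{0, 1} Un {0, 3} = ({0, 1, 3} :: nat set)"
 "{0, 2} Un {0, 3} = ({0, 2, 3} :: nat set)"
 "{0, 3} Un {0, 3} = ({0, 3} :: nat set)"
 "{1, 2} Un {0, 3} = ({0, 1, 2, 3} :: nat set)"
 "{1, 3} Un {0, 3} = ({0, 1, 3} :: nat set)"
 "{2, 3} Un {0, 3} = ({0, 2, 3} :: nat set)"
 "{0, 1, 2} Un {0, 3} = ({0, 1, 2, 3} :: nat set)"
 "{0, 1, 3} Un {0, 3} = ({0, 1, 3} :: nat set)"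
 "{0, 2, 3} Un {0, 3} = ({0, 2, 3} :: nat set)"
 "{1, 2, 3} Un {0, 3} = ({0, 1, 2, 3} :: nat set)"
 "{0, 1, 2, 3} Un {0, 3} = ({0, 1, 2, 3} :: nat set)"
 by auto

lemma nths4:
 "nths [a, b, c, d] {0, 1} = [a, b]" "nths [a, b, c, d] {1, 2} = [b, c]" "nths [a, b, c, d] {2, 3} = [c, d]"
 "nths [a, b, c, d] {0, 3} = [a, d]" "nths [a, b, c, d] {0, 2} = [a, c]" "nths [a, b, c, d] {1, 3} = [b, d]"
 "nths [a, b, c, d] {0, 1, 2} = [a, b, c]" "nths [a, b, c, d] {0, 2, 3} = [a, c, d]"
 "nths [a, b, c, d] {0, 1, 3} = [a, b, d]" "nths [a, b, c, d] {1, 2, 3} = [b, c, d]"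
 "nths [a, b, c, d] {0, 1, 2, 3} = [a, b, c, d]"
 by (simp_all add: nths_Cons)

lemma FeatD:
 assumes "I \<in> Feat"
 shows "I \<in> {{0, 1}, {1, 2}, {2, 3}, {0, 3}} \<or> (I = {0, 2} \<or> I = {1, 3}) \<or>
  I \<in> {{0, 1, 2}, {0, 2, 3}, {0, 1, 3}, {1, 2, 3}} \<or> I = {0, 1, 2, 3}"
proof -
 have four: "{..<4::nat} = {0, 1, 2, 3}" by auto
 have sub: "I <= {0, 1, 2, 3}" and c: "2 <= card I" using assms unfolding Feat_def four by auto
 have fI: "finite I" using sub by (rule finite_subset) simp
 have "card I <= card {0, 1, 2, 3::nat}" using sub by (intro card_mono) auto
 then have "card I <= 4" by simp
 then have "card I = 2 \<or> card I = 3 \<or> card I = 4" using c by linarith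
 then consider "card I = 2" | "card I = 3" | "card I = 4" by blast
 then show ?thesis
 proof cases
  case 1
  then obtain a b where ab: "I = {a, b}" "a ~= b" unfolding card_2_iff by blast
  obtain i j where ij: "I = {i, j}" "i < j"
  proof (cases "a < b")
   case True then show thesis using that[of a b] ab by blast
  next
   case False
   then have "b < a" using ab by linarith
   then show thesis using that[of b a] ab by blast
  qed
  then have "j < 4" using sub by auto
  then have "j = 0 \<or> j = 1 \<or> j = 2 \<or> j = 3" "i < 3" using ij(2) by linarith+
  then have "i = 0 \<or> i = 1 \<or> i = 2" "j = 1 \<or> j = 2 \<or> j = 3" using ij(2) by linarith+
  then show ?thesis using ij(2) unfolding ij(1) by (elim disjE; hypsubst; simp)
 next
  case 2
  have "card ({0, 1, 2, 3} - I) = 1" using 2 sub fI by (simp add: card_Diff_subset)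
  then obtain k where k: "{0, 1, 2, 3} - I = {k}" by (auto simp: card_1_singleton_iff)
  have "I = {0, 1, 2, 3} - ({0, 1, 2, 3} - I)" using sub by (simp only: double_diff subset_refl)
  then have "k \<in> {0, 1, 2, 3}" "I = {0, 1, 2, 3} - {k}" using k by (blast, simp only:)
  moreover have "{0, 1, 2, 3} - {0} = {1, 2, 3::nat}" "{0, 1, 2, 3} - {1} = {0, 2, 3::nat}"
   "{0, 1, 2, 3} - {2} = {0, 1, 3::nat}" "{0, 1, 2, 3} - {3} = {0, 1, 2::nat}" by auto
  ultimately show ?thesis by (elim insertE emptyE) (simp_all only: insert_iff simp_thms)
 next
  case 3
  then have "I = {0, 1, 2, 3}" using sub by (intro card_subset_eq) auto
  then show ?thesis by simp
 qed
qed

lemma FeatI: "{0, 1} \<in> Feat" "{1, 2} \<in> Feat" "{2, 3} \<in> Feat" "{0, 3} \<in> Feat" "{0, 2} \<in> Feat" "{1, 3} \<in> Feat"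
 by (auto simp: Feat_def)

text \<open>Positions 0, 1, 2, 3 run around a 4-cycle, so \<open>{0, 2}\<close> and
  \<open>{1, 3}\<close> are its diagonals and the remaining pairs its sides. The last value 1 says
  that a full tuple occurs once.\<close>

definition Dinit :: "real => real => real => nat set => real" where
 "Dinit e c x I = (if I = {0, 2} \<or> I = {1, 3} then c else if card I = 2 then e else if card I = 3 then x else 1)"

lemma Dinit_vals:
 "Dinit e c x {0, 1} = e" "Dinit e c x {1, 2} = e" "Dinit e c x {2, 3} = e" "Dinit e c x {0, 3} = e"
 "Dinit e c x {0, 2} = c" "Dinit e c x {1, 3} = c"
 "Dinit e c x {0, 1, 2} = x" "Dinit e c x {0, 2, 3} = x" "Dinit e c x {0, 1, 3} = x" "Dinit e c x {1, 2, 3} = x"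
 "Dinit e c x {0, 1, 2, 3} = 1"
proof -
 have "{0, 1} ~= {0, 2::nat}" "{0, 1} ~= {1, 3::nat}" "{1, 2} ~= {0, 2::nat}" "{1, 2} ~= {1, 3::nat}"
  "{2, 3} ~= {0, 2::nat}" "{2, 3} ~= {1, 3::nat}" "{0, 3} ~= {0, 2::nat}" "{0, 3} ~= {1, 3::nat}"
  by (auto simp: doubleton_eq_iff)
 moreover have "I ~= {0, 2} & I ~= {1, 3}" if "card I >= 3" for I :: "nat set" using that by auto
 ultimately show
  "Dinit e c x {0, 1} = e" "Dinit e c x {1, 2} = e" "Dinit e c x {2, 3} = e" "Dinit e c x {0, 3} = e"
  "Dinit e c x {0, 2} = c" "Dinit e c x {1, 3} = c"
  "Dinit e c x {0, 1, 2} = x" "Dinit e c x {0, 2, 3} = x" "Dinit e c x {0, 1, 3} = x" "Dinit e c x {1, 2, 3} = x"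
  "Dinit e c x {0, 1, 2, 3} = 1"
  by (auto simp: Dinit_def)
qed

text \<open>The exemption set for \<open>caps\<close>: a diagonal in \<open>N0\<close> cannot be an
  edge of \<open>G\<close>, so it never enters the final count in \<open>shrink_C4\<close>.\<close>

definition diag_free :: "nat set set => nat set => nat list set" where
 "diag_free N0 I = (if I = {0, 2} \<or> I = {1, 3} then dire N0 else {})"

lemma diag_free_card3: "card I >= 3 ==> diag_free N0 I = {}"
 by (auto simp: diag_free_def)

lemma diag_free_edges:
 "diag_free N0 {0, 1} = {}" "diag_free N0 {1, 2} = {}" "diag_free N0 {2, 3} = {}" "diag_free N0 {0, 3} = {}"
 "diag_free N0 {0, 2} = dire N0" "diag_free N0 {1, 3} = dire N0"
 by (auto simp: diag_free_def doubleton_eq_iff)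

lemma card_cover_le:
 fixes H :: "'a set" and f g :: "'a => 'b"
 assumes "finite A" "finite H" "\<And>t. t \<in> H ==> f t \<in> A \<or> g t \<in> A"
  and "\<And>z. z \<in> A ==> rcard {t\<in>H. f t = z} <= a" "\<And>z. z \<in> A ==> rcard {t\<in>H. g t = z} <= b"
 shows "rcard H <= rcard A*(a + b)"
proof -
 have "H <= (\<Union>z\<in>A. {t\<in>H. f t = z} Un {t\<in>H. g t = z})" using assms(3) by auto
 then have "card H <= card (\<Union>z\<in>A. {t\<in>H. f t = z} Un {t\<in>H. g t = z})"
  using assms by (intro card_mono) auto
 also have "... <= (\<Sum>z\<in>A. card ({t\<in>H. f t = z} Un {t\<in>H. g t = z}))" by (rule card_UN_le[OF assms(1)])
 also have "... <= (\<Sum>z\<in>A. card {t\<in>H. f t = z} + card {t\<in>H. g t = z})" by (intro sum_mono card_Un_le)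
 finally have "rcard H <= (\<Sum>z\<in>A. rcard {t\<in>H. f t = z} + rcard {t\<in>H. g t = z})"
  by (metis (mono_tags, lifting) of_nat_add of_nat_le_iff of_nat_sum sum.cong)
 also have "... <= (\<Sum>z\<in>A. a + b)" by (intro sum_mono add_mono assms)
 finally show ?thesis by simp
qed

definition cyc4 :: "nat set set => nat list set" where
 "cyc4 M = {[a, b, c, d] | a b c d. distinct [a, b, c, d] & {a, b} \<in> M & {b, c} \<in> M & {c, d} \<in> M & {a, d} \<in> M}"

text \<open>Once the four sides have been scanned, all remaining cycles have their sides in
  \<open>G\<close>. Without induced 4-cycles each has a diagonal in \<open>G\<close>, thus outside
  \<open>N0\<close> and capped. Counting by that diagonal gives fewer than
  \<open>\<theta>^4*N\<close> cycles, the contradiction that \<open>shrink\<close> asks for.\<close>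

lemma shrink_C4:
 assumes M: "M <= nsets V 2" "finite V"
  and H: "finite H" "H <= cyc4 M"
  and theta: "0 < \<theta>" "\<theta> <= 1/64" and pos: "e > 0" "c > 0" "x > 0" "e0 >= 0"
  and caps: "caps (diag_free N0) (Dinit e c x) H"
  and N: "0 < N" "N <= rcard H"
  and K: "262144*e0 + 10000 <= K"
  and u: "u = 2*rcard M"
  and e: "e <= e0*(N/u)" and x: "x <= \<theta>*(N/u)" and one: "1 <= \<theta>^3*(N/u)"
  and fin: "2*real m*(2*(64*\<theta>)^4*c + 12*(64*\<theta>)^2*x + 20) < \<theta>^4*N"
  and GG: "\<And>G. G \<in> GG ==> G <= M & card G = m & G Int N0 = {} & \<not> contains_induced V G C4_verts C4_edges"
 shows "\<exists>MM. finite MM & card MM <= num_prints (dire M) (8*\<theta>*rcard M + 1)^4 &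
  (\<forall>M'\<in>MM. M' <= M & rcard M' <= (1 - 1/(4*K))*rcard M) &
  (\<forall>G\<in>GG. \<exists>M'\<in>MM. G <= M')"
proof -
 define \<mu> where "\<mu> = 64*\<theta>"
 define y where "y = N/u"
 have mu: "0 < \<mu>" "\<mu> <= 1" using theta by (auto simp: \<mu>_def)
 let ?Js = "[{0, 1}, {1, 2}, {2, 3}, {0, 3}] :: nat set list"
 have finM: "finite M" using finite_subset[OF M(1)] M(2) by (simp add: finite_imp_finite_nsets)
 have Kp: "K >= 0" using K pos by linarith
 have y3: "1 <= \<theta>^3*y" using one by (simp add: y_def)
 have ypos: "y > 0"
 proof (rule ccontr)
  assume "\<not> y > 0"
  then have "\<theta>^3*y <= 0" using theta by (intro mult_nonneg_nonpos) auto
  then show False using y3 by linarith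
 qed
 have y2: "1 <= \<theta>^2*y"
 proof -
  have "\<theta>^3*y <= \<theta>^2*y" using theta ypos by (intro mult_right_mono power_decreasing) auto
  then show ?thesis using y3 by linarith
 qed
 have Ky: "K*N/u = K*y" "K*(\<theta>*N)/u = K*(\<theta>*y)" "K*(\<theta>*(\<theta>*N))/u = K*(\<theta>^2*y)"
  "K*(\<theta>*(\<theta>*(\<theta>*N)))/u = K*(\<theta>^3*y)"
  by (simp_all add: y_def power2_eq_square power3_eq_cube mult_ac)
 have e': "e <= e0*y" and x': "x <= \<theta>*y" using e x by (auto simp: y_def)
 \<comment> \<open>\<open>s1\<close> to \<open>s4\<close> are the four conditions of
   \<open>stages_ok\<close>: the cap of the next side, as changed by the preceding stages, against
   \<open>K\<close> times the average key degree guaranteed by then.\<close>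
 have s1: "e <= K*y"
 proof -
  have "e0*y <= K*y" using K pos ypos by (intro mult_right_mono) auto
  then show ?thesis using e' by linarith
 qed
 have s2: "\<mu>*e + x <= K*(\<theta>*y)"
 proof -
  have "\<mu>*e <= \<mu>*(e0*y)" using e' mu by (intro mult_left_mono) auto
  then have "\<mu>*e + x <= (64*e0 + 1)*(\<theta>*y)" using x' by (simp add: \<mu>_def algebra_simps)
  also have "... <= K*(\<theta>*y)" using K pos theta ypos by (intro mult_right_mono) auto
  finally show ?thesis .
 qed
 have mux: "\<mu>*x <= 64*(\<theta>^2*y)"
  using mult_left_mono[OF x', of \<mu>] mu by (simp add: \<mu>_def power2_eq_square algebra_simps)
 have mue: "\<mu>^2*e <= 4096*e0*(\<theta>^2*y)"
  using mult_left_mono[OF e', of "\<mu>^2"] by (simp add: \<mu>_def power2_eq_square algebra_simps)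
 have mux3: "\<mu>^2*x <= 4096*(\<theta>^3*y)"
  using mult_left_mono[OF x', of "\<mu>^2"] by (simp add: \<mu>_def power2_eq_square power3_eq_cube algebra_simps)
 \<comment> \<open>262144 is \<open>64^3\<close>: before the last stage the cap of the last side has
   been multiplied by \<mu> three times.\<close>
 have mue3: "\<mu>^3*e <= 262144*e0*(\<theta>^3*y)"
  using mult_left_mono[OF e', of "\<mu>^3"] mu by (simp add: \<mu>_def power3_eq_cube algebra_simps)
 have mu2: "\<mu>^2 <= 1" using mu by (simp add: power_le_one)
 have s3: "\<mu>*(\<mu>*e + 1) + (\<mu>*x + 1) <= K*(\<theta>^2*y)"
 proof -
  have "\<mu>*(\<mu>*e + 1) + (\<mu>*x + 1) = \<mu>^2*e + \<mu> + \<mu>*x + 1" by (simp add: power2_eq_square algebra_simps)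
  also have "... <= (4096*e0 + 66)*(\<theta>^2*y)" using mue mux mu y2 by (simp add: algebra_simps)
  also have "... <= K*(\<theta>^2*y)" using K pos y2 by (intro mult_right_mono) auto
  finally show ?thesis .
 qed
 have s4: "\<mu>*(\<mu>*(\<mu>*e + x) + (\<mu> + 1)) + (\<mu>*(\<mu>*x + 1) + (\<mu> + 1)) <= K*(\<theta>^3*y)"
 proof -
  have "\<mu>*(\<mu>*(\<mu>*e + x) + (\<mu> + 1)) + (\<mu>*(\<mu>*x + 1) + (\<mu> + 1))
   = \<mu>^3*e + 2*(\<mu>^2*x) + \<mu>^2 + 3*\<mu> + 1" by (simp add: power2_eq_square power3_eq_cube algebra_simps)
  also have "... <= (262144*e0 + 9000)*(\<theta>^3*y)" using mue3 mux3 mu mu2 y3 by (simp add: algebra_simps)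
  also have "... <= K*(\<theta>^3*y)" using K pos y3 by (intro mult_right_mono) auto
  finally show ?thesis .
 qed
 \<comment> \<open>The final cap of a diagonal: each stage either multiplies by \<mu> or merges its
   key positions, so the lone diagonal cap survives only with \<open>\<mu>^4\<close>.\<close>
 have d4: "fold (Dstep \<mu>) ?Js (Dinit e c x) {0, 2} <= \<mu>^4*c + 6*(\<mu>^2*x) + 10"
  "fold (Dstep \<mu>) ?Js (Dinit e c x) {1, 3} <= \<mu>^4*c + 6*(\<mu>^2*x) + 10"
 proof -
  have p: "\<mu>^3*x <= \<mu>^2*x" using mu pos by (intro mult_right_mono power_decreasing) auto
  have mu4: "\<mu>^4 <= 1" "\<mu>^3 <= 1" "\<mu>^2 <= 1" using mu by (auto intro: power_le_one)
  have "fold (Dstep \<mu>) ?Js (Dinit e c x) {0, 2} = 4*\<mu>^2 + 4*\<mu>^1 + 1*\<mu>^0 + 1*(\<mu>^4*c) + 4*(\<mu>^3*x) + 2*(\<mu>^2*x)"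
   unfolding fold.simps id_apply comp_apply Dstep_def coord_unions Dinit_vals by algebra
  then show "fold (Dstep \<mu>) ?Js (Dinit e c x) {0, 2} <= \<mu>^4*c + 6*(\<mu>^2*x) + 10"
   using p mu mu4 unfolding power_one_right power_0 mult_1 mult_1_right by linarith
  have "fold (Dstep \<mu>) ?Js (Dinit e c x) {1, 3} = 4*\<mu>^2 + 4*\<mu>^1 + 1*\<mu>^0 + 1*(\<mu>^4*c) + 4*(\<mu>^3*x) + 2*(\<mu>^2*x)"
   unfolding fold.simps id_apply comp_apply Dstep_def coord_unions Dinit_vals by algebra
  then show "fold (Dstep \<mu>) ?Js (Dinit e c x) {1, 3} <= \<mu>^4*c + 6*(\<mu>^2*x) + 10"
   using p mu mu4 unfolding power_one_right power_0 mult_1 mult_1_right by linarith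
 qed
 have Hlen: "\<And>t. t \<in> H ==> length t = 4" using H(2) by (auto simp: cyc4_def)
 have "\<exists>MM. finite MM & card MM <= num_prints (dire M) (8*\<theta>*rcard M + 1)^length ?Js &
  (\<forall>M'\<in>MM. M' <= M & rcard M' <= (1 - 1/(4*K))*rcard M) &
  (\<forall>G\<in>GG. \<exists>M'\<in>MM. G <= M')"
 proof (rule shrink[where Nn = "diag_free N0" and D = "Dinit e c x" and N = N and H = H, OF M(1) finM H(1) Hlen])
  show "nths t J \<in> dire M" if t: "t \<in> H" and J: "J \<in> set ?Js" for t J
  proof -
   obtain p q r s where t': "t = [p, q, r, s]" "{p, q} \<in> M" "{q, r} \<in> M" "{r, s} \<in> M" "{p, s} \<in> M"
    using t H(2) unfolding cyc4_def by blast
   have "J = {0, 1} \<or> J = {1, 2} \<or> J = {2, 3} \<or> J = {0, 3}" using J by simp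
   then show ?thesis unfolding t'(1) using t'(2-5) by (elim disjE) (simp_all only: nths4 dire_mem)
  qed
  show "J \<in> Feat & diag_free N0 J = {}" if "J \<in> set ?Js" for J
   using that FeatI diag_free_edges by (auto simp del: One_nat_def)
  show "diag_free N0 I = {}" if "3 <= card I" for I using that by (rule diag_free_card3)
  show "0 < \<theta>" "\<theta> <= 1/4" "0 <= K" "0 < N" "N <= rcard H" using theta Kp N by auto
  show "0 < Dinit e c x I" for I using pos by (auto simp: Dinit_def)
  show "caps (diag_free N0) (Dinit e c x) H" by fact
  show "stages_ok K (2*rcard M) \<theta> ?Js N (Dinit e c x)"
   unfolding u[symmetric] stages_ok.simps \<mu>_def[symmetric] Ky Dstep_def coord_unions Dinit_vals
   using s1 s2 s3 s4 by (simp add: algebra_simps)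
  show "G <= M" if "G \<in> GG" for G using GG that by auto
 next
  fix G H'
  assume a: "G \<in> GG" "H' <= H" "\<forall>t\<in>H'. \<forall>J\<in>set ?Js. nths t J \<in> dire G"
   "\<theta>^length ?Js*N <= rcard H'" "caps (diag_free N0) (fold (Dstep (64*\<theta>)) ?Js (Dinit e c x)) H'"
  have G: "G <= M" "card G = m" "G Int N0 = {}" "\<not> contains_induced V G C4_verts C4_edges" using GG a(1) by auto
  have fG: "finite (dire G)" "card (dire G) = 2*m"
   using finite_card_dire[of G V] G(1,2) M finM finite_subset by blast+
  let ?b = "\<mu>^4*c + 6*(\<mu>^2*x) + 10"
  have dg: "rcard {t\<in>H'. nths t I = z} <= ?b" if "z \<in> dire G" "I = {0, 2} \<or> I = {1, 3}" for z I
  proof -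
   have "z ~: diag_free N0 I" using that G(3) by (auto simp: diag_free_def dire_def)
   moreover have "I \<in> Feat" using that FeatI by blast
   ultimately have "rcard {t\<in>H'. nths t I = z} <= fold (Dstep \<mu>) ?Js (Dinit e c x) I"
    using a(5) unfolding caps_def \<mu>_def by blast
   then show ?thesis using that(2) d4 by fastforce
  qed
  have "rcard H' <= rcard (dire G)*(?b + ?b)"
  proof (rule card_cover_le[where f = "%t. nths t {0, 2}" and g = "%t. nths t {1, 3}"])
   show "finite (dire G)" by fact
   show "finite H'" using a(2) H(1) finite_subset by auto
   fix t assume t: "t \<in> H'"
   then obtain p q r s where t': "t = [p, q, r, s]" "distinct [p, q, r, s]" "{p, q} \<in> M" "{r, s} \<in> M"
    using a(2) H(2) by (auto simp: cyc4_def)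
   have ed: "{p, q} \<in> G" "{q, r} \<in> G" "{r, s} \<in> G" "{p, s} \<in> G"
    using a(3) t unfolding t'(1) by (auto simp: nths4 simp del: One_nat_def)
   have "{p, q, r, s} <= V" using t'(3,4) M(1) by (auto simp: nsets_def)
   from induced_C4D[OF G(4) t'(2) this ed] show "nths t {0, 2} \<in> dire G \<or> nths t {1, 3} \<in> dire G"
    unfolding t'(1) nths4 by simp
  qed (use dg in auto)
  also have "... = 2*real m*(2*\<mu>^4*c + 12*\<mu>^2*x + 20)" using fG by (simp add: algebra_simps)
  also have "... < \<theta>^4*N" using fin by (simp add: \<mu>_def)
  finally show False using a(4) by (simp add: power4_eq_xxxx mult_ac)
 qed
 then show ?thesis by (simp add: power4_eq_xxxx mult.assoc)
qed

text \<open>The sides vv' and xx' are known edges, only vx and v'x' remain to be revealed. The cycle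
  is v, x, x', v', so its diagonals sit at positions \<open>{0, 3}\<close> and \<open>{1, 2}\<close>
  of the list.\<close>

definition quad4 :: "nat set set => nat set set => nat list set" where
 "quad4 M F = {[v, x, v', x'] | v x v' x'. distinct [v, x, v', x'] & {v, x} \<in> M & {v', x'} \<in> M & {v, v'} \<in> F & {x, x'} \<in> F}"

text \<open>Two stages are enough, as \<open>F\<close> supplies the other two sides; then one of the
  two diagonals is in \<open>G\<close>, and both are capped. The bound \<open>g\<close> stands for
  degrees in \<open>F\<close>: two adjacent corners fix the others up to two choices of
  \<open>F\<close>-neighbours, three corners up to one.\<close>

lemma shrink_quads:
 assumes M: "M <= nsets V 2" "finite V"
  and H: "finite H" "H <= quad4 M F"
  and theta: "0 < \<theta>" "\<theta> <= 1/64" and pos: "g > 0" "e0 >= 0"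
  and deg: "\<And>I z. I \<in> {{0, 1}, {1, 2}, {2, 3}, {0, 3}} ==> rcard {t\<in>H. nths t I = z} <= g^2"
   "\<And>I z. I \<in> {{0, 1, 2}, {0, 2, 3}, {0, 1, 3}, {1, 2, 3}} ==> rcard {t\<in>H. nths t I = z} <= g"
  and N: "0 < N" "N <= rcard H"
  and K: "64*e0 + 1 <= K"
  and u: "u = 2*rcard M"
  and g: "g^2 <= e0*(N/u)" and one: "1 <= \<theta>*(N/u)"
  and fin: "4*real m*((64*\<theta>)^2*g^2 + 2*(64*\<theta>)*g + 1) < \<theta>\<^sup>2*N"
  and GG: "\<And>G. G \<in> GG ==> F <= G & G <= M & card G = m & \<not> contains_induced V G C4_verts C4_edges"
 shows "\<exists>MM. finite MM & card MM <= num_prints (dire M) (8*\<theta>*rcard M + 1)^2 &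
  (\<forall>M'\<in>MM. M' <= M & rcard M' <= (1 - 1/(4*K))*rcard M) &
  (\<forall>G\<in>GG. \<exists>M'\<in>MM. G <= M')"
proof -
 define \<mu> where "\<mu> = 64*\<theta>"
 define y where "y = N/u"
 \<comment> \<open>Quadruples may share an edge of \<open>F\<close>, at positions
   \<open>{0, 2}\<close> or \<open>{1, 3}\<close>, arbitrarily often; this value exceeds
   \<open>card H\<close> and is a trivially valid cap there.\<close>
 define cc where "cc = rcard H + 1"
 have mu: "0 < \<mu>" "\<mu> <= 1" using theta by (auto simp: \<mu>_def)
 let ?Js = "[{0, 1}, {2, 3}] :: nat set list"
 let ?D = "Dinit (g^2) cc g"
 have finM: "finite M" using finite_subset[OF M(1)] M(2) by (simp add: finite_imp_finite_nsets)
 have Kp: "K >= 0" using K pos by linarith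
 have y1: "1 <= \<theta>*y" using one by (simp add: y_def)
 have ypos: "y > 0" using y1 theta by (smt (verit) mult_nonneg_nonpos)
 have Ky: "K*N/u = K*y" "K*(\<theta>*N)/u = K*(\<theta>*y)" by (simp_all add: y_def mult_ac)
 have g': "g^2 <= e0*y" using g by (auto simp: y_def)
 have s1: "g^2 <= K*y"
 proof -
  have "e0*y <= K*y" using K pos ypos by (intro mult_right_mono) auto
  then show ?thesis using g' by linarith
 qed
 have s2: "\<mu>*g^2 + 1 <= K*(\<theta>*y)"
 proof -
  have "\<mu>*g^2 <= \<mu>*(e0*y)" using g' mu by (intro mult_left_mono) auto
  then have "\<mu>*g^2 + 1 <= (64*e0 + 1)*(\<theta>*y)" using y1 by (simp add: \<mu>_def algebra_simps)
  also have "... <= K*(\<theta>*y)" using K pos theta ypos by (intro mult_right_mono) auto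
  finally show ?thesis .
 qed
 let ?b = "\<mu>^2*g^2 + 2*\<mu>*g + 1"
 have d2: "fold (Dstep \<mu>) ?Js ?D {0, 3} = ?b" "fold (Dstep \<mu>) ?Js ?D {1, 2} = ?b"
  unfolding fold.simps id_apply comp_apply Dstep_def coord_unions Dinit_vals
  by (simp_all add: algebra_simps power2_eq_square)
 have Hlen: "\<And>t. t \<in> H ==> length t = 4" using H(2) by (auto simp: quad4_def)
 have "\<exists>MM. finite MM & card MM <= num_prints (dire M) (8*\<theta>*rcard M + 1)^length ?Js &
  (\<forall>M'\<in>MM. M' <= M & rcard M' <= (1 - 1/(4*K))*rcard M) &
  (\<forall>G\<in>GG. \<exists>M'\<in>MM. G <= M')"
 proof (rule shrink[where Nn = "%_. {}" and D = ?D and N = N and H = H, OF M(1) finM H(1) Hlen])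
  show "nths t J \<in> dire M" if t: "t \<in> H" and J: "J \<in> set ?Js" for t J
  proof -
   obtain v x v' x' where t': "t = [v, x, v', x']" "{v, x} \<in> M" "{v', x'} \<in> M"
    using t H(2) unfolding quad4_def by blast
   have "J = {0, 1} \<or> J = {2, 3}" using J by simp
   then show ?thesis unfolding t'(1) using t'(2,3) by (elim disjE) (simp_all only: nths4 dire_mem)
  qed
  show "J \<in> Feat & {} = {}" if "J \<in> set ?Js" for J
   using that FeatI by (auto simp del: One_nat_def)
  show "0 < \<theta>" "\<theta> <= 1/4" "0 <= K" "0 < N" "N <= rcard H" using theta Kp N by auto
  show "0 < ?D I" for I using pos by (auto simp: Dinit_def cc_def)
  show "caps (%_. {}) ?D H"
  proof -
   have c1: "rcard {t\<in>H. nths t I = z} <= cc" for I z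
    using card_mono[OF H(1), of "{t\<in>H. nths t I = z}"] by (auto simp: cc_def)
   have c2: "rcard {t\<in>H. nths t {0, 1, 2, 3} = z} <= 1" for z
   proof -
    have "nths t {0, 1, 2, 3} = t" if tH: "t \<in> H" for t
    proof -
     obtain v x v' x' where "t = [v, x, v', x']" using tH H(2) unfolding quad4_def by blast
     then show ?thesis by (simp only: nths4)
    qed
    then have "{t\<in>H. nths t {0, 1, 2, 3} = z} <= {z}" by auto
    then have "card {t\<in>H. nths t {0, 1, 2, 3} = z} <= card {z}" by (intro card_mono) auto
    then show ?thesis by simp
   qed
   have "rcard {t\<in>H. nths t I = z} <= ?D I" if F: "I \<in> Feat" for I z
   proof -
    from FeatD[OF F] show ?thesis
    proof (elim disjE)
     assume I: "I \<in> {{0, 1}, {1, 2}, {2, 3}, {0, 3}}"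
     then have "?D I = g^2" by (elim insertE emptyE; hypsubst; intro Dinit_vals)
     then show ?thesis using deg(1)[OF I] by simp
    next
     assume I: "I = {0, 2}"
     have "?D I = cc" unfolding I by (rule Dinit_vals)
     then show ?thesis using c1 by simp
    next
     assume I: "I = {1, 3}"
     have "?D I = cc" unfolding I by (rule Dinit_vals)
     then show ?thesis using c1 by simp
    next
     assume I: "I \<in> {{0, 1, 2}, {0, 2, 3}, {0, 1, 3}, {1, 2, 3}}"
     then have "?D I = g" by (elim insertE emptyE; hypsubst; intro Dinit_vals)
     then show ?thesis using deg(2)[OF I] by simp
    next
     assume I: "I = {0, 1, 2, 3}"
     have "?D I = 1" unfolding I by (rule Dinit_vals)
     then show ?thesis using c2 unfolding I by simp
    qed
   qed
   then show ?thesis by (simp add: caps_def)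
  qed
  show "stages_ok K (2*rcard M) \<theta> ?Js N ?D"
   unfolding u[symmetric] stages_ok.simps \<mu>_def[symmetric] Ky Dstep_def coord_unions Dinit_vals
   using s1 s2 by (simp add: algebra_simps)
  show "G <= M" if "G \<in> GG" for G using GG that by auto
 next
  fix G H'
  assume a: "G \<in> GG" "H' <= H" "\<forall>t\<in>H'. \<forall>J\<in>set ?Js. nths t J \<in> dire G"
   "\<theta>^length ?Js*N <= rcard H'" "caps (%_. {}) (fold (Dstep (64*\<theta>)) ?Js ?D) H'"
  have G: "F <= G" "G <= M" "card G = m" "\<not> contains_induced V G C4_verts C4_edges" using GG a(1) by auto
  have fG: "finite (dire G)" "card (dire G) = 2*m"
   using finite_card_dire[of G V] G(2,3) M finM finite_subset by blast+
  have dg: "rcard {t\<in>H'. nths t I = z} <= ?b" if "z \<in> dire G" "I = {0, 3} \<or> I = {1, 2}" for z I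
  proof -
   have "I \<in> Feat" using that FeatI by blast
   then have "rcard {t\<in>H'. nths t I = z} <= fold (Dstep \<mu>) ?Js ?D I"
    using a(5) unfolding caps_def \<mu>_def by blast
   then show ?thesis using that(2) d2 by fastforce
  qed
  have "rcard H' <= rcard (dire G)*(?b + ?b)"
  proof (rule card_cover_le[where f = "%t. nths t {0, 3}" and g = "%t. nths t {1, 2}"])
   show "finite (dire G)" by fact
   show "finite H'" using a(2) H(1) finite_subset by auto
   fix t assume t: "t \<in> H'"
   then obtain v x v' x' where t': "t = [v, x, v', x']" "distinct [v, x, v', x']" "{v, x} \<in> M" "{v', x'} \<in> M"
    "{v, v'} \<in> F" "{x, x'} \<in> F"
    using a(2) H(2) by (auto simp: quad4_def)
   have ed: "{v, x} \<in> G" "{v', x'} \<in> G"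
    using a(3) t unfolding t'(1) by (auto simp: nths4 simp del: One_nat_def)
   have "{v, x, x', v'} <= V" using t'(3,4) M(1) by (auto simp: nsets_def)
   moreover have "distinct [v, x, x', v']" using t'(2) by auto
   ultimately have "{v, x'} \<in> G \<or> {x, v'} \<in> G"
    using induced_C4D[OF G(4), of v x x' v'] ed t'(5,6) G(1) by (auto simp: insert_commute)
   then show "nths t {0, 3} \<in> dire G \<or> nths t {1, 2} \<in> dire G"
    unfolding t'(1) nths4 by simp
  qed (use dg in auto)
  also have "... = 4*real m*?b" using fG by (simp add: algebra_simps)
  also have "... < \<theta>\<^sup>2*N" using fin by (simp add: \<mu>_def)
  finally show False using a(4) by (simp add: power2_eq_square mult_ac)
 qed simp_all
 then show ?thesis by (simp add: power2_eq_square)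
qed

section \<open>Supersaturation: many good 4-cycles or many quadruples\<close>

lemma sum_sq_ge:
 fixes f :: "'a => real"
 assumes "finite A"
 shows "(\<Sum>a\<in>A. f a)^2 <= rcard A*(\<Sum>a\<in>A. (f a)\<^sup>2)"
 using Cauchy_Schwarz_ineq_sum[of "%_. 1" f A] by simp

lemma sum_Un_nonneg_le:
 fixes f :: "'a => real"
 assumes "finite A" "finite B" "\<And>x. 0 <= f x"
 shows "sum f (A Un B) <= sum f A + sum f B"
proof -
 have "sum f (A Un B) + sum f (A Int B) = sum f A + sum f B" using assms by (simp add: sum.union_inter)
 then show ?thesis using sum_nonneg[of "A Int B" f] assms by simp
qed

lemma card_le_fibers:
 fixes k :: real
 assumes "finite T" "finite B" "f ` T <= B" "\<And>b. b \<in> B ==> rcard {t\<in>T. f t = b} <= k"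
 shows "rcard T <= rcard B*k"
proof -
 have "card T = (\<Sum>b\<in>B. card {t\<in>T. f t = b})" by (rule card_UN_fibers) fact+
 then have "rcard T = (\<Sum>b\<in>B. rcard {t\<in>T. f t = b})" by simp
 also have "... <= (\<Sum>b\<in>B. k)" by (intro sum_mono assms)
 finally show ?thesis by simp
qed

lemma sum_fiber_le:
 fixes \<omega> :: "'t => real"
 assumes "finite B" "\<And>t. t \<in> S ==> P t ==> \<exists>y\<in>B. t = g y" "\<And>t. 0 <= \<omega> t"
 shows "(\<Sum>t\<in>{t\<in>S. P t}. \<omega> t) <= (\<Sum>y\<in>B. \<omega> (g y))"
proof -
 have "(\<Sum>t\<in>{t\<in>S. P t}. \<omega> t) <= (\<Sum>t\<in>g ` B. \<omega> t)"
  using assms by (intro sum_mono2) auto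
 also have "... <= sum (\<omega> \<circ> g) B" by (rule sum_image_le) (use assms in auto)
 finally show ?thesis by simp
qed

definition degF :: "'a set set => 'a => nat" where "degF F w = card {u. {w, u} \<in> F}"

lemma card_ordered_pairs:
 assumes "F <= nsets V 2" "finite V"
 shows "finite {(v, w). {v, w} \<in> F}" "card {(v, w). {v, w} \<in> F} = 2*card F"
proof -
 have fF: "finite F" using finite_subset[OF assms(1)] assms(2) by (simp add: finite_imp_finite_nsets)
 let ?f = "%e. {(v, w). {v, w} = e}"
 have eq: "{(v, w). {v, w} \<in> F} = (\<Union>e\<in>F. ?f e)" by auto
 have two: "finite (?f e) & card (?f e) = 2" if e: "e \<in> F" for e
 proof -
  have "card e = 2" using e assms by (auto simp: nsets_def)
  then obtain x y where xy: "e = {x, y}" "x ~= y" by (auto simp: card_2_iff)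
  have "?f e = {(x, y), (y, x)}" unfolding xy(1) by (auto simp: doubleton_eq_iff)
  then show ?thesis using xy by simp
 qed
 show "finite {(v, w). {v, w} \<in> F}" unfolding eq using fF two by auto
 have "card (\<Union>e\<in>F. ?f e) = (\<Sum>e\<in>F. card (?f e))"
  using fF two by (intro card_UN_disjoint) auto
 then show "card {(v, w). {v, w} \<in> F} = 2*card F" unfolding eq using two by simp
qed

lemma sum_degF:
 assumes "F <= nsets V 2" "finite V"
 shows "(\<Sum>w\<in>V. degF F w) = 2*card F"
proof -
 have "{(v, w). {v, w} \<in> F} = (SIGMA v:V. {u. {v, u} \<in> F})"
  using assms(1) by (auto simp: nsets_def)
 moreover have "finite {u. {v, u} \<in> F}" for v
  by (rule finite_subset[OF _ assms(2)]) (use assms(1) in \<open>auto simp: nsets_def\<close>)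
 ultimately have "card {(v, w). {v, w} \<in> F} = (\<Sum>w\<in>V. degF F w)"
  using assms(2) by (simp add: degF_def)
 then show ?thesis using card_ordered_pairs[OF assms] by simp
qed

text \<open>\<open>R\<close> will be the out-neighbourhoods of a container oriented from lower to
  higher degree, minus saturated edges, and \<open>D\<close> the degrees in the container.
  \<open>dens\<close> says that out-neighbourhoods are on average far from being cliques of
  \<open>F\<close>, as they would be for a nearly split container.\<close>

locale supersat =
 fixes V :: "nat set" and R :: "nat => nat set" and F :: "nat set set" and D :: "nat => real"
  and n :: nat and X \<xi> :: real
 assumes finV: "finite V" and cardV: "card V = n"
  and RV: "\<And>v. v \<in> V ==> R v <= V" and irr: "\<And>v. v \<in> V ==> v ~: R v"
  and outD: "\<And>v. v \<in> V ==> rcard (R v) <= D v"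
  and inD: "\<And>x. x \<in> V ==> rcard {v\<in>V. x \<in> R v} <= D x"
  and monoD: "\<And>v x. v \<in> V ==> x \<in> R v ==> D v <= D x"
  and Dn: "\<And>v. v \<in> V ==> D v <= real n"
  and sumD: "(\<Sum>v\<in>V. D v) <= 2*real n*X"
  and F2: "F <= nsets V 2"
  and xi: "0 < \<xi>" "\<xi> <= 1" and X0: "X > 0"
  and dens: "(\<Sum>v\<in>V. rcard {(x, y) \<in> R v \<times> R v. x ~= y & {x, y} ~: F}/rcard (R v)) >= 2*\<xi>*real n*X"
begin

text \<open>The threshold between low and high degrees in units of \<open>X\<close>. The next two
  constants measure which share of vertices and which in-degrees may be neglected.\<close>

definition "\<tau> = 128/\<xi>^2"
definition "\<xi>2 = \<xi>^2/(24*\<tau>^2)"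
definition "\<xi>3 = \<xi>^2/(16*\<tau>)"
definition "c1 = \<xi>^2/4"
definition "c2 = c1^2*\<xi>3^2/32"
definition "g0 = 2*rcard F/(\<xi>2*real n)"

text \<open>The 4-cycle v, x, v', y with both its edges at v and at v' directed away from them; vv'
  and xy are its diagonals.\<close>

definition good_tuple :: "nat list => bool" where
 "good_tuple t \<longleftrightarrow> (\<exists>v x v' y. t = [v, x, v', y] & v \<in> V & v' \<in> V & v ~= v' & x ~= y &
  {v, v'} ~: F & {x, y} ~: F & x \<in> R v & y \<in> R v & x \<in> R v' & y \<in> R v')"

text \<open>A fractional family instead of a set: weights even out unequal degrees so that no three
  corners carry more than \<open>X\<close>. This is the form that can be compared with a maximal
  capped family in \<open>round\<close>.\<close>

definition spread :: "real => bool" where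
 "spread b \<longleftrightarrow> (\<exists>S \<omega>. finite S & (\<forall>t\<in>S. good_tuple t) & (\<forall>t. 0 <= \<omega> t & \<omega> t <= 1) &
  (\<forall>I\<in>{{0, 1, 2}, {0, 2, 3}, {0, 1, 3}, {1, 2, 3}}. \<forall>z. (\<Sum>t\<in>{t\<in>S. nths t I = z}. \<omega> t) <= X) &
  b <= (\<Sum>t\<in>S. \<omega> t))"

lemma tau: "\<tau> >= 128" "\<tau> > 0" "\<tau>*\<xi>^2 = 128"
proof -
 have "\<xi>^2 <= 1" "\<xi>^2 > 0" using xi by (auto simp: power_le_one)
 then show "\<tau> >= 128" "\<tau> > 0" "\<tau>*\<xi>^2 = 128" by (auto simp: \<tau>_def field_simps)
qed

lemma cpos: "\<xi>2 > 0" "\<xi>3 > 0" "c1 > 0" "c2 > 0"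
 using xi tau by (auto simp: \<xi>2_def \<xi>3_def c1_def c2_def)

lemma finR: "v \<in> V ==> finite (R v)"
 using RV finV finite_subset by blast

definition "nfp v = {(x, y) \<in> R v \<times> R v. x ~= y & {x, y} ~: F}"
text \<open>Normalises the weighted out-degree of v to at most \<open>\<xi>*X\<close> and discards
  vertices of tiny out-degree.\<close>

definition "\<alpha> v = (if \<xi>*X <= rcard (R v) then \<xi>*X/rcard (R v) else 0)"
definition "NP = {(x, y) \<in> V \<times> V. x ~= y & {x, y} ~: F}"
definition "W p = {v\<in>V. fst p \<in> R v & snd p \<in> R v}"
definition "r p = (\<Sum>v\<in>W p. \<alpha> v)"
definition "A = {v\<in>V. \<tau>*X <= D v}"
definition "PA = {(x, y) \<in> NP. x \<in> A \<or> y \<in> A}"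

lemma finNP: "finite NP" and cardNP: "card NP <= n^2"
proof -
 have sub: "NP <= V \<times> V" by (auto simp: NP_def)
 then show "finite NP" by (rule finite_subset) (use finV in auto)
 have "card NP <= card (V \<times> V)" using sub finV by (intro card_mono) auto
 then show "card NP <= n^2" using cardV by (simp add: card_cartesian_product power2_eq_square)
qed

lemma finW: "finite (W p)" using finV by (simp add: W_def)

lemma alpha: "0 <= \<alpha> v" "\<alpha> v <= 1" "\<alpha> v * rcard (R v) <= \<xi>*X"
proof -
 have p: "\<xi>*X > 0" using xi X0 by simp
 show "0 <= \<alpha> v" using p by (simp add: \<alpha>_def)
 show "\<alpha> v <= 1" using p by (simp add: \<alpha>_def divide_le_eq)
 show "\<alpha> v * rcard (R v) <= \<xi>*X" using p by (simp add: \<alpha>_def)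
qed

lemma r_nonneg: "0 <= r p" by (simp add: r_def sum_nonneg alpha)

lemma nfp_card: "v \<in> V ==> finite (nfp v) & rcard (nfp v) <= (rcard (R v))^2"
proof -
 assume v: "v \<in> V"
 have sub: "nfp v <= R v \<times> R v" by (auto simp: nfp_def)
 have "card (nfp v) <= card (R v \<times> R v)" using sub finR[OF v] by (intro card_mono) auto
 moreover have "finite (nfp v)" using sub finR[OF v] by (auto intro: finite_subset)
 ultimately show ?thesis by (simp add: card_cartesian_product power2_eq_square flip: of_nat_mult)
qed

text \<open>Discarding the vertices of out-degree below \<open>\<xi>*X\<close> costs at most
  \<open>(\<xi>*X)^2\<close> each, which in total is half of what \<open>dens\<close>
  provides.\<close>

lemma weight_total: "(\<Sum>p\<in>NP. r p) >= \<xi>^2*real n*X^2"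
proof -
 have pt: "\<alpha> v * rcard (nfp v) >= \<xi>*X*(rcard (nfp v)/rcard (R v)) - (\<xi>*X)^2" if v: "v \<in> V" for v
 proof (cases "\<xi>*X <= rcard (R v)")
  case True
  then show ?thesis by (simp add: \<alpha>_def)
 next
  case False
  have "rcard (nfp v)/rcard (R v) <= rcard (R v)"
   using nfp_card[OF v] by (auto simp: divide_le_eq power2_eq_square)
  also have "... <= \<xi>*X" using False by simp
  finally have "\<xi>*X*(rcard (nfp v)/rcard (R v)) <= \<xi>*X*(\<xi>*X)"
   using xi X0 by (intro mult_left_mono) auto
  then show ?thesis using False by (simp add: \<alpha>_def power2_eq_square)
 qed
 have "\<xi>^2*real n*X^2 = \<xi>*X*(2*\<xi>*real n*X) - real n*(\<xi>*X)^2"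
  by (simp add: power2_eq_square algebra_simps)
 also have "... <= \<xi>*X*(\<Sum>v\<in>V. rcard (nfp v)/rcard (R v)) - real n*(\<xi>*X)^2"
  using dens xi X0 unfolding nfp_def by (intro diff_right_mono mult_left_mono) auto
 also have "... = (\<Sum>v\<in>V. \<xi>*X*(rcard (nfp v)/rcard (R v)) - (\<xi>*X)^2)"
  by (simp add: sum_subtractf sum_distrib_left cardV)
 also have "... <= (\<Sum>v\<in>V. \<alpha> v * rcard (nfp v))" by (intro sum_mono pt)
 also have "... = (\<Sum>v\<in>V. \<Sum>p\<in>NP. if p \<in> nfp v then \<alpha> v else 0)"
 proof (rule sum.cong[OF refl])
  fix v assume v: "v \<in> V"
  have "nfp v <= NP" using RV[OF v] by (auto simp: nfp_def NP_def)
  then have "(\<Sum>p\<in>NP. if p \<in> nfp v then \<alpha> v else 0) = (\<Sum>p\<in>nfp v. \<alpha> v)"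
   using finNP by (simp add: sum.If_cases Int_absorb1)
  then show "\<alpha> v * rcard (nfp v) = (\<Sum>p\<in>NP. if p \<in> nfp v then \<alpha> v else 0)" by simp
 qed
 also have "... = (\<Sum>p\<in>NP. \<Sum>v\<in>V. if p \<in> nfp v then \<alpha> v else 0)" by (rule sum.swap)
 also have "... = (\<Sum>p\<in>NP. r p)"
 proof (rule sum.cong[OF refl])
  fix p assume p: "p \<in> NP"
  have "{v\<in>V. p \<in> nfp v} = W p" using p by (auto simp: NP_def nfp_def W_def)
  then show "(\<Sum>v\<in>V. if p \<in> nfp v then \<alpha> v else 0) = r p"
   using finV by (simp add: sum.If_cases r_def Int_def)
 qed
 finally show ?thesis .
qed

lemma cardA: "rcard A <= 2*real n/\<tau>"
proof -
 have "rcard A*(\<tau>*X) = (\<Sum>v\<in>A. \<tau>*X)" by simp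
 also have "... <= (\<Sum>v\<in>A. D v)" by (intro sum_mono) (auto simp: A_def)
 also have "... <= (\<Sum>v\<in>V. D v)"
  using finV outD by (intro sum_mono2) (auto simp: A_def intro: order_trans[OF of_nat_0_le_iff])
 also have "... <= 2*real n*X" by (rule sumD)
 finally show ?thesis using tau X0 by (simp add: field_simps)
qed

lemma cardPA: "rcard PA <= 4*(real n)^2/\<tau>"
proof -
 have fA: "finite A" using finV by (simp add: A_def)
 have "PA <= A \<times> V Un V \<times> A" by (auto simp: PA_def NP_def)
 then have "card PA <= card (A \<times> V Un V \<times> A)" using finV fA by (intro card_mono) auto
 also have "... <= card (A \<times> V) + card (V \<times> A)" by (rule card_Un_le)
 also have "... = 2*(card A*n)" by (simp add: card_cartesian_product cardV)
 finally have "rcard PA <= 2*(rcard A*real n)" by (metis of_nat_le_iff of_nat_mult of_nat_numeral)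
 also have "... <= 2*(2*real n/\<tau>*real n)" using cardA by (intro mult_left_mono mult_right_mono) auto
 finally show ?thesis by (simp add: power2_eq_square)
qed

lemma card_PF: "rcard {(v, v') \<in> V \<times> V. {v, v'} \<in> F} <= 2*rcard F"
proof -
 have "card {(v, v') \<in> V \<times> V. {v, v'} \<in> F} <= card {(v, v'). {v, v'} \<in> F}"
  using card_ordered_pairs[OF F2 finV] by (intro card_mono) auto
 then show ?thesis using card_ordered_pairs[OF F2 finV] by simp
qed

text \<open>Few pairs meet \<open>A\<close>, so their average weighted codegree \<open>r\<close> is
  large and its square counts many cycles. Cycles get the weight
  \<open>\<alpha> v * \<alpha> v'\<close>, reduced by a factor \<open>m\<close> depending on the
  pair x, y.\<close>

lemma case_high:
 assumes S0: "(\<Sum>p\<in>PA. r p) >= \<xi>^2*real n*X^2/2" and n0: "n > 0"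
  and cF: "rcard F <= X^2" and Xn: "X^2 >= real n"
 shows "spread (2*\<xi>^2*X^4)"
proof -
 define S0 where "S0 = \<xi>^2*real n*X^2/2"
 have S0pos: "S0 > 0" using xi X0 n0 by (simp add: S0_def)
 have finPA: "finite PA" using finNP by (auto simp: PA_def intro: finite_subset)
 \<comment> \<open>Truncation: for fixed v, x, y the weights sum over v' to at most
   \<open>m p*r p\<close>, which has to stay below \<open>X\<close>.\<close>
 define m where "m p = min 1 (X/r p)" for p
 have m01: "0 <= m p" "m p <= 1" for p using r_nonneg[of p] X0 by (auto simp: m_def)
 have mr: "m p*r p <= X" for p
  using r_nonneg[of p] X0 by (cases "r p = 0") (auto simp: m_def min_def field_simps)
 define \<omega> where "\<omega> t = (case t of [v, x, v', y] => \<alpha> v * \<alpha> v'*m (x, y) | _ => 0)" for t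
 have om: "0 <= \<omega> t & \<omega> t <= 1" for t
  using alpha m01 by (auto simp: \<omega>_def mult_le_one split: list.splits)
 have omv: "\<omega> [v, x, v', y] = \<alpha> v * \<alpha> v'*m (x, y)" for v x v' y by (simp add: \<omega>_def)
 define WW where "WW p = {(v, v') \<in> W p \<times> W p. v ~= v' & {v, v'} ~: F}" for p
 define S where "S = (%(p, q). [fst q, fst p, snd q, snd p]) ` (SIGMA p:PA. WW p)"
 have finWW: "finite (WW p)" for p
  by (rule finite_subset[of _ "W p \<times> W p"]) (use finW in \<open>auto simp: WW_def\<close>)
 have finS: "finite S" unfolding S_def using finPA finWW by auto
 have good: "good_tuple t" if "t \<in> S" for t
  using that by (auto simp: S_def good_tuple_def WW_def W_def PA_def NP_def)
 have Sform: "\<exists>v x v' y. t = [v, x, v', y] & v \<in> V & v' \<in> V & x \<in> R v & y \<in> R v & x \<in> R v' & y \<in> R v'" if "t \<in> S" for t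
  using that by (auto simp: S_def WW_def W_def)
 have deg1: "(\<Sum>y\<in>R v. \<alpha> v * \<alpha> v'*m (q y)) <= X" if "v \<in> V" for v v' and q :: "nat => nat \<times> nat"
 proof -
  have "(\<Sum>y\<in>R v. \<alpha> v * \<alpha> v'*m (q y)) <= (\<Sum>y\<in>R v. \<alpha> v * 1*1)"
   by (intro sum_mono mult_mono) (use alpha m01 in auto)
  also have "... = \<alpha> v * rcard (R v)" by simp
  also have "... <= \<xi>*X" by (rule alpha)
  also have "... <= X" using xi X0 by simp
  finally show ?thesis .
 qed
 have deg2: "(\<Sum>v'\<in>W p. \<alpha> v * \<alpha> v'*m p) <= X" for v p
 proof -
  have "(\<Sum>v'\<in>W p. \<alpha> v * \<alpha> v'*m p) = \<alpha> v * (m p*r p)"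
   by (simp add: r_def sum_distrib_left sum_distrib_right mult_ac)
  also have "... <= 1*X" using mr alpha m01 r_nonneg by (intro mult_mono) auto
  finally show ?thesis by simp
 qed
 have tri: "(\<Sum>t\<in>{t\<in>S. nths t I = z}. \<omega> t) <= X"
  if I: "I \<in> {{0, 1, 2}, {0, 2, 3}, {0, 1, 3}, {1, 2, 3}}" for I z
 proof (cases "{t\<in>S. nths t I = z} = {}")
  case True
  show ?thesis unfolding True using X0 by simp
 next
  case False
  then obtain t0 where t0: "t0 \<in> S" "nths t0 I = z" by auto
  obtain v x v' y where t0': "t0 = [v, x, v', y]" and in0: "v \<in> V" "v' \<in> V" "x \<in> R v" "y \<in> R v" "x \<in> R v'" "y \<in> R v'"
   using Sform[OF t0(1)] by blast
  from I consider "I = {0, 1, 2}" | "I = {0, 2, 3}" | "I = {0, 1, 3}" | "I = {1, 2, 3}" by blast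
  then show ?thesis
  proof cases
   case 1
   have "(\<Sum>t\<in>{t\<in>S. nths t I = z}. \<omega> t) <= (\<Sum>y\<in>R v. \<omega> [v, x, v', y])"
    by (rule sum_fiber_le) (use finR in0 om Sform t0 in \<open>fastforce simp: 1 t0' nths_Cons\<close>)+
   then show ?thesis using deg1[OF in0(1), of v' "%y. (x, y)"] by (simp add: omv)
  next
   case 2
   have "(\<Sum>t\<in>{t\<in>S. nths t I = z}. \<omega> t) <= (\<Sum>x\<in>R v. \<omega> [v, x, v', y])"
    by (rule sum_fiber_le) (use finR in0 om Sform t0 in \<open>fastforce simp: 2 t0' nths_Cons\<close>)+
   then show ?thesis using deg1[OF in0(1), of v' "%x. (x, y)"] by (simp add: omv)
  next
   case 3
   have "(\<Sum>t\<in>{t\<in>S. nths t I = z}. \<omega> t) <= (\<Sum>v'\<in>W (x, y). \<omega> [v, x, v', y])"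
    by (rule sum_fiber_le) (use finW om Sform t0 in \<open>fastforce simp: 3 t0' nths_Cons W_def\<close>)+
   then show ?thesis using deg2[of v "(x, y)"] by (simp add: omv)
  next
   case 4
   have "(\<Sum>t\<in>{t\<in>S. nths t I = z}. \<omega> t) <= (\<Sum>v\<in>W (x, y). \<omega> [v, x, v', y])"
    by (rule sum_fiber_le) (use finW om Sform t0 in \<open>fastforce simp: 4 t0' nths_Cons W_def\<close>)+
   then show ?thesis using deg2[of v' "(x, y)"] by (simp add: omv mult_ac)
  qed
 qed
 have inj: "inj_on (%(p, q). [fst q, fst p, snd q, snd p]) (SIGMA p:PA. WW p)"
  by (auto simp: inj_on_def)
 have "(\<Sum>t\<in>S. \<omega> t) = (\<Sum>(p, q)\<in>(SIGMA p:PA. WW p). \<omega> [fst q, fst p, snd q, snd p])"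
  unfolding S_def by (subst sum.reindex[OF inj]) (simp add: case_prod_beta)
 also have "... = (\<Sum>p\<in>PA. \<Sum>q\<in>WW p. \<alpha> (fst q)*\<alpha> (snd q)*m p)"
  by (subst sum.Sigma[symmetric]) (use finPA finWW in \<open>auto simp: omv\<close>)
 finally have tot: "(\<Sum>t\<in>S. \<omega> t) = (\<Sum>p\<in>PA. m p*(\<Sum>q\<in>WW p. \<alpha> (fst q)*\<alpha> (snd q)))"
  by (simp add: sum_distrib_left mult_ac)
 define PF where "PF = {(v, v') \<in> V \<times> V. {v, v'} \<in> F}"
 have finPF: "finite PF" using finV by (auto simp: PF_def intro: finite_subset[of _ "V \<times> V"])
 let ?w = "%q. \<alpha> (fst q)*\<alpha> (snd q)"
 have pt: "m p*(\<Sum>q\<in>WW p. ?w q) >= m p*((r p)^2 - r p) - (\<Sum>q\<in>PF Int (W p \<times> W p). ?w q)" for p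
 proof -
  have "(r p)^2 = (\<Sum>q\<in>W p \<times> W p. ?w q)"
   by (simp add: r_def power2_eq_square sum_product sum.cartesian_product case_prod_beta)
  also have "... <= (\<Sum>q\<in>WW p Un (%v. (v, v)) ` W p Un (PF Int (W p \<times> W p)). ?w q)"
   by (rule sum_mono2) (use finWW finW finPF alpha in \<open>auto simp: WW_def PF_def W_def\<close>)
  also have "... <= (\<Sum>q\<in>WW p. ?w q) + (\<Sum>q\<in>(%v. (v, v)) ` W p. ?w q) + (\<Sum>q\<in>PF Int (W p \<times> W p). ?w q)"
   by (intro order_trans[OF sum_Un_nonneg_le] add_mono order_refl) (use finWW finW finPF alpha in auto)
  also have "(\<Sum>q\<in>(%v. (v, v)) ` W p. ?w q) = (\<Sum>v\<in>W p. \<alpha> v * \<alpha> v)"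
   by (subst sum.reindex) (auto simp: inj_on_def)
  also have "... <= r p" unfolding r_def
  proof (rule sum_mono)
   fix v show "\<alpha> v * \<alpha> v <= \<alpha> v" using mult_left_le[of "\<alpha> v" "\<alpha> v"] alpha[of v] by simp
  qed
  finally have "(r p)^2 - r p - (\<Sum>q\<in>PF Int (W p \<times> W p). ?w q) <= (\<Sum>q\<in>WW p. ?w q)" by simp
  then have "m p*((r p)^2 - r p - (\<Sum>q\<in>PF Int (W p \<times> W p). ?w q)) <= m p*(\<Sum>q\<in>WW p. ?w q)"
   using m01 by (intro mult_left_mono) auto
  moreover have "m p*(\<Sum>q\<in>PF Int (W p \<times> W p). ?w q) <= 1*(\<Sum>q\<in>PF Int (W p \<times> W p). ?w q)"
   using m01 alpha by (intro mult_right_mono sum_nonneg) auto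
  ultimately show ?thesis by (simp add: right_diff_distrib)
 qed
 \<comment> \<open>Cycles with vv' in \<open>F\<close> must be discarded. Both weighted out-degrees
   are at most \<open>\<xi>*X\<close>, so each ordered pair vv' costs at most
   \<open>(\<xi>*X)^2\<close>.\<close>
 have F_part: "(\<Sum>p\<in>PA. \<Sum>q\<in>PF Int (W p \<times> W p). ?w q) <= 2*\<xi>^2*X^4"
 proof -
  have "(\<Sum>p\<in>PA. \<Sum>q\<in>PF Int (W p \<times> W p). ?w q) = (\<Sum>p\<in>PA. \<Sum>q\<in>PF. if q \<in> W p \<times> W p then ?w q else 0)"
   by (intro sum.cong refl sum.inter_restrict finPF)
  also have "... = (\<Sum>q\<in>PF. \<Sum>p\<in>PA. if q \<in> W p \<times> W p then ?w q else 0)" by (rule sum.swap)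
  also have "... <= (\<Sum>q\<in>PF. (\<xi>*X)\<^sup>2)"
  proof (rule sum_mono)
   fix q assume q: "q \<in> PF"
   then have qV: "fst q \<in> V" "snd q \<in> V" by (auto simp: PF_def)
   let ?P = "{p\<in>PA. q \<in> W p \<times> W p}"
   have "?P <= R (fst q) \<times> R (snd q)" by (auto simp: W_def)
   then have "card ?P <= card (R (fst q) \<times> R (snd q))"
    using finR qV by (intro card_mono) auto
   then have cP: "rcard ?P <= rcard (R (fst q))*rcard (R (snd q))"
    by (simp add: card_cartesian_product flip: of_nat_mult)
   have "(\<Sum>p\<in>PA. if q \<in> W p \<times> W p then ?w q else 0) = rcard ?P*?w q"
    using finPA by (simp add: sum.If_cases Int_def)
   also have "... <= rcard (R (fst q))*rcard (R (snd q))*?w q"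
    using cP alpha by (intro mult_right_mono) auto
   also have "... = (\<alpha> (fst q)*rcard (R (fst q)))*(\<alpha> (snd q)*rcard (R (snd q)))" by (simp add: mult_ac)
   also have "... <= (\<xi>*X)*(\<xi>*X)"
    using alpha(1,3) xi X0 by (intro mult_mono[OF alpha(3) alpha(3)] mult_nonneg_nonneg) auto
   finally show "(\<Sum>p\<in>PA. if q \<in> W p \<times> W p then ?w q else 0) <= (\<xi>*X)^2" by (simp add: power2_eq_square)
  qed
  also have "... = rcard PF*(\<xi>*X)^2" by simp
  also have "... <= (2*X^2)*(\<xi>*X)^2"
   using card_PF cF unfolding PF_def by (intro mult_right_mono) auto
  also have "... = 2*\<xi>^2*X^4" by (simp add: power2_eq_square power4_eq_xxxx)
  finally show ?thesis .
 qed
 \<comment> \<open>By \<open>cardPA\<close> and \<open>\<tau>*\<xi>^2 = 128\<close> the average of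
   \<open>r\<close> over \<open>PA\<close> is at least \<open>t\<close>. There the square is
   replaced by its tangent in \<open>pt2\<close>.\<close>
 define t where "t = 16*X^2/real n"
 \<comment> \<open>A vertex of \<open>A\<close> has degree at least \<open>\<tau>*X\<close>, and no
   degree exceeds \<open>n\<close>. This bounds \<open>t\<close> by \<open>X/2\<close>, so that the
   tangent bound survives the truncation.\<close>
 have "PA ~= {}" using S0 S0pos by (auto simp: S0_def)
 then obtain w where "w \<in> A" by (auto simp: PA_def)
 then have "\<tau>*X <= real n" using Dn by (fastforce simp: A_def)
 moreover have "128*X <= \<tau>*X" using tau X0 by (intro mult_right_mono) auto
 ultimately have "128*X <= real n" by linarith
 then have t1: "t <= X/2" using n0 X0 by (simp add: t_def field_simps power2_eq_square)
 have t2: "t >= 2" using Xn n0 by (simp add: t_def field_simps)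
 have pt2: "m p*((r p)^2 - r p) >= (2*t - 1)*r p - t^2" for p
 proof (cases "r p <= X")
  case True
  show ?thesis
  proof (cases "r p = 0")
   case True then show ?thesis by simp
  next
   case False
   then have "m p = 1" using True r_nonneg[of p] by (simp add: m_def)
   then show ?thesis using zero_le_power2[of "r p - t"] by (simp add: power2_eq_square algebra_simps)
  qed
 next
  case False
  then have "m p = X/r p" using X0 by (simp add: m_def min_def)
  then have e: "m p*((r p)^2 - r p) = X*r p - X" using False X0 by (simp add: field_simps power2_eq_square)
  have "2*t*r p <= X*r p" using t1 r_nonneg by (intro mult_right_mono) auto
  then have "(2*t - 1)*r p <= X*r p - X" using False by (simp add: algebra_simps)
  then show ?thesis unfolding e using zero_le_power2[of t] by linarith
 qed
 have "(\<Sum>t\<in>S. \<omega> t) >= (\<Sum>p\<in>PA. m p*((r p)^2 - r p) - (\<Sum>q\<in>PF Int (W p \<times> W p). ?w q))"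
  unfolding tot by (intro sum_mono pt)
 then have "(\<Sum>t\<in>S. \<omega> t) >= (\<Sum>p\<in>PA. m p*((r p)^2 - r p)) - 2*\<xi>^2*X^4"
  using F_part by (simp add: sum_subtractf)
 moreover have "(\<Sum>p\<in>PA. m p*((r p)^2 - r p)) >= (\<Sum>p\<in>PA. (2*t - 1)*r p - t^2)" by (intro sum_mono pt2)
 moreover have "(\<Sum>p\<in>PA. (2*t - 1)*r p - t^2) = (2*t - 1)*(\<Sum>p\<in>PA. r p) - rcard PA*t^2"
  by (simp add: sum_subtractf sum_distrib_left)
 moreover have "(2*t - 1)*(\<Sum>p\<in>PA. r p) >= (2*t - 1)*S0"
  using S0 t2 by (intro mult_left_mono) (auto simp: S0_def)
 moreover have "rcard PA*t^2 <= 4*(real n)^2/\<tau>*t^2" by (intro mult_right_mono cardPA) auto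
 moreover have "4*(real n)^2/\<tau>*t^2 = t*S0"
 proof -
  have "4*(real n)^2/\<tau>*t = 64*real n*X^2/\<tau>" using n0 by (simp add: t_def power2_eq_square)
  also have "... = S0" using xi tau by (simp add: S0_def \<tau>_def)
  finally have e: "4*(real n)^2/\<tau>*t = S0" .
  have "4*(real n)^2/\<tau>*t^2 = t*(4*(real n)^2/\<tau>*t)" by (simp add: power2_eq_square)
  then show ?thesis unfolding e .
 qed
 moreover have "t*S0 = 8*\<xi>^2*X^4" using n0 by (simp add: t_def S0_def power2_eq_square power4_eq_xxxx)
 moreover have "2*S0 <= t*S0" using t2 S0pos by simp
 ultimately have "(\<Sum>t\<in>S. \<omega> t) >= 2*\<xi>^2*X^4" by (simp add: algebra_simps)
 then show ?thesis unfolding spread_def using finS good om tri by blast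
qed

text \<open>Outside \<open>A\<close> all degrees are of order \<open>X\<close>, so that there the counts below are uniform up to constants.\<close>

definition "B = {w\<in>V. real (degF F w) > g0}"
definition "V2 = {v\<in>V. v ~: A & v ~: B}"
definition "i2 x = card {v\<in>V2. x \<in> R v}"
definition "U2 = {x\<in>V2. \<xi>3*X <= real (i2 x)}"
definition "Q0 = (SIGMA p:{p\<in>NP. fst p \<in> U2 & snd p \<in> U2}. W p Int V2)"

lemma finite_sets: "finite A" "finite B" "finite V2" "finite U2"
 using finV by (auto simp: A_def B_def V2_def U2_def)

lemma low_deg:
 assumes "v \<in> V" "v ~: A"
 shows "rcard (R v) <= \<tau>*X" "rcard {u\<in>V. v \<in> R u} <= \<tau>*X"
 using outD[OF assms(1)] inD[OF assms(1)] assms by (auto simp: A_def)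

text \<open>The orientation goes from lower to higher degree, so a low target has only low
  sources.\<close>

lemma low_source: "v \<in> V ==> x \<in> R v ==> x ~: A ==> v ~: A"
 using monoD[of v x] RV[of v] by (force simp: A_def)

lemma i2_le: "x \<in> V ==> x ~: A ==> real (i2 x) <= \<tau>*X"
proof -
 assume x: "x \<in> V" "x ~: A"
 have "i2 x <= card {u\<in>V. x \<in> R u}" unfolding i2_def using finV by (intro card_mono) (auto simp: V2_def)
 then show ?thesis using low_deg(2)[OF x] by linarith
qed

lemma cardB:
 assumes "n > 0"
 shows "rcard B <= \<xi>2*real n"
proof (cases "card F = 0")
 case True
 have fF: "finite F" using finite_subset[OF F2] finV by (simp add: finite_imp_finite_nsets)
 then have "F = {}" using True by simp
 then have "degF F w = 0" for w by (simp add: degF_def)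
 then have "B = {}" using True by (simp add: B_def g0_def)
 then show ?thesis using cpos by simp
next
 case False
 then have g: "g0 > 0" using cpos assms by (simp add: g0_def)
 have "rcard B*g0 = (\<Sum>w\<in>B. g0)" by simp
 also have "... <= (\<Sum>w\<in>B. real (degF F w))" by (intro sum_mono) (auto simp: B_def)
 also have "... <= (\<Sum>w\<in>V. real (degF F w))" using finV by (intro sum_mono2) (auto simp: B_def)
 also have "... = 2*rcard F" using sum_degF[OF F2 finV] by (metis of_nat_mult of_nat_numeral of_nat_sum)
 also have "... = \<xi>2*real n*g0" using cpos assms by (simp add: g0_def)
 finally show ?thesis using g by simp
qed

text \<open>Three families of cherries meet \<open>B\<close>, and two have an end of small
  in-degree. The definitions of \<xi>2 and \<xi>3 make each of the two totals an eighth of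
  \<open>\<xi>^2*n*X^2\<close>, so that a quarter remains, which is \<open>c1\<close>.\<close>

lemma Q0_card:
 assumes S0: "(\<Sum>p\<in>NP - PA. r p) >= \<xi>^2*real n*X^2/2" and n0: "n > 0"
 shows "rcard Q0 >= c1*real n*X^2"
proof -
 define Q where "Q = (SIGMA p:NP - PA. W p)"
 have finQ: "finite Q" unfolding Q_def using finNP finW by auto
 have "(\<Sum>p\<in>NP - PA. r p) <= (\<Sum>p\<in>NP - PA. rcard (W p))"
 proof (rule sum_mono)
  fix p
  have "r p <= (\<Sum>v\<in>W p. 1)" unfolding r_def by (intro sum_mono alpha)
  then show "r p <= rcard (W p)" by simp
 qed
 also have "... = rcard Q" unfolding Q_def using finNP finW by (subst card_SigmaI) auto
 finally have Qc: "rcard Q >= \<xi>^2*real n*X^2/2" using S0 by linarith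
 have Qlow: "x \<in> V" "y \<in> V" "v \<in> V" "x ~: A" "y ~: A" "v ~: A" "x \<in> R v" "y \<in> R v" if "((x, y), v) \<in> Q" for x y v
  using that low_source[of v x] by (auto simp: Q_def NP_def PA_def W_def)
 have tX: "0 <= \<tau>*X" using tau X0 by simp
 have fib1: "rcard {q\<in>Q. P q & snd q = v} <= (\<tau>*X)^2" for P v
 proof (cases "\<exists>p. (p, v) \<in> Q")
  case False
  then have e: "{q\<in>Q. P q & snd q = v} = {}" by auto
  show ?thesis unfolding e by simp
 next
  case True
  then obtain x y where xy: "((x, y), v) \<in> Q" by auto
  note l = Qlow[OF xy]
  have "{q\<in>Q. P q & snd q = v} <= (%p. (p, v)) ` (R v \<times> R v)" using Qlow by force
  then have "card {q\<in>Q. P q & snd q = v} <= card ((%p. (p, v)) ` (R v \<times> R v))"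
   using finR[OF l(3)] by (intro card_mono) auto
  also have "... <= card (R v \<times> R v)" using finR[OF l(3)] by (intro card_image_le) auto
  finally have "rcard {q\<in>Q. P q & snd q = v} <= rcard (R v)*rcard (R v)"
   by (simp add: card_cartesian_product flip: of_nat_mult)
  also have "... <= (\<tau>*X)*(\<tau>*X)" using low_deg[OF l(3,6)] tX by (intro mult_mono) auto
  finally show ?thesis by (simp add: power2_eq_square)
 qed
 have fib2: "rcard {((x, y), v). ((x, y), v) \<in> Q & v \<in> Z & x = w} <= rcard {v\<in>Z. w \<in> R v}*(\<tau>*X)"
  and fib3: "rcard {((x, y), v). ((x, y), v) \<in> Q & v \<in> Z & y = w} <= rcard {v\<in>Z. w \<in> R v}*(\<tau>*X)"
  if Z: "Z <= V" for Z w
 proof -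
  have fZ: "finite {v\<in>Z. w \<in> R v}" using finite_subset[OF Z finV] by simp
  have fR: "finite (R v)" if "v \<in> Z" for v using finR that Z by auto
  define ZZ where "ZZ = {v\<in>Z. w \<in> R v & v ~: A}"
  have fZZ: "finite ZZ" by (rule finite_subset[OF _ fZ]) (auto simp: ZZ_def)
  have cs: "rcard (SIGMA v:ZZ. R v) <= rcard {v\<in>Z. w \<in> R v}*(\<tau>*X)"
  proof -
   have "rcard (SIGMA v:ZZ. R v) = (\<Sum>v\<in>ZZ. rcard (R v))"
    using fZZ fR by (subst card_SigmaI) (auto simp: ZZ_def)
   also have "... <= (\<Sum>v\<in>ZZ. \<tau>*X)" using Z by (intro sum_mono low_deg) (auto simp: ZZ_def)
   also have "... = rcard ZZ*(\<tau>*X)" by simp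
   also have "... <= rcard {v\<in>Z. w \<in> R v}*(\<tau>*X)"
    using fZ tX by (intro mult_right_mono of_nat_mono card_mono) (auto simp: ZZ_def)
   finally show ?thesis .
  qed
  have fS: "finite (SIGMA v:ZZ. R v)" using fZZ fR by (auto simp: ZZ_def)
  have "{((x, y), v). ((x, y), v) \<in> Q & v \<in> Z & x = w} <= (%(v, y). ((w, y), v)) ` (SIGMA v:ZZ. R v)"
   using Qlow by (force simp: ZZ_def image_iff)
  then have "card {((x, y), v). ((x, y), v) \<in> Q & v \<in> Z & x = w} <= card (SIGMA v:ZZ. R v)"
   by (rule surj_card_le[OF fS])
  then show "rcard {((x, y), v). ((x, y), v) \<in> Q & v \<in> Z & x = w} <= rcard {v\<in>Z. w \<in> R v}*(\<tau>*X)"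
   using cs by linarith
  have "{((x, y), v). ((x, y), v) \<in> Q & v \<in> Z & y = w} <= (%(v, x). ((x, w), v)) ` (SIGMA v:ZZ. R v)"
   using Qlow by (force simp: ZZ_def image_iff)
  then have "card {((x, y), v). ((x, y), v) \<in> Q & v \<in> Z & y = w} <= card (SIGMA v:ZZ. R v)"
   by (rule surj_card_le[OF fS])
  then show "rcard {((x, y), v). ((x, y), v) \<in> Q & v \<in> Z & y = w} <= rcard {v\<in>Z. w \<in> R v}*(\<tau>*X)"
   using cs by linarith
 qed
 define Qv where "Qv = {q\<in>Q. snd q \<in> B}"
 define Qx where "Qx = {((x, y), v). ((x, y), v) \<in> Q & x \<in> B}"
 define Qy where "Qy = {((x, y), v). ((x, y), v) \<in> Q & y \<in> B}"
 define Rx where "Rx = {((x, y), v). ((x, y), v) \<in> Q & v \<in> V2 & x \<in> V2 - U2}"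
 define Ry where "Ry = {((x, y), v). ((x, y), v) \<in> Q & v \<in> V2 & y \<in> V2 - U2}"
 have fins: "finite Qv" "finite Qx" "finite Qy" "finite Rx" "finite Ry"
  unfolding Qv_def Qx_def Qy_def Rx_def Ry_def by (rule finite_subset[OF _ finQ], auto)+
 have cB: "rcard B*(\<tau>*X)^2 <= \<xi>2*real n*(\<tau>*X)^2" using cardB[OF n0] by (intro mult_right_mono) auto
 have 1: "rcard Qv <= rcard B*(\<tau>*X)^2"
 proof (rule card_le_fibers[where f = snd])
  show "rcard {t\<in>Qv. snd t = b} <= (\<tau>*X)^2" for b
   using fib1[of "%q. snd q \<in> B" b] by (simp add: Qv_def conj_assoc)
 qed (use fins finite_sets in \<open>auto simp: Qv_def\<close>)
 have inB: "rcard {v\<in>V. b \<in> R v}*(\<tau>*X) <= (\<tau>*X)^2 \<or> (\<forall>x y v. ((x, y), v) \<in> Q --> x ~= b & y ~= b)" for b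
 proof (cases "\<exists>x y v. ((x, y), v) \<in> Q & (x = b \<or> y = b)")
  case True
  then have "b \<in> V" "b ~: A" using Qlow by blast+
  then have "rcard {v\<in>V. b \<in> R v}*(\<tau>*X) <= (\<tau>*X)*(\<tau>*X)" using low_deg tX by (intro mult_right_mono) auto
  then show ?thesis by (simp add: power2_eq_square)
 qed blast
 have 2: "rcard Qx <= rcard B*(\<tau>*X)^2"
 proof (rule card_le_fibers[where f = "fst \<circ> fst"])
  fix b
  have e: "{t\<in>Qx. (fst \<circ> fst) t = b} <= {((x, y), v). ((x, y), v) \<in> Q & v \<in> V & x = b}" using Qlow by (auto simp: Qx_def)
  have "card {t\<in>Qx. (fst \<circ> fst) t = b} <= card {((x, y), v). ((x, y), v) \<in> Q & v \<in> V & x = b}"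
   by (rule card_mono[OF finite_subset[OF _ finQ] e]) auto
  moreover have "{((x, y), v). ((x, y), v) \<in> Q & v \<in> V & x = b} = {}" if "\<forall>x y v. ((x, y), v) \<in> Q --> x ~= b & y ~= b"
   using that by auto
  ultimately show "rcard {t\<in>Qx. (fst \<circ> fst) t = b} <= (\<tau>*X)^2"
   using inB[of b] fib2[of V b] by (smt (verit) card.empty of_nat_0 of_nat_le_iff order_refl zero_le_power2)
 qed (use fins finite_sets in \<open>auto simp: Qx_def\<close>)
 have 3: "rcard Qy <= rcard B*(\<tau>*X)^2"
 proof (rule card_le_fibers[where f = "snd \<circ> fst"])
  fix b
  have e: "{t\<in>Qy. (snd \<circ> fst) t = b} <= {((x, y), v). ((x, y), v) \<in> Q & v \<in> V & y = b}" using Qlow by (auto simp: Qy_def)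
  have "card {t\<in>Qy. (snd \<circ> fst) t = b} <= card {((x, y), v). ((x, y), v) \<in> Q & v \<in> V & y = b}"
   by (rule card_mono[OF finite_subset[OF _ finQ] e]) auto
  moreover have "{((x, y), v). ((x, y), v) \<in> Q & v \<in> V & y = b} = {}" if "\<forall>x y v. ((x, y), v) \<in> Q --> x ~= b & y ~= b"
   using that by auto
  ultimately show "rcard {t\<in>Qy. (snd \<circ> fst) t = b} <= (\<tau>*X)^2"
   using inB[of b] fib3[of V b] by (smt (verit) card.empty of_nat_0 of_nat_le_iff order_refl zero_le_power2)
 qed (use fins finite_sets in \<open>auto simp: Qy_def\<close>)
 have V2n: "rcard (V2 - U2) <= real n"
  using card_mono[OF finV, of "V2 - U2"] cardV by (auto simp: V2_def)
 have i2b: "rcard {v\<in>V2. b \<in> R v}*(\<tau>*X) <= \<xi>3*X*(\<tau>*X)" if "b \<in> V2 - U2" for b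
  using that tX by (intro mult_right_mono) (auto simp: U2_def i2_def)
 have V2V: "V2 <= V" by (auto simp: V2_def)
 have 4: "rcard Rx <= rcard (V2 - U2)*(\<xi>3*X*(\<tau>*X))"
 proof (rule card_le_fibers[where f = "fst \<circ> fst"])
  fix b assume b: "b \<in> V2 - U2"
  have e: "{t\<in>Rx. (fst \<circ> fst) t = b} <= {((x, y), v). ((x, y), v) \<in> Q & v \<in> V2 & x = b}" by (auto simp: Rx_def)
  have "card {t\<in>Rx. (fst \<circ> fst) t = b} <= card {((x, y), v). ((x, y), v) \<in> Q & v \<in> V2 & x = b}"
   by (rule card_mono[OF finite_subset[OF _ finQ] e]) auto
  then show "rcard {t\<in>Rx. (fst \<circ> fst) t = b} <= \<xi>3*X*(\<tau>*X)"
   using fib2[OF V2V, of b] i2b[OF b] by linarith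
 qed (use fins finite_sets in \<open>auto simp: Rx_def\<close>)
 have 5: "rcard Ry <= rcard (V2 - U2)*(\<xi>3*X*(\<tau>*X))"
 proof (rule card_le_fibers[where f = "snd \<circ> fst"])
  fix b assume b: "b \<in> V2 - U2"
  have e: "{t\<in>Ry. (snd \<circ> fst) t = b} <= {((x, y), v). ((x, y), v) \<in> Q & v \<in> V2 & y = b}" by (auto simp: Ry_def)
  have "card {t\<in>Ry. (snd \<circ> fst) t = b} <= card {((x, y), v). ((x, y), v) \<in> Q & v \<in> V2 & y = b}"
   by (rule card_mono[OF finite_subset[OF _ finQ] e]) auto
  then show "rcard {t\<in>Ry. (snd \<circ> fst) t = b} <= \<xi>3*X*(\<tau>*X)"
   using fib3[OF V2V, of b] i2b[OF b] by linarith
 qed (use fins finite_sets in \<open>auto simp: Ry_def\<close>)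
 have finQ0: "finite Q0" unfolding Q0_def using finNP finW by auto
 have "Q <= Q0 Un (Qv Un (Qx Un (Qy Un (Rx Un Ry))))"
 proof
  fix q assume q: "q \<in> Q"
  obtain x y v where q': "q = ((x, y), v)" by (metis surj_pair)
  note l = Qlow[OF q[unfolded q']]
  have "(x, y) \<in> NP" "v \<in> W (x, y)" using q unfolding q' Q_def by auto
  then show "q \<in> Q0 Un (Qv Un (Qx Un (Qy Un (Rx Un Ry))))"
   using q l unfolding q' Q0_def Qv_def Qx_def Qy_def Rx_def Ry_def by (auto simp: V2_def)
 qed
 then have "card Q <= card (Q0 Un (Qv Un (Qx Un (Qy Un (Rx Un Ry)))))" using fins finQ0 by (intro card_mono) auto
 also have "... <= card Q0 + (card Qv + (card Qx + (card Qy + (card Rx + card Ry))))"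
  by (meson add_left_mono card_Un_le le_trans)
 finally have "rcard Q <= rcard Q0 + (3*(\<xi>2*real n*(\<tau>*X)^2) + 2*(rcard (V2 - U2)*(\<xi>3*X*(\<tau>*X))))"
  using 1 2 3 4 5 cB by linarith
 also have "rcard (V2 - U2)*(\<xi>3*X*(\<tau>*X)) <= real n*(\<xi>3*X*(\<tau>*X))"
  using V2n cpos tX X0 by (intro mult_right_mono) auto
 finally have "rcard Q <= rcard Q0 + (3*(\<xi>2*real n*(\<tau>*X)^2) + 2*(real n*(\<xi>3*X*(\<tau>*X))))" by simp
 moreover have "3*(\<xi>2*real n*(\<tau>*X)^2) = \<xi>^2*real n*X^2/8"
  using tau by (simp add: \<xi>2_def power_mult_distrib)
 moreover have "2*(real n*(\<xi>3*X*(\<tau>*X))) = \<xi>^2*real n*X^2/8"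
  using tau by (simp add: \<xi>3_def power2_eq_square)
 ultimately have "rcard Q0 >= \<xi>^2*real n*X^2/4" using Qc by linarith
 then show ?thesis by (simp add: c1_def)
qed

end

context supersat
begin

text \<open>The bound on the degrees in \<open>F\<close> is recorded because it later caps how many
  quadruples share two or three corners.\<close>

definition many_quads :: "real => bool" where
 "many_quads b \<longleftrightarrow> (\<exists>S. finite S & b <= rcard S &
  (\<forall>t\<in>S. \<exists>v x v' x'. t = [v, x, v', x'] & v \<in> V & v' \<in> V & x \<in> R v & x' \<in> R v & x \<in> R v' & x' \<in> R v' &
    {v, v'} \<in> F & {x, x'} \<in> F & (\<forall>w\<in>{v, v', x, x'}. real (degF F w) <= g0)))"

text \<open>Away from \<open>A\<close> all in- and out-degrees are at most \<open>\<tau>*X\<close>,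
  so the constant weight 1/\<tau> already respects the cap on triples.\<close>

lemma spread_const:
 assumes "finite S" and good: "\<And>t. t \<in> S ==> good_tuple t" and low: "\<And>t. t \<in> S ==> set t Int A = {}"
 shows "spread (rcard S/\<tau>)"
proof -
 define \<omega> where "\<omega> = (%t::nat list. 1/\<tau>)"
 have om: "0 <= \<omega> t & \<omega> t <= 1" for t using tau by (simp add: \<omega>_def)
 have Sform: "\<exists>v x v' y. t = [v, x, v', y] & v \<in> V & v' \<in> V & x \<in> R v & y \<in> R v & x \<in> R v' & y \<in> R v' &
   v ~: A & v' ~: A & x ~: A & y ~: A" if "t \<in> S" for t
  using good[OF that] low[OF that] unfolding good_tuple_def by auto
 have bnd: "(\<Sum>y\<in>Z. 1/\<tau>) <= X" if "rcard Z <= \<tau>*X" for Z :: "nat set"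
  using that tau by (simp add: field_simps)
 have tri: "(\<Sum>t\<in>{t\<in>S. nths t I = z}. \<omega> t) <= X"
  if I: "I \<in> {{0, 1, 2}, {0, 2, 3}, {0, 1, 3}, {1, 2, 3}}" for I z
 proof (cases "{t\<in>S. nths t I = z} = {}")
  case True
  show ?thesis unfolding True using X0 by simp
 next
  case False
  then obtain t0 where t0: "t0 \<in> S" "nths t0 I = z" by auto
  obtain v x v' y where t0': "t0 = [v, x, v', y]" and in0: "v \<in> V" "v' \<in> V" "x \<in> R v" "y \<in> R v" "x \<in> R v'" "y \<in> R v'"
   "v ~: A" "v' ~: A" "x ~: A" "y ~: A"
   using Sform[OF t0(1)] by blast
  have xV: "x \<in> V" "y \<in> V" using RV in0 by auto
  from I consider "I = {0, 1, 2}" | "I = {0, 2, 3}" | "I = {0, 1, 3}" | "I = {1, 2, 3}" by blast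
  then show ?thesis
  proof cases
   case 1
   have "(\<Sum>t\<in>{t\<in>S. nths t I = z}. \<omega> t) <= (\<Sum>y\<in>R v. \<omega> [v, x, v', y])"
    by (rule sum_fiber_le) (use finR in0 om Sform t0 in \<open>fastforce simp: 1 t0' nths_Cons\<close>)+
   then show ?thesis using bnd[OF low_deg(1)[OF in0(1,7)]] by (simp add: \<omega>_def)
  next
   case 2
   have "(\<Sum>t\<in>{t\<in>S. nths t I = z}. \<omega> t) <= (\<Sum>x\<in>R v. \<omega> [v, x, v', y])"
    by (rule sum_fiber_le) (use finR in0 om Sform t0 in \<open>fastforce simp: 2 t0' nths_Cons\<close>)+
   then show ?thesis using bnd[OF low_deg(1)[OF in0(1,7)]] by (simp add: \<omega>_def)
  next
   case 3
   have "(\<Sum>t\<in>{t\<in>S. nths t I = z}. \<omega> t) <= (\<Sum>v'\<in>{u\<in>V. x \<in> R u}. \<omega> [v, x, v', y])"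
    by (rule sum_fiber_le) (use finV om Sform t0 in \<open>fastforce simp: 3 t0' nths_Cons\<close>)+
   then show ?thesis using bnd[OF low_deg(2)[OF xV(1) in0(9)]] by (simp add: \<omega>_def)
  next
   case 4
   have "(\<Sum>t\<in>{t\<in>S. nths t I = z}. \<omega> t) <= (\<Sum>v\<in>{u\<in>V. x \<in> R u}. \<omega> [v, x, v', y])"
    by (rule sum_fiber_le) (use finV om Sform t0 in \<open>fastforce simp: 4 t0' nths_Cons\<close>)+
   then show ?thesis using bnd[OF low_deg(2)[OF xV(1) in0(9)]] by (simp add: \<omega>_def)
  qed
 qed
 have "(\<Sum>t\<in>S. \<omega> t) = rcard S/\<tau>" by (simp add: \<omega>_def)
 then show ?thesis unfolding spread_def
  using assms(1) good om tri by (intro exI[of _ S] exI[of _ \<omega>]) auto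
qed

lemma card_offdiag: "finite J ==> rcard {(x, y) \<in> J \<times> J. x ~= y} = (rcard J)^2 - rcard J"
proof -
 assume J: "finite J"
 have "{(x, y) \<in> J \<times> J. x ~= y} = J \<times> J - (%x. (x, x)) ` J" by auto
 moreover have "card (J \<times> J - (%x. (x, x)) ` J) = card (J \<times> J) - card ((%x. (x, x)) ` J)"
  using J by (intro card_Diff_subset) auto
 moreover have "card ((%x. (x, x)) ` J) = card J" by (rule card_image) (auto simp: inj_on_def)
 moreover have "card J <= card J*card J" by (cases "card J") auto
 ultimately show ?thesis by (simp add: card_cartesian_product power2_eq_square of_nat_diff)
qed

text \<open>Cauchy-Schwarz over pairs x, y outside \<open>F\<close> gives order X^4 pairs of
  cherries with sources v, v'. If vv' is often outside \<open>F\<close>, these are good cycles. If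
  not, a third source u that is not joined to v in \<open>F\<close> is added, with any x, y below v,
  v' and u: if xy is outside \<open>F\<close>, then v, x, u, y is good; if it is in
  \<open>F\<close>, then v, x, v', y is a quadruple.\<close>

lemma case_low:
 assumes S0: "(\<Sum>p\<in>NP - PA. r p) >= \<xi>^2*real n*X^2/2" and n0: "n > 0"
  and cF: "rcard F <= X^2" and g0: "g0 <= \<xi>3*X/4" and X4: "4 <= \<xi>3*X"
  and Xn1: "2*\<tau>^2/c1^2*real n <= X^2" and Xn2: "64*\<tau>^2/(c1^2*\<xi>3^2)*real n <= X^2"
 shows "spread (min (c1^2/(4*\<tau>)) (c2*\<xi>2/(4*\<tau>))*X^4) \<or> many_quads (c2/(2*\<tau>)*(X^5/real n))"
proof -
 define PU where "PU = {p\<in>NP. fst p \<in> U2 & snd p \<in> U2}"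
 define WV where "WV p = W p Int V2" for p
 have finPU: "finite PU" using finNP by (simp add: PU_def)
 have finWV: "finite (WV p)" for p using finW by (simp add: WV_def)
 have Q0e: "Q0 = (SIGMA p:PU. WV p)" by (simp add: Q0_def PU_def WV_def)
 have cQ0: "rcard Q0 = (\<Sum>p\<in>PU. rcard (WV p))"
  unfolding Q0e using finPU finWV by (subst card_SigmaI) auto
 have Q0l: "c1*real n*X^2 <= rcard Q0" by (rule Q0_card[OF S0 n0])
 have V2V: "V2 <= V" "V2 Int A = {}" by (auto simp: V2_def)
 have U2V: "U2 <= V2" by (auto simp: U2_def)
 have V2A: "w ~: A" if "w \<in> V2" for w using that by (simp add: V2_def)
 have U2sub: "w \<in> V2" if "w \<in> U2" for w using that by (simp add: U2_def)
 have nn: "real n > 0" using n0 by simp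
 have Q0u: "rcard Q0 <= real n*(\<tau>*X)^2"
 proof -
  have "rcard Q0 <= rcard V2*(\<tau>*X)^2"
  proof (rule card_le_fibers[where f = snd])
   fix v assume v: "v \<in> V2"
   have "{t\<in>Q0. snd t = v} <= (%p. (p, v)) ` (R v \<times> R v)" by (force simp: Q0_def W_def)
   then have "card {t\<in>Q0. snd t = v} <= card ((%p. (p, v)) ` (R v \<times> R v))"
    using finR v V2V by (intro card_mono) auto
   also have "... <= card (R v \<times> R v)" using finR v V2V by (intro card_image_le) auto
   finally have "rcard {t\<in>Q0. snd t = v} <= rcard (R v)*rcard (R v)"
    by (simp add: card_cartesian_product flip: of_nat_mult)
   also have "... <= (\<tau>*X)*(\<tau>*X)" using low_deg(1)[of v] v V2V tau X0 by (intro mult_mono) auto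
   finally show "rcard {t\<in>Q0. snd t = v} <= (\<tau>*X)^2" by (simp add: power2_eq_square)
  next
   show "finite Q0" unfolding Q0e using finPU finWV by auto
   show "snd ` Q0 <= V2" by (auto simp: Q0_def)
  qed (rule finite_sets)
  also have "... <= real n*(\<tau>*X)^2"
   using card_mono[OF finV V2V(1)] cardV by (intro mult_right_mono) auto
  finally show ?thesis .
 qed
 define T4 where "T4 = (SIGMA p:PU. WV p \<times> WV p)"
 define Td where "Td = {(p, v, v'). (p, v, v') \<in> T4 & v = v'}"
 define Tg where "Tg = {(p, v, v'). (p, v, v') \<in> T4 & v ~= v' & {v, v'} ~: F}"
 define Tb where "Tb = {(p, v, v'). (p, v, v') \<in> T4 & {v, v'} \<in> F}"
 have finT4: "finite T4" unfolding T4_def using finPU finWV by auto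
 have finTs: "finite Td" "finite Tg" "finite Tb"
  unfolding Td_def Tg_def Tb_def by (rule finite_subset[OF _ finT4], auto)+
 have "(rcard Q0)^2 <= rcard PU*(\<Sum>p\<in>PU. (rcard (WV p))\<^sup>2)"
  unfolding cQ0 by (rule sum_sq_ge[OF finPU])
 also have "(\<Sum>p\<in>PU. (rcard (WV p))\<^sup>2) = rcard T4"
  unfolding T4_def using finPU finWV by (subst card_SigmaI) (auto simp: card_cartesian_product power2_eq_square)
 also have "rcard PU*rcard T4 <= (real n)^2*rcard T4"
 proof -
  have "card PU <= card NP" using finNP by (intro card_mono) (auto simp: PU_def)
  then have "card PU <= n^2" using cardNP by linarith
  then show ?thesis by (intro mult_right_mono) (auto simp flip: of_nat_power)
 qed
 finally have cT4: "(c1*X^2)^2 <= rcard T4"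
 proof -
  assume a: "(rcard Q0)^2 <= (real n)^2*rcard T4"
  have "(c1*real n*X^2)^2 <= (rcard Q0)^2" using Q0l cpos nn by (intro power_mono) auto
  then have "(real n)^2*(c1*X^2)^2 <= (real n)^2*rcard T4" using a by (simp add: power_mult_distrib mult_ac)
  then show ?thesis using nn by simp
 qed
 have cTd: "rcard Td <= c1^2*X^4/2"
 proof -
  have "Td <= (%(p, v). (p, v, v)) ` Q0" by (auto simp: Td_def T4_def Q0e image_iff)
  then have "card Td <= card Q0"
   unfolding Q0e using finPU finWV by (intro surj_card_le) auto
  then have "rcard Td <= real n*(\<tau>*X)^2" using Q0u by linarith
  also have "... = (2*\<tau>^2/c1^2*real n)*(c1^2*X^2/2)" using cpos by (simp add: power_mult_distrib)
  also have "... <= X^2*(c1^2*X^2/2)" using Xn1 by (intro mult_right_mono) auto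
  also have "... = c1^2*X^4/2" by (simp add: power2_eq_square power4_eq_xxxx)
  finally show ?thesis .
 qed
 have "T4 <= Td Un (Tg Un Tb)" by (auto simp: Td_def Tg_def Tb_def)
 then have "card T4 <= card (Td Un (Tg Un Tb))" using finTs by (intro card_mono) auto
 also have "... <= card Td + (card Tg + card Tb)" by (meson add_left_mono card_Un_le le_trans)
 finally have "rcard T4 <= rcard Td + (rcard Tg + rcard Tb)" by linarith
 moreover have "(c1*X^2)^2 = c1^2*X^4" by (simp add: power2_eq_square power4_eq_xxxx)
 ultimately have split: "c1^2*X^4/2 <= rcard Tg + rcard Tb" using cT4 cTd by linarith
 show ?thesis
 proof (cases "c1^2*X^4/4 <= rcard Tg")
  case True
  define S where "S = (%((x, y), (v, v')). [v, x, v', y]) ` Tg"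
  have inj: "inj_on (%((x, y), (v, v')). [v, x, v', y]) Tg" by (auto simp: inj_on_def)
  have cS: "card S = card Tg" unfolding S_def by (rule card_image[OF inj])
  have "spread (rcard S/\<tau>)"
  proof (rule spread_const)
   show "finite S" unfolding S_def using finTs by auto
   fix t assume "t \<in> S"
   then show "good_tuple t" "set t Int A = {}"
    using V2A U2sub by (auto simp: S_def Tg_def T4_def PU_def WV_def W_def NP_def good_tuple_def)
  qed
  moreover have "min (c1^2/(4*\<tau>)) (c2*\<xi>2/(4*\<tau>))*X^4 <= rcard S/\<tau>"
  proof -
   have "min (c1^2/(4*\<tau>)) (c2*\<xi>2/(4*\<tau>))*X^4 <= c1^2/(4*\<tau>)*X^4"
    using X0 by (intro mult_right_mono) auto
   also have "... = (c1^2*X^4/4)/\<tau>" by simp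
   also have "... <= rcard S/\<tau>" using True cS tau by (intro divide_right_mono) auto
   finally show ?thesis .
  qed
  ultimately show ?thesis unfolding spread_def by (meson order_trans)
 next
  case False
  then have cTb: "c1^2*X^4/4 <= rcard Tb" using split by linarith
  define FP where "FP = {(v, v') \<in> V2 \<times> V2. {v, v'} \<in> F}"
  define J where "J q = {x\<in>U2. x \<in> R (fst q) & x \<in> R (snd q)}" for q
  have finFP: "finite FP" by (rule finite_subset[of _ "V2 \<times> V2"]) (use finite_sets in \<open>auto simp: FP_def\<close>)
  have finJ: "finite (J q)" for q using finite_sets by (simp add: J_def)
  have cFP: "rcard FP <= 2*X^2"
  proof -
   have "card FP <= card {(v, v'). {v, v'} \<in> F}"
    using card_ordered_pairs[OF F2 finV] by (intro card_mono) (auto simp: FP_def)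
   then show ?thesis using card_ordered_pairs[OF F2 finV] cF by simp
  qed
  have Jle: "rcard (J q) <= \<tau>*X" if "q \<in> FP" for q
  proof -
   have v: "fst q \<in> V" "fst q ~: A" using that V2V by (auto simp: FP_def)
   have "card (J q) <= card (R (fst q))" using finR[OF v(1)] by (intro card_mono) (auto simp: J_def)
   then show ?thesis using low_deg(1)[OF v] by linarith
  qed
  have J2: "c1^2*X^4/4 <= (\<Sum>q\<in>FP. (rcard (J q))\<^sup>2)"
  proof -
   have "rcard Tb = (\<Sum>q\<in>FP. rcard {t\<in>Tb. snd t = q})"
    using card_UN_fibers[OF finTs(3) finFP, of snd] by (force simp: Tb_def T4_def FP_def WV_def)
   also have "... <= (\<Sum>q\<in>FP. (rcard (J q))\<^sup>2)"
   proof (rule sum_mono)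
    fix q
    have "{t\<in>Tb. snd t = q} <= (%p. (p, q)) ` (J q \<times> J q)"
     by (force simp: Tb_def T4_def PU_def WV_def W_def J_def)
    then have "card {t\<in>Tb. snd t = q} <= card ((%p. (p, q)) ` (J q \<times> J q))"
     using finJ by (intro card_mono) auto
    also have "... <= card (J q \<times> J q)" using finJ by (intro card_image_le) auto
    finally show "rcard {t\<in>Tb. snd t = q} <= (rcard (J q))^2"
     by (simp add: card_cartesian_product power2_eq_square flip: of_nat_mult)
   qed
   finally show ?thesis using cTb by linarith
  qed
  define Uok where "Uok q = {u\<in>V2. u ~= fst q & {fst q, u} ~: F}" for q :: "nat \<times> nat"
  define XX where "XX q u = {(x, y) \<in> (J q Int R u) \<times> (J q Int R u). x ~= y}" for q u
  define T5 where "T5 = (SIGMA q:FP. SIGMA u:Uok q. XX q u)"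
  have finU: "finite (Uok q)" for q using finite_sets by (simp add: Uok_def)
  have finXX: "finite (XX q u)" for q u
   by (rule finite_subset[of _ "J q \<times> J q"]) (use finJ in \<open>auto simp: XX_def\<close>)
  \<comment> \<open>Every point of \<open>J q\<close> has at least \<open>\<xi>3*X\<close> sources
    in \<open>V2\<close>, and few sources are joined in \<open>F\<close> to the first vertex.
    Cauchy-Schwarz over the remaining sources u counts the pairs x, y below u.\<close>
  have perq: "(rcard (J q))^2*(\<xi>3^2*X^2/(4*real n)) - (\<tau>*X)^2 <= (\<Sum>u\<in>Uok q. rcard (XX q u))"
   if q: "q \<in> FP" for q
  proof -
   let ?j = "%u. rcard (J q Int R u)"
   have v: "fst q \<in> V2" "fst q \<in> V" "fst q ~: B" using q by (auto simp: FP_def V2_def)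
   have dF: "real (degF F (fst q)) <= g0" using v by (auto simp: B_def)
   have tot: "(\<Sum>u\<in>V2. ?j u) = (\<Sum>x\<in>J q. real (i2 x))"
   proof -
    have "(\<Sum>u\<in>V2. ?j u) = (\<Sum>u\<in>V2. \<Sum>x\<in>J q. if x \<in> R u then 1 else 0)"
     using finJ by (intro sum.cong refl) (simp add: sum.If_cases)
    also have "... = (\<Sum>x\<in>J q. \<Sum>u\<in>V2. if x \<in> R u then 1 else 0)" by (rule sum.swap)
    also have "... = (\<Sum>x\<in>J q. real (i2 x))"
     using finite_sets by (intro sum.cong refl) (simp add: sum.If_cases i2_def Int_def)
    finally show ?thesis .
   qed
   have lo: "rcard (J q)*(\<xi>3*X) <= (\<Sum>u\<in>V2. ?j u)"
   proof -
    have "rcard (J q)*(\<xi>3*X) = (\<Sum>x\<in>J q. \<xi>3*X)" by simp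
    also have "... <= (\<Sum>x\<in>J q. real (i2 x))" by (intro sum_mono) (auto simp: J_def U2_def)
    finally show ?thesis using tot by simp
   qed
   have hi: "(\<Sum>u\<in>V2. ?j u) <= rcard (J q)*(\<tau>*X)"
   proof -
    have "(\<Sum>x\<in>J q. real (i2 x)) <= (\<Sum>x\<in>J q. \<tau>*X)"
     by (intro sum_mono i2_le) (auto simp: J_def U2_def V2_def)
    then show ?thesis using tot by simp
   qed
   have bad: "(\<Sum>u\<in>V2 - Uok q. ?j u) <= (g0 + 1)*rcard (J q)"
   proof -
    have fd: "finite {u. {fst q, u} \<in> F}"
     by (rule finite_subset[OF _ finV]) (use F2 in \<open>auto simp: nsets_def\<close>)
    have "V2 - Uok q <= insert (fst q) {u. {fst q, u} \<in> F}" by (auto simp: Uok_def)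
    then have "card (V2 - Uok q) <= card (insert (fst q) {u. {fst q, u} \<in> F})" using fd by (intro card_mono) auto
    also have "... <= degF F (fst q) + 1" using fd by (simp add: degF_def card_insert_if)
    finally have c: "rcard (V2 - Uok q) <= g0 + 1" using dF by linarith
    have "(\<Sum>u\<in>V2 - Uok q. ?j u) <= (\<Sum>u\<in>V2 - Uok q. rcard (J q))"
     using finJ by (intro sum_mono of_nat_mono card_mono) auto
    also have "... = rcard (V2 - Uok q)*rcard (J q)" by simp
    also have "... <= (g0 + 1)*rcard (J q)" using c by (intro mult_right_mono) auto
    finally show ?thesis .
   qed
   have "(\<Sum>u\<in>V2. ?j u) = (\<Sum>u\<in>V2 - Uok q. ?j u) + (\<Sum>u\<in>Uok q. ?j u)"
    by (rule sum.subset_diff) (auto simp: Uok_def finite_sets)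
   then have "(\<Sum>u\<in>Uok q. ?j u) >= rcard (J q)*(\<xi>3*X) - (g0 + 1)*rcard (J q)" using lo bad by linarith
   moreover have "(g0 + 1)*rcard (J q) <= (\<xi>3*X/2)*rcard (J q)"
    using g0 X4 by (intro mult_right_mono) auto
   ultimately have mass: "rcard (J q)*(\<xi>3*X/2) <= (\<Sum>u\<in>Uok q. ?j u)" by (simp add: algebra_simps)
   have "(rcard (J q)*(\<xi>3*X/2))^2 <= (\<Sum>u\<in>Uok q. ?j u)^2"
    using mass cpos X0 by (intro power_mono) auto
   also have "... <= rcard (Uok q)*(\<Sum>u\<in>Uok q. (?j u)\<^sup>2)" by (rule sum_sq_ge[OF finU])
   also have "... <= real n*(\<Sum>u\<in>Uok q. (?j u)\<^sup>2)"
   proof -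
    have "card (Uok q) <= card V" using finV V2V by (intro card_mono) (auto simp: Uok_def)
    then show ?thesis using cardV by (intro mult_right_mono sum_nonneg) auto
   qed
   finally have sq: "(rcard (J q))^2*(\<xi>3^2*X^2/(4*real n)) <= (\<Sum>u\<in>Uok q. (?j u)\<^sup>2)"
    using nn by (simp add: field_simps power_mult_distrib)
   have "(\<Sum>u\<in>Uok q. ?j u) <= (\<Sum>u\<in>V2. ?j u)" by (intro sum_mono2) (auto simp: Uok_def finite_sets)
   also have "... <= rcard (J q)*(\<tau>*X)" by (rule hi)
   also have "... <= (\<tau>*X)*(\<tau>*X)" using Jle[OF q] tau X0 by (intro mult_right_mono) auto
   finally have lin: "(\<Sum>u\<in>Uok q. ?j u) <= (\<tau>*X)^2" by (simp add: power2_eq_square)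
   have "(\<Sum>u\<in>Uok q. rcard (XX q u)) = (\<Sum>u\<in>Uok q. (?j u)\<^sup>2 - ?j u)"
    unfolding XX_def by (intro sum.cong refl card_offdiag) (simp add: finJ)
   also have "... = (\<Sum>u\<in>Uok q. (?j u)\<^sup>2) - (\<Sum>u\<in>Uok q. ?j u)" by (rule sum_subtractf)
   finally show ?thesis using sq lin by linarith
  qed
  have finT5: "finite T5" unfolding T5_def using finFP finU finXX by auto
  have "rcard T5 = (\<Sum>q\<in>FP. \<Sum>u\<in>Uok q. rcard (XX q u))"
   unfolding T5_def using finFP finU finXX by (subst card_SigmaI) auto
  also have "... >= (\<Sum>q\<in>FP. (rcard (J q))\<^sup>2*(\<xi>3^2*X^2/(4*real n)) - (\<tau>*X)^2)"
   by (intro sum_mono perq)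
  also have "(\<Sum>q\<in>FP. (rcard (J q))\<^sup>2*(\<xi>3^2*X^2/(4*real n)) - (\<tau>*X)^2)
   = (\<Sum>q\<in>FP. (rcard (J q))\<^sup>2)*(\<xi>3^2*X^2/(4*real n)) - rcard FP*(\<tau>*X)^2"
   by (simp add: sum_subtractf sum_distrib_right sum_divide_distrib)
  finally have t5: "(\<Sum>q\<in>FP. (rcard (J q))\<^sup>2)*(\<xi>3^2*X^2/(4*real n)) - rcard FP*(\<tau>*X)^2 <= rcard T5" .
  have a1: "c1^2*X^4/4*(\<xi>3^2*X^2/(4*real n)) <= (\<Sum>q\<in>FP. (rcard (J q))\<^sup>2)*(\<xi>3^2*X^2/(4*real n))"
   using J2 by (intro mult_right_mono) auto
  have a2: "c1^2*X^4/4*(\<xi>3^2*X^2/(4*real n)) = 2*(c2*(X^6/real n))"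
   using nn by (simp add: c2_def power2_eq_square eval_nat_numeral)
  have a3: "rcard FP*(\<tau>*X)^2 <= c2*(X^6/real n)"
  proof -
   have "rcard FP*(\<tau>*X)^2 <= 2*X^2*(\<tau>*X)^2" using cFP by (intro mult_right_mono) auto
   also have "... = (64*\<tau>^2/(c1^2*\<xi>3^2)*real n)*(c2*X^4/real n)"
    using nn cpos by (simp add: c2_def power_mult_distrib power2_eq_square power4_eq_xxxx)
   also have "... <= X^2*(c2*X^4/real n)" using Xn2 cpos by (intro mult_right_mono) auto
   also have "... = c2*(X^6/real n)" by (simp add: power2_eq_square eval_nat_numeral)
   finally show ?thesis .
  qed
  have cT5: "c2*(X^6/real n) <= rcard T5" using t5 a1 a2 a3 by linarith
  define Tn where "Tn = {(q, u, x, y). (q, u, x, y) \<in> T5 & {x, y} ~: F}"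
  define Tf where "Tf = {(q, u, x, y). (q, u, x, y) \<in> T5 & {x, y} \<in> F}"
  have finTnf: "finite Tn" "finite Tf" unfolding Tn_def Tf_def by (rule finite_subset[OF _ finT5], auto)+
  have "T5 <= Tn Un Tf" by (auto simp: Tn_def Tf_def)
  then have "card T5 <= card (Tn Un Tf)" using finTnf by (intro card_mono) auto
  also have "... <= card Tn + card Tf" by (rule card_Un_le)
  finally have nf: "c2*(X^6/real n) <= rcard Tn + rcard Tf" using cT5 by linarith
  have T5D: "v \<in> V2" "v' \<in> V2" "u \<in> V2" "x \<in> U2" "y \<in> U2" "{v, v'} \<in> F" "u ~= v" "{v, u} ~: F" "x ~= y"
   "x \<in> R v" "x \<in> R v'" "y \<in> R v" "y \<in> R v'" "x \<in> R u" "y \<in> R u" if "((v, v'), u, x, y) \<in> T5" for v v' u x y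
   using that by (auto simp: T5_def FP_def Uok_def XX_def J_def)
  have V2g: "real (degF F w) <= g0" if "w \<in> V2" for w using that by (auto simp: V2_def B_def)
  show ?thesis
  proof (cases "c2*(X^6/real n)/2 <= rcard Tn")
   case True
   define f where "f = (%((v, v'::nat), u, x, y). [v, x, u, y] :: nat list)"
   define S where "S = f ` Tn"
   have finS: "finite S" unfolding S_def using finTnf by auto
   have "spread (rcard S/\<tau>)"
   proof (rule spread_const)
    fix t assume "t \<in> S"
    then obtain v v' u x y where t: "t = [v, x, u, y]" "((v, v'), u, x, y) \<in> T5" "{x, y} ~: F"
     by (auto simp: S_def f_def Tn_def)
    show "good_tuple t" "set t Int A = {}"
     using T5D[OF t(2)] t(3) V2V U2V unfolding t(1) good_tuple_def by (auto simp: V2_def)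
   qed (rule finS)
   \<comment> \<open>The map forgets v', an \<open>F\<close>-neighbour of v, which has at most
     \<open>g0\<close> values because v is not in \<open>B\<close>.\<close>
   moreover have "rcard Tn <= rcard S*g0"
   proof (rule card_le_fibers[where f = f])
    fix b assume "b \<in> S"
    then obtain v v' u x y where b: "b = [v, x, u, y]" "((v, v'), u, x, y) \<in> T5"
     by (auto simp: S_def f_def Tn_def)
    have fd: "finite {w. {v, w} \<in> F}"
     by (rule finite_subset[OF _ finV]) (use F2 in \<open>auto simp: nsets_def\<close>)
    have "{t\<in>Tn. f t = b} <= (%w. ((v, w), u, x, y)) ` {w. {v, w} \<in> F}"
    proof
     fix t assume t: "t \<in> {t\<in>Tn. f t = b}"
     obtain v1 w1 u1 x1 y1 where t': "t = ((v1, w1), u1, x1, y1)" by (metis surj_pair)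
     have "[v1, x1, u1, y1] = [v, x, u, y]" using t unfolding t' f_def b(1) by simp
     then have e: "v1 = v" "x1 = x" "u1 = u" "y1 = y" by simp_all
     have "((v, w1), u, x, y) \<in> T5" using t unfolding t' Tn_def e by simp
     then have "{v, w1} \<in> F" by (rule T5D(6))
     then show "t \<in> (%w. ((v, w), u, x, y)) ` {w. {v, w} \<in> F}" unfolding t' e by simp
    qed
    then have "card {t\<in>Tn. f t = b} <= card {w. {v, w} \<in> F}"
     by (rule surj_card_le[OF fd])
    then show "rcard {t\<in>Tn. f t = b} <= g0"
     using V2g[OF T5D(1)[OF b(2)]] unfolding degF_def by linarith
   qed (use finTnf finS in \<open>auto simp: S_def\<close>)
   moreover have "min (c1^2/(4*\<tau>)) (c2*\<xi>2/(4*\<tau>))*X^4 <= rcard S/\<tau>"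
   proof -
    have "g0 <= 2*X^2/(\<xi>2*real n)" unfolding g0_def using cF cpos nn by (intro divide_right_mono) auto
    then have "rcard S*g0 <= rcard S*(2*X^2/(\<xi>2*real n))" by (intro mult_left_mono) auto
    then have "c2*(X^6/real n)/2 <= rcard S*(2*X^2/(\<xi>2*real n))"
     using True calculation(2) by linarith
    then have "c2*X^6/2*\<xi>2 <= rcard S*2*X^2" using nn cpos by (simp add: field_simps)
    then have "(c2*\<xi>2/4*X^4)*(2*X^2) <= rcard S*(2*X^2)"
     by (simp add: power2_eq_square eval_nat_numeral mult_ac)
    then have s: "c2*\<xi>2/4*X^4 <= rcard S" by (rule mult_right_le_imp_le) (use X0 in simp)
    have "min (c1^2/(4*\<tau>)) (c2*\<xi>2/(4*\<tau>))*X^4 <= c2*\<xi>2/(4*\<tau>)*X^4"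
     using X0 by (intro mult_right_mono) auto
    also have "... = (c2*\<xi>2/4*X^4)/\<tau>" by simp
    also have "... <= rcard S/\<tau>" using s tau by (intro divide_right_mono) auto
    finally show ?thesis .
   qed
   ultimately show ?thesis unfolding spread_def by (meson order_trans)
  next
   case False
   then have cTf: "c2*(X^6/real n)/2 <= rcard Tf" using nf by linarith
   define f where "f = (%((v, v'), u::nat, x, y). [v, x, v', y] :: nat list)"
   define S where "S = f ` Tf"
   have finS: "finite S" unfolding S_def using finTnf by auto
   have S1: "\<exists>v x v' x'. t = [v, x, v', x'] & v \<in> V & v' \<in> V & x \<in> R v & x' \<in> R v & x \<in> R v' & x' \<in> R v' &
    {v, v'} \<in> F & {x, x'} \<in> F & (\<forall>w\<in>{v, v', x, x'}. real (degF F w) <= g0)" if "t \<in> S" for t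
   proof -
    obtain v v' u x y where t: "t = [v, x, v', y]" "((v, v'), u, x, y) \<in> T5" "{x, y} \<in> F"
     using \<open>t \<in> S\<close> by (auto simp: S_def f_def Tf_def)
    have "\<forall>w\<in>{v, v', x, y}. real (degF F w) <= g0" using T5D(1,2,4,5)[OF t(2)] V2g U2V by blast
    then show ?thesis using T5D[OF t(2)] t(1,3) V2V by blast
   qed
   \<comment> \<open>Here u is forgotten. It is an in-neighbour of x, so the exponent of
     \<open>X\<close> drops from 6 to 5.\<close>
   have "rcard Tf <= rcard S*(\<tau>*X)"
   proof (rule card_le_fibers[where f = f])
    fix b assume "b \<in> S"
    then obtain v v' u x y where b: "b = [v, x, v', y]" "((v, v'), u, x, y) \<in> T5"
     by (auto simp: S_def f_def Tf_def)
    have x: "x \<in> V" "x ~: A" using T5D(4)[OF b(2)] U2V V2V by auto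
    have "{t\<in>Tf. f t = b} <= (%u. ((v, v'), u, x, y)) ` {u\<in>V. x \<in> R u}"
    proof
     fix t assume t: "t \<in> {t\<in>Tf. f t = b}"
     obtain v1 w1 u1 x1 y1 where t': "t = ((v1, w1), u1, x1, y1)" by (metis surj_pair)
     have "[v1, x1, w1, y1] = [v, x, v', y]" using t unfolding t' f_def b(1) by simp
     then have e: "v1 = v" "x1 = x" "w1 = v'" "y1 = y" by simp_all
     have "((v, v'), u1, x, y) \<in> T5" using t unfolding t' Tf_def e by simp
     then have "u1 \<in> V2" "x \<in> R u1" by (rule T5D)+
     then have "u1 \<in> V" "x \<in> R u1" using V2V by auto
     then show "t \<in> (%u. ((v, v'), u, x, y)) ` {u\<in>V. x \<in> R u}" unfolding t' e by simp
    qed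
    then have "card {t\<in>Tf. f t = b} <= card {u\<in>V. x \<in> R u}"
     by (intro surj_card_le) (use finV in auto)
    then show "rcard {t\<in>Tf. f t = b} <= \<tau>*X" using low_deg(2)[OF x] by linarith
   qed (use finTnf finS in \<open>auto simp: S_def\<close>)
   then have "c2*(X^6/real n)/2 <= rcard S*(\<tau>*X)" using cTf by linarith
   then have "(c2/(2*\<tau>)*(X^5/real n))*(\<tau>*X) <= rcard S*(\<tau>*X)"
    using tau by (simp add: eval_nat_numeral mult_ac)
   then have "c2/(2*\<tau>)*(X^5/real n) <= rcard S"
    using tau X0 mult_le_cancel_right[of _ "\<tau>*X"] by (smt (verit) mult_pos_pos)
   then have "many_quads (c2/(2*\<tau>)*(X^5/real n))"
    unfolding many_quads_def using finS S1 by blast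
   then show ?thesis ..
  qed
 qed
qed

lemma supersat_dichotomy:
 assumes n0: "n > 0" and cF: "rcard F <= X^2" and g0: "g0 <= \<xi>3*X/4" and X4: "4 <= \<xi>3*X"
  and Xn1: "2*\<tau>^2/c1^2*real n <= X^2" and Xn2: "64*\<tau>^2/(c1^2*\<xi>3^2)*real n <= X^2" and Xn3: "real n <= X^2"
 shows "spread (min (2*\<xi>^2) (min (c1^2/(4*\<tau>)) (c2*\<xi>2/(4*\<tau>)))*X^4) \<or>
  many_quads (c2/(2*\<tau>)*(X^5/real n))"
proof -
 have sub: "PA <= NP" by (auto simp: PA_def)
 have "(\<Sum>p\<in>NP. r p) = (\<Sum>p\<in>NP - PA. r p) + (\<Sum>p\<in>PA. r p)" by (rule sum.subset_diff[OF sub finNP])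
 then consider "(\<Sum>p\<in>PA. r p) >= \<xi>^2*real n*X^2/2" | "(\<Sum>p\<in>NP - PA. r p) >= \<xi>^2*real n*X^2/2"
  using weight_total by linarith
 then show ?thesis
 proof cases
  case 1
  have "spread (2*\<xi>^2*X^4)" by (rule case_high[OF 1 n0 cF Xn3])
  moreover have "min (2*\<xi>^2) (min (c1^2/(4*\<tau>)) (c2*\<xi>2/(4*\<tau>)))*X^4 <= 2*\<xi>^2*X^4"
   using X0 by (intro mult_right_mono) auto
  ultimately show ?thesis unfolding spread_def by (meson order_trans)
 next
  case 2
  have "min (2*\<xi>^2) (min (c1^2/(4*\<tau>)) (c2*\<xi>2/(4*\<tau>)))*X^4 <= min (c1^2/(4*\<tau>)) (c2*\<xi>2/(4*\<tau>))*X^4"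
   using X0 by (intro mult_right_mono) auto
  then show ?thesis using case_low[OF 2 n0 cF g0 X4 Xn1 Xn2] unfolding spread_def by (meson order_trans)
 qed
qed

end

section \<open>Degree orientation and maximal capped families of 4-cycles\<close>

definition outn :: "nat set set => nat => nat set" where
 "outn M v = {x. {v, x} \<in> M & (degF M v < degF M x \<or> degF M v = degF M x & v < x)}"

definition nonF :: "nat set set => nat set => (nat \<times> nat) set" where
 "nonF F Y = {(x, y) \<in> Y \<times> Y. x ~= y & {x, y} ~: F}"

text \<open>The average number of missing \<open>F\<close>-neighbours inside each out-neighbourhood,
  summed over the vertices. An empty \<open>R v\<close> contributes 0 by division by zero.\<close>

definition wt :: "nat set => (nat => nat set) => nat set set => real" where
 "wt V R F = (\<Sum>v\<in>V. rcard (nonF F (R v))/rcard (R v))"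

lemma edge_in:
 assumes "M <= nsets V 2" "{a, b} \<in> M"
 shows "a \<in> V" "b \<in> V" "a ~= b"
proof -
 have "card {a, b} = 2" "{a, b} <= V" using assms by (auto simp: nsets_def)
 then show "a \<in> V" "b \<in> V" "a ~= b" by auto
qed

lemma outn_sub: "M <= nsets V 2 ==> outn M v <= V" "v ~: outn M v"
 by (auto simp: outn_def dest: edge_in)

lemma sum_outn:
 assumes M: "M <= nsets V 2" and fin: "finite V"
 shows "(\<Sum>v\<in>V. card (outn M v)) = card M"
proof -
 have fo: "finite (outn M v)" for v using outn_sub(1)[OF M] fin finite_subset by blast
 have "bij_betw (%(v, x). {v, x}) (SIGMA v:V. outn M v) M"
  unfolding bij_betw_def
 proof
  show "inj_on (%(v, x). {v, x}) (SIGMA v:V. outn M v)"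
   by (auto simp: inj_on_def outn_def doubleton_eq_iff)
  have "e \<in> (%(v, x). {v, x}) ` (SIGMA v:V. outn M v)" if e: "e \<in> M" for e
  proof -
   have "card e = 2" using e M by (auto simp: nsets_def)
   then obtain x y where xy: "e = {x, y}" "x ~= y" by (auto simp: card_2_iff)
   have xyV: "x \<in> V" "y \<in> V" using edge_in[OF M] e xy by auto
   have "y \<in> outn M x \<or> x \<in> outn M y" using e xy by (auto simp: outn_def insert_commute)
   then show ?thesis
   proof
    assume "y \<in> outn M x" then show ?thesis using xy xyV by (force simp: image_iff)
   next
    assume "x \<in> outn M y" then show ?thesis using xy xyV by (force simp: image_iff insert_commute)
   qed
  qed
  then show "(%(v, x). {v, x}) ` (SIGMA v:V. outn M v) = M" by (auto simp: outn_def)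
 qed
 then have "card (SIGMA v:V. outn M v) = card M" by (rule bij_betw_same_card)
 then show ?thesis using fin fo by simp
qed

lemma finite_nonF: "finite Y ==> finite (nonF F Y)"
 by (rule finite_subset[of _ "Y \<times> Y"]) (auto simp: nonF_def)

lemma card_nonF_le: "finite Y ==> rcard (nonF F Y) <= (rcard Y)^2"
proof -
 assume Y: "finite Y"
 have "card (nonF F Y) <= card (Y \<times> Y)" using Y by (intro card_mono) (auto simp: nonF_def)
 then show ?thesis by (simp add: card_cartesian_product power2_eq_square flip: of_nat_mult)
qed

text \<open>A removed vertex spoils at most \<open>2*card Y\<close> ordered pairs, and dividing by
  the smaller \<open>card Z\<close> only helps.\<close>

lemma nonF_remove:
 assumes Y: "finite Y" and Z: "Z <= Y"
 shows "rcard (nonF F Y)/rcard Y - 2*rcard (Y - Z) <= rcard (nonF F Z)/rcard Z"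
proof (cases "Z = {}")
 case True
 show ?thesis
 proof (cases "Y = {}")
  case False
  then have c: "rcard Y > 0" using Y by (simp add: card_gt_0_iff)
  have "rcard (nonF F Y)/rcard Y <= rcard Y"
   using card_nonF_le[OF Y, of F] c by (simp add: divide_le_eq power2_eq_square)
  then show ?thesis using True by simp
 qed (use True in simp)
next
 case False
 have fZ: "finite Z" using Y Z finite_subset by blast
 have cZ: "rcard Z > 0" using False fZ by (simp add: card_gt_0_iff)
 have cYZ: "rcard Z <= rcard Y" using Y Z by (simp add: card_mono)
 have "nonF F Y <= nonF F Z Un ((Y - Z) \<times> Y Un Y \<times> (Y - Z))" by (auto simp: nonF_def)
 then have "card (nonF F Y) <= card (nonF F Z Un ((Y - Z) \<times> Y Un Y \<times> (Y - Z)))"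
  using Y fZ by (intro card_mono) (auto intro: finite_nonF)
 also have "... <= card (nonF F Z) + (card ((Y - Z) \<times> Y) + card (Y \<times> (Y - Z)))"
  by (meson add_left_mono card_Un_le le_trans)
 also have "... = card (nonF F Z) + 2*(card (Y - Z)*card Y)" by (simp add: card_cartesian_product)
 finally have "rcard (nonF F Y) <= real (card (nonF F Z) + 2*(card (Y - Z)*card Y))"
  by (simp only: of_nat_le_iff)
 then have "rcard (nonF F Y) <= rcard (nonF F Z) + 2*(rcard (Y - Z)*rcard Y)" by simp
 then have "rcard (nonF F Y)/rcard Y <= (rcard (nonF F Z) + 2*(rcard (Y - Z)*rcard Y))/rcard Y"
  by (rule divide_right_mono) simp
 also have "... = rcard (nonF F Z)/rcard Y + 2*rcard (Y - Z)"
  using cZ cYZ by (simp add: add_divide_distrib)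
 also have "rcard (nonF F Z)/rcard Y <= rcard (nonF F Z)/rcard Z"
  using cZ cYZ by (intro divide_left_mono) auto
 finally show ?thesis by simp
qed

text \<open>Each edge of \<open>Sat\<close> leaves one out-neighbourhood only, that of its tail, so
  \<open>nonF_remove\<close> charges it 2.\<close>

lemma wt_remove:
 assumes M: "M <= nsets V 2" and fin: "finite V" and Sat: "Sat <= M"
 shows "wt V (outn M) F - 2*rcard Sat <= wt V (%v. {x \<in> outn M v. {v, x} ~: Sat}) F"
proof -
 define R where "R v = {x \<in> outn M v. {v, x} ~: Sat}" for v
 have fo: "finite (outn M v)" for v using outn_sub(1)[OF M] fin finite_subset by blast
 have fS: "finite Sat" using finite_subset[OF Sat finite_subset[OF M]] fin by (simp add: finite_imp_finite_nsets)
 have "(\<Sum>v\<in>V. card (outn M v - R v)) <= card Sat"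
 proof -
  have "(\<Sum>v\<in>V. card (outn M v - R v)) = card (SIGMA v:V. outn M v - R v)" using fin fo by simp
  also have "... <= card Sat"
  proof (rule card_inj_on_le[OF _ _ fS])
   show "inj_on (%(v, x). {v, x}) (SIGMA v:V. outn M v - R v)"
    by (auto simp: inj_on_def outn_def doubleton_eq_iff)
   show "(%(v, x). {v, x}) ` (SIGMA v:V. outn M v - R v) <= Sat" by (auto simp: R_def)
  qed
  finally show ?thesis .
 qed
 then have s: "(\<Sum>v\<in>V. rcard (outn M v - R v)) <= rcard Sat"
  by (metis of_nat_le_iff of_nat_sum)
 have "wt V (outn M) F - (\<Sum>v\<in>V. 2*rcard (outn M v - R v)) <= wt V R F"
  unfolding wt_def sum_subtractf[symmetric]
  by (intro sum_mono nonF_remove fo) (auto simp: R_def)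
 then show ?thesis using s unfolding R_def by (simp add: sum_distrib_left[symmetric])
qed

definition goodT :: "nat set set => nat set set => nat list set" where
 "goodT M F = {[a, b, c, d] | a b c d. [a, b, c, d] \<in> cyc4 M & {a, c} ~: F & {b, d} ~: F}"

lemma cyc4_mem: "[a, b, c, d] \<in> cyc4 M \<longleftrightarrow>
  distinct [a, b, c, d] & {a, b} \<in> M & {b, c} \<in> M & {c, d} \<in> M & {a, d} \<in> M"
 unfolding cyc4_def by blast

lemma finite_cyc4:
 assumes "M <= nsets V 2" "finite V"
 shows "finite (cyc4 M)"
proof (rule finite_subset)
 show "cyc4 M <= {xs. set xs <= V & length xs = 4}"
  using edge_in[OF assms(1)] unfolding cyc4_def by fastforce
 show "finite {xs. set xs <= V & length xs = 4}" using assms(2) by (rule finite_lists_length_eq)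
qed

lemma goodT_sub: "goodT M F <= cyc4 M" by (auto simp: goodT_def)

abbreviation "Edges4 \<equiv> {{0, 1}, {1, 2}, {2, 3}, {0, 3::nat}}"
abbreviation "Triples4 \<equiv> {{0, 1, 2}, {0, 2, 3}, {0, 1, 3}, {1, 2, 3::nat}}"

lemma sum_UN_nonneg_le:
 fixes f :: "'a => real"
 assumes "finite I" "\<And>i. i \<in> I ==> finite (B i)" "\<And>x. 0 <= f x"
 shows "sum f (\<Union>i\<in>I. B i) <= (\<Sum>i\<in>I. sum f (B i))"
 using assms(1,2)
proof (induction I rule: finite_induct)
 case (insert i I)
 have "sum f (\<Union>i\<in>insert i I. B i) <= sum f (B i) + sum f (\<Union>i\<in>I. B i)"
  using insert by (simp add: sum_Un_nonneg_le assms(3))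
 then show ?case using insert by auto
qed simp

lemma card_heavy_le:
 assumes "finite H" "d > 0" "\<And>z. z \<in> Z ==> d <= rcard {s\<in>H. f s = z}"
 shows "finite Z & rcard Z <= rcard H/d"
proof -
 have "Z <= f ` H"
 proof
  fix z assume "z \<in> Z"
  then have "card {s\<in>H. f s = z} > 0" using assms(2,3) by fastforce
  then show "z \<in> f ` H" by (auto simp: card_gt_0_iff)
 qed
 then have fZ: "finite Z" using assms(1) finite_subset by blast
 have "rcard Z*d = (\<Sum>z\<in>Z. d)" by simp
 also have "... <= (\<Sum>z\<in>Z. rcard {s\<in>H. f s = z})" by (intro sum_mono assms)
 also have "... = rcard (\<Union>z\<in>Z. {s\<in>H. f s = z})" using fZ assms(1) by (subst card_UN_disjoint) auto
 also have "... <= rcard H" using assms(1) by (intro of_nat_mono card_mono) auto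
 finally show ?thesis using fZ assms(2) by (simp add: field_simps)
qed

text \<open>Take a maximal family \<open>H\<close> obeying the caps; a good cycle outside it meets a
  saturated side, diagonal or triple. If \<open>H\<close> is small, few sides and diagonals are
  saturated, and the saturated triples catch weight at most \<open>N\<close> for each of the four
  position sets. So cycles avoiding \<open>Sat\<close> and \<open>Z\<close> weigh at most
  \<open>N + 4*N\<close>.\<close>

lemma round:
 assumes M: "M <= nsets V 2" "finite V" and pos: "E0 > 0" "c0 > 0" "X > 0"
 shows "\<exists>H Sat Z. H <= cyc4 M & caps (diag_free N0) (Dinit (E0 + 1) (c0 + 1) (X + 1)) H &
  (rcard H < N --> Sat <= M & rcard Sat <= 4*(N/E0) &
   Z <= nsets V 2 & Z Int F = {} & Z Int N0 = {} & rcard Z <= 2*(N/c0) &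
   (\<forall>S \<omega>. finite S --> S <= goodT M F --> (\<forall>t. 0 <= \<omega> t & \<omega> t <= 1) -->
    (\<forall>I\<in>Triples4. \<forall>z. (\<Sum>t\<in>{t\<in>S. nths t I = z}. \<omega> t) <= X) -->
    (\<forall>a b c d. [a, b, c, d] \<in> S --> {a, b} ~: Sat & {b, c} ~: Sat & {c, d} ~: Sat & {a, d} ~: Sat & {a, c} ~: Z & {b, d} ~: Z) -->
    (\<Sum>t\<in>S. \<omega> t) <= 5*N))"
proof -
 let ?D = "Dinit (E0 + 1) (c0 + 1) (X + 1)"
 let ?C = "caps (diag_free N0) ?D"
 have fG: "finite (goodT M F)" using finite_cyc4[OF M] goodT_sub finite_subset by blast
 define HH where "HH = {H. H <= goodT M F & ?C H}"
 have fHH: "finite HH" unfolding HH_def using fG by simp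
 have "?C {}" using pos by (auto simp: caps_def Dinit_def)
 then have "HH ~= {}" unfolding HH_def by blast
 from finite_has_maximal[OF fHH this] obtain H where H0: "H \<in> HH" "\<forall>H'\<in>HH. H <= H' --> H = H'" by (rule bexE)
 have H: "H <= goodT M F" "?C H" using H0(1) by (simp_all add: HH_def)
 have mx: "H' = H" if "H' <= goodT M F" "?C H'" "H <= H'" for H' using H0(2) that unfolding HH_def by blast
 have finH: "finite H" using H fG finite_subset by blast
 define dg where "dg I z = rcard {s\<in>H. nths s I = z}" for I z
 define Sat where "Sat = {e. \<exists>a b. \<exists>I\<in>Edges4. e = {a, b} & E0 < dg I [a, b]}"
 define Z where "Z = {e. \<exists>a b. \<exists>I\<in>{{0, 2}, {1, 3}}. e = {a, b} & e ~: N0 & c0 < dg I [a, b]}"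
 have Hform: "\<exists>a b c d. t = [a, b, c, d] & distinct [a, b, c, d] & {a, b} \<in> M & {b, c} \<in> M & {c, d} \<in> M & {a, d} \<in> M & {a, c} ~: F & {b, d} ~: F"
  if "t \<in> goodT M F" for t using that unfolding goodT_def cyc4_mem by blast
 have dgpos: "\<exists>t\<in>H. nths t I = z" if "d < dg I z" "d > 0" for I z d
 proof -
  have "card {s\<in>H. nths s I = z} > 0" using that by (simp add: dg_def)
  then show ?thesis by (auto simp: card_gt_0_iff)
 qed
 have main: "Sat <= M & rcard Sat <= 4*(N/E0) &
   Z <= nsets V 2 & Z Int F = {} & Z Int N0 = {} & rcard Z <= 2*(N/c0) &
   (\<forall>S \<omega>. finite S --> S <= goodT M F --> (\<forall>t. 0 <= \<omega> t & \<omega> t <= 1) -->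
    (\<forall>I\<in>Triples4. \<forall>z. (\<Sum>t\<in>{t\<in>S. nths t I = z}. \<omega> t) <= X) -->
    (\<forall>a b c d. [a, b, c, d] \<in> S --> {a, b} ~: Sat & {b, c} ~: Sat & {c, d} ~: Sat & {a, d} ~: Sat & {a, c} ~: Z & {b, d} ~: Z) -->
    (\<Sum>t\<in>S. \<omega> t) <= 5*N)" if HN: "rcard H < N"
 proof (intro conjI allI impI)
  show "Sat <= M"
  proof
   fix e assume "e \<in> Sat"
   then obtain a b I where I: "I \<in> Edges4" "e = {a, b}" "E0 < dg I [a, b]" unfolding Sat_def by blast
   from dgpos[OF I(3) pos(1)] obtain t where t: "t \<in> H" "nths t I = [a, b]" by blast
   obtain p q r s where t': "t = [p, q, r, s]" "{p, q} \<in> M" "{q, r} \<in> M" "{r, s} \<in> M" "{p, s} \<in> M"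
    using Hform t(1) H(1) by blast
   from I(1) consider "I = {0, 1}" | "I = {1, 2}" | "I = {2, 3}" | "I = {0, 3}" by blast
   then have "[a, b] = [p, q] \<or> [a, b] = [q, r] \<or> [a, b] = [r, s] \<or> [a, b] = [p, s]"
    using t(2) unfolding t'(1) by cases (simp_all only: nths4 simp_thms)
   then show "e \<in> M" using t'(2-5) unfolding I(2) by auto
  qed
  have hs: "finite {z. E0 < dg I z} & rcard {z. E0 < dg I z} <= rcard H/E0" for I
   by (rule card_heavy_le[OF finH pos(1), where f = "%s. nths s I"]) (simp add: dg_def)
  have hz: "finite {z. c0 < dg I z} & rcard {z. c0 < dg I z} <= rcard H/c0" for I
   by (rule card_heavy_le[OF finH pos(2), where f = "%s. nths s I"]) (simp add: dg_def)
  have ht: "finite {z. X < dg I z} & rcard {z. X < dg I z} <= rcard H/X" for I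
   by (rule card_heavy_le[OF finH pos(3), where f = "%s. nths s I"]) (simp add: dg_def)
  have HE: "rcard H/E0 <= N/E0" "rcard H/c0 <= N/c0" "rcard H/X <= N/X"
   using HN pos by (auto intro: divide_right_mono)
  have "Sat <= (\<Union>I\<in>Edges4. set ` {z. E0 < dg I z})" unfolding Sat_def by (force simp: image_iff)
  then have "card Sat <= card (\<Union>I\<in>Edges4. set ` {z. E0 < dg I z})" using hs by (intro card_mono) auto
  also have "... <= (\<Sum>I\<in>Edges4. card (set ` {z. E0 < dg I z}))" by (rule card_UN_le) simp
  also have "... <= (\<Sum>I\<in>Edges4. card {z. E0 < dg I z})" using hs by (intro sum_mono card_image_le) auto
  finally have "rcard Sat <= (\<Sum>I\<in>Edges4. rcard {z. E0 < dg I z})" by (metis of_nat_le_iff of_nat_sum)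
  also have "... <= (\<Sum>I\<in>Edges4. N/E0)" using hs HE by (intro sum_mono) (meson order_trans)
  also have "... <= 4*(N/E0)"
  proof -
   have "card Edges4 <= 4" using card_length[of "[{0, 1}, {1, 2}, {2, 3}, {0, 3}] :: nat set list"] by simp
   moreover have "0 <= N/E0" "0 <= N/c0" using HN pos by (auto intro!: divide_nonneg_pos)
   ultimately show ?thesis unfolding sum_constant by (intro mult_right_mono) auto
  qed
  finally show "rcard Sat <= 4*(N/E0)" .
  have Zd: "\<exists>p q r s. [p, q, r, s] \<in> H & (e = {p, r} \<or> e = {q, s})" if "e \<in> Z" for e
  proof -
   obtain a b I where I: "I \<in> {{0, 2}, {1, 3}}" "e = {a, b}" "c0 < dg I [a, b]" using \<open>e \<in> Z\<close> unfolding Z_def by blast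
   from dgpos[OF I(3) pos(2)] obtain t where t: "t \<in> H" "nths t I = [a, b]" by blast
   obtain p q r s where t': "t = [p, q, r, s]" using Hform t(1) H(1) by blast
   have "I = {0, 2} \<or> I = {1, 3}" using I(1) by simp
   then have "e = {p, r} \<or> e = {q, s}" using t(2) unfolding I(2) t'
    by (elim disjE) (simp_all only: nths4 list.inject simp_thms)
   then show ?thesis using t(1) t' by blast
  qed
  show "Z <= nsets V 2"
  proof
   fix e assume "e \<in> Z"
   from Zd[OF this] obtain p q r s where e: "[p, q, r, s] \<in> H" "e = {p, r} \<or> e = {q, s}" by blast
   have "[p, q, r, s] \<in> goodT M F" using e H by blast
   then have d: "distinct [p, q, r, s]" "{p, q} \<in> M" "{r, s} \<in> M" using Hform by blast+
   then have "p \<in> V" "q \<in> V" "r \<in> V" "s \<in> V" using edge_in[OF M(1)] by blast+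
   then show "e \<in> nsets V 2" using d(1) e(2) by (auto simp: nsets_def)
  qed
  show "Z Int F = {}"
  proof -
   have False if "e \<in> Z" "e \<in> F" for e
   proof -
    from Zd[OF that(1)] obtain p q r s where e: "[p, q, r, s] \<in> H" "e = {p, r} \<or> e = {q, s}" by blast
    have "[p, q, r, s] \<in> goodT M F" using e H by blast
    then have "{p, r} ~: F" "{q, s} ~: F" using Hform by blast+
    then show False using e(2) that(2) by auto
   qed
   then show ?thesis by blast
  qed
  show "Z Int N0 = {}" by (auto simp: Z_def)
  have "Z <= (\<Union>I\<in>{{0, 2}, {1, 3}}. set ` {z. c0 < dg I z})" unfolding Z_def by (force simp: image_iff)
  then have "card Z <= card (\<Union>I\<in>{{0, 2}, {1, 3}}. set ` {z. c0 < dg I z})" using hz by (intro card_mono) auto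
  also have "... <= (\<Sum>I\<in>{{0, 2}, {1, 3}}. card (set ` {z. c0 < dg I z}))" by (rule card_UN_le) simp
  also have "... <= (\<Sum>I\<in>{{0, 2}, {1, 3}}. card {z. c0 < dg I z})" using hz by (intro sum_mono card_image_le) auto
  finally have "rcard Z <= (\<Sum>I\<in>{{0, 2}, {1, 3}}. rcard {z. c0 < dg I z})" by (metis of_nat_le_iff of_nat_sum)
  also have "... <= (\<Sum>I\<in>{{0, 2}, {1, 3::nat}}. N/c0)" using hz HE by (intro sum_mono) (meson order_trans)
  also have "... <= 2*(N/c0)"
  proof -
   have "card {{0, 2}, {1, 3::nat}} <= 2" using card_length[of "[{0, 2}, {1, 3}] :: nat set list"] by simp
   moreover have "0 <= N/E0" "0 <= N/c0" using HN pos by (auto intro!: divide_nonneg_pos)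
   ultimately show ?thesis unfolding sum_constant by (intro mult_right_mono) auto
  qed
  finally show "rcard Z <= 2*(N/c0)" .
  fix S :: "nat list set" and \<omega> :: "nat list => real"
  assume S: "finite S" "S <= goodT M F" and om: "\<forall>t. 0 <= \<omega> t & \<omega> t <= 1"
   and tri: "\<forall>I\<in>Triples4. \<forall>z. (\<Sum>t\<in>{t\<in>S. nths t I = z}. \<omega> t) <= X"
   and free: "\<forall>a b c d. [a, b, c, d] \<in> S --> {a, b} ~: Sat & {b, c} ~: Sat & {c, d} ~: Sat & {a, d} ~: Sat & {a, c} ~: Z & {b, d} ~: Z"
  define Bl where "Bl I = (\<Union>z\<in>{z. X < dg I z}. {t\<in>S. nths t I = z})" for I
  have fB: "finite (Bl I)" for I unfolding Bl_def using S(1) ht by auto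
  have cov: "t \<in> H \<or> (\<exists>I\<in>Triples4. t \<in> Bl I)" if t: "t \<in> S" for t
  proof (rule ccontr)
   assume neg: "\<not> (t \<in> H \<or> (\<exists>I\<in>Triples4. t \<in> Bl I))"
   obtain p q r s where t': "t = [p, q, r, s]" using Hform t S(2) by blast
   have tf: "{p, q} ~: Sat" "{q, r} ~: Sat" "{r, s} ~: Sat" "{p, s} ~: Sat" "{p, r} ~: Z" "{q, s} ~: Z"
    using free t unfolding t' by blast+
   \<comment> \<open>By maximality inserting \<open>t\<close> breaks a cap, and only the cap of a
     sub-tuple of \<open>t\<close> itself can break.\<close>
   have "\<not> ?C (insert t H)" using mx[of "insert t H"] H(1) t S(2) neg by blast
   then obtain I z where Iz: "I \<in> Feat" "z ~: diag_free N0 I" "rcard {u\<in>insert t H. nths u I = z} > ?D I"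
    unfolding caps_def by force
   have zt: "z = nths t I"
   proof (rule ccontr)
    assume "z ~= nths t I"
    then have "{u\<in>insert t H. nths u I = z} = {u\<in>H. nths u I = z}" by auto
    then show False using Iz H(2) unfolding caps_def by force
   qed
   have "{u\<in>insert t H. nths u I = z} = insert t {u\<in>H. nths u I = z}" using zt by auto
   then have "rcard {u\<in>insert t H. nths u I = z} = dg I z + 1" using finH neg by (simp add: dg_def)
   then have big: "?D I - 1 < dg I (nths t I)" using Iz(3) zt by simp
   from FeatD[OF Iz(1)] show False
   proof (elim disjE)
    assume I: "I \<in> Edges4"
    then have "?D I = E0 + 1" by (elim insertE emptyE; hypsubst; intro Dinit_vals)
    then have "E0 < dg I (nths t I)" using big by simp
    moreover have "nths t I = [p, q] \<or> nths t I = [q, r] \<or> nths t I = [r, s] \<or> nths t I = [p, s]"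
     using I unfolding t' by (elim insertE emptyE; hypsubst) (simp_all only: nths4 simp_thms)
    ultimately have "{p, q} \<in> Sat \<or> {q, r} \<in> Sat \<or> {r, s} \<in> Sat \<or> {p, s} \<in> Sat" using I unfolding Sat_def by (elim disjE) auto
    then show False using tf by blast
   next
    assume I: "I = {0, 2}"
    have "?D I = c0 + 1" unfolding I by (rule Dinit_vals)
    then have "c0 < dg {0, 2} [p, r]" using big unfolding I t' nths4 by simp
    moreover have "{p, r} ~: N0" using Iz(2) unfolding zt I t' nths4 diag_free_edges by simp
    ultimately have "{p, r} \<in> Z" unfolding Z_def by blast
    then show False using tf by blast
   next
    assume I: "I = {1, 3}"
    have "?D I = c0 + 1" unfolding I by (rule Dinit_vals)
    then have "c0 < dg {1, 3} [q, s]" using big unfolding I t' nths4 by simp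
    moreover have "{q, s} ~: N0" using Iz(2) unfolding zt I t' nths4 diag_free_edges by simp
    ultimately have "{q, s} \<in> Z" unfolding Z_def by blast
    then show False using tf by blast
   next
    assume I: "I \<in> Triples4"
    then have "?D I = X + 1" by (elim insertE emptyE; hypsubst; intro Dinit_vals)
    then have "X < dg I (nths t I)" using big by simp
    then have "t \<in> Bl I" using t by (auto simp: Bl_def)
    then show False using neg I by blast
   next
    assume I: "I = {0, 1, 2, 3}"
    have "?D I = 1" unfolding I by (rule Dinit_vals)
    then have "0 < dg I (nths t I)" using big by simp
    then obtain u where u: "u \<in> H" "nths u I = nths t I" using dgpos[of 0] by (auto simp: dg_def card_gt_0_iff)
    have "length u = length t" using u(1) H(1) t S(2) Hform by (metis length_Cons subsetD)
    moreover obtain p' q' r' s' where "u = [p', q', r', s']" using Hform u(1) H(1) by blast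
    ultimately have "u = t" using u(2) unfolding I t' by (simp only: nths4)
    then show False using u neg by blast
   qed
  qed
  have "(\<Sum>t\<in>S. \<omega> t) <= (\<Sum>t\<in>(H Int S) Un (\<Union>I\<in>Triples4. Bl I). \<omega> t)"
   using cov finH fB om S(1) by (intro sum_mono2) auto
  also have "... <= (\<Sum>t\<in>H Int S. \<omega> t) + (\<Sum>t\<in>(\<Union>I\<in>Triples4. Bl I). \<omega> t)"
   using finH fB om by (intro sum_Un_nonneg_le) auto
  also have "(\<Sum>t\<in>H Int S. \<omega> t) <= (\<Sum>t\<in>H. 1)"
   using finH om by (intro order_trans[OF sum_mono sum_mono2]) auto
  also have "(\<Sum>t\<in>H. 1) = rcard H" by simp
  also have "(\<Sum>t\<in>(\<Union>I\<in>Triples4. Bl I). \<omega> t) <= (\<Sum>I\<in>Triples4. \<Sum>t\<in>Bl I. \<omega> t)"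
   using fB om by (intro sum_UN_nonneg_le) auto
  also have "... <= (\<Sum>I\<in>Triples4. N)"
  proof (rule sum_mono)
   fix I assume I: "I \<in> Triples4"
   have "(\<Sum>t\<in>Bl I. \<omega> t) <= (\<Sum>z\<in>{z. X < dg I z}. \<Sum>t\<in>{t\<in>S. nths t I = z}. \<omega> t)"
    unfolding Bl_def using ht S(1) om by (intro sum_UN_nonneg_le) auto
   also have "... <= (\<Sum>z\<in>{z. X < dg I z}. X)" using tri I by (intro sum_mono) blast
   also have "... = rcard {z. X < dg I z}*X" by simp
   also have "... <= (N/X)*X" using ht[of I] HE pos by (intro mult_right_mono) auto
   finally show "(\<Sum>t\<in>Bl I. \<omega> t) <= N" using pos by simp
  qed
  also have "... <= 4*N"
  proof -
   have "card Triples4 <= 4" using card_length[of "[{0, 1, 2}, {0, 2, 3}, {0, 1, 3}, {1, 2, 3}] :: nat set list"] by simp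
   moreover have "N >= 0" using HN by simp
   ultimately show ?thesis by (simp add: mult_right_mono)
  qed
  finally show "(\<Sum>t\<in>S. \<omega> t) <= 5*N" using HN by linarith
 qed
 have Hc: "H <= cyc4 M" using H(1) goodT_sub by (rule subset_trans)
 show ?thesis
  apply (rule exI[of _ H], rule exI[of _ Sat], rule exI[of _ Z])
  apply (rule conjI, rule Hc, rule conjI, rule H(2), rule impI)
  apply (rule main, assumption)
  done
qed

section \<open>Recursion over containers with queries for diagonals\<close>

definition cT :: "real => real" where "cT \<xi> = 128/\<xi>^2"
definition cX2 :: "real => real" where "cX2 \<xi> = \<xi>^2/(24*(cT \<xi>)^2)"
definition cX3 :: "real => real" where "cX3 \<xi> = \<xi>^2/(16*cT \<xi>)"
definition cC1 :: "real => real" where "cC1 \<xi> = \<xi>^2/4"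
definition cC2 :: "real => real" where "cC2 \<xi> = (cC1 \<xi>)^2*(cX3 \<xi>)^2/32"
text \<open>The constants of \<open>supersat\<close> as functions of \<xi> alone, so that
  \<open>admissible\<close> can be stated outside the locale; \<open>cOm\<close> and
  \<open>cQd\<close> are the densities of the two alternatives in
  \<open>supersat_dichotomy\<close>.\<close>

definition cOm :: "real => real" where
 "cOm \<xi> = min (2*\<xi>^2) (min ((cC1 \<xi>)^2/(4*cT \<xi>)) (cC2 \<xi>*cX2 \<xi>/(4*cT \<xi>)))"
definition cQd :: "real => real" where "cQd \<xi> = cC2 \<xi>/(2*cT \<xi>)"
text \<open>The two entries are the values of \<open>K\<close> required by \<open>shrink_C4\<close>
  and by \<open>shrink_quads\<close>.\<close>

definition cK :: "real => real" where
 "cK \<xi> = max (262144*(24/\<xi> + 1) + 10000) (64*(8/((cX2 \<xi>)^2*cQd \<xi>)) + 1)"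

lemma const_pos:
 assumes "0 < \<xi>"
 shows "cT \<xi> > 0" "cX2 \<xi> > 0" "cX3 \<xi> > 0" "cC1 \<xi> > 0" "cC2 \<xi> > 0" "cOm \<xi> > 0" "cQd \<xi> > 0"
proof -
 show 1: "cT \<xi> > 0" using assms by (simp add: cT_def)
 show 2: "cX2 \<xi> > 0" using 1 assms by (simp add: cX2_def)
 show 3: "cX3 \<xi> > 0" using 1 assms by (simp add: cX3_def)
 show 4: "cC1 \<xi> > 0" using assms by (simp add: cC1_def)
 show 5: "cC2 \<xi> > 0" using 3 4 by (simp add: cC2_def)
 show "cOm \<xi> > 0" "cQd \<xi> > 0" using 1 2 4 5 assms by (simp_all add: cOm_def cQd_def)
qed

text \<open>The admissible average out-degrees \<open>X\<close>. Here \<open>\<theta>\<close> is the sampling rate for a fingerprint of about \<open>\<kappa> m\<close>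
 edges, \<open>N\<close> and \<open>N'\<close> are the sizes of the families of 4-cycles and of quadruples, and \<open>g\<close> bounds the degrees in \<open>F\<close>.\<close>

definition admissible :: "real => real => nat => nat => real => bool" where
 "admissible \<xi> \<kappa> n m X \<longleftrightarrow>
  (let \<theta> = \<kappa>*real m/(8*real n*X); N = cOm \<xi>*X^4/16; N' = cQd \<xi>*(X^5/real n);
    g = 2*X^2/(cX2 \<xi>*real n); c = N/(2^28*real m) + 1
  in X > 0 & \<theta> <= 1/64 & 1 <= X &
    2*X <= \<theta>*(N/(2*real n*X)) & 1 <= \<theta>^3*(N/(2*real n*X)) &
    2*real m*(2*(64*\<theta>)^4*c + 12*(64*\<theta>)^2*(2*X) + 20) < \<theta>^4*N &
    1 <= \<theta>*(N'/(2*real n*X)) &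
    4*real m*((64*\<theta>)^2*g^2 + 2*(64*\<theta>)*g + 1) < \<theta>\<^sup>2*N' &
    2*min (real m) (X^2)/(cX2 \<xi>*real n) <= cX3 \<xi>*X/4 & 4 <= cX3 \<xi>*X &
    2*(cT \<xi>)^2/(cC1 \<xi>)^2*real n <= X^2 &
    64*(cT \<xi>)^2/((cC1 \<xi>)^2*(cX3 \<xi>)^2)*real n <= X^2 & real n <= X^2)"

lemma num_prints_mono: "finite U' ==> U <= U' ==> num_prints U b <= num_prints U' b"
 unfolding num_prints_def by (intro card_mono) auto

locale container =
 fixes V :: "nat set" and n m :: nat and NN :: "nat set set set" and \<xi> \<kappa> Xmin z B0 :: real
 assumes finV: "finite V" and cardV: "card V = n" and n0: "n > 0" and m0: "m > 0"
  and NN: "\<And>G. G \<in> NN ==> G <= nsets V 2 & card G = m & \<not> contains_induced V G C4_verts C4_edges"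
  and xi: "0 < \<xi>" "\<xi> <= 1" and kap: "\<kappa> > 0" and z0: "z > 0" and B00: "B0 >= 0"
  and adm: "\<And>X. Xmin <= X ==> X <= real n ==> admissible \<xi> \<kappa> n m X"
begin

definition cnt :: "nat set set => nat set set => nat set set => real" where
 "cnt M F N0 = rcard {G\<in>NN. F <= G & G <= M & G Int N0 = {}}"

definition XX :: "nat set set => real" where "XX M = rcard M/real n"

text \<open>The recursion stops when the container is small, when \<open>F\<close> is so large
  compared with it that knowing \<open>F\<close> pays, or when the out-neighbourhoods are nearly
  cliques of \<open>F\<close>, which \<open>stability\<close> turns into a split structure.\<close>

definition final_state :: "nat set set => nat set set => bool" where
 "final_state M F \<longleftrightarrow> XX M < Xmin \<or> (XX M)\<^sup>2 < rcard F \<or> wt V (outn M) F < 4*\<xi>*rcard M"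

definition Tc :: nat where "Tc = num_prints (dire (nsets V 2)) (\<kappa>*real m + 1)"

lemma finP: "finite (nsets V 2)" using finV by (rule finite_imp_finite_nsets)

lemma finNN: "finite NN"
 by (rule finite_subset[of _ "Pow (nsets V 2)"]) (use NN finP in auto)

lemma finite_dire_all: "finite (dire (nsets V 2))"
 by (rule finite_card_dire(1)[OF subset_refl finP])

lemma Tc1: "1 <= Tc"
 unfolding Tc_def using finite_dire_all kap by (intro num_prints_ge1) auto

lemma cnt_N0: "cnt M F N0 <= cnt M F {}"
 unfolding cnt_def using finNN by (intro of_nat_mono card_mono) auto

lemma cnt_cover:
 assumes "finite MM" "\<And>G. G \<in> NN ==> F <= G ==> G <= M ==> G Int N0 = {} ==> \<exists>M'\<in>MM. G <= M'"
 shows "cnt M F N0 <= (\<Sum>M'\<in>MM. cnt M' F {})"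
proof -
 have "card {G\<in>NN. F <= G & G <= M & G Int N0 = {}} <= card (\<Union>M'\<in>MM. {G\<in>NN. F <= G & G <= M' & G Int {} = {}})"
  using assms finNN by (intro card_mono) auto
 also have "... <= (\<Sum>M'\<in>MM. card {G\<in>NN. F <= G & G <= M' & G Int {} = {}})" by (rule card_UN_le[OF assms(1)])
 finally have "rcard {G\<in>NN. F <= G & G <= M & G Int N0 = {}} <= real (\<Sum>M'\<in>MM. card {G\<in>NN. F <= G & G <= M' & G Int {} = {}})"
  by (simp only: of_nat_le_iff)
 then show ?thesis by (simp add: cnt_def)
qed

text \<open>Split by the intersection of the graph with \<open>Z\<close>. An edge found is charged a
  factor \<open>z\<close>, and the sum of \<open>z^card S\<close> over all subsets is
  \<open>(1 + z)^card Z\<close>: for small \<open>z\<close> it is cheap to query order m pairs, at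
  the price of a stronger demand on states with large \<open>F\<close>.\<close>

lemma cnt_query:
 assumes Z: "finite Z" "Z Int F = {}" and F: "finite F" and C: "C >= 0"
  and sub: "\<And>S. S <= Z ==> cnt M (F Un S) (N0 Un (Z - S)) <= z^card (F Un S)* C"
 shows "cnt M F N0 <= z^card F*((1 + z)^card Z* C)"
proof -
 let ?A = "%S. {G\<in>NN. F Un S <= G & G <= M & G Int (N0 Un (Z - S)) = {}}"
 have "{G\<in>NN. F <= G & G <= M & G Int N0 = {}} <= (\<Union>S\<in>Pow Z. ?A S)"
 proof
  fix G assume G: "G \<in> {G\<in>NN. F <= G & G <= M & G Int N0 = {}}"
  then have "G \<in> ?A (G Int Z)" by auto
  then show "G \<in> (\<Union>S\<in>Pow Z. ?A S)" by (rule UN_I[rotated]) simp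
 qed
 then have "card {G\<in>NN. F <= G & G <= M & G Int N0 = {}} <= card (\<Union>S\<in>Pow Z. ?A S)"
  using finNN Z by (intro card_mono) auto
 also have "... <= (\<Sum>S\<in>Pow Z. card (?A S))" using Z by (intro card_UN_le) auto
 finally have "cnt M F N0 <= real (\<Sum>S\<in>Pow Z. card (?A S))" unfolding cnt_def by (simp only: of_nat_le_iff)
 also have "... = (\<Sum>S\<in>Pow Z. cnt M (F Un S) (N0 Un (Z - S)))" by (simp add: cnt_def)
 also have "... <= (\<Sum>S\<in>Pow Z. z^card F* C*z^card S)"
 proof (rule sum_mono)
  fix S assume S: "S \<in> Pow Z"
  then have "finite S" "F Int S = {}" using Z finite_subset by auto
  then have "card (F Un S) = card F + card S" using F by (intro card_Un_disjoint) auto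
  then show "cnt M (F Un S) (N0 Un (Z - S)) <= z^card F* C*z^card S"
   using sub[of S] S by (simp add: power_add mult_ac)
 qed
 also have "... = z^card F* C*(\<Sum>S\<in>Pow Z. z^card S)" by (simp add: sum_distrib_left)
 also have "(\<Sum>S\<in>Pow Z. z^card S) = (1 + z)^card Z"
 proof -
  have "(\<Prod>x\<in>Z. z + 1) = (\<Sum>S\<in>Pow Z. (\<Prod>x\<in>S. z)*(\<Prod>x\<in>Z - S. 1))" by (rule prod_add[OF Z(1)])
  then show ?thesis by (simp add: add.commute)
 qed
 finally show ?thesis by (simp add: mult_ac)
qed

text \<open>A record of a failed round: the 4-cycles avoiding \<open>Sat\<close> whose diagonals avoid \<open>Z\<close> have bounded fractional weight.\<close>

definition blk :: "nat set set => nat set set => nat set set => nat set set => bool" where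
 "blk M F Sat Z \<longleftrightarrow> Sat <= M & rcard Sat <= \<xi>/3*rcard M &
  (\<forall>S \<omega>. finite S --> S <= goodT M F --> (\<forall>t. 0 <= \<omega> t & \<omega> t <= 1) -->
    (\<forall>I\<in>Triples4. \<forall>z. (\<Sum>t\<in>{t\<in>S. nths t I = z}. \<omega> t) <= XX M) -->
    (\<forall>a b c d. [a, b, c, d] \<in> S --> {a, b} ~: Sat & {b, c} ~: Sat & {c, d} ~: Sat & {a, d} ~: Sat & {a, c} ~: Z & {b, d} ~: Z) -->
    (\<Sum>t\<in>S. \<omega> t) <= 5*(cOm \<xi>*(XX M)^4/16))"

lemma blk_mono: "blk M F Sat Z ==> F <= F' ==> blk M F' Sat Z"
proof -
 assume a: "blk M F Sat Z" "F <= F'"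
 have "goodT M F' <= goodT M F" using a(2) unfolding goodT_def by blast
 then show ?thesis using a(1) unfolding blk_def by (meson order_trans)
qed

context
 fixes M :: "nat set set" and B' :: real
 assumes M: "M <= nsets V 2" and XM: "Xmin <= XX M" and B': "B' >= 0"
  and IH: "\<And>M' F. M' <= M ==> rcard M' <= (1 - 1/(4*cK \<xi>))*rcard M ==> F <= nsets V 2 ==>
    cnt M' F {} <= z^card F*B'"
  and term0: "\<And>F. F <= nsets V 2 ==> final_state M F ==> cnt M F {} <= z^card F*B0"
begin

definition "X = XX M"
definition "\<theta> = \<kappa>*real m/(8*real n*X)"
definition "NC = cOm \<xi>*X^4/16"

lemma cardM: "rcard M = real n*X" using n0 by (simp add: X_def XX_def)

lemma Xn: "X <= real n"
proof -
 have "card M <= card (nsets V 2)" using M finP by (rule card_mono[rotated])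
 also have "... = n choose 2" using cardV by simp
 also have "... <= n*n" by (auto simp: choose_two intro: order_trans[OF div_le_dividend])
 finally have "rcard M <= real n*real n" by (simp flip: of_nat_mult)
 then show ?thesis using n0 cardM by simp
qed

lemma admX: "admissible \<xi> \<kappa> n m X" using adm[of X] XM Xn by (simp add: X_def)

lemma X1: "X > 0" "X >= 1" using admX unfolding admissible_def Let_def by blast+

lemma theta: "0 < \<theta>" "\<theta> <= 1/64"
proof -
 show "0 < \<theta>" using X1 kap m0 n0 by (simp add: \<theta>_def)
 show "\<theta> <= 1/64" using admX unfolding admissible_def Let_def \<theta>_def by blast
qed

text \<open>\<theta> scales inversely with the container, so a fingerprint has about
  \<open>\<kappa>*m\<close> edges at every size, and one bound \<open>Tc\<close> serves all
  steps.\<close>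

lemma prints: "num_prints (dire M) (8*\<theta>*rcard M + 1) <= Tc"
proof -
 have "8*\<theta>*rcard M = \<kappa>*real m" using X1 n0 by (simp add: \<theta>_def cardM)
 then show ?thesis unfolding Tc_def using num_prints_mono[OF finite_dire_all dire_mono[OF M]] by simp
qed

lemma cover_bound:
 assumes MM: "finite MM" "card MM <= Tc^4"
  "\<forall>M'\<in>MM. M' <= M & rcard M' <= (1 - 1/(4*cK \<xi>))*rcard M"
  and cov: "\<And>G. G \<in> NN ==> F <= G ==> G <= M ==> G Int N0 = {} ==> \<exists>M'\<in>MM. G <= M'"
  and F: "F <= nsets V 2"
 shows "cnt M F N0 <= z^card F*(real Tc^4*B')"
proof -
 have "cnt M F N0 <= (\<Sum>M'\<in>MM. cnt M' F {})" by (rule cnt_cover[OF MM(1) cov])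
 also have "... <= (\<Sum>M'\<in>MM. z^card F*B')" using MM F by (intro sum_mono IH) auto
 also have "... = rcard MM*(z^card F*B')" by simp
 also have "... <= real (Tc^4)*(z^card F*B')" using MM z0 B' by (intro mult_right_mono of_nat_mono) auto
 finally show ?thesis by (simp add: mult_ac)
qed

lemma NC0: "NC > 0" using const_pos[OF xi(1)] X1 by (simp add: NC_def)

lemma round_step:
 assumes F: "F <= nsets V 2"
 shows "cnt M F N0 <= z^card F*(real Tc^4*B') \<or>
  (\<exists>Sat Z. blk M F Sat Z & Z <= nsets V 2 & Z Int F = {} & Z Int N0 = {} & rcard Z <= 2^29*real m)"
proof -
 \<comment> \<open>Makes the saturated edges at most a share \<xi>/3 of \<open>M\<close>, so that
   three rounds lose at most the share \<xi>.\<close>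
 define E0 where "E0 = 12*NC/(\<xi>*rcard M)"
 \<comment> \<open>Since \<open>(64*\<theta>)^4 = 2^24*\<theta>^4\<close>, the power 28 makes the
   diagonal term in \<open>shrink_C4\<close> a quarter of \<open>\<theta>^4*NC\<close>, apart from
   the \<open>+ 1\<close> in the cap. The set to be queried then has at most
   \<open>2*NC/c0 = 2^29*m\<close> pairs.\<close>
 define c0 where "c0 = NC/(2^28*real m)"
 have cM: "rcard M > 0" using cardM X1 n0 by simp
 have pos: "E0 > 0" "c0 > 0" using NC0 xi cM m0 by (auto simp: E0_def c0_def)
 from round[OF M finV pos X1(1), of N0 NC F] obtain H Sat Z where
  H: "H <= cyc4 M" "caps (diag_free N0) (Dinit (E0 + 1) (c0 + 1) (X + 1)) H" and
  small: "rcard H < NC --> Sat <= M & rcard Sat <= 4*(NC/E0) &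
   Z <= nsets V 2 & Z Int F = {} & Z Int N0 = {} & rcard Z <= 2*(NC/c0) &
   (\<forall>S \<omega>. finite S --> S <= goodT M F --> (\<forall>t. 0 <= \<omega> t & \<omega> t <= 1) -->
    (\<forall>I\<in>Triples4. \<forall>z. (\<Sum>t\<in>{t\<in>S. nths t I = z}. \<omega> t) <= X) -->
    (\<forall>a b c d. [a, b, c, d] \<in> S --> {a, b} ~: Sat & {b, c} ~: Sat & {c, d} ~: Sat & {a, d} ~: Sat & {a, c} ~: Z & {b, d} ~: Z) -->
    (\<Sum>t\<in>S. \<omega> t) <= 5*NC)" by (elim exE conjE) (rule that)
 show ?thesis
 proof (cases "rcard H < NC")
  case True
  have e1: "4*(NC/E0) = \<xi>/3*rcard M" using NC0 xi cM by (simp add: E0_def field_simps)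
  have e2: "2*(NC/c0) = 2^29*real m" using NC0 m0 by (simp add: c0_def field_simps)
  have "blk M F Sat Z & Z <= nsets V 2 & Z Int F = {} & Z Int N0 = {} & rcard Z <= 2^29*real m"
  proof (intro conjI)
   note sm = small[THEN mp, OF True, unfolded e1 e2]
   show "blk M F Sat Z" unfolding blk_def
    using sm unfolding NC_def X_def by (elim conjE) (intro conjI, assumption+)
   show "Z <= nsets V 2" "Z Int F = {}" "Z Int N0 = {}" "rcard Z <= 2^29*real m"
    using sm by - (elim conjE, assumption)+
  qed
  then show ?thesis by blast
 next
  case False
  define u where "u = 2*rcard M"
  have u2: "u = 2*real n*X" by (simp add: u_def cardM)
  have a: "2*X <= \<theta>*(NC/u)" "1 <= \<theta>^3*(NC/u)"
   "2*real m*(2*(64*\<theta>)^4*(c0 + 1) + 12*(64*\<theta>)^2*(2*X) + 20) < \<theta>^4*NC"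
   using admX unfolding u2 admissible_def Let_def \<theta>_def NC_def c0_def by blast+
  have Nu: "1 <= NC/u"
  proof -
   have "\<theta>^3*(NC/u) <= 1*(NC/u)"
    using theta NC0 u2 X1 n0 by (intro mult_right_mono power_le_one) auto
   then show ?thesis using a(2) by simp
  qed
  have "\<exists>MM. finite MM & card MM <= num_prints (dire M) (8*\<theta>*rcard M + 1)^4 &
   (\<forall>M'\<in>MM. M' <= M & rcard M' <= (1 - 1/(4*cK \<xi>))*rcard M) &
   (\<forall>G\<in>{G\<in>NN. F <= G & G <= M & G Int N0 = {}}. \<exists>M'\<in>MM. G <= M')"
  proof (rule shrink_C4[where x = "X + 1" and ?e0.0 = "24/\<xi> + 1" and N = NC and H = H and m = m, OF M finV _ H(1) theta _ _ _ _ H(2) NC0 _ _ u_def])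
   show "finite H" using finite_cyc4[OF M finV] H(1) finite_subset by blast
   show "0 < E0 + 1" "0 < c0 + 1" "0 < X + 1" "0 <= 24/\<xi> + 1" using pos X1 xi by auto
   show "NC <= rcard H" using False by simp
   show "262144*(24/\<xi> + 1) + 10000 <= cK \<xi>" by (simp add: cK_def)
   have "E0 = 24/\<xi>*(NC/u)" using xi cM by (simp add: E0_def u_def)
   then show "E0 + 1 <= (24/\<xi> + 1)*(NC/u)" using Nu by (simp add: algebra_simps)
   show "X + 1 <= \<theta>*(NC/u)" using a(1) X1 by linarith
   show "1 <= \<theta>^3*(NC/u)" by (rule a)
   have "12*(64*\<theta>)^2*(X + 1) <= 12*(64*\<theta>)^2*(2*X)" using X1 by (intro mult_left_mono) auto
   then have "2*real m*(2*(64*\<theta>)^4*(c0 + 1) + 12*(64*\<theta>)^2*(X + 1) + 20)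
    <= 2*real m*(2*(64*\<theta>)^4*(c0 + 1) + 12*(64*\<theta>)^2*(2*X) + 20)"
    by (intro mult_left_mono) auto
   then show "2*real m*(2*(64*\<theta>)^4*(c0 + 1) + 12*(64*\<theta>)^2*(X + 1) + 20) < \<theta>^4*NC"
    using a(3) by linarith
   show "G <= M & card G = m & G Int N0 = {} & \<not> contains_induced V G C4_verts C4_edges"
    if "G \<in> {G\<in>NN. F <= G & G <= M & G Int N0 = {}}" for G using that NN by auto
  qed
  then obtain MM where MM: "finite MM" "card MM <= num_prints (dire M) (8*\<theta>*rcard M + 1)^4"
   "\<forall>M'\<in>MM. M' <= M & rcard M' <= (1 - 1/(4*cK \<xi>))*rcard M"
   "\<forall>G\<in>{G\<in>NN. F <= G & G <= M & G Int N0 = {}}. \<exists>M'\<in>MM. G <= M'" by blast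
  have "card MM <= Tc^4" using MM(2) power_mono[OF prints, of 4] by linarith
  then have "cnt M F N0 <= z^card F*(real Tc^4*B')"
   by (rule cover_bound[OF MM(1) _ MM(3) _ F]) (use MM(4) in auto)
  then show ?thesis ..
 qed
qed

text \<open>A cycle has two diagonals, so one of the three disjoint sets \<open>Z1\<close>,
  \<open>Z2\<close>, \<open>Z3\<close> misses both. A spread family thus weighs at most
  \<open>3*5/16\<close> of what \<open>supersat_dichotomy\<close> would provide. So the other
  alternative holds, and \<open>shrink_quads\<close> applies to the quadruples.\<close>

lemma final_round:
 assumes F: "F <= nsets V 2" and cF: "card F <= m" and nt: "\<not> final_state M F"
  and b1: "blk M F S1 Z1" and b2: "blk M F S2 Z2" and b3: "blk M F S3 Z3"
  and disj: "Z1 Int Z2 = {}" "Z1 Int Z3 = {}" "Z2 Int Z3 = {}"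
 shows "cnt M F {} <= z^card F*(real Tc^4*B')"
proof -
 define Sat where "Sat = S1 Un S2 Un S3"
 define R where "R v = {x \<in> outn M v. {v, x} ~: Sat}" for v
 have finM: "finite M" using M finP finite_subset by blast
 have fS: "finite S1" "finite S2" "finite S3" "Sat <= M"
 proof -
  have "S1 <= M" "S2 <= M" "S3 <= M" using b1 b2 b3 unfolding blk_def by simp_all
  then show "finite S1" "finite S2" "finite S3" "Sat <= M" using finM finite_subset by (auto simp: Sat_def)
 qed
 have "card Sat <= card S1 + card S2 + card S3"
  using card_Un_le[of "S1 Un S2" S3] card_Un_le[of S1 S2] unfolding Sat_def by linarith
 then have cS: "rcard Sat <= \<xi>*rcard M"
 proof -
  have "rcard S1 <= \<xi>/3*rcard M" "rcard S2 <= \<xi>/3*rcard M" "rcard S3 <= \<xi>/3*rcard M"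
   using b1 b2 b3 unfolding blk_def by blast+
  then show ?thesis using \<open>card Sat <= card S1 + card S2 + card S3\<close> by linarith
 qed
 have wtR: "wt V R F >= 2*\<xi>*real n*X"
 proof -
  have "wt V (outn M) F - 2*rcard Sat <= wt V R F" unfolding R_def by (rule wt_remove[OF M finV fS(4)])
  moreover have "wt V (outn M) F >= 4*\<xi>*rcard M" using nt by (simp add: final_state_def)
  ultimately show ?thesis using cS cardM by (simp add: algebra_simps)
 qed
 have cFX: "rcard F <= X^2" using nt by (simp add: final_state_def X_def)
 have inM: "{u. {w, u} \<in> M} <= V" for w using edge_in[OF M] by blast
 have finin: "finite {u. {w, u} \<in> M}" for w using inM finV finite_subset by blast
 have card_le: "card Y <= degF M w" if "Y <= {u. {w, u} \<in> M}" for Y w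
  using card_mono[OF finin that] by (simp add: degF_def)
 interpret S: supersat V R F "%v. real (degF M v)" n X \<xi>
 proof
  show "finite V" by (rule finV)
  show "card V = n" by (rule cardV)
  show "R v <= V" "v ~: R v" for v using outn_sub(1)[of M V v] outn_sub(2)[of v M] M by (auto simp: R_def)
  show "rcard (R v) <= real (degF M v)" for v
   using card_le[of "R v" v] by (auto simp: R_def outn_def)
  show "rcard {v \<in> V. x \<in> R v} <= real (degF M x)" for x
   using card_le[of "{v \<in> V. x \<in> R v}" x] by (auto simp: R_def outn_def insert_commute)
  show "real (degF M v) <= real (degF M x)" if "x \<in> R v" for v x using that by (auto simp: R_def outn_def)
  show "real (degF M v) <= real n" for v using card_mono[OF finV inM, of v] cardV by (simp add: degF_def)
  have "(\<Sum>v\<in>V. real (degF M v)) = 2*rcard M"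
   using sum_degF[OF M finV] by (metis of_nat_mult of_nat_numeral of_nat_sum)
  then show "(\<Sum>v\<in>V. real (degF M v)) <= 2*real n*X" by (simp add: cardM)
  show "F <= nsets V 2" by (rule F)
  show "0 < \<xi>" "\<xi> <= 1" "0 < X" by (rule xi X1)+
  show "2*\<xi>*real n*X <= (\<Sum>v\<in>V. rcard {(x, y) \<in> R v \<times> R v. x ~= y & {x, y} ~: F}/rcard (R v))"
   using wtR by (simp add: wt_def nonF_def)
 qed
 have cst: "S.\<tau> = cT \<xi>" "S.\<xi>2 = cX2 \<xi>" "S.\<xi>3 = cX3 \<xi>" "S.c1 = cC1 \<xi>" "S.c2 = cC2 \<xi>"
  unfolding S.\<tau>_def S.\<xi>2_def S.\<xi>3_def S.c1_def S.c2_def cT_def cX2_def cX3_def cC1_def cC2_def by simp_all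
 have cp: "cX2 \<xi> > 0" "cOm \<xi> > 0" "cQd \<xi> > 0" using const_pos[OF xi(1)] by auto
 have g0: "S.g0 <= cX3 \<xi>*X/4"
 proof -
  have "S.g0 <= 2*min (real m) (X^2)/(cX2 \<xi>*real n)"
   unfolding S.g0_def cst using cF cFX cp by (intro divide_right_mono) auto
  then show ?thesis using admX by (simp add: admissible_def Let_def)
 qed
 have "S.spread (cOm \<xi>*X^4) \<or> S.many_quads (cQd \<xi>*(X^5/real n))"
  using S.supersat_dichotomy[OF n0 cFX] g0 admX
  unfolding cst by (simp add: admissible_def Let_def cOm_def cQd_def)
 moreover have "\<not> S.spread (cOm \<xi>*X^4)"
 proof
  assume "S.spread (cOm \<xi>*X^4)"
  then obtain S \<omega> where S: "finite S" "\<forall>t\<in>S. S.good_tuple t" and om: "\<forall>t. 0 <= \<omega> t & \<omega> t <= 1"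
   and tri: "\<forall>I\<in>Triples4. \<forall>z. (\<Sum>t\<in>{t\<in>S. nths t I = z}. \<omega> t) <= X"
   and tot: "cOm \<xi>*X^4 <= (\<Sum>t\<in>S. \<omega> t)" unfolding S.spread_def by blast
  have form: "\<exists>v x v' y. t = [v, x, v', y] & t \<in> goodT M F &
   {v, x} ~: Sat & {x, v'} ~: Sat & {v', y} ~: Sat & {v, y} ~: Sat" if t: "t \<in> S" for t
  proof -
   from S(2) t have "S.good_tuple t" by blast
   then obtain v x v' y where g: "t = [v, x, v', y]" "v ~= v'" "x ~= y"
    "{v, v'} ~: F" "{x, y} ~: F" "x \<in> R v" "y \<in> R v" "x \<in> R v'" "y \<in> R v'"
    unfolding S.good_tuple_def by blast
   have e: "{v, x} \<in> M" "{v, y} \<in> M" "{x, v'} \<in> M" "{v', y} \<in> M"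
    using g(6-9) by (auto simp: R_def outn_def insert_commute)
   then have "v ~= x" "v ~= y" "x ~= v'" "v' ~= y" using edge_in(3)[OF M] by blast+
   then have "t \<in> goodT M F" using g(1-5) e unfolding goodT_def cyc4_mem by auto
   moreover have "{v, x} ~: Sat" "{x, v'} ~: Sat" "{v', y} ~: Sat" "{v, y} ~: Sat"
    using g(6-9) by (auto simp: R_def insert_commute)
   ultimately show ?thesis using g(1) by blast
  qed
  define part where "part Z = {t\<in>S. \<forall>a b c d. t = [a, b, c, d] --> {a, c} ~: Z & {b, d} ~: Z}" for Z
  have pb: "(\<Sum>t\<in>part Z. \<omega> t) <= 5*(cOm \<xi>*X^4/16)" if b: "blk M F Si Z" and Si: "Si <= Sat" for Si Z
  proof -
   have 1: "finite (part Z)" using S(1) by (simp add: part_def)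
   have 2: "part Z <= goodT M F" using form by (auto simp: part_def)
   have 3: "\<forall>I\<in>Triples4. \<forall>z. (\<Sum>t\<in>{t\<in>part Z. nths t I = z}. \<omega> t) <= XX M"
   proof (intro ballI allI)
    fix I z assume I: "I \<in> Triples4"
    have "(\<Sum>t\<in>{t\<in>part Z. nths t I = z}. \<omega> t) <= (\<Sum>t\<in>{t\<in>S. nths t I = z}. \<omega> t)"
     using S(1) om by (intro sum_mono2) (auto simp: part_def)
    then show "(\<Sum>t\<in>{t\<in>part Z. nths t I = z}. \<omega> t) <= XX M" using tri I unfolding X_def by (meson order_trans)
   qed
   have 4: "\<forall>a b c d. [a, b, c, d] \<in> part Z --> {a, b} ~: Si & {b, c} ~: Si & {c, d} ~: Si & {a, d} ~: Si & {a, c} ~: Z & {b, d} ~: Z"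
   proof (intro allI impI)
    fix a b c d assume t: "[a, b, c, d] \<in> part Z"
    then have "[a, b, c, d] \<in> S" by (simp add: part_def)
    then have "{a, b} ~: Sat & {b, c} ~: Sat & {c, d} ~: Sat & {a, d} ~: Sat" using form by fastforce
    then show "{a, b} ~: Si & {b, c} ~: Si & {c, d} ~: Si & {a, d} ~: Si & {a, c} ~: Z & {b, d} ~: Z"
     using Si t by (auto simp: part_def)
   qed
   show ?thesis using b 1 2 3 4 om unfolding blk_def X_def by blast
  qed
  have "S <= part Z1 Un (part Z2 Un part Z3)"
  proof
   fix t assume t: "t \<in> S"
   obtain a b c d where t': "t = [a, b, c, d]" using form t by blast
   have "({a, c} ~: Z1 & {b, d} ~: Z1) \<or> ({a, c} ~: Z2 & {b, d} ~: Z2) \<or> ({a, c} ~: Z3 & {b, d} ~: Z3)"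
    using disj by blast
   then show "t \<in> part Z1 Un (part Z2 Un part Z3)" using t unfolding t' part_def by auto
  qed
  then have "(\<Sum>t\<in>S. \<omega> t) <= (\<Sum>t\<in>part Z1 Un (part Z2 Un part Z3). \<omega> t)"
   using S(1) om by (intro sum_mono2) (auto simp: part_def)
  also have "... <= (\<Sum>t\<in>part Z1. \<omega> t) + (\<Sum>t\<in>part Z2 Un part Z3. \<omega> t)"
   using S(1) om by (intro sum_Un_nonneg_le) (auto simp: part_def)
  also have "(\<Sum>t\<in>part Z2 Un part Z3. \<omega> t) <= (\<Sum>t\<in>part Z2. \<omega> t) + (\<Sum>t\<in>part Z3. \<omega> t)"
   using S(1) om by (intro sum_Un_nonneg_le) (auto simp: part_def)
  finally have "(\<Sum>t\<in>S. \<omega> t) <= 15*(cOm \<xi>*X^4/16)"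
   using pb[OF b1] pb[OF b2] pb[OF b3] by (force simp: Sat_def)
  moreover have "cOm \<xi>*X^4 > 0" using cp X1 by simp
  ultimately show False using tot by linarith
 qed
 ultimately have mq: "S.many_quads (cQd \<xi>*(X^5/real n))" by blast
 define g where "g = 2*X^2/(cX2 \<xi>*real n)"
 define NQ where "NQ = cQd \<xi>*(X^5/real n)"
 define u where "u = 2*rcard M"
 have u2: "u = 2*real n*X" by (simp add: u_def cardM)
 have gpos: "g > 0" using cp X1 n0 by (simp add: g_def)
 have g0g: "S.g0 <= g" unfolding S.g0_def g_def cst using cFX cp by (intro divide_right_mono) auto
 from mq obtain S where S: "finite S" "NQ <= rcard S"
  "\<forall>t\<in>S. \<exists>v x v' x'. t = [v, x, v', x'] & v \<in> V & v' \<in> V & x \<in> R v & x' \<in> R v & x \<in> R v' & x' \<in> R v' &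
    {v, v'} \<in> F & {x, x'} \<in> F & (\<forall>w\<in>{v, v', x, x'}. real (degF F w) <= S.g0)"
  unfolding S.many_quads_def NQ_def by blast
 have form: "\<exists>v x v' x'. t = [v, x, v', x'] & distinct [v, x, v', x'] & {v, x} \<in> M & {v', x'} \<in> M & {v, v'} \<in> F & {x, x'} \<in> F &
   real (degF F v) <= g & real (degF F v') <= g & real (degF F x) <= g & real (degF F x') <= g" if t: "t \<in> S" for t
 proof -
  from S(3) t obtain v x v' x' where q: "t = [v, x, v', x']" "x \<in> R v" "x' \<in> R v" "x \<in> R v'" "x' \<in> R v'"
    "{v, v'} \<in> F" "{x, x'} \<in> F" "\<forall>w\<in>{v, v', x, x'}. real (degF F w) <= S.g0" by blast
  have e: "{v, x} \<in> M" "{v, x'} \<in> M" "{v', x} \<in> M" "{v', x'} \<in> M"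
   using q(2-5) by (auto simp: R_def outn_def)
  then have "v ~= x" "v ~= x'" "v' ~= x" "v' ~= x'" using edge_in(3)[OF M] by blast+
  moreover have "v ~= v'" "x ~= x'" using q(6,7) edge_in(3)[OF F] by blast+
  moreover have "real (degF F v) <= g" "real (degF F v') <= g" "real (degF F x) <= g" "real (degF F x') <= g"
   using q(8) g0g by force+
  ultimately show ?thesis using q e by (intro exI[of _ v] exI[of _ x] exI[of _ v'] exI[of _ x']) auto
 qed
 have finF: "finite {w. {v, w} \<in> F}" for v
  by (rule finite_subset[OF _ finV]) (use edge_in[OF F] in blast)
 \<comment> \<open>Two corners joined by a side outside \<open>F\<close> determine the other two up
   to their \<open>F\<close>-neighbours, since each missing corner is joined in \<open>F\<close> to
   one of them.\<close>
 have prod_bound: "rcard {t\<in>S. nths t I = zz} <= g^2"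
  if d: "\<And>t. t \<in> S ==> nths t I = zz ==> \<exists>w\<in>{w. {p, w} \<in> F}. \<exists>w'\<in>{w. {q, w} \<in> F}. t = f w w'"
   and dg: "real (degF F p) <= g" "real (degF F q) <= g" for I zz p q f
 proof -
  have "card {t\<in>S. nths t I = zz} <= card ({w. {p, w} \<in> F} \<times> {w. {q, w} \<in> F})"
   by (rule surj_card_le[where f = "%(w, w'). f w w'"]) (use d finF in \<open>force+\<close>)
  then have "rcard {t\<in>S. nths t I = zz} <= real (degF F p)*real (degF F q)"
   by (simp add: card_cartesian_product degF_def flip: of_nat_mult)
  also have "... <= g*g" using dg gpos by (intro mult_mono) auto
  finally show ?thesis by (simp add: power2_eq_square)
 qed
 have single_bound: "rcard {t\<in>S. nths t I = zz} <= g"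
  if d: "\<And>t. t \<in> S ==> nths t I = zz ==> \<exists>w\<in>{w. {p, w} \<in> F}. t = f w"
   and dg: "real (degF F p) <= g" for I zz p f
 proof -
  have "card {t\<in>S. nths t I = zz} <= card {w. {p, w} \<in> F}"
   by (rule surj_card_le[where f = f]) (use d finF in \<open>force+\<close>)
  then show ?thesis using dg unfolding degF_def by linarith
 qed
 have empty_bound: "rcard {t\<in>S. nths t I = zz} <= b" if "\<not> (\<exists>t\<in>S. nths t I = zz)" "0 <= b" for I zz b
 proof -
  have e: "{t\<in>S. nths t I = zz} = {}" using that(1) by blast
  show ?thesis unfolding e using that(2) by simp
 qed
 have pairs: "rcard {t\<in>S. nths t I = zz} <= g^2" if I: "I \<in> Edges4" for I zz
 proof (cases "\<exists>t\<in>S. nths t I = zz")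
  case False
  then show ?thesis by (rule empty_bound) simp
 next
  case True
  then obtain t0 where t0: "t0 \<in> S" "nths t0 I = zz" by blast
  from form[OF t0(1)] obtain v x v' x' where q: "t0 = [v, x, v', x']" "real (degF F v) <= g" "real (degF F v') <= g"
   "real (degF F x) <= g" "real (degF F x') <= g" by blast
  from I consider "I = {0, 1}" | "I = {1, 2}" | "I = {2, 3}" | "I = {0, 3}" by blast
  then show ?thesis
  proof cases
   case 1
   have z: "zz = [v, x]" using t0(2) unfolding q(1) 1 nths4 by simp
   show ?thesis
   proof (rule prod_bound[where f = "%w w'. [v, x, w, w']", OF _ q(2) q(4)])
    fix t assume t: "t \<in> S" "nths t I = zz"
    from form[OF t(1)] obtain a b c d where t': "t = [a, b, c, d]" "{a, c} \<in> F" "{b, d} \<in> F" by blast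
    have "a = v" "b = x" using t(2) unfolding t'(1) 1 z nths4 by simp_all
    then show "\<exists>w\<in>{w. {v, w} \<in> F}. \<exists>w'\<in>{w. {x, w} \<in> F}. t = [v, x, w, w']" using t' by blast
   qed
  next
   case 2
   have z: "zz = [x, v']" using t0(2) unfolding q(1) 2 nths4 by simp
   show ?thesis
   proof (rule prod_bound[where f = "%w w'. [w, x, v', w']", OF _ q(3) q(4)])
    fix t assume t: "t \<in> S" "nths t I = zz"
    from form[OF t(1)] obtain a b c d where t': "t = [a, b, c, d]" "{a, c} \<in> F" "{b, d} \<in> F" by blast
    have "c = v'" "b = x" using t(2) unfolding t'(1) 2 z nths4 by simp_all
    then show "\<exists>w\<in>{w. {v', w} \<in> F}. \<exists>w'\<in>{w. {x, w} \<in> F}. t = [w, x, v', w']" using t' by (auto simp: insert_commute)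
   qed
  next
   case 3
   have z: "zz = [v', x']" using t0(2) unfolding q(1) 3 nths4 by simp
   show ?thesis
   proof (rule prod_bound[where f = "%w w'. [w, w', v', x']", OF _ q(3) q(5)])
    fix t assume t: "t \<in> S" "nths t I = zz"
    from form[OF t(1)] obtain a b c d where t': "t = [a, b, c, d]" "{a, c} \<in> F" "{b, d} \<in> F" by blast
    have "c = v'" "d = x'" using t(2) unfolding t'(1) 3 z nths4 by simp_all
    then show "\<exists>w\<in>{w. {v', w} \<in> F}. \<exists>w'\<in>{w. {x', w} \<in> F}. t = [w, w', v', x']" using t' by (auto simp: insert_commute)
   qed
  next
   case 4
   have z: "zz = [v, x']" using t0(2) unfolding q(1) 4 nths4 by simp
   show ?thesis
   proof (rule prod_bound[where f = "%w w'. [v, w', w, x']", OF _ q(2) q(5)])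
    fix t assume t: "t \<in> S" "nths t I = zz"
    from form[OF t(1)] obtain a b c d where t': "t = [a, b, c, d]" "{a, c} \<in> F" "{b, d} \<in> F" by blast
    have "a = v" "d = x'" using t(2) unfolding t'(1) 4 z nths4 by simp_all
    then show "\<exists>w\<in>{w. {v, w} \<in> F}. \<exists>w'\<in>{w. {x', w} \<in> F}. t = [v, w', w, x']" using t' by (auto simp: insert_commute)
   qed
  qed
 qed
 have triples: "rcard {t\<in>S. nths t I = zz} <= g" if I: "I \<in> Triples4" for I zz
 proof (cases "\<exists>t\<in>S. nths t I = zz")
  case False
  then show ?thesis by (rule empty_bound) (use gpos in simp)
 next
  case True
  then obtain t0 where t0: "t0 \<in> S" "nths t0 I = zz" by blast
  from form[OF t0(1)] obtain v x v' x' where q: "t0 = [v, x, v', x']" "real (degF F v) <= g" "real (degF F v') <= g"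
   "real (degF F x) <= g" "real (degF F x') <= g" by blast
  from I consider "I = {0, 1, 2}" | "I = {0, 2, 3}" | "I = {0, 1, 3}" | "I = {1, 2, 3}" by blast
  then show ?thesis
  proof cases
   case 1
   have z: "zz = [v, x, v']" using t0(2) unfolding q(1) 1 nths4 by simp
   show ?thesis
   proof (rule single_bound[where f = "%w. [v, x, v', w]", OF _ q(4)])
    fix t assume t: "t \<in> S" "nths t I = zz"
    from form[OF t(1)] obtain a b c d where t': "t = [a, b, c, d]" "{a, c} \<in> F" "{b, d} \<in> F" by blast
    have "a = v" "b = x" "c = v'" using t(2) unfolding t'(1) 1 z nths4 by simp_all
    then show "\<exists>w\<in>{w. {x, w} \<in> F}. t = [v, x, v', w]" using t' by blast
   qed
  next
   case 2
   have z: "zz = [v, v', x']" using t0(2) unfolding q(1) 2 nths4 by simp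
   show ?thesis
   proof (rule single_bound[where f = "%w. [v, w, v', x']", OF _ q(5)])
    fix t assume t: "t \<in> S" "nths t I = zz"
    from form[OF t(1)] obtain a b c d where t': "t = [a, b, c, d]" "{a, c} \<in> F" "{b, d} \<in> F" by blast
    have "a = v" "d = x'" "c = v'" using t(2) unfolding t'(1) 2 z nths4 by simp_all
    then show "\<exists>w\<in>{w. {x', w} \<in> F}. t = [v, w, v', x']" using t' by (auto simp: insert_commute)
   qed
  next
   case 3
   have z: "zz = [v, x, x']" using t0(2) unfolding q(1) 3 nths4 by simp
   show ?thesis
   proof (rule single_bound[where f = "%w. [v, x, w, x']", OF _ q(2)])
    fix t assume t: "t \<in> S" "nths t I = zz"
    from form[OF t(1)] obtain a b c d where t': "t = [a, b, c, d]" "{a, c} \<in> F" "{b, d} \<in> F" by blast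
    have "a = v" "d = x'" "b = x" using t(2) unfolding t'(1) 3 z nths4 by simp_all
    then show "\<exists>w\<in>{w. {v, w} \<in> F}. t = [v, x, w, x']" using t' by blast
   qed
  next
   case 4
   have z: "zz = [x, v', x']" using t0(2) unfolding q(1) 4 nths4 by simp
   show ?thesis
   proof (rule single_bound[where f = "%w. [w, x, v', x']", OF _ q(3)])
    fix t assume t: "t \<in> S" "nths t I = zz"
    from form[OF t(1)] obtain a b c d where t': "t = [a, b, c, d]" "{a, c} \<in> F" "{b, d} \<in> F" by blast
    have "c = v'" "d = x'" "b = x" using t(2) unfolding t'(1) 4 z nths4 by simp_all
    then show "\<exists>w\<in>{w. {v', w} \<in> F}. t = [w, x, v', x']" using t' by (auto simp: insert_commute)
   qed
  qed
 qed
 have NQ0: "NQ > 0" using cp X1 n0 by (simp add: NQ_def)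
 have "\<exists>MM. finite MM & card MM <= num_prints (dire M) (8*\<theta>*rcard M + 1)^2 &
   (\<forall>M'\<in>MM. M' <= M & rcard M' <= (1 - 1/(4*cK \<xi>))*rcard M) &
   (\<forall>G\<in>{G\<in>NN. F <= G & G <= M}. \<exists>M'\<in>MM. G <= M')"
 proof (rule shrink_quads[where ?e0.0 = "8/((cX2 \<xi>)^2*cQd \<xi>)" and F = F and m = m, OF M finV S(1) _ theta gpos _ pairs triples NQ0 S(2) _ u_def])
  show "S <= quad4 M F" using form unfolding quad4_def by blast
  show "0 <= 8/((cX2 \<xi>)^2*cQd \<xi>)" using cp by simp
  show "64*(8/((cX2 \<xi>)^2*cQd \<xi>)) + 1 <= cK \<xi>" by (simp add: cK_def)
  show "g^2 <= 8/((cX2 \<xi>)^2*cQd \<xi>)*(NQ/u)"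
   using cp X1 n0 by (simp add: g_def NQ_def u2 power2_eq_square eval_nat_numeral field_simps)
  show "1 <= \<theta>*(NQ/u)" "4*real m*((64*\<theta>)^2*g^2 + 2*(64*\<theta>)*g + 1) < \<theta>\<^sup>2*NQ"
   using admX unfolding u2 admissible_def Let_def \<theta>_def NQ_def g_def by blast+
  show "F <= G & G <= M & card G = m & \<not> contains_induced V G C4_verts C4_edges"
   if "G \<in> {G\<in>NN. F <= G & G <= M}" for G using that NN by auto
 qed
 then obtain MM where MM: "finite MM" "card MM <= num_prints (dire M) (8*\<theta>*rcard M + 1)^2"
  "\<forall>M'\<in>MM. M' <= M & rcard M' <= (1 - 1/(4*cK \<xi>))*rcard M"
  "\<forall>G\<in>{G\<in>NN. F <= G & G <= M}. \<exists>M'\<in>MM. G <= M'" by blast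
 have "card MM <= Tc^2" using MM(2) power_mono[OF prints, of 2] by linarith
 also have "... <= Tc^4" using Tc1 by (intro power_increasing) auto
 finally show ?thesis by (rule cover_bound[OF MM(1) _ MM(3) _ F]) (use MM(4) in auto)
qed

text \<open>Three rounds, each followed by a query that puts its \<open>Z\<close> into
  \<open>F Un N0\<close>; later sets avoid both and are therefore disjoint from it. A round that
  already shrinks the container ends the step by the induction hypothesis.\<close>

lemma step:
 assumes F: "F <= nsets V 2"
 shows "cnt M F {} <= z^card F*((1 + z) powr (3*2^29*real m)*max B0 (real Tc^4*B'))"
proof -
 define Bm where "Bm = max B0 (real Tc^4*B')"
 define q where "q = (1 + z) powr (2^29*real m)"
 have Bm0: "0 <= Bm" using B00 by (simp add: Bm_def)
 have q1: "1 <= q" using z0 by (simp add: q_def ge_one_powr_ge_zero)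
 have qZ: "(1 + z)^card Z <= q" if "rcard Z <= 2^29*real m" for Z :: "nat set set"
 proof -
  have "(1 + z)^card Z = (1 + z) powr rcard Z" using z0 by (simp add: powr_realpow)
  also have "... <= q" unfolding q_def using that z0 by (intro powr_mono) auto
  finally show ?thesis .
 qed
 have finF: "finite F" if "F <= nsets V 2" for F :: "nat set set" using that finP finite_subset by blast
 have base: "cnt M F N0 <= z^card F*Bm"
  if F: "F <= nsets V 2" and b: "blk M F S1 Z1" "blk M F S2 Z2" "blk M F S3 Z3"
   and disj: "Z1 Int Z2 = {}" "Z1 Int Z3 = {}" "Z2 Int Z3 = {}" for F N0 S1 S2 S3 Z1 Z2 Z3
 proof (cases "card F <= m")
  case False
  have "{G\<in>NN. F <= G & G <= M & G Int N0 = {}} = {}"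
  proof -
   have "card F <= m" if "G \<in> NN" "F <= G" for G
    using NN[OF that(1)] that(2) card_mono[of G F] finP finite_subset by metis
   then show ?thesis using False by blast
  qed
  then have "cnt M F N0 = 0" unfolding cnt_def by (simp only: card.empty of_nat_0)
  then show ?thesis using Bm0 z0 by simp
 next
  case True
  show ?thesis
  proof (cases "final_state M F")
   case True
   have "cnt M F N0 <= z^card F*B0" using cnt_N0 term0[OF F True] by (rule order_trans)
   also have "... <= z^card F*Bm" using z0 by (intro mult_left_mono) (auto simp: Bm_def)
   finally show ?thesis .
  next
   case nt: False
   have "cnt M F N0 <= z^card F*(real Tc^4*B')" using cnt_N0 final_round[OF F True nt b disj] by (rule order_trans)
   also have "... <= z^card F*Bm" using z0 by (intro mult_left_mono) (auto simp: Bm_def)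
   finally show ?thesis .
  qed
 qed
 have shr: "cnt M F N0 <= z^card F*(r*Bm)" if "cnt M F N0 <= z^card F*(real Tc^4*B')" "1 <= r" for F N0 r
 proof -
  have "real Tc^4*B' <= 1*Bm" by (simp add: Bm_def)
  also have "... <= r*Bm" using that Bm0 by (intro mult_right_mono) auto
  finally have "z^card F*(real Tc^4*B') <= z^card F*(r*Bm)" using z0 by (intro mult_left_mono) auto
  then show ?thesis using that(1) by linarith
 qed
 have query: "cnt M F N0 <= z^card F*(q* C)"
  if F: "F <= nsets V 2" and Z: "Z <= nsets V 2" "Z Int F = {}" "rcard Z <= 2^29*real m" and C: "C >= 0"
   and sub: "\<And>S. S <= Z ==> cnt M (F Un S) (N0 Un (Z - S)) <= z^card (F Un S)* C" for F N0 Z C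
 proof -
  have "cnt M F N0 <= z^card F*((1 + z)^card Z* C)"
   by (rule cnt_query) (use F Z C sub finF in auto)
  also have "... <= z^card F*(q* C)" using qZ[OF Z(3)] z0 C by (intro mult_left_mono mult_right_mono) auto
  finally show ?thesis .
 qed
 have r3: "cnt M F N0 <= z^card F*(q*Bm)"
  if F: "F <= nsets V 2" and b: "blk M F S1 Z1" "blk M F S2 Z2" and d: "Z1 Int Z2 = {}" "Z1 <= F Un N0" "Z2 <= F Un N0" for F N0 S1 S2 Z1 Z2
  using round_step[OF F, of N0]
 proof
  assume "cnt M F N0 <= z^card F*(real Tc^4*B')"
  then show ?thesis using q1 by (rule shr)
 next
  assume "\<exists>Sat Z. blk M F Sat Z & Z <= nsets V 2 & Z Int F = {} & Z Int N0 = {} & rcard Z <= 2^29*real m"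
  then obtain S3 Z3 where s3: "blk M F S3 Z3" "Z3 <= nsets V 2" "Z3 Int F = {}" "Z3 Int N0 = {}" "rcard Z3 <= 2^29*real m"
   by blast
  show ?thesis
  proof (rule query[OF F s3(2,3,5) Bm0])
   fix S assume S: "S <= Z3"
   show "cnt M (F Un S) (N0 Un (Z3 - S)) <= z^card (F Un S)*Bm"
   proof (rule base)
    show "F Un S <= nsets V 2" using F S s3(2) by blast
    show "blk M (F Un S) S1 Z1" "blk M (F Un S) S2 Z2" "blk M (F Un S) S3 Z3"
     using b s3(1) blk_mono by blast+
    show "Z1 Int Z2 = {}" "Z1 Int Z3 = {}" "Z2 Int Z3 = {}" using d s3(3,4) by blast+
   qed
  qed
 qed
 have r2: "cnt M F N0 <= z^card F*(q*(q*Bm))"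
  if F: "F <= nsets V 2" and b: "blk M F S1 Z1" and d: "Z1 <= F Un N0" for F N0 S1 Z1
  using round_step[OF F, of N0]
 proof
  assume a: "cnt M F N0 <= z^card F*(real Tc^4*B')"
  have "1 <= q*q" using mult_mono[OF q1 q1] q1 by simp
  then have "cnt M F N0 <= z^card F*(q*q*Bm)" by (rule shr[OF a])
  then show ?thesis by (simp only: mult.assoc)
 next
  assume "\<exists>Sat Z. blk M F Sat Z & Z <= nsets V 2 & Z Int F = {} & Z Int N0 = {} & rcard Z <= 2^29*real m"
  then obtain S2 Z2 where s2: "blk M F S2 Z2" "Z2 <= nsets V 2" "Z2 Int F = {}" "Z2 Int N0 = {}" "rcard Z2 <= 2^29*real m"
   by blast
  show ?thesis
  proof (rule query[OF F s2(2,3,5)])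
   show "0 <= q*Bm" using q1 Bm0 by simp
   fix S assume S: "S <= Z2"
   show "cnt M (F Un S) (N0 Un (Z2 - S)) <= z^card (F Un S)*(q*Bm)"
   proof (rule r3)
    show "F Un S <= nsets V 2" using F S s2(2) by blast
    show "blk M (F Un S) S1 Z1" "blk M (F Un S) S2 Z2" using b s2(1) blk_mono by blast+
    show "Z1 Int Z2 = {}" "Z1 <= F Un S Un (N0 Un (Z2 - S))" "Z2 <= F Un S Un (N0 Un (Z2 - S))" using d s2(3,4) by blast+
   qed
  qed
 qed
 have r1: "cnt M F {} <= z^card F*(q*(q*(q*Bm)))"
  using round_step[OF F, of "{}"]
 proof
  assume a: "cnt M F {} <= z^card F*(real Tc^4*B')"
  have "1 <= q*q" using mult_mono[OF q1 q1] q1 by simp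
  then have "1 <= q*(q*q)" using mult_mono[OF q1, of 1 "q*q"] q1 by simp
  then have "cnt M F {} <= z^card F*(q*(q*q)*Bm)" by (rule shr[OF a])
  then show ?thesis by (simp only: mult.assoc)
 next
  assume "\<exists>Sat Z. blk M F Sat Z & Z <= nsets V 2 & Z Int F = {} & Z Int {} = {} & rcard Z <= 2^29*real m"
  then obtain S1 Z1 where s1: "blk M F S1 Z1" "Z1 <= nsets V 2" "Z1 Int F = {}" "rcard Z1 <= 2^29*real m"
   by blast
  show ?thesis
  proof (rule query[OF F s1(2,3,4)])
   show "0 <= q*(q*Bm)" using q1 Bm0 by simp
   fix S assume S: "S <= Z1"
   show "cnt M (F Un S) ({} Un (Z1 - S)) <= z^card (F Un S)*(q*(q*Bm))"
   proof (rule r2)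
    show "F Un S <= nsets V 2" using F S s1(2) by blast
    show "blk M (F Un S) S1 Z1" using s1(1) blk_mono by blast
    show "Z1 <= F Un S Un ({} Un (Z1 - S))" by blast
   qed
  qed
 qed
 have "q*(q*q) = (1 + z) powr (3*2^29*real m)"
  using z0 by (simp add: q_def powr_add[symmetric])
 then show ?thesis using r1 unfolding Bm_def by (simp add: mult.assoc[symmetric])
qed

end

end

section \<open>Counting by exponential weights and the iterated container bound\<close>

lemma choose_two_le: "real (k choose 2) <= (real k)^2/2"
proof -
 have "2*(k choose 2) <= k*(k - 1)" unfolding choose_two by simp
 also have "... <= k*k" by simp
 finally have "real (2*(k choose 2)) <= real (k*k)" by (simp only: of_nat_le_iff)
 then show ?thesis by (simp add: power2_eq_square)
qed

text \<open>Weight 1/y per element: a set with at most \<open>x\<close> elements has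
  \<open>y powr x\<close> times its weight at least 1, and the weights of all subsets sum to a
  product.\<close>

lemma num_prints_le:
 assumes U: "finite U" and b: "0 < b" and x: "b <= x" "1 <= y"
 shows "real (num_prints U b) <= exp (x*ln y + rcard U/y)"
proof -
 have y0: "y > 0" using x by simp
 have "real (num_prints U b) = (\<Sum>T\<in>{T. T <= U & rcard T <= b}. 1)" by (simp add: num_prints_def)
 also have "... <= (\<Sum>T\<in>{T. T <= U & rcard T <= b}. exp (x*ln y)*(1/y)^card T)"
 proof (rule sum_mono)
  fix T assume T: "T \<in> {T. T <= U & rcard T <= b}"
  have "y^card T = exp (rcard T*ln y)" using y0 by (simp add: exp_of_nat_mult)
  also have "... <= exp (x*ln y)" using T x by (auto intro: mult_right_mono)
  finally show "1 <= exp (x*ln y)*(1/y)^card T" using y0 by (simp add: power_one_over field_simps)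
 qed
 also have "... <= (\<Sum>T\<in>Pow U. exp (x*ln y)*(1/y)^card T)" using U y0 by (intro sum_mono2) auto
 also have "... = exp (x*ln y)*(\<Sum>T\<in>Pow U. (1/y)^card T)" by (simp add: sum_distrib_left)
 also have "(\<Sum>T\<in>Pow U. (1/y)^card T) = (1/y + 1)^card U"
  using prod_add[OF U, of "%_. 1/y" "%_. 1"] by simp
 also have "... <= exp (1/y)^card U" using y0 by (intro power_mono) (auto simp: add.commute exp_ge_add_one_self)
 also have "... = exp (rcard U/y)" by (simp flip: exp_of_nat_mult)
 finally show ?thesis by (simp add: exp_add)
qed

text \<open>Weight \<theta> per edge and an extra factor \<open>s\<close> on \<open>D\<close>; the
  sum over all subsets of \<open>M\<close> is a product. A large \<open>s\<close> exploits that many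
  edges must fall into a part \<open>D\<close> where the container is sparse.\<close>

lemma card_between_le:
 fixes M F D :: "'a set"
 assumes M: "finite M" and lam: "\<theta> > 0" and s: "s >= 1" and f: "card F <= m"
 shows "rcard {G. F <= G & G <= M & card G = m & r <= rcard ((G - F) Int D)}
  <= exp (\<theta>*rcard M + \<theta>* s*rcard (M Int D) - real (m - card F)*ln \<theta> - r*ln s)" (is "rcard ?S <= _")
proof -
 define w where "w e = \<theta>*(if e \<in> D then s else 1)" for e
 have w0: "w e > 0" for e using lam s by (simp add: w_def)
 have each: "exp (real (m - card F)*ln \<theta> + r*ln s) <= prod w (G - F)" if G: "G \<in> ?S" for G
 proof -
  have sub: "G <= M" "F <= G" using G by simp_all
  have fG: "finite G" "finite F" using finite_subset[OF sub(1) M] finite_subset[OF sub(2)] by simp_all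
  have c: "card (G - F) = m - card F" using G fG by (simp add: card_Diff_subset)
  have "prod w (G - F) = (\<Prod>e\<in>G - F. \<theta>)*(\<Prod>e\<in>G - F. if e \<in> D then s else 1)"
   unfolding w_def by (rule prod.distrib)
  also have "(\<Prod>e\<in>G - F. if e \<in> D then s else 1) = s^card ((G - F) Int D)"
   using fG by (subst prod.inter_restrict[symmetric]) auto
  also have "(\<Prod>e\<in>G - F. \<theta>) = \<theta>^(m - card F)" using c by simp
  also have "\<theta>^(m - card F) = exp (real (m - card F)*ln \<theta>)" using lam by (simp add: exp_of_nat_mult)
  also have "s^card ((G - F) Int D) = exp (rcard ((G - F) Int D)*ln s)" using s by (simp add: exp_of_nat_mult)
  finally have "prod w (G - F) = exp (real (m - card F)*ln \<theta> + rcard ((G - F) Int D)*ln s)" by (simp add: exp_add)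
  moreover have "r*ln s <= rcard ((G - F) Int D)*ln s" using G s by (intro mult_right_mono) auto
  ultimately show ?thesis by simp
 qed
 have "rcard ?S*exp (real (m - card F)*ln \<theta> + r*ln s) = (\<Sum>G\<in>?S. exp (real (m - card F)*ln \<theta> + r*ln s))" by simp
 also have "... <= (\<Sum>G\<in>?S. prod w (G - F))" by (rule sum_mono) (rule each)
 also have "... = (\<Sum>W\<in>(%G. G - F) ` ?S. prod w W)"
  by (rule sum.reindex[symmetric, unfolded o_def]) (auto simp: inj_on_def)
 also have "... <= (\<Sum>W\<in>Pow M. prod w W)" using M w0 by (intro sum_mono2) (auto intro: prod_nonneg less_imp_le)
 also have "... = (\<Prod>e\<in>M. w e + 1)" using prod_add[OF M, of w "%_. 1"] by simp
 also have "... <= (\<Prod>e\<in>M. exp (w e))"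
 proof (rule prod_mono)
  fix e show "0 <= w e + 1 & w e + 1 <= exp (w e)" using w0[of e] exp_ge_add_one_self[of "w e"] by (simp add: add.commute)
 qed
 also have "... = exp (\<Sum>e\<in>M. w e)" using M by (simp add: exp_sum)
 also have "(\<Sum>e\<in>M. w e) <= (\<Sum>e\<in>M. \<theta> + (if e \<in> D then \<theta>* s else 0))"
  using lam s by (intro sum_mono) (auto simp: w_def)
 also have "... = \<theta>*rcard M + \<theta>* s*rcard (M Int D)"
  using M by (simp add: sum.distrib sum.If_cases Int_def)
 finally have "rcard ?S*exp (real (m - card F)*ln \<theta> + r*ln s) <= exp (\<theta>*rcard M + \<theta>* s*rcard (M Int D))" by simp
 then have "rcard ?S <= exp (\<theta>*rcard M + \<theta>* s*rcard (M Int D))/exp (real (m - card F)*ln \<theta> + r*ln s)"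
  by (simp add: pos_le_divide_eq)
 then show ?thesis by (simp add: exp_diff[symmetric] algebra_simps)
qed

lemma binomial_exp_le:
 assumes "\<theta> > 0"
 shows "real (N choose k) <= exp (\<theta>*real N - real k*ln \<theta>)"
proof -
 have "{G. {} <= G & G <= {..<N} & card G = k & 0 <= rcard ((G - {}) Int {})} = {G. G <= {..<N} & card G = k}" by simp
 then show ?thesis
  using card_between_le[of "{..<N}" \<theta> 1 "{}" k 0 "{}"] assms n_subsets[of "{..<N}" k] by simp
qed

context container begin

definition "cstep = (1 + z) powr (3*2^29*real m)*real Tc^4"

lemma cstep1: "1 <= cstep"
proof -
 have "1 <= (1 + z) powr (3*2^29*real m)" using z0 by (simp add: ge_one_powr_ge_zero)
 moreover have "1 <= real Tc^4" using Tc1 by (intro one_le_power) simp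
 ultimately show ?thesis unfolding cstep_def using mult_mono[of 1 _ 1 "real Tc^4"] by simp
qed

lemma cK1: "1 <= cK \<xi>"
proof -
 have "1 <= 262144*(24/\<xi> + 1) + 10000" using xi by simp
 then show ?thesis unfolding cK_def by (rule max.coboundedI1)
qed

text \<open>Induction on a bound for the steps still possible. \<open>F\<close> stays arbitrary
  because queries enlarge it within a step.\<close>

lemma iterate:
 assumes term0: "\<And>M F. M <= nsets V 2 ==> F <= nsets V 2 ==> final_state M F ==> cnt M F {} <= z^card F*B0"
 shows "M <= nsets V 2 ==> F <= nsets V 2 ==> rcard M*(1 - 1/(4*cK \<xi>))^k < real n*Xmin ==>
  cnt M F {} <= z^card F*(cstep^k*B0)"
proof (induction k arbitrary: M F)
 case 0
 then have "final_state M F" using n0 by (simp add: final_state_def XX_def divide_less_eq mult.commute)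
 then show ?case using term0 0 by simp
next
 case (Suc k)
 show ?case
 proof (cases "XX M < Xmin")
  case True
  then have "cnt M F {} <= z^card F*B0" using term0 Suc.prems by (simp add: final_state_def)
  also have "... <= z^card F*(cstep^Suc k*B0)"
   using z0 B00 cstep1 mult_right_mono[OF one_le_power[OF cstep1, of "Suc k"] B00] by (intro mult_left_mono) auto
  finally show ?thesis .
 next
  case False
  have r: "0 <= 1 - 1/(4*cK \<xi>)" using cK1 by (simp add: divide_le_eq)
  have "cnt M F {} <= z^card F*((1 + z) powr (3*2^29*real m)*max B0 (real Tc^4*(cstep^k*B0)))"
  proof (rule step)
   show "M <= nsets V 2" "F <= nsets V 2" by (rule Suc.prems)+
   show "Xmin <= XX M" using False by simp
   show "0 <= cstep^k*B0" using cstep1 B00 by simp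
   show "cnt M' F {} <= z^card F*(cstep^k*B0)"
    if "M' <= M" "rcard M' <= (1 - 1/(4*cK \<xi>))*rcard M" "F <= nsets V 2" for M' F
   proof (rule Suc.IH)
    show "M' <= nsets V 2" "F <= nsets V 2" using that Suc.prems by auto
    have "rcard M'*(1 - 1/(4*cK \<xi>))^k <= ((1 - 1/(4*cK \<xi>))*rcard M)*(1 - 1/(4*cK \<xi>))^k"
     using that(2) r by (intro mult_right_mono) auto
    then show "rcard M'*(1 - 1/(4*cK \<xi>))^k < real n*Xmin" using Suc.prems(3) by (simp add: mult_ac)
   qed
   show "cnt M F {} <= z^card F*B0" if "F <= nsets V 2" "final_state M F" for F using term0 that Suc.prems by blast
  qed
  also have "... <= z^card F*(cstep^Suc k*B0)"
  proof (intro mult_left_mono)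
   have T1: "1 <= real Tc^4" using Tc1 by (intro one_le_power) simp
   have "1 <= real Tc^4*cstep^k" using mult_mono[OF T1 one_le_power[OF cstep1, of k]] by simp
   from mult_right_mono[OF this B00] have "max B0 (real Tc^4*(cstep^k*B0)) = real Tc^4*(cstep^k*B0)"
    by (simp add: mult.assoc)
   then show "(1 + z) powr (3*2^29*real m)*max B0 (real Tc^4*(cstep^k*B0)) <= cstep^Suc k*B0"
    by (simp add: cstep_def mult_ac)
  qed (use z0 in simp)
  finally show ?thesis .
 qed
qed

text \<open>Each step removes a share \<open>1/(4*cK \<xi>)\<close> of a container that starts with
  at most n^2 edges, so after \<open>k\<close> steps fewer than \<open>n*Xmin\<close> edges
  remain.\<close>

lemma card_NN_le:
 assumes term0: "\<And>M F. M <= nsets V 2 ==> F <= nsets V 2 ==> final_state M F ==> cnt M F {} <= z^card F*B0"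
  and k: "4*cK \<xi>*ln (real n/Xmin) < real k" and Xm: "Xmin > 0"
 shows "rcard NN <= cstep^k*B0"
proof -
 have "NN = {G\<in>NN. {} <= G & G <= nsets V 2 & G Int {} = {}}" using NN by auto
 then have "rcard NN = cnt (nsets V 2) {} {}" by (simp add: cnt_def)
 also have "... <= z^card ({} :: nat set set)*(cstep^k*B0)"
 proof (rule iterate[OF term0])
  have c: "rcard (nsets V 2) <= real n*real n"
  proof -
   have "card (nsets V 2) <= n*n" using cardV by (auto simp: choose_two intro: order_trans[OF div_le_dividend])
   then show ?thesis by (simp flip: of_nat_mult)
  qed
  have "(1 - 1/(4*cK \<xi>)) <= exp (- (1/(4*cK \<xi>)))" using exp_ge_add_one_self[of "- (1/(4*cK \<xi>))"] by simp
  then have "(1 - 1/(4*cK \<xi>))^k <= exp (- (1/(4*cK \<xi>)))^k"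
   using cK1 by (intro power_mono) (auto simp: divide_le_eq)
  also have "... = exp (- (real k/(4*cK \<xi>)))" by (simp flip: exp_of_nat_mult)
  also have "... < exp (- ln (real n/Xmin))"
  proof -
   have "ln (real n/Xmin) < real k/(4*cK \<xi>)" using k cK1 by (simp add: pos_less_divide_eq mult.commute)
   then show ?thesis by simp
  qed
  also have "... = Xmin/real n" using Xm n0 by (simp add: exp_minus)
  finally have "(1 - 1/(4*cK \<xi>))^k < Xmin/real n" .
  then have "real n*real n*(1 - 1/(4*cK \<xi>))^k < real n*real n*(Xmin/real n)"
   using n0 by (intro mult_strict_left_mono) auto
  also have "... = real n*Xmin" using n0 by simp
  finally have "real n*real n*(1 - 1/(4*cK \<xi>))^k < real n*Xmin" .
  moreover have "rcard (nsets V 2)*(1 - 1/(4*cK \<xi>))^k <= real n*real n*(1 - 1/(4*cK \<xi>))^k"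
   using c cK1 by (intro mult_right_mono) (auto simp: divide_le_eq)
  ultimately show "rcard (nsets V 2)*(1 - 1/(4*cK \<xi>))^k < real n*Xmin" by linarith
 qed auto
 finally show ?thesis by simp
qed

end

section \<open>Stability of the final containers\<close>

lemma edges_within_mono: "finite G ==> F <= G ==> edges_within F A <= edges_within G A"
 unfolding edges_within_def by (intro card_mono) auto

text \<open>A clique with \<open>card F\<close> edges has about \<open>s\<close> vertices. The
  average \<open>F\<close>-degree \<open>q v\<close> inside an out-neighbourhood is at most
  \<open>s\<close>, while small \<open>wt\<close> keeps the mean of \<open>q\<close> close to
  \<open>X\<close>. If \<open>X\<close> is also close to \<open>s\<close>, most out-neighbourhoods
  have about \<open>s\<close> vertices and hold nearly all of \<open>F\<close>; one of them is taken
  as \<open>A\<close>.\<close>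

lemma stability:
 fixes M F :: "nat set set"
 assumes M: "M <= nsets V 2" and F: "F <= nsets V 2" and V: "finite V" "card V = n" "n > 0"
  and xi: "0 < \<xi>" "\<xi> <= 1/10" and wt: "wt V (outn M) F < 4*\<xi>*rcard M"
  and MX: "rcard M = real n*X" and X1: "1 <= \<xi>*X"
 defines "s \<equiv> sqrt (2*rcard F)"
 shows "(1 - 5*\<xi>)*X <= s"
  and "\<And>b. 5*\<xi> <= b^2 ==> 0 < b ==> b <= 1/4 ==> (1 - b^2)* s <= (1 - 5*\<xi>)*X ==>
   \<exists>A\<subseteq>V. real (edges_within F A) >= (1 - 2*b)*rcard F &
     real (edges_within F A) >= (1 - 4*b)*real (card A choose 2) &
     rcard (M Int {e. e <= V - A}) <= 7*b*(real n* s)"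
proof -
 have X0: "X > 0" using X1 xi by (smt (verit) mult_nonneg_nonpos)
 have fV: "finite Y" if "Y <= V" for Y using that V(1) finite_subset by blast
 have fF: "finite F" using F V(1) by (meson finite_imp_finite_nsets finite_subset)
 define od where "od v = rcard (outn M v)" for v
 define E where "E Y = real (edges_within F Y)" for Y
 have oV: "outn M v <= V" for v by (rule outn_sub(1)[OF M])
 have Ef: "E Y <= rcard F" for Y
  unfolding E_def edges_within_def using fF by (intro of_nat_mono card_mono) auto
 have s2: "s^2 = 2*rcard F" and s0: "s >= 0" by (simp_all add: s_def)
 have pairs: "rcard Y^2 = rcard Y + 2*E Y + rcard (nonF F Y)" if Y: "Y <= V" for Y
 proof -
  have fy: "finite Y" using fV[OF Y] .
  let ?P = "{(x, y) \<in> Y \<times> Y. {x, y} \<in> {e\<in>F. e <= Y}}"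
  have "Y \<times> Y = (%x. (x, x)) ` Y Un (?P Un nonF F Y)"
   using edge_in(3)[OF F] by (auto simp: nonF_def)
  moreover have "card ((%x. (x, x)) ` Y Un (?P Un nonF F Y)) = card ((%x. (x, x)) ` Y) + card (?P Un nonF F Y)"
   using fy edge_in(3)[OF F] by (intro card_Un_disjoint) (auto simp: nonF_def intro: finite_subset[of _ "Y \<times> Y"])
  moreover have "card (?P Un nonF F Y) = card ?P + card (nonF F Y)"
   using fy by (intro card_Un_disjoint finite_nonF) (auto simp: nonF_def intro: finite_subset[of _ "Y \<times> Y"])
  moreover have "card ((%x. (x, x)) ` Y) = card Y" by (rule card_image) (auto simp: inj_on_def)
  moreover have "card ?P = 2*card {e\<in>F. e <= Y}"
  proof -
   let ?Fy = "{e\<in>F. e <= Y}"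
   have sub: "?Fy <= nsets V 2" using F by auto
   have "dire ?Fy = (%(x, y). [x, y]) ` ?P" by (auto simp: dire_def image_iff)
   moreover have "card ((%(x, y). [x, y]) ` ?P) = card ?P" by (rule card_image) (auto simp: inj_on_def)
   ultimately show ?thesis using finite_card_dire(2)[OF sub] fF by simp
  qed
  ultimately have "card (Y \<times> Y) = card Y + (2*card {e\<in>F. e <= Y} + card (nonF F Y))" by presburger
  then have "real (card Y*card Y) = real (card Y + (2*card {e\<in>F. e <= Y} + card (nonF F Y)))"
   by (simp only: card_cartesian_product)
  then show ?thesis by (simp add: E_def edges_within_def power2_eq_square)
 qed
 have Eo: "2*E Y <= rcard Y^2" if "Y <= V" for Y using pairs[OF that] by simp
 define q where "q v = 2*E (outn M v)/od v" for v
 have o0: "od v >= 0" for v by (simp add: od_def)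
 have E0: "E Y >= 0" for Y by (simp add: E_def)
 have qs: "q v <= s" for v
 proof (cases "od v = 0")
  case False
  then have op: "od v > 0" using o0[of v] by simp
  \<comment> \<open>The product of two bounds for \<open>2*E\<close>: by twice all of
    \<open>F\<close>, which is \<open>s^2\<close>, and by the squared size of the set.\<close>
  have "(2*E (outn M v))^2 <= s^2*(od v)^2"
  proof -
   have "2*E (outn M v)*(2*E (outn M v)) <= s^2*(od v)^2"
    using Ef Eo[OF oV] E0 unfolding s2 od_def by (intro mult_mono) auto
   then show ?thesis by (simp add: power2_eq_square)
  qed
  then have "(2*E (outn M v))^2 <= (s* od v)^2" by (simp add: power_mult_distrib)
  then have "2*E (outn M v) <= s* od v" using s0 op by (meson mult_nonneg_nonneg less_imp_le power2_le_imp_le)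
  then show ?thesis using op by (simp add: q_def divide_le_eq)
 qed (use s0 in \<open>simp add: q_def\<close>)
 have so: "(\<Sum>v\<in>V. od v) = real n*X"
 proof -
  have "(\<Sum>v\<in>V. od v) = real (\<Sum>v\<in>V. card (outn M v))" by (simp add: od_def)
  then show ?thesis by (simp only: sum_outn[OF M V(1)] MX)
 qed
 have qsum: "(1 - 5*\<xi>)*(real n*X) <= (\<Sum>v\<in>V. q v)"
 proof -
  have "od v - 1 - rcard (nonF F (outn M v))/od v <= q v" if "v \<in> V" for v
  proof (cases "od v = 0")
   case False
   then have op: "od v > 0" using o0[of v] by simp
   have "od v * od v = od v + 2*E (outn M v) + rcard (nonF F (outn M v))"
    using pairs[OF oV, of v] by (simp add: od_def power2_eq_square)
   then show ?thesis using op by (simp add: q_def field_simps)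
  qed (simp add: q_def)
  then have "(\<Sum>v\<in>V. od v - 1 - rcard (nonF F (outn M v))/od v) <= (\<Sum>v\<in>V. q v)" by (rule sum_mono)
  moreover have "(\<Sum>v\<in>V. od v - 1 - rcard (nonF F (outn M v))/od v) = real n*X - real n - wt V (outn M) F"
   unfolding sum_subtractf so wt_def using V(2) by (simp add: od_def)
  moreover have "real n*1 <= real n*(\<xi>*X)" using X1 by (intro mult_left_mono) auto
  ultimately show ?thesis using wt MX by (simp add: algebra_simps)
 qed
 also have "(\<Sum>v\<in>V. q v) <= (\<Sum>v\<in>V. s)" by (intro sum_mono qs)
 finally have "real n*((1 - 5*\<xi>)*X) <= real n* s" by (simp add: V mult_ac)
 then show up: "(1 - 5*\<xi>)*X <= s" using V(3) by simp
 have xi2: "1 - 5*\<xi> >= 1/2" using xi by simp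
 have spos: "s > 0"
 proof -
  have "0 < (1 - 5*\<xi>)*X" using X0 xi2 by (intro mult_pos_pos) auto
  then show ?thesis using up by linarith
 qed
 fix b :: real assume b: "5*\<xi> <= b^2" "0 < b" "b <= 1/4" and lo: "(1 - b^2)* s <= (1 - 5*\<xi>)*X"
 \<comment> \<open>The total deficit of \<open>q\<close> against \<open>s\<close> is at most
   \<open>b^2*n*s\<close>, so at most a share \<open>b\<close> of the vertices falls short by more
   than \<open>b*s\<close>.\<close>
 define bad where "bad = {v\<in>V. q v < (1 - b)* s}"
 have fbad: "finite bad" "bad <= V" using V(1) by (auto simp: bad_def)
 have cbad: "rcard bad <= b*real n"
 proof -
  have "(\<Sum>v\<in>V. q v) <= (\<Sum>v\<in>V. s - (if v \<in> bad then b* s else 0))"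
  proof (rule sum_mono)
   fix v assume "v \<in> V"
   then show "q v <= s - (if v \<in> bad then b* s else 0)" using qs[of v] by (auto simp: bad_def algebra_simps)
  qed
  also have "... = real n* s - rcard bad*(b* s)"
   using V fbad by (simp add: sum_subtractf sum.If_cases Int_absorb1)
  finally have "(1 - 5*\<xi>)*(real n*X) <= real n* s - rcard bad*(b* s)" using qsum by linarith
  moreover have "real n*((1 - b^2)* s) <= real n*((1 - 5*\<xi>)*X)" using lo by (intro mult_left_mono) auto
  ultimately have "rcard bad*(b* s) <= b*real n*(b* s)" by (simp add: algebra_simps power2_eq_square)
  then show ?thesis using b spos by (simp add: mult.commute)
 qed
 have good: "od v > 0 & (1 - b)* od v <= s & (1 - 2*b)*rcard F <= E (outn M v)" if v: "v \<in> V - bad" for v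
 proof -
  have qv: "(1 - b)* s <= q v" using v by (auto simp: bad_def)
  moreover have "0 < (1 - b)* s" using b spos by (intro mult_pos_pos) auto
  ultimately have "q v > 0" by linarith
  then have op: "od v > 0" using o0[of v] by (auto simp: q_def zero_less_divide_iff)
  have 1: "(1 - b)* s* od v <= 2*E (outn M v)" using qv op by (simp add: q_def le_divide_eq)
  have "(1 - b)* s* od v <= s* s" using 1 Ef[of "outn M v"] s2 by (simp add: power2_eq_square)
  then have a: "(1 - b)* od v <= s" using spos by (simp add: mult_ac)
  have "(1 - b)* s* od v <= od v * od v" using 1 Eo[OF oV, of v] by (simp add: od_def power2_eq_square)
  then have "(1 - b)* s <= od v" using op by simp
  then have "(1 - b)* s*((1 - b)* s) <= (1 - b)* s* od v" using b spos by (intro mult_left_mono) auto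
  then have "(1 - b)*(1 - b)*(s* s) <= 2*E (outn M v)" using 1 by (simp add: mult_ac)
  moreover have "(1 - 2*b)*(s* s) <= (1 - b)*(1 - b)*(s* s)"
   by (intro mult_right_mono) (auto simp: algebra_simps)
  ultimately show ?thesis using a op s2 by (simp add: power2_eq_square)
 qed
 have "V - bad ~= {}"
 proof
  assume "V - bad = {}"
  then have "rcard V <= rcard bad" using fbad by (simp add: card_mono)
  moreover have "b*real n <= 1/4*real n" using b by (intro mult_right_mono) auto
  ultimately show False using cbad V by linarith
 qed
 then obtain v0 where v0: "v0 \<in> V - bad" by blast
 define A where "A = outn M v0"
 have AV: "A <= V" using oV by (simp add: A_def)
 have gA: "od v0 > 0" "(1 - b)* od v0 <= s" "(1 - 2*b)*rcard F <= E A" using good[OF v0] by (auto simp: A_def)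
 \<comment> \<open>Both sets hold nearly all of \<open>F\<close>, hence so does their intersection,
   which must then have nearly \<open>s\<close> vertices.\<close>
 have inter: "(1 - 4*b)* s <= rcard (outn M v Int A)" if v: "v \<in> V - bad" for v
 proof -
  have "edges_within F (outn M v) + edges_within F A <= card F + edges_within F (outn M v Int A)"
  proof -
   have "card {e\<in>F. e <= outn M v} + card {e\<in>F. e <= A} = card ({e\<in>F. e <= outn M v} Un {e\<in>F. e <= A}) + card ({e\<in>F. e <= outn M v} Int {e\<in>F. e <= A})"
    using fF by (intro card_Un_Int) auto
   also have "... <= card F + card {e\<in>F. e <= outn M v Int A}"
    using fF by (intro add_mono card_mono) auto
   finally show ?thesis by (simp add: edges_within_def)
  qed
  then have "E (outn M v) + E A <= rcard F + E (outn M v Int A)" unfolding E_def by linarith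
  then have "(1 - 4*b)*rcard F <= E (outn M v Int A)" using good[OF v] gA(3) by (simp add: algebra_simps)
  then have "(1 - 4*b)* s^2 <= (rcard (outn M v Int A))^2" using Eo[OF le_infI2[OF AV, of "outn M v"]] unfolding s2 by linarith
  moreover have "((1 - 4*b)* s)^2 <= (1 - 4*b)* s^2"
  proof -
   have "(1 - 4*b)*(1 - 4*b) <= 1 - 4*b" using b mult_left_le[of "1 - 4*b" "1 - 4*b"] by auto
   then have "(1 - 4*b)*(1 - 4*b)* s^2 <= (1 - 4*b)* s^2" by (rule mult_right_mono) simp
   then show ?thesis unfolding power_mult_distrib by (simp only: power2_eq_square)
  qed
  ultimately show ?thesis by (meson order_trans of_nat_0_le_iff power2_le_imp_le)
 qed
 have "rcard (M Int {e. e <= V - A}) <= 7*b*(real n* s)"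
 proof -
  have "M Int {e. e <= V - A} <= (%(v, x). {v, x}) ` (SIGMA v:V. outn M v - A)"
  proof
   fix e assume e: "e \<in> M Int {e. e <= V - A}"
   then have "card e = 2" using M by (auto simp: nsets_def)
   then obtain x y where xy: "e = {x, y}" by (auto simp: card_2_iff)
   have "y \<in> outn M x \<or> x \<in> outn M y" using e edge_in(3)[OF M, of x y] xy by (auto simp: outn_def insert_commute)
   then show "e \<in> (%(v, x). {v, x}) ` (SIGMA v:V. outn M v - A)"
    using e xy by (force simp: image_iff insert_commute)
  qed
  then have "card (M Int {e. e <= V - A}) <= card (SIGMA v:V. outn M v - A)"
   using V(1) fV[OF oV] by (intro surj_card_le) auto
  also have "... = (\<Sum>v\<in>V. card (outn M v - A))" using V(1) fV[OF oV] by simp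
  finally have "rcard (M Int {e. e <= V - A}) <= real (\<Sum>v\<in>V. card (outn M v - A))" by (simp only: of_nat_le_iff)
  also have "... <= (\<Sum>v\<in>V. od v - (if v \<in> V - bad then (1 - 4*b)* s else 0))"
   unfolding of_nat_sum
  proof (rule sum_mono)
   fix v assume v: "v \<in> V"
   have "card (outn M v - A) = card (outn M v) - card (outn M v Int A)"
    using fV[OF oV] by (simp add: card_Diff_subset_Int)
   moreover have "card (outn M v Int A) <= card (outn M v)" using fV[OF oV] by (intro card_mono) auto
   ultimately have "rcard (outn M v - A) = od v - rcard (outn M v Int A)" by (simp add: od_def of_nat_diff)
   then show "rcard (outn M v - A) <= od v - (if v \<in> V - bad then (1 - 4*b)* s else 0)"
    using inter[of v] by auto
  qed
  also have "... = real n*X - rcard (V - bad)*((1 - 4*b)* s)"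
  proof -
   have "V Int {v. v ~: bad} = V - bad" "V Int {v \<in> V. v ~: bad} = V - bad" by auto
   then show ?thesis using V by (simp add: sum_subtractf so sum.If_cases)
  qed
  also have "rcard (V - bad) = real n - rcard bad"
   using fbad V card_mono[OF V(1) fbad(2)] by (simp add: card_Diff_subset of_nat_diff)
  also have "real n*X - (real n - rcard bad)*((1 - 4*b)* s) <= real n*((1 + 2*b^2)* s) - (real n - b*real n)*((1 - 4*b)* s)"
  proof (intro diff_mono mult_left_mono mult_right_mono)
   have "X <= (1 + 2*b^2)*((1 - 5*\<xi>)*X)"
   proof -
    have "(1 + 2*(5*\<xi>))*(1 - 5*\<xi>) >= 1"
     using xi mult_nonneg_nonneg[of "5*\<xi>" "1 - 10*\<xi>"] by (simp add: algebra_simps)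
    moreover have "(1 + 2*(5*\<xi>))*(1 - 5*\<xi>) <= (1 + 2*b^2)*(1 - 5*\<xi>)"
     using b xi2 by (intro mult_right_mono) auto
    ultimately have "1*X <= (1 + 2*b^2)*(1 - 5*\<xi>)*X" using X0 by (intro mult_right_mono) auto
    then show ?thesis by (simp add: mult.assoc)
   qed
   also have "... <= (1 + 2*b^2)* s" using up by (intro mult_left_mono) auto
   finally show "X <= (1 + 2*b^2)* s" .
  qed (use cbad b s0 in auto)
  also have "... = (5*b - 2*b^2)*(real n* s)" by (simp add: algebra_simps power2_eq_square)
  also have "... <= 7*b*(real n* s)"
  proof (rule mult_right_mono)
   show "5*b - 2*b^2 <= 7*b" using b zero_le_power2[of b] by linarith
  qed (use s0 in simp)
  finally show ?thesis .
 qed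
 moreover have "(1 - 4*b)*real (card A choose 2) <= E A"
 proof -
  have "real (card A choose 2) <= (od v0)^2/2"
  proof -
   show ?thesis using choose_two_le[of "card A"] by (simp add: od_def A_def)
  qed
  then have "(1 - 4*b)*real (card A choose 2) <= (1 - 4*b)*((od v0)^2/2)" using b by (intro mult_left_mono) auto
  also have "... <= (1 - 2*b)*((1 - b)^2*(od v0)^2/2)"
  proof -
   have "1 - 4*b <= (1 - 2*b)*(1 - b)^2"
   proof -
    have "(1 - 2*b)*(1 - b)^2 = 1 - 4*b + b^2*(5 - 2*b)" by (simp add: power2_eq_square algebra_simps)
    moreover have "b^2*(5 - 2*b) >= 0" using b by simp
    ultimately show ?thesis by linarith
   qed
   from mult_right_mono[OF this, of "(od v0)^2/2"] show ?thesis by (simp add: mult_ac)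
  qed
  also have "... <= (1 - 2*b)*(s^2/2)"
  proof -
   have "((1 - b)* od v0)^2 <= s^2" using gA b o0[of v0] by (intro power_mono) auto
   then show ?thesis using b by (intro mult_left_mono) (auto simp: power_mult_distrib)
  qed
  also have "... <= E A" using gA(3) s2 by simp
  finally show ?thesis .
 qed
 ultimately show "\<exists>A\<subseteq>V. real (edges_within F A) >= (1 - 2*b)*rcard F &
     real (edges_within F A) >= (1 - 4*b)*real (card A choose 2) &
     rcard (M Int {e. e <= V - A}) <= 7*b*(real n* s)"
  using AV gA(3) unfolding E_def by blast
qed

section \<open>Lower bound by split graphs\<close>

lemma fact_exp_le: "k >= 1 ==> fact k*exp (real k) <= exp 1*real k*real k^k"
proof (induction k rule: nat_induct_at_least)
 case (Suc k)
 have k: "real k > 0" using Suc by simp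
 have e: "exp 1*real k^Suc k <= real (Suc k)^Suc k"
 proof -
  have "1/real (Suc k) <= ln (1 + 1/real k)"
  proof -
   have "ln (real k/real (Suc k)) <= real k/real (Suc k) - 1" using k by (intro ln_le_minus_one) simp
   also have "... = - (1/real (Suc k))" using k by (simp add: field_simps)
   finally have "1/real (Suc k) <= - ln (real k/real (Suc k))" by simp
   also have "... = ln (real (Suc k)/real k)" using k by (simp add: ln_div)
   also have "real (Suc k)/real k = 1 + 1/real k" using k by (simp add: field_simps)
   finally show ?thesis .
  qed
  then have "1 <= real (Suc k)*ln (1 + 1/real k)" using k by (simp add: field_simps)
  then have "exp 1 <= exp (real (Suc k)*ln (1 + 1/real k))" by simp
  also have "... = (1 + 1/real k)^Suc k" using k by (subst exp_of_nat_mult) (simp add: add_pos_pos)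
  finally have "exp 1*real k^Suc k <= (1 + 1/real k)^Suc k*real k^Suc k" by (intro mult_right_mono) auto
  also have "... = real (Suc k)^Suc k" using k by (simp add: power_mult_distrib[symmetric] field_simps del: power_Suc)
  finally show ?thesis .
 qed
 have "fact (Suc k)*exp (real (Suc k)) = (real (Suc k)*exp 1)*(fact k*exp (real k))"
  by (simp add: exp_add algebra_simps)
 also have "... <= (real (Suc k)*exp 1)*(exp 1*real k*real k^k)" by (intro mult_left_mono Suc.IH) auto
 also have "... = real (Suc k)*exp 1*(exp 1*real k^Suc k)" by simp
 also have "... <= real (Suc k)*exp 1*real (Suc k)^Suc k" by (intro mult_left_mono e) auto
 finally show ?case by (simp only: mult_ac)
qed simp

lemma diff_pow_le_binomial_fact: "(N - k)^k <= (N choose k)*fact k"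
proof (induction k)
 case (Suc k)
 have "(N - Suc k)^Suc k <= (N - k)*(N - k)^k" by (simp add: mult_mono power_mono)
 also have "... <= (N - k)*((N choose k)*fact k)" by (intro mult_left_mono Suc.IH) simp
 also have "... = ((N - k)*(N choose k))*fact k" by simp
 also have "(N - k)*(N choose k) = Suc k*(N choose Suc k)"
  by (metis binomial_absorb_comp binomial_absorption)
 finally show ?case by (simp only: fact_Suc of_nat_id mult_ac)
qed simp

text \<open>A crude form of Stirling suffices: the lost factor of order \<open>k\<close> only costs
  \<open>1 + ln k\<close> in an exponent of order \<open>k\<close>.\<close>

lemma binomial_exp_ge:
 assumes k: "1 <= k" "k < N"
 shows "exp (real k*(1 + ln ((real N - real k)/real k)) - 1 - ln (real k)) <= real (N choose k)"
proof -
 have k0: "real k > 0" "real N - real k > 0" using k by auto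
 have "(real N - real k)^k <= real (N choose k)*fact k"
 proof -
  have "real ((N - k)^k) <= real ((N choose k)*fact k)" using diff_pow_le_binomial_fact by (simp only: of_nat_le_iff)
  then show ?thesis using k by (simp add: of_nat_diff)
 qed
 then have "(real N - real k)^k*exp (real k) <= real (N choose k)*(fact k*exp (real k))"
  by (simp add: mult_right_mono flip: mult.assoc)
 also have "... <= real (N choose k)*(exp 1*real k*real k^k)" by (intro mult_left_mono fact_exp_le k) auto
 finally have "(real N - real k)^k*exp (real k)/(exp 1*real k*real k^k) <= real (N choose k)"
  using k0 by (simp add: divide_le_eq)
 moreover have "exp (real k*(1 + ln ((real N - real k)/real k)) - 1 - ln (real k)) = (real N - real k)^k*exp (real k)/(exp 1*real k*real k^k)"
 proof -
  have "exp (real k*ln ((real N - real k)/real k)) = ((real N - real k)/real k)^k" using k0 by (simp add: exp_of_nat_mult)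
  then show ?thesis using k0 by (simp add: exp_diff exp_add distrib_left power_divide field_simps)
 qed
 ultimately show ?thesis by simp
qed

text \<open>Opposite corners of an induced 4-cycle are not adjacent, so each diagonal has an end in
  \<open>B\<close>; these two ends are adjacent although \<open>B\<close> is independent.\<close>

lemma split_graph_no_induced_C4:
 assumes AB: "V <= A Un B" and A: "\<And>x y. x \<in> A ==> y \<in> A ==> x ~= y ==> {x, y} \<in> E"
  and B: "\<And>x y. x \<in> B ==> y \<in> B ==> {x, y} ~: E"
 shows "\<not> contains_induced V E C4_verts C4_edges"
proof
 assume "contains_induced V E C4_verts C4_edges"
 then obtain f where f: "inj_on f C4_verts" "f ` C4_verts <= V"
  "\<And>u v. u \<in> C4_verts ==> v \<in> C4_verts ==> u ~= v ==> {u, v} \<in> C4_edges \<longleftrightarrow> {f u, f v} \<in> E"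
  unfolding contains_induced_def by blast
 have v: "0 \<in> C4_verts" "1 \<in> C4_verts" "2 \<in> C4_verts" "3 \<in> C4_verts" by (auto simp: C4_verts_def)
 have ne: "{0, 2} ~: C4_edges" "{1, 3} ~: C4_edges" "{0, 1} \<in> C4_edges" "{1, 2} \<in> C4_edges" "{2, 3} \<in> C4_edges" "{0, 3} \<in> C4_edges"
  by (auto simp: C4_edges_def doubleton_eq_iff)
 have d: "f 0 ~= f 2" "f 1 ~= f 3" using inj_onD[OF f(1)] v by fastforce+
 have "{f 0, f 2} ~: E" "{f 1, f 3} ~: E" "{f 0, f 1} \<in> E" "{f 1, f 2} \<in> E" "{f 2, f 3} \<in> E" "{f 0, f 3} \<in> E"
  using f(3)[OF v(1) v(3)] f(3)[OF v(2) v(4)] f(3)[OF v(1) v(2)] f(3)[OF v(2) v(3)] f(3)[OF v(3) v(4)] f(3)[OF v(1) v(4)] ne by auto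
 moreover have "f 0 \<in> A Un B" "f 1 \<in> A Un B" "f 2 \<in> A Un B" "f 3 \<in> A Un B" using f(2) v AB by auto
 moreover have "f 0 \<in> B \<or> f 2 \<in> B" using calculation A d by blast
 moreover have "f 1 \<in> B \<or> f 3 \<in> B" using calculation A d by blast
 moreover have "{f 2, f 1} \<in> E" using \<open>{f 1, f 2} \<in> E\<close> by (simp add: insert_commute)
 ultimately show False using B by blast
qed

lemma finite_induced_C4_free: "finite (\<G> n m)"
proof (rule finite_subset)
 show "\<G> n m <= Pow (nsets {1..n} 2)" by (auto simp: induced_C4_free_graphs_def)
 show "finite (Pow (nsets {1..n} 2))" by (simp add: finite_imp_finite_nsets)
qed

lemma card_split_graphs:
 assumes a: "a <= n" and m: "a choose 2 <= m"
 shows "(a*(n - a)) choose (m - (a choose 2)) <= card (\<G> n m)"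
proof -
 define A where "A = {1..a}"
 define B where "B = {a + 1..n}"
 define W where "W = (%(x, y). {x, y}) ` (A \<times> B)"
 have AB: "{1..n} <= A Un B" "A Int B = {}" "A <= {1..n}" "B <= {1..n}" using a by (auto simp: A_def B_def)
 have cW: "card W = a*(n - a)"
 proof -
  have "inj_on (%(x, y). {x, y}) (A \<times> B)" using AB(2) by (auto simp: inj_on_def doubleton_eq_iff)
  then have "card W = card (A \<times> B)" unfolding W_def by (rule card_image)
  then show ?thesis by (simp add: A_def B_def card_cartesian_product)
 qed
 have fW: "finite W" by (simp add: W_def A_def B_def)
 have fA: "finite (nsets A 2)" by (simp add: A_def finite_imp_finite_nsets)
 have cA: "card (nsets A 2) = a choose 2" by (simp add: A_def)
 have WB: "\<not> (e <= A)" "\<not> e <= B" "e \<in> nsets {1..n} 2" if "e \<in> W" for e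
 proof -
  obtain x y where xy: "e = {x, y}" "x \<in> A" "y \<in> B" using \<open>e \<in> W\<close> by (auto simp: W_def)
  then have "x ~= y" "x ~: B" "y ~: A" using AB(2) by auto
  then show "\<not> (e <= A)" "\<not> e <= B" "e \<in> nsets {1..n} 2" using xy AB by (auto simp: nsets_def)
 qed
 have dis: "nsets A 2 Int W = {}" using WB by (auto simp: nsets_def)
 let ?S = "{S. S <= W & card S = m - (a choose 2)}"
 have "card ?S = (a*(n - a)) choose (m - (a choose 2))" using n_subsets[OF fW] cW by simp
 moreover have "card ?S <= card (\<G> n m)"
 proof (rule card_inj_on_le[OF _ _ finite_induced_C4_free])
  show "inj_on (%S. nsets A 2 Un S) ?S"
   unfolding inj_on_def using dis by blast
  show "(%S. nsets A 2 Un S) ` ?S <= \<G> n m"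
  proof
   fix E assume "E \<in> (%S. nsets A 2 Un S) ` ?S"
   then obtain S where S: "E = nsets A 2 Un S" "S <= W" "card S = m - (a choose 2)" by blast
   have "finite S" "nsets A 2 Int S = {}" using S(2) fW dis finite_subset by auto
   then have "card E = m" using S(1,3) fA cA m by (simp add: card_Un_disjoint)
   moreover have "E <= nsets {1..n} 2" using S WB(3) nsets_mono[OF AB(3)] by blast
   moreover have "\<not> contains_induced {1..n} E C4_verts C4_edges"
   proof (rule split_graph_no_induced_C4[OF AB(1)])
    show "{x, y} \<in> E" if "x \<in> A" "y \<in> A" "x ~= y" for x y using that S(1) by (auto simp: nsets_def)
    show "{x, y} ~: E" if "x \<in> B" "y \<in> B" for x y
    proof
     assume "{x, y} \<in> E"
     moreover have "{x, y} ~: nsets A 2" using that AB(2) by (auto simp: nsets_def)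
     ultimately have "{x, y} \<in> W" using S by blast
     then show False using WB(2)[of "{x, y}"] that by blast
    qed
   qed
   ultimately show "E \<in> \<G> n m" by (simp add: induced_C4_free_graphs_def)
  qed
 qed
 ultimately show ?thesis by simp
qed

text \<open>Cliques of order about \<open>r\<close> balance two effects: a larger clique spends
  edges on itself, a smaller one leaves fewer free pairs, about \<open>r*n\<close>. The clique uses
  about m/(2 \<Lambda>) edges, each worth about \<Lambda> in the exponent; this turns the summand 1
  of the binomial estimate into 1/2.\<close>

lemma card_induced_C4_free_ge:
 fixes n m :: nat
 defines "\<Lambda> \<equiv> ln (real n/sqrt (real m))"
 defines "r \<equiv> sqrt (real m/\<Lambda>)"
 assumes n: "n > 0" and m: "m > 0" and L1: "1 <= \<Lambda>" and eta: "0 < \<eta>" "\<eta> <= 1/2"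
  and small: "1/r + r/real n + real m/(real n*r) <= \<eta>" and L2: "1/(2*\<Lambda>) <= \<eta>"
  and lm: "1 + ln (real m) <= \<eta>*real m"
 shows "exp (real m*(\<Lambda> - ln \<Lambda>/2 + 1/2 - 4*\<eta>)) <= rcard (\<G> n m)"
proof -
 have r0: "r > 0" using m L1 by (simp add: r_def)
 have r2: "r^2 = real m/\<Lambda>" using L1 by (simp add: r_def)
 have p: "0 < 1/r" "0 < r/real n" "0 < real m/(real n*r)" using r0 n m by auto
 have s1: "1/r <= \<eta>" "r/real n <= \<eta>" using p small by linarith+
 have r1: "2 <= r"
 proof -
  have "1/r <= 1/2" using s1 eta by linarith
  then show ?thesis using r0 by (simp add: field_simps)
 qed
 have rn: "r <= real n/2"
 proof -
  have "r/real n <= 1/2" using s1 eta by linarith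
  then show ?thesis using n by (simp add: field_simps)
 qed
 define a where "a = nat \<lfloor>r\<rfloor>"
 have a: "real a <= r" "r - 1 <= real a" using r0 unfolding a_def by linarith+
 have an: "a <= n" using a rn n by linarith
 define N where "N = a*(n - a)"
 define k where "k = m - (a choose 2)"
 have ca: "real (a choose 2) <= real m/(2*\<Lambda>)"
 proof -
  have "real (a choose 2) <= (real a)^2/2" by (rule choose_two_le)
  also have "... <= r^2/2" using a r0 by (intro divide_right_mono power_mono) auto
  finally show ?thesis by (simp add: r2)
 qed
 have "real m/(2*\<Lambda>) <= \<eta>*real m" using mult_right_mono[OF L2, of "real m"] by simp
 also have "\<eta>*real m < real m" using eta m by simp
 finally have cm: "a choose 2 < m" using ca by linarith
 have k: "1 <= k" "k <= m" "real k >= real m*(1 - 1/(2*\<Lambda>))"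
  using cm ca by (auto simp: k_def of_nat_diff algebra_simps)
 have Nm: "real N - real m >= real n*r*(1 - \<eta>)"
 proof -
  have "real N = real a*(real n - real a)" using an by (simp add: N_def of_nat_diff)
  also have "... >= (r - 1)*(real n - r)" using a rn r1 n by (intro mult_mono) auto
  finally have "real N >= real n*r - r^2 - real n + r" by (simp add: algebra_simps power2_eq_square)
  then have "real N - real m >= real n*r - r^2 - real n - real m" using r0 by linarith
  moreover have "real n*r*(1/r + r/real n + real m/(real n*r)) = real n + r^2 + real m"
   using r0 n by (simp add: field_simps power2_eq_square)
  moreover have "real n*r*(1/r + r/real n + real m/(real n*r)) <= real n*r*\<eta>"
   using small r0 n by (intro mult_left_mono) auto
  ultimately show ?thesis by (simp add: algebra_simps)
 qed
 have nr: "real n*r*(1 - \<eta>) > 0" using n r0 eta by simp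
 then have kN: "k < N" using Nm k by linarith
 define Q where "Q = 1 + \<Lambda> - ln \<Lambda>/2 - 2*\<eta>"
 have lnL: "0 <= ln \<Lambda>" "ln \<Lambda> <= \<Lambda> - 1" using L1 by (auto intro: ln_le_minus_one)
 have Q0: "Q >= 0" using lnL eta by (simp add: Q_def)
 have lnq: "Q <= 1 + ln ((real N - real k)/real k)"
 proof -
  have sm: "sqrt (real m) > 0" "sqrt (real m)* sqrt (real m) = real m" using m by auto
  have "real n*r/real m = real n/sqrt (real m)/sqrt \<Lambda>"
   using sm L1 by (simp add: r_def real_sqrt_divide field_simps)
  then have "ln (real n*r/real m) = ln (real n/sqrt (real m)) - ln (sqrt \<Lambda>)"
   using n sm(1) L1 ln_div[of "real n/sqrt (real m)" "sqrt \<Lambda>"] by simp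
  then have 1: "ln (real n*r/real m) = \<Lambda> - ln \<Lambda>/2" using L1 by (simp add: ln_sqrt \<Lambda>_def)
  have "- 2*\<eta> <= ln (1 - \<eta>)"
  proof -
   have "ln (1/(1 - \<eta>)) <= 1/(1 - \<eta>) - 1" using eta by (intro ln_le_minus_one) auto
   also have "... = \<eta>/(1 - \<eta>)" using eta by (simp add: field_simps)
   also have "... <= \<eta>/(1/2)" using eta by (intro divide_left_mono) auto
   finally show ?thesis using eta by (simp add: ln_div)
  qed
  then have "Q <= 1 + (ln (real n*r/real m) + ln (1 - \<eta>))" using 1 by (simp add: Q_def)
  also have "ln (real n*r/real m) + ln (1 - \<eta>) = ln (real n*r*(1 - \<eta>)/real m)"
  proof -
   have "real n*r*(1 - \<eta>)/real m = real n*r/real m*(1 - \<eta>)" by simp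
   then show ?thesis using n r0 m eta ln_mult_pos[of "real n*r/real m" "1 - \<eta>"] by simp
  qed
  also have "... <= ln ((real N - real k)/real k)"
  proof -
   have "real n*r*(1 - \<eta>)/real m <= (real N - real k)/real k"
    using Nm nr k m by (intro frac_le) auto
   then show ?thesis using nr m by (simp add: ln_mono)
  qed
  finally show ?thesis by simp
 qed
 have "real m*(\<Lambda> - ln \<Lambda>/2 + 1/2 - 4*\<eta>) <= real k*Q - \<eta>*real m"
 proof -
  have "Q/(2*\<Lambda>) <= (1 + \<Lambda>)/(2*\<Lambda>)"
  proof (rule divide_right_mono)
   show "Q <= 1 + \<Lambda>" unfolding Q_def using lnL(1) eta by linarith
  qed (use L1 in simp)
  also have "... = 1/2 + 1/(2*\<Lambda>)" using L1 by (simp add: field_simps)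
  also have "... <= 1/2 + \<eta>" using L2 by simp
  finally have "real m*(Q - (1/2 + \<eta>)) <= real m*(Q - Q/(2*\<Lambda>))" by (intro mult_left_mono) auto
  also have "... = real m*(1 - 1/(2*\<Lambda>))*Q" by (simp add: algebra_simps)
  also have "... <= real k*Q" using k Q0 by (intro mult_right_mono) auto
  finally show ?thesis by (simp add: Q_def algebra_simps)
 qed
 also have "... <= real k*(1 + ln ((real N - real k)/real k)) - 1 - ln (real k)"
 proof -
  have "real k*Q <= real k*(1 + ln ((real N - real k)/real k))" using lnq by (intro mult_left_mono) auto
  moreover have "ln (real k) <= ln (real m)" using k by simp
  ultimately show ?thesis using lm by linarith
 qed
 finally have "exp (real m*(\<Lambda> - ln \<Lambda>/2 + 1/2 - 4*\<eta>)) <= exp (real k*(1 + ln ((real N - real k)/real k)) - 1 - ln (real k))" by simp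
 also have "... <= real (N choose k)" by (rule binomial_exp_ge[OF k(1) kN])
 also have "... <= rcard (\<G> n m)"
  using card_split_graphs[OF an less_imp_le[OF cm]] unfolding N_def k_def by (simp only: of_nat_le_iff)
 finally show ?thesis .
qed

section \<open>Numerical conditions and the count of graphs far from split\<close>

lemma admissible_sufficient:
 assumes xi: "0 < \<xi>"
 shows "\<exists>C\<ge>16. \<forall>n m \<kappa> X. 0 < n --> 0 < m --> 0 < \<kappa> --> \<kappa> <= 1 --> C <= X --> C*real m <= real n*X -->
  C*real n^2 <= \<kappa>^2*real m*X --> C*real n^4 <= \<kappa>^4*real m^3 --> C*real n <= \<kappa>*X^2 -->
  admissible \<xi> \<kappa> n m X"
proof -
 define c where "c = cOm \<xi>"
 define d where "d = cQd \<xi>"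
 define e2 where "e2 = cX2 \<xi>"
 define e3 where "e3 = cX3 \<xi>"
 define D1 where "D1 = 2*(cT \<xi>)^2/(cC1 \<xi>)^2"
 define D2 where "D2 = 64*(cT \<xi>)^2/((cC1 \<xi>)^2*e3^2)"
 have pos: "c > 0" "d > 0" "e2 > 0" "e3 > 0" "D1 > 0" "D2 > 0"
  using const_pos[OF xi] by (simp_all add: c_def d_def e2_def e3_def D1_def D2_def)
 \<comment> \<open>The summands are thresholds taken from the clauses of \<open>admissible\<close>,
   with some room to spare.\<close>
 define C where "C = 16 + 2^32/c + 1024/d + 262144/(d*e2^2) + 32768/(e2*d) + 8/(e2*e3) + 4/e3 + D1 + D2"
 have p2: "0 < 2^32/c" "0 < 1024/d" "0 < 262144/(d*e2^2)" "0 < 32768/(e2*d)" "0 < 8/(e2*e3)" "0 < 4/e3"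
  using pos by simp_all
 have C: "16 <= C" "2^32/c <= C" "1024/d <= C" "262144/(d*e2^2) <= C" "32768/(e2*d) <= C" "8/(e2*e3) <= C" "4/e3 <= C" "D1 <= C" "D2 <= C"
  unfolding C_def using p2 pos by linarith+
 have "admissible \<xi> \<kappa> n m X"
  if n0: "0 < n" and m0: "0 < m" and k0: "0 < \<kappa>" "\<kappa> <= 1" and h1: "C <= X" and h2: "C*real m <= real n*X"
   and h3: "C*real n^2 <= \<kappa>^2*real m*X" and h4: "C*real n^4 <= \<kappa>^4*real m^3" and h5: "C*real n <= \<kappa>*X^2"
  for n m \<kappa> X
 proof -
  define N M where "N = real n" and "M = real m"
  have NM: "N > 0" "M > 0" using n0 m0 by (simp_all add: N_def M_def)
  have X0: "X >= 16" using h1 C by linarith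
  have g2: "K*M <= N*X" if "K <= C" for K using order_trans[OF mult_right_mono[OF that] h2] unfolding N_def M_def by simp
  have g3: "K*N^2 <= \<kappa>^2*M*X" if "K <= C" for K using order_trans[OF mult_right_mono[OF that] h3] unfolding N_def M_def by simp
  have g4: "K*N^4 <= \<kappa>^4*M^3" if "K <= C" for K using order_trans[OF mult_right_mono[OF that] h4] unfolding N_def M_def by simp
  have g5: "K*N <= \<kappa>*X^2" if "K <= C" for K using order_trans[OF mult_right_mono[OF that] h5] unfolding N_def M_def by simp
  have kk: "\<kappa>^2 <= \<kappa>" "\<kappa>^4 <= \<kappa>^3" using k0 by (auto simp: power2_eq_square power_decreasing intro: mult_left_le_one_le)
  have X2: "K*N <= X^2" if "K <= C" for K
  proof -
   have "\<kappa>*X^2 <= 1*X^2" using k0 by (intro mult_right_mono) auto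
   then show ?thesis using g5[OF that] by simp
  qed
  have g6: "K*N^3 <= \<kappa>^2*M*X^3" if "K <= C" "0 <= K" for K
  proof -
   have "K*N^3 = (K*N^2)*(1*N)" by (simp add: power2_eq_square power3_eq_cube)
   also have "... <= (\<kappa>^2*M*X)*X^2"
   proof (rule mult_mono)
    show "1*N <= X^2" by (rule X2) (use C in linarith)
   qed (use g3[OF that(1)] NM k0 X0 in auto)
   finally show ?thesis by (simp add: power2_eq_square power3_eq_cube mult_ac)
  qed
  have g7: "K*M <= X^4" if "K <= C" "0 <= K" for K
  proof -
   have "K*M <= N*X" by (rule g2[OF that(1)])
   also have "... <= X^2*X" using X2[of 1] C X0 by (intro mult_right_mono) auto
   also have "... <= X^2*(X*X)" using X0 by (intro mult_left_mono) auto
   finally show ?thesis by (simp add: eval_nat_numeral mult_ac)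
  qed
  define \<theta> where "\<theta> = \<kappa>*M/(8*N*X)"
  define NC where "NC = c*X^4/16"
  define NQ where "NQ = d*(X^5/N)"
  define g where "g = 2*X^2/(e2*N)"
  have t0: "\<theta> > 0" using k0 NM X0 by (simp add: \<theta>_def)
  have k8: "8*N*X > 0" using NM X0 by simp
  have c1: "\<theta> <= 1/64"
  proof -
   have "\<kappa>*M <= 1*M" using k0 NM by (intro mult_right_mono) auto
   then have "8*(\<kappa>*M) <= N*X" using g2[of 8] C by linarith
   then show ?thesis using k8 by (simp add: \<theta>_def divide_le_eq mult.commute)
  qed
  have q3: "512*N^2 <= c*(\<kappa>^2*M*X)" "2147483648*N^2 <= c*(\<kappa>^2*M*X)"
  proof -
   have h: "2^32*N^2 <= c*(\<kappa>^2*M*X)" "N^2 >= 0"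
    using mult_left_mono[OF g3[OF C(2)], of c] pos by simp_all
   show "512*N^2 <= c*(\<kappa>^2*M*X)" by (rule order_trans[OF mult_right_mono h(1)]) auto
   show "2147483648*N^2 <= c*(\<kappa>^2*M*X)" by (rule order_trans[OF mult_right_mono h(1)]) auto
  qed
  have c3: "2*X <= \<theta>*(NC/(2*N*X))"
  proof -
   have "\<theta>*(NC/(2*N*X)) = (c*(\<kappa>*M*X))*X/(256*N^2)"
    using NM X0 by (simp add: \<theta>_def NC_def field_simps power2_eq_square eval_nat_numeral)
   moreover have "c*(\<kappa>^2*M*X) <= c*(\<kappa>*M*X)" using kk pos NM X0 by (intro mult_left_mono mult_right_mono) auto
   with q3(1) have "512*N^2 <= c*(\<kappa>*M*X)" by linarith
   then have "512*N^2*X <= c*(\<kappa>*M*X)*X" using X0 by (intro mult_right_mono) auto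
   then have "2*X <= (c*(\<kappa>*M*X))*X/(256*N^2)" using NM by (simp add: le_divide_eq mult_ac)
   ultimately show ?thesis by simp
  qed
  have q4: "4294967296*N^4 <= c*(\<kappa>^4*M^3)"
   using mult_left_mono[OF g4[OF C(2)], of c] pos by simp
  have c4: "1 <= \<theta>^3*(NC/(2*N*X))"
  proof -
   have e: "\<theta>^3*(NC/(2*N*X)) = c*(\<kappa>^3*M^3)/(16384*N^4)"
    using NM X0 by (simp add: \<theta>_def NC_def field_simps eval_nat_numeral)
   have "c*(\<kappa>^4*M^3) <= c*(\<kappa>^3*M^3)" using pos NM kk by (intro mult_left_mono mult_right_mono) auto
   moreover have "N^4 >= 0" by simp
   ultimately have "16384*N^4 <= c*(\<kappa>^3*M^3)" using q4 by linarith
   then show ?thesis unfolding e using NM by (simp add: le_divide_eq)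
  qed
  have A0: "\<theta>^4*NC > 0" using t0 pos X0 by (simp add: NC_def)
  have c5: "2*M*(2*(64*\<theta>)^4*(NC/(2^28*M) + 1) + 12*(64*\<theta>)^2*(2*X) + 20) < \<theta>^4*NC"
  proof -
   have e: "2*M*(2*(64*\<theta>)^4*(NC/(2^28*M) + 1) + 12*(64*\<theta>)^2*(2*X) + 20)
    = \<theta>^4*NC/4 + \<theta>^4*(2^26*M) + \<theta>^2*(196608*(M*X)) + 40*M"
    using NM by (simp add: field_simps power_mult_distrib)
   have "2^28*M <= NC"
    using mult_left_mono[OF g7[OF C(2)], of c] pos by (simp add: NC_def)
   then have "\<theta>^4*(2^28*M) <= \<theta>^4*NC" using t0 by (intro mult_left_mono) auto
   then have 1: "\<theta>^4*(2^26*M) <= \<theta>^4*NC/4" by simp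
   have "\<theta>^2*NC = c*(\<kappa>^2*M*X)*(M*X)/(1024*N^2)"
    using NM X0 by (simp add: \<theta>_def NC_def field_simps power2_eq_square eval_nat_numeral)
   moreover have "2147483648*N^2*(M*X) <= c*(\<kappa>^2*M*X)*(M*X)" using q3(2) NM X0 by (intro mult_right_mono) auto
   then have "2097152*(M*X) <= c*(\<kappa>^2*M*X)*(M*X)/(1024*N^2)" using NM by (simp add: le_divide_eq mult_ac)
   ultimately have "2097152*(M*X) <= \<theta>^2*NC" by simp
   moreover have "0 <= M*X" using NM X0 by simp
   ultimately have "8*(196608*(M*X)) <= \<theta>^2*NC" by linarith
   then have "\<theta>^2*(8*(196608*(M*X))) <= \<theta>^2*(\<theta>^2*NC)" by (intro mult_left_mono) auto
   moreover have "\<theta>^2*(\<theta>^2*NC) = \<theta>^4*NC" by (simp add: eval_nat_numeral mult_ac)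
   ultimately have 2: "\<theta>^2*(196608*(M*X)) <= \<theta>^4*NC/8" by simp
   have "\<theta>^4*NC = c*(\<kappa>^4*M^3)*M/(65536*N^4)"
    using NM X0 by (simp add: \<theta>_def NC_def field_simps eval_nat_numeral)
   moreover have "4294967296*N^4*M <= c*(\<kappa>^4*M^3)*M" using q4 NM by (intro mult_right_mono) auto
   then have "65536*M <= c*(\<kappa>^4*M^3)*M/(65536*N^4)" using NM by (simp add: le_divide_eq mult_ac)
   ultimately have 3: "40*M <= \<theta>^4*NC/8" using NM by simp
   show ?thesis unfolding e using 1 2 3 A0 by linarith
  qed
  have q6: "1024*N^3 <= d*(\<kappa>^2*M*X^3)"
   using mult_left_mono[OF g6[OF C(3)], of d] pos by simp
  have c6: "1 <= \<theta>*(NQ/(2*N*X))"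
  proof -
   have e: "\<theta>*(NQ/(2*N*X)) = d*(\<kappa>*M*X^3)/(16*N^3)"
    using NM X0 by (simp add: \<theta>_def NQ_def field_simps eval_nat_numeral)
   have "d*(\<kappa>^2*M*X^3) <= d*(\<kappa>*M*X^3)" using pos NM kk X0 by (intro mult_left_mono mult_right_mono) auto
   moreover have "N^3 >= 0" using NM by simp
   ultimately have "16*N^3 <= d*(\<kappa>*M*X^3)" using q6 by linarith
   then show ?thesis unfolding e using NM by (simp add: le_divide_eq)
  qed
  have c7: "4*M*((64*\<theta>)^2*g^2 + 2*(64*\<theta>)*g + 1) < \<theta>\<^sup>2*NQ"
  proof -
   have B0: "\<theta>^2*NQ > 0" using t0 pos NM X0 by (simp add: NQ_def)
   have e: "4*M*((64*\<theta>)^2*g^2 + 2*(64*\<theta>)*g + 1) = 16384*M*(\<theta>^2*g^2) + 512*M*(\<theta>*g) + 4*M"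
    by (simp add: algebra_simps power_mult_distrib)
   have 1: "16384*M*(\<theta>^2*g^2) <= \<theta>^2*NQ/4"
   proof -
    have "262144*M <= d*e2^2*(N*X)"
     using mult_left_mono[OF g2[OF C(4)], of "d*e2^2"] pos by simp
    then have "262144*M*X^4 <= d*e2^2*(N*X)*X^4" using X0 by (intro mult_right_mono) auto
    note h = this
    have "16384*M*g^2 = 262144*M*X^4/(4*(e2^2*N^2))"
     using NM pos by (simp add: g_def field_simps power2_eq_square eval_nat_numeral)
    also have "... <= d*e2^2*(N*X)*X^4/(4*(e2^2*N^2))" using h by (rule divide_right_mono) (use NM pos in simp)
    also have "... = NQ/4"
     using NM pos by (simp add: NQ_def field_simps power2_eq_square eval_nat_numeral)
    finally have "16384*M*g^2 <= NQ/4" .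
    then have "\<theta>^2*(16384*M*g^2) <= \<theta>^2*(NQ/4)" by (intro mult_left_mono) auto
    then show ?thesis by (simp add: mult_ac)
   qed
   have 2: "512*M*(\<theta>*g) <= \<theta>^2*NQ/4"
   proof -
    have "32768*N <= e2*d*(\<kappa>*X^2)"
     using mult_left_mono[OF g5[OF C(5)], of "e2*d"] pos by simp
    then have "32768*N*(M*X^2) <= e2*d*(\<kappa>*X^2)*(M*X^2)" using X0 NM by (intro mult_right_mono) auto
    note h = this
    have "512*M*g = 32768*N*(M*X^2)/(32*e2*N^2)"
     using NM pos by (simp add: g_def field_simps power2_eq_square eval_nat_numeral)
    also have "... <= e2*d*(\<kappa>*X^2)*(M*X^2)/(32*e2*N^2)" using h by (rule divide_right_mono) (use NM pos in simp)
    also have "... = \<theta>*NQ/4"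
     using NM pos X0 by (simp add: NQ_def \<theta>_def field_simps power2_eq_square eval_nat_numeral)
    finally have "512*M*g <= \<theta>*NQ/4" .
    then have "\<theta>*(512*M*g) <= \<theta>*(\<theta>*NQ/4)" using t0 by (intro mult_left_mono) auto
    then show ?thesis by (simp add: mult_ac power2_eq_square)
   qed
   have 3: "4*M <= \<theta>^2*NQ/4"
   proof -
    have "1024*N^3*M <= d*(\<kappa>^2*M*X^3)*M" using q6 NM by (intro mult_right_mono) auto
    moreover have "\<theta>^2*NQ/4 = d*(\<kappa>^2*M*X^3)*M/(256*N^3)"
     using NM X0 by (simp add: NQ_def \<theta>_def field_simps power2_eq_square eval_nat_numeral)
    ultimately show ?thesis using NM by (simp add: le_divide_eq mult_ac)
   qed
   show ?thesis unfolding e using 1 2 3 B0 by linarith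
  qed
  have c8: "2*min M (X^2)/(e2*N) <= e3*X/4"
  proof -
   have "8*M <= e2*e3*(N*X)"
    using mult_left_mono[OF g2[OF C(6)], of "e2*e3"] pos by simp
   then have "8*min M (X^2) <= e2*e3*(N*X)" by linarith
   then show ?thesis using NM pos by (simp add: divide_le_eq mult_ac)
  qed
  have c9: "4 <= e3*X"
  proof -
   have "4/e3 <= X" using C(7) h1 by linarith
   then show ?thesis using pos by (simp add: divide_le_eq mult.commute)
  qed
  show ?thesis
   unfolding admissible_def Let_def c_def[symmetric] d_def[symmetric] e2_def[symmetric] e3_def[symmetric] N_def[symmetric] M_def[symmetric]
    \<theta>_def[symmetric] NC_def[symmetric] NQ_def[symmetric] g_def[symmetric]
   unfolding D1_def[symmetric] D2_def[symmetric]
   using c1 c3 c4 c5 c6 c7 c8 c9 X2[OF C(8)] X2[OF C(9)] X2[of 1] X0 C(1) by simp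
 qed
 then show ?thesis using C(1) by blast
qed

text \<open>\<open>f\<close> stands for \<open>card F\<close> and \<open>exp c* sqrt (2*f)\<close>
  for the average out-degree of the container. The estimate \<open>ln t <= t - 1\<close> is applied
  with t = 2 (f/m) \<Lambda> (1 - \<eta>), so it is tight near f = m/(2 \<Lambda>), the clique of
  the typical split graphs. Hence the exponent matches the lower bound up to
  \<open>c + \<eta>\<close>, also after \<open>f\<close> edges have been charged
  \<open>z\<close>.\<close>

lemma log_sum_bound:
 fixes \<Lambda> \<eta> f m c z n :: real
 assumes n: "n > 0" and f: "0 < f" "f <= m" and L: "1 <= \<Lambda>" "\<Lambda> = ln (n/sqrt m)" and eta: "0 < \<eta>" "\<eta> <= 1/2" and c: "-1 <= c" and z: "z > 0"
  and zc: "(1 - \<eta>)*\<Lambda> <= \<Lambda> - ln \<Lambda>/2 - 5 + ln z" and fm: "exp (- 4)*m/\<Lambda> <= 8*f"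
 defines "W \<equiv> ln (n*(exp c* sqrt (2*f))/m)"
 shows "m + (m - f)*W <= f*ln z + m*(\<Lambda> - ln \<Lambda>/2 + 1/2 + c + \<eta>)"
proof -
 have m: "m > 0" using f by linarith
 have sm: "sqrt m > 0" "sqrt m* sqrt m = m" using m by auto
 have W: "W = c + \<Lambda> + ln (2*f/m)/2"
 proof -
  have "n*(exp c* sqrt (2*f))/m = exp c*(n/sqrt m)* sqrt (2*f/m)"
   using sm by (simp add: real_sqrt_divide field_simps)
  then have "W = ln (exp c*(n/sqrt m)) + ln (sqrt (2*f/m))"
   unfolding W_def using n sm(1) f m by (simp only:) (rule ln_mult_pos, auto)
  also have "ln (exp c*(n/sqrt m)) = c + \<Lambda>" unfolding L using n sm(1) by (subst ln_mult_pos) auto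
  also have "ln (sqrt (2*f/m)) = ln (2*f/m)/2" using f m by (intro ln_sqrt) auto
  finally show ?thesis .
 qed
 have lf: "ln (2*f/m) >= - 6 - ln \<Lambda>"
 proof -
  have "exp (-6) <= exp (-4)/(4::real)"
  proof -
   have "4*exp (-6) <= exp 2*exp (-6 :: real)" using exp_ge_one_plus_x_over_n_power_n[of 2 2] by (intro mult_right_mono) auto
   also have "... = exp (-4)" by (simp flip: exp_add)
   finally show ?thesis by simp
  qed
  then have "exp (-6)/\<Lambda> <= exp (-4)/4/\<Lambda>" using L by (intro divide_right_mono) auto
  also have "... <= 2*f/m" using fm m L by (simp add: field_simps)
  finally have "ln (exp (-6)/\<Lambda>) <= ln (2*f/m)" using L by (intro ln_mono) auto
  then show ?thesis using L by (simp add: ln_div)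
 qed
 have Wz: "(1 - \<eta>)*\<Lambda> <= W + ln z" using zc lf c unfolding W by linarith
 have lt: "ln (2*f/m)/2 <= (f/m)*((1 - \<eta>)*\<Lambda>) - 1/2 - ln \<Lambda>/2 + \<eta>"
 proof -
  define t where "t = 2*f/m*\<Lambda>*(1 - \<eta>)"
  have "t > 0" using f m L eta by (simp add: t_def)
  then have "ln t <= t - 1" by (rule ln_le_minus_one)
  moreover have "ln t = ln (2*f/m) + ln \<Lambda> + ln (1 - \<eta>)"
  proof -
   have "0 < 2*f/m" "0 < \<Lambda>" "0 < 1 - \<eta>" using f m L(1) eta by auto
   then show ?thesis unfolding t_def
    using ln_mult_pos[OF mult_pos_pos[of "2*f/m" \<Lambda>], of "1 - \<eta>"] ln_mult_pos[of "2*f/m" \<Lambda>] by linarith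
  qed
  moreover have "- 2*\<eta> <= ln (1 - \<eta>)"
  proof -
   have "ln (1/(1 - \<eta>)) <= 1/(1 - \<eta>) - 1" using eta by (intro ln_le_minus_one) auto
   also have "... = \<eta>/(1 - \<eta>)" using eta by (simp add: field_simps)
   also have "... <= \<eta>/(1/2)" using eta by (intro divide_left_mono) auto
   finally show ?thesis using eta by (simp add: ln_div)
  qed
  moreover have "t = 2*((f/m)*((1 - \<eta>)*\<Lambda>))" by (simp add: t_def)
  ultimately show ?thesis by linarith
 qed
 have "f*((1 - \<eta>)*\<Lambda>) <= f*(W + ln z)" using Wz f by (intro mult_left_mono) auto
 then have "m + (m - f)*W <= m + m*W - f*((1 - \<eta>)*\<Lambda>) + f*ln z" by (simp add: algebra_simps)
 also have "m*W <= m*(c + \<Lambda> + ((f/m)*((1 - \<eta>)*\<Lambda>) - 1/2 - ln \<Lambda>/2 + \<eta>))"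
  unfolding W using lt m by (intro mult_left_mono) auto
 also have "... = m*(c + \<Lambda> - 1/2 - ln \<Lambda>/2 + \<eta>) + f*((1 - \<eta>)*\<Lambda>)" using m by (simp add: algebra_simps)
 finally show ?thesis by (simp add: algebra_simps)
qed

text \<open>\<open>F\<close> makes \<open>G\<close> dense on \<open>A\<close>, so failure to be
  close to split can only come from many edges off \<open>A\<close>; few of those are in
  \<open>F\<close>, since nearly all of \<open>F\<close> lies inside \<open>A\<close>.\<close>

lemma not_close_edges:
 assumes G: "finite G" "G <= nsets V 2" and FG: "F <= G" and nc: "\<not> close_to_split \<epsilon> V G" and AV: "A <= V"
  and A1: "real (edges_within F A) >= (1 - \<epsilon>)*real (card A choose 2)"
  and A2: "real (edges_within F A) >= (1 - b)*rcard F"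
 shows "\<epsilon>*rcard G - b*rcard F <= rcard ((G - F) Int {e. e <= V - A})"
proof -
 have fF: "finite F" using G FG finite_subset by blast
 have "edges_within F A <= edges_within G A" by (rule edges_within_mono[OF G(1) FG])
 then have "(1 - \<epsilon>)*real (card A choose 2) <= real (edges_within G A)" using A1 by linarith
 moreover have "A Un (V - A) = V" "A Int (V - A) = {}" using AV by auto
 ultimately have 1: "\<epsilon>*rcard G < real (edges_within G (V - A))"
  using nc unfolding close_to_split_def by (meson not_le)
 have "edges_within F A + card {e\<in>F. e <= V - A} <= card F"
 proof -
  have "{e\<in>F. e <= A} Int {e\<in>F. e <= V - A} = {}"
  proof -
   have "e ~= {}" if "e \<in> F" for e using that FG G(2) by (auto simp: nsets_def)
   then show ?thesis by blast
  qed
  then have "card {e\<in>F. e <= A} + card {e\<in>F. e <= V - A} = card ({e\<in>F. e <= A} Un {e\<in>F. e <= V - A})"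
   using fF by (intro card_Un_disjoint[symmetric]) auto
  also have "... <= card F" using fF by (intro card_mono) auto
  finally show ?thesis by (simp add: edges_within_def)
 qed
 then have 2: "rcard {e\<in>F. e <= V - A} <= b*rcard F" using A2 by (simp add: algebra_simps)
 have "edges_within G (V - A) <= card ((G - F) Int {e. e <= V - A}) + card {e\<in>F. e <= V - A}"
 proof -
  have "{e\<in>G. e <= V - A} <= ((G - F) Int {e. e <= V - A}) Un {e\<in>F. e <= V - A}" by auto
  then have "card {e\<in>G. e <= V - A} <= card (((G - F) Int {e. e <= V - A}) Un {e\<in>F. e <= V - A})"
   using G fF by (intro card_mono) auto
  also have "... <= card ((G - F) Int {e. e <= V - A}) + card {e\<in>F. e <= V - A}" by (rule card_Un_le)
  finally show ?thesis by (simp add: edges_within_def)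
 qed
 then have "real (edges_within G (V - A)) <= rcard ((G - F) Int {e. e <= V - A}) + rcard {e\<in>F. e <= V - A}"
  by linarith
 then show ?thesis using 1 2 by linarith
qed

text \<open>If the final container is small, or its \<open>X\<close> is at most
  \<open>(1 - b^2/2)* s\<close>, the plain count is already too small. Otherwise
  \<open>stability\<close> yields \<open>A\<close>; each graph counted has at least
  \<open>\<epsilon>/2*m\<close> new edges off \<open>A\<close>, where the container is sparse, and
  weighting these by \<open>1/(7*b)\<close> wins.\<close>

lemma card_not_close_le:
 fixes n m :: nat and z b \<epsilon> P :: real and k :: nat
 defines "\<Lambda> \<equiv> ln (real n/sqrt (real m))"
 defines "Xmin \<equiv> exp (-2)* sqrt (real m/\<Lambda>)"
 defines "\<xi> \<equiv> b\<^sup>2/10" and "\<eta> \<equiv> b\<^sup>2/32"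
 assumes n: "n > 0" and m: "m > 0" and eps: "0 < \<epsilon>" "\<epsilon> <= 1" and b: "0 < b" "8*b <= \<epsilon>" "7*b <= exp (- 6/\<epsilon>)"
  and kap: "\<kappa> > 0" and L1: "1 <= \<Lambda>" and z: "z > 0"
  and zc: "(1 - \<eta>)*\<Lambda> <= \<Lambda> - ln \<Lambda>/2 - 5 + ln z"
  and adm: "\<And>X. Xmin <= X ==> X <= real n ==> admissible \<xi> \<kappa> n m X"
  and Xm1: "1 <= \<xi>*Xmin"
  and k: "4*cK \<xi>*ln (real n/Xmin) < real k"
  and P: "real (num_prints (dire (nsets {1..n} 2)) (\<kappa>*real m + 1)) <= exp P"
  and cost: "real k*(3*2^29*real m*z + 4*P) <= \<eta>*real m"
 shows "rcard {G \<in> \<G> n m. \<not> close_to_split \<epsilon> {1..n} G}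
  <= exp (real m*(\<Lambda> - ln \<Lambda>/2 + 1/2 - b^2/2 + 2*\<eta>))"
proof -
 define V where "V = {1..n}"
 define NN where "NN = {G \<in> \<G> n m. \<not> close_to_split \<epsilon> {1..n} G}"
 define T where "T = \<Lambda> - ln \<Lambda>/2 + 1/2"
 define B0 where "B0 = exp (real m*(T - b^2/2 + \<eta>))"
 have b1: "b <= 1/8" using b eps by linarith
 have b2: "b^2 <= 1/64" using power_mono[OF b1, of 2] b by (simp add: power2_eq_square)
 have xi3: "0 < \<xi>" "\<xi> <= 1/10" "5*\<xi> = b^2/2" using b b2 by (auto simp: \<xi>_def)
 have eta: "0 < \<eta>" "\<eta> <= 1/2" using b b2 by (auto simp: \<eta>_def)
 have rm: "real m > 0" using m by simp
 have Xm0: "Xmin > 0" using m L1 by (simp add: Xmin_def)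
 have V: "finite V" "card V = n" by (simp_all add: V_def)
 have finP: "finite (nsets V 2)" using V(1) by (rule finite_imp_finite_nsets)
 have NNp: "G <= nsets V 2 & card G = m & \<not> contains_induced V G C4_verts C4_edges & \<not> close_to_split \<epsilon> V G" if "G \<in> NN" for G
  using that by (simp add: NN_def induced_C4_free_graphs_def V_def)
 interpret container V n m NN \<xi> \<kappa> Xmin z B0
  by standard (use V n m NNp xi3 kap z adm in \<open>auto simp: B0_def\<close>)
 have base: "cnt M F {} <= exp (\<theta>*rcard M + \<theta>* s*rcard (M Int D) - (real m - rcard F)*ln \<theta> - r*ln s)"
  if "M <= nsets V 2" "card F <= m" "0 < \<theta>" "1 <= s"
   "\<And>G. G \<in> NN ==> F <= G ==> G <= M ==> r <= rcard ((G - F) Int D)" for M F D \<theta> s r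
 proof -
  have fM: "finite M" using that(1) finP finite_subset by blast
  have "cnt M F {} <= rcard {G. F <= G & G <= M & card G = m & r <= rcard ((G - F) Int D)}"
   unfolding cnt_def
  proof (intro of_nat_mono card_mono)
   show "finite {G. F <= G & G <= M & card G = m & r <= rcard ((G - F) Int D)}"
    by (rule finite_subset[of _ "Pow M"]) (use fM in auto)
  qed (use that(5) NNp in auto)
  then show ?thesis using card_between_le[OF fM that(3,4,2), of r D] that(2) by (simp add: of_nat_diff)
 qed
 have key: "cnt M F {} <= z^card F*B0"
  if "cnt M F {} <= exp e" "e <= rcard F*ln z + real m*(T - b^2/2 + \<eta>)" for M F e
 proof -
  have "exp e <= exp (rcard F*ln z + real m*(T - b^2/2 + \<eta>))" using that(2) by simp
  also have "... = z^card F*B0" using z by (simp add: exp_add exp_of_nat_mult B0_def)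
  finally show ?thesis using that(1) by linarith
 qed
 have "rcard NN <= cstep^k*B0"
 proof (rule card_NN_le[OF _ k Xm0])
  fix M F assume M: "M <= nsets V 2" and F: "F <= nsets V 2" and fin: "final_state M F"
  define f where "f = rcard F"
  define X where "X = XX M"
  have cM: "rcard M = real n*X" using n by (simp add: X_def XX_def)
  show "cnt M F {} <= z^card F*B0"
  proof (cases "card F <= m")
   case False
   have "card F <= m" if "G \<in> NN" "F <= G" for G
    using NNp[OF that(1)] that(2) card_mono[of G F] finP finite_subset by metis
   then have "{G\<in>NN. F <= G & G <= M & G Int {} = {}} = {}" using False by blast
   then have "cnt M F {} = 0" unfolding cnt_def by (simp only: card.empty of_nat_0)
   then show ?thesis using z by (simp add: B0_def)
  next
   case fm: True
   then have fm': "f <= real m" by (simp add: f_def)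
   have f0: "f >= 0" by (simp add: f_def)
   define rate where "rate X' = real m/(real n*X')" for X'
   have ratepos: "rate X' > 0" if "X' > 0" for X' using that m n by (simp add: rate_def)
   have rateM: "rate X'*rcard M <= real m" if "0 < X'" "X <= X'" for X'
   proof -
    have "real m*X <= real m*X'" using that by (intro mult_left_mono) auto
    then have "real m*X/X' <= real m" using that by (simp add: divide_le_eq)
    then show ?thesis using that n unfolding rate_def cM by simp
   qed
   have lnr: "- ln (rate X') = ln (real n*X'/real m)" if "X' > 0" for X'
    using that m n by (simp add: rate_def ln_div)
   have plain: "cnt M F {} <= exp (real m + (real m - f)*ln (real n*X'/real m))" if "0 < X'" "X <= X'" for X'
   proof -
    have "cnt M F {} <= exp (rate X'*rcard M + rate X'*1*rcard (M Int {}) - (real m - rcard F)*ln (rate X') - 0*ln 1)"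
     by (rule base[OF M fm ratepos[OF that(1)]]) auto
    also have "... <= exp (real m + (real m - f)*ln (real n*X'/real m))"
     using rateM[OF that] unfolding lnr[OF that(1), symmetric] by (simp add: f_def algebra_simps)
    finally show ?thesis .
   qed
   show ?thesis
   proof (cases "X < Xmin")
    case True
    \<comment> \<open>The factor \<open>exp (-2)\<close> in \<open>Xmin\<close> turns
      \<open>1 + ln (n*Xmin/m)\<close> into \<open>T - 3/2\<close>, a comfortable margin.\<close>
    have w: "ln (real n*Xmin/real m) = T - 5/2"
    proof -
     have "real n*Xmin/real m = exp (-2)*(real n/sqrt (real m))/sqrt \<Lambda>"
      using rm L1 by (simp add: Xmin_def real_sqrt_divide field_simps)
     then have "ln (real n*Xmin/real m) = ln (exp (-2)*(real n/sqrt (real m))) - ln (sqrt \<Lambda>)"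
      using n rm L1 ln_div[of "exp (-2)*(real n/sqrt (real m))" "sqrt \<Lambda>"] by (simp only:) simp
     also have "ln (exp (-2)*(real n/sqrt (real m))) = -2 + \<Lambda>"
      unfolding \<Lambda>_def using n rm by (subst ln_mult_pos) auto
     also have "ln (sqrt \<Lambda>) = ln \<Lambda>/2" using L1 by (intro ln_sqrt) auto
     finally show ?thesis by (simp add: T_def)
    qed
    show ?thesis
    proof (rule key[OF plain[OF Xm0 less_imp_le[OF True]]])
     have "0 <= (1 - \<eta>)*\<Lambda>" using eta L1 by simp
     then have "0 <= (T - 5/2) + ln z" using zc by (simp add: T_def)
     then have "0 <= f*((T - 5/2) + ln z)" using f0 by simp
     moreover have "0 <= real m*(3/2 - b^2/2 + \<eta>)" using b2 eta by simp
     ultimately show "real m + (real m - f)*ln (real n*Xmin/real m) <= rcard F*ln z + real m*(T - b^2/2 + \<eta>)"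
      unfolding w f_def[symmetric] by (simp add: field_simps)
    qed
   next
    case XM: False
    define s where "s = sqrt (2*f)"
    have X0: "X > 0" using XM Xm0 by simp
    have fpos: "f > 0" and Xs: "X <= 2* s" if "X <= 2* s"
     using that X0 f0 by (auto simp: s_def order_less_le)
    have bnd: "real m + (real m - f)*ln (real n*(exp c* s)/real m) <= f*ln z + real m*(T + c + \<eta>)"
     if "X <= 2* s" "-1 <= c" for c
    proof -
     have "Xmin^2 <= (2* s)^2" using XM Xm0 that(1) by (intro power_mono) auto
     moreover have "Xmin^2 = exp (-4)*real m/\<Lambda>"
      using L1 rm by (simp add: Xmin_def power_mult_distrib flip: exp_of_nat_mult)
     moreover have "(2* s)^2 = 8*f" using f0 by (simp add: s_def power_mult_distrib)
     ultimately have "exp (-4)*real m/\<Lambda> <= 8*f" by simp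
     from log_sum_bound[OF _ fpos[OF that(1)] fm' L1 \<Lambda>_def[THEN meta_eq_to_obj_eq] eta that(2) z zc this] show ?thesis
      using n by (simp add: s_def T_def)
    qed
    show ?thesis
    proof (cases "X <= (1 - b^2/2)* s")
     case True
     have s0: "s >= 0" by (simp add: s_def f0)
     have "(1 - b^2/2)* s <= 2* s" using s0 zero_le_power2[of b] by (intro mult_right_mono) linarith+
     then have X2: "X <= 2* s" using True by linarith
     define c where "c = ln (1 - b^2/2)"
     have c1: "c <= - (b^2/2)" unfolding c_def using b2 ln_le_minus_one[of "1 - b^2/2"] by simp
     have c2: "-1 <= c"
     proof -
      have "exp (-1 :: real) <= 1/2" using exp_ge_add_one_self[of 1] by (simp add: exp_minus field_simps)
      then have "exp (-1 :: real) <= 1 - b^2/2" using b2 by linarith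
      then have "ln (exp (-1)) <= c" unfolding c_def using b2 by (intro ln_mono) auto
      then show ?thesis by simp
     qed
     have ec: "exp c = 1 - b^2/2" unfolding c_def using b2 by simp
     have sp: "0 < exp c* s" using fpos[OF X2] by (simp add: s_def)
     show ?thesis
     proof (rule key[OF plain[OF sp]])
      show "X <= exp c* s" using True by (simp add: ec)
      have "real m*(T + c + \<eta>) <= real m*(T - b^2/2 + \<eta>)" using c1 by (intro mult_left_mono) auto
      then show "real m + (real m - f)*ln (real n*(exp c* s)/real m) <= rcard F*ln z + real m*(T - b^2/2 + \<eta>)"
       using bnd[OF X2 c2] unfolding f_def[symmetric] by linarith
     qed
    next
     case big: False
     \<comment> \<open>Here \<open>X\<close> is close to \<open>s = sqrt (2*f)\<close>, so
       \<open>X^2 < f\<close> is impossible and the state can be final only on account of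
       \<open>wt\<close>.\<close>
     have nwt: "wt V (outn M) F < 4*\<xi>*rcard M"
     proof -
      have "\<not> X\<^sup>2 < f"
      proof
       assume "X^2 < f"
       moreover have "((1 - b^2/2)* s)^2 <= X^2" using big b2 by (intro power_mono mult_nonneg_nonneg) (auto simp: s_def f0)
       moreover have "((1 - b^2/2)* s)^2 = (1 - b^2/2)^2*(2*f)" using f0 by (simp add: s_def power_mult_distrib)
       moreover have "(3/4)^2*(2*f) <= (1 - b^2/2)^2*(2*f)" using b2 f0 by (intro mult_right_mono power_mono) auto
       moreover have "(3/4)^2*(2*f) = 9/8*f" by (simp add: power2_eq_square)
       ultimately show False using f0 by linarith
      qed
      then show ?thesis using fin XM by (simp add: final_state_def X_def f_def)
     qed
     have xX: "1 <= \<xi>*X" using Xm1 XM xi3 mult_left_mono[of Xmin X \<xi>] by linarith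
     have sF: "s = sqrt (2*rcard F)" by (simp add: s_def f_def)
     note stab = stability[OF M F V n xi3(1,2) nwt cM xX, folded sF]
     have X2: "X <= 2* s"
     proof -
      have "(1/2)*X <= (1 - 5*\<xi>)*X" using xi3 X0 by (intro mult_right_mono) auto
      then show ?thesis using stab(1) by linarith
     qed
     note fp = fpos[OF X2]
     have s0: "s > 0" using fp by (simp add: s_def)
     have lo: "(1 - b^2)* s <= (1 - 5*\<xi>)*X"
     proof -
      have "(1 - b^2)* s <= (1 - b^2/2)*((1 - b^2/2)* s)"
       unfolding mult.assoc[symmetric] using s0 by (intro mult_right_mono) (auto simp: algebra_simps)
      also have "... <= (1 - b^2/2)*X" using big b2 by (intro mult_left_mono) auto
      finally show ?thesis by (simp add: xi3(3))
     qed
     obtain A where A: "A <= V" "real (edges_within F A) >= (1 - 2*b)*rcard F"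
      "real (edges_within F A) >= (1 - 4*b)*real (card A choose 2)"
      "rcard (M Int {e. e <= V - A}) <= 7*b*(real n* s)"
      using stab(2)[of b] lo b b1 xi3(3) by (auto simp: power2_eq_square)
     define X' where "X' = exp (ln 2)* s"
     have X': "X' = 2* s" "X' > 0" using s0 by (simp_all add: X'_def)
     have b7: "7*b <= 1"
     proof -
      have "exp (- 6/\<epsilon>) <= 1" using eps by simp
      then show ?thesis using b(3) by linarith
     qed
     have "cnt M F {} <= exp (rate X'*rcard M + rate X'*(1/(7*b))*rcard (M Int {e. e <= V - A})
      - (real m - rcard F)*ln (rate X') - (\<epsilon>/2*real m)*ln (1/(7*b)))"
     proof (rule base[OF M fm ratepos[OF X'(2)]])
      show "1 <= 1/(7*b)" using b7 b by simp
      fix G assume G: "G \<in> NN" "F <= G" "G <= M"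
      have "(1 - \<epsilon>)*real (card A choose 2) <= (1 - 4*b)*real (card A choose 2)" using b by (intro mult_right_mono) auto
      then have "\<epsilon>*rcard G - 2*b*rcard F <= rcard ((G - F) Int {e. e <= V - A})"
       using NNp[OF G(1)] G(2) A finP finite_subset by (intro not_close_edges) (auto intro: order_trans)
      moreover have "2*b*rcard F <= \<epsilon>/2*real m" using b fm eps by (intro mult_mono) auto
      ultimately show "\<epsilon>/2*real m <= rcard ((G - F) Int {e. e <= V - A})" using NNp[OF G(1)] by simp
     qed
     then show ?thesis
     proof (rule key)
      have 1: "rate X'*rcard M <= real m" using rateM[OF X'(2)] X2 X' by simp
      have 2: "rate X'*(1/(7*b))*rcard (M Int {e. e <= V - A}) <= real m/2"
      proof -
       have "rate X'*(1/(7*b))*rcard (M Int {e. e <= V - A}) <= rate X'*(1/(7*b))*(7*b*(real n* s))"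
        using ratepos[OF X'(2)] b A(4) by (intro mult_left_mono) auto
       also have "... = real m/2" using b n s0 by (simp add: rate_def X'(1))
       finally show ?thesis .
      qed
      \<comment> \<open>The choice \<open>7*b <= exp (- 6/\<epsilon>)\<close> is made for this gain
        of \<open>3*m\<close>, which outweighs the loss \<open>ln 2\<close> from replacing
        \<open>X\<close> by \<open>2* s\<close> and the loss 1/2 from the extra weights.\<close>
      have 3: "(\<epsilon>/2*real m)*ln (1/(7*b)) >= 3*real m"
      proof -
       have "ln (7*b) <= ln (exp (- 6/\<epsilon>))" using b by (intro ln_mono) auto
       then have "6/\<epsilon> <= ln (1/(7*b))" using b by (simp add: ln_div)
       then have "(\<epsilon>/2*real m)*(6/\<epsilon>) <= (\<epsilon>/2*real m)*ln (1/(7*b))" using eps by (intro mult_left_mono) auto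
       then show ?thesis using eps by simp
      qed
      have 4: "real m + (real m - f)*ln (real n*X'/real m) <= f*ln z + real m*(T + ln 2 + \<eta>)"
       unfolding X'_def by (rule bnd[OF X2]) (use ln_2_less_1 ln_gt_zero[of "2::real"] in linarith)
      have 5: "real m*(T + ln 2 + \<eta>) + real m/2 - 3*real m <= real m*(T - b^2/2 + \<eta>)"
      proof -
       have "real m*(T + ln 2 + \<eta> + 1/2 - 3) <= real m*(T - b^2/2 + \<eta>)"
        using ln_2_less_1 b2 by (intro mult_left_mono) auto
       then show ?thesis by (simp add: algebra_simps)
      qed
      have 6: "- ((real m - rcard F)*ln (rate X')) = (real m - f)*ln (real n*X'/real m)"
       unfolding lnr[OF X'(2), symmetric] by (simp add: f_def)
      show "rate X'*rcard M + rate X'*(1/(7*b))*rcard (M Int {e. e <= V - A})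
      - (real m - rcard F)*ln (rate X') - (\<epsilon>/2*real m)*ln (1/(7*b))
      <= rcard F*ln z + real m*(T - b^2/2 + \<eta>)"
       using 1 2 3 4 5 6 unfolding f_def[symmetric] by linarith
     qed
    qed
   qed
  qed
 qed
 also have "cstep^k <= exp (\<eta>*real m)"
 proof -
  have "cstep <= exp (3*2^29*real m*z)*exp P^4"
   unfolding cstep_def
  proof (intro mult_mono power_mono)
   have "(1 + z) powr (3*2^29*real m) = exp (3*2^29*real m*ln (1 + z))" using z by (simp add: powr_def)
   also have "... <= exp (3*2^29*real m*z)" using z ln_add_one_self_le_self[of z] by (simp add: mult_left_mono)
   finally show "(1 + z) powr (3*2^29*real m) <= exp (3*2^29*real m*z)" .
   show "real Tc <= exp P" unfolding Tc_def using P by (simp only: V_def)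
  qed auto
  also have "... = exp (3*2^29*real m*z + 4*P)" by (simp add: exp_add flip: exp_of_nat_mult)
  finally have "cstep^k <= exp (3*2^29*real m*z + 4*P)^k" using cstep1 by (intro power_mono) auto
  also have "... = exp (real k*(3*2^29*real m*z + 4*P))" by (simp flip: exp_of_nat_mult)
  also have "... <= exp (\<eta>*real m)" using cost by simp
  finally show ?thesis .
 qed
 then have "cstep^k*B0 <= exp (\<eta>*real m)*B0" by (intro mult_right_mono) (simp_all add: B0_def)
 also have "... = exp (real m*(T - b^2/2 + 2*\<eta>))" by (simp add: B0_def algebra_simps flip: exp_add)
 finally show ?thesis by (simp add: NN_def T_def)
qed

text \<open>Upper and lower exponents per edge differ by \<open>- b^2/2 + 6*\<eta>\<close>, which is
  negative for \<open>\<eta> = b^2/32\<close>. What remains is to choose parameters: with order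
  \<Lambda> steps, the queries force \<open>z\<close> down to order 1/\<Lambda>, and the
  fingerprints bound \<kappa> from above.\<close>

lemma card_not_close_exp_small:
 fixes \<epsilon> :: real
 assumes eps: "0 < \<epsilon>" "\<epsilon> <= 1"
 shows "\<exists>\<delta>>0. \<exists>c>0. \<forall>\<^sub>F n in sequentially. \<forall>m. real n powr (4/3)*ln (real n)^4 <= real m --> real m <= \<delta>*real n^2 -->
  0 < card (\<G> n m) & rcard {G \<in> \<G> n m. \<not> close_to_split \<epsilon> {1..n} G} <= exp (- c*real m)*rcard (\<G> n m)"
proof -
 define b where "b = min (\<epsilon>/8) (exp (- 6/\<epsilon>)/7)"
 have b: "0 < b" "8*b <= \<epsilon>" "7*b <= exp (- 6/\<epsilon>)" using eps by (auto simp: b_def)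
 define \<xi> where "\<xi> = b^2/10"
 define \<eta> where "\<eta> = b^2/32"
 have b2: "0 < b\<^sup>2" "b^2 <= 1/64" using power_mono[of b "1/8" 2] b eps by (auto simp: power2_eq_square)
 have eta: "0 < \<eta>" "\<eta> <= 1/2" and xi: "0 < \<xi>" "\<xi> <= 1" using b2 by (auto simp: \<eta>_def \<xi>_def)
 obtain C where C16: "C >= 16" and Cadm: "\<And>n m \<kappa> X. 0 < n ==> 0 < m ==> 0 < \<kappa> ==> \<kappa> <= 1 ==> C <= X ==> C*real m <= real n*X ==>
  C*real n^2 <= \<kappa>^2*real m*X ==> C*real n^4 <= \<kappa>^4*real m^3 ==> C*real n <= \<kappa>*X^2 ==>
  admissible \<xi> \<kappa> n m X"
  using admissible_sufficient[OF xi(1)] by blast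
 define K where "K = cK \<xi>"
 have K1: "K >= 1"
 proof -
  have "1 <= 262144*(24/\<xi> + 1) + 10000" using xi by simp
  then show ?thesis unfolding K_def cK_def by (rule max.coboundedI1)
 qed
 define S where "S = 108*2^29*K"
 have S0: "S > 0" using K1 by (simp add: S_def)
 define E where "E = exp (2 :: real)"
 have E1: "E >= 1" "exp (-2) = 1/E" by (simp_all add: E_def exp_minus field_simps)
 have "\<forall>\<^sub>F x in at_top. 1 <= x & (3/2*ln x + (5 + ln (S/\<eta>)))/x < \<eta> & (1 + x)*exp (- x) < \<eta>/2 & x*exp (- x) < 1/(C*E) & 1/x < \<eta>"
 proof (intro eventually_conj)
  show "\<forall>\<^sub>F x in at_top. 1 <= (x :: real)" by (rule eventually_ge_at_top)
  have "((%x. (3/2*ln x + (5 + ln (S/\<eta>)))/x) \<longlongrightarrow> 0) at_top" by real_asymp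
  then show "\<forall>\<^sub>F x in at_top. (3/2*ln x + (5 + ln (S/\<eta>)))/x < \<eta>" using eta(1) by (rule order_tendstoD)
  have "((%x::real. (1 + x)*exp (- x)) \<longlongrightarrow> 0) at_top" by real_asymp
  then show "\<forall>\<^sub>F x in at_top. (1 + x)*exp (- x) < \<eta>/2" by (rule order_tendstoD) (use eta in simp)
  have "((%x::real. x*exp (- x)) \<longlongrightarrow> 0) at_top" by real_asymp
  then show "\<forall>\<^sub>F x in at_top. x*exp (- x) < 1/(C*E)" by (rule order_tendstoD) (use C16 E1 in simp)
  have "((%x::real. 1/x) \<longlongrightarrow> 0) at_top" by real_asymp
  then show "\<forall>\<^sub>F x in at_top. 1/x < \<eta>" using eta(1) by (rule order_tendstoD)
 qed
 then obtain \<Lambda>0 where Lam0: "\<And>x. x >= \<Lambda>0 ==> 1 <= x & (3/2*ln x + (5 + ln (S/\<eta>)))/x < \<eta> & (1 + x)*exp (- x) < \<eta>/2 & x*exp (- x) < 1/(C*E) & 1/x < \<eta>"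
  unfolding eventually_at_top_linorder by blast
 define \<delta> where "\<delta> = exp (- 2*max 1 \<Lambda>0)"
 have d0: "\<delta> > 0" "\<delta> <= 1" by (simp_all add: \<delta>_def)
 define Q where "Q = max (C*E^2) (max (1440*K/\<eta>) (max ((C*E)^2) (max (4/\<eta>^2) (E^2/\<xi>^2))))"
 have "\<forall>\<^sub>F x in at_top. 1 <= x & Q <= x powr (3/4) & Q <= x powr (1/4) & Q <= x & (\<forall>y\<ge>x. (1 + ln y)/y < \<eta>)"
 proof (intro eventually_conj)
  show "\<forall>\<^sub>F x in at_top. 1 <= (x :: real)" "\<forall>\<^sub>F x in at_top. Q <= (x :: real)" by (rule eventually_ge_at_top)+
  have "filterlim (%x::real. x powr (3/4)) at_top at_top" by real_asymp
  then show "\<forall>\<^sub>F x in at_top. Q <= x powr (3/4)" by (auto simp: filterlim_at_top)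
  have "filterlim (%x::real. x powr (1/4)) at_top at_top" by real_asymp
  then show "\<forall>\<^sub>F x in at_top. Q <= x powr (1/4)" by (auto simp: filterlim_at_top)
  have "((%x::real. (1 + ln x)/x) \<longlongrightarrow> 0) at_top" by real_asymp
  then have "\<forall>\<^sub>F x in at_top. (1 + ln x)/x < \<eta>" using eta(1) by (rule order_tendstoD)
  then show "\<forall>\<^sub>F x in at_top. \<forall>y\<ge>x. (1 + ln y)/y < \<eta>" by (rule eventually_all_ge_at_top)
 qed
 then obtain L0 where L0: "\<And>x. x >= L0 ==> 1 <= x & Q <= x powr (3/4) & Q <= x powr (1/4) & Q <= x & (\<forall>y\<ge>x. (1 + ln y)/y < \<eta>)"
  unfolding eventually_at_top_linorder by blast
 have ev: "\<forall>\<^sub>F n in sequentially. L0 <= ln (real n)"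
 proof -
  have "filterlim (%n. ln (real n)) at_top sequentially" by real_asymp
  then show ?thesis by (auto simp: filterlim_at_top)
 qed
 have main: "0 < card (\<G> n m) & rcard {G \<in> \<G> n m. \<not> close_to_split \<epsilon> {1..n} G} <= exp (- (b^2/4)*real m)*rcard (\<G> n m)"
  if nL: "L0 <= ln (real n)" and lo: "real n powr (4/3)*ln (real n)^4 <= real m" and hi: "real m <= \<delta>*real n^2" for n m
 proof -
  define L where "L = ln (real n)"
  have L: "1 <= L" "Q <= L powr (3/4)" "Q <= L powr (1/4)" "Q <= L" "\<And>y. y >= L ==> (1 + ln y)/y < \<eta>"
   using L0[of L] nL unfolding L_def by blast+
  have n: "n > 0" using L(1) by (cases n) (auto simp: L_def)
  have rn: "real n >= 1" using n by simp
  define \<mu> where "\<mu> = real n powr (4/3)*L^4"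
  have mu: "\<mu> <= real m" using lo by (simp add: \<mu>_def L_def)
  have n43: "real n powr (4/3) >= real n" using powr_mono[of 1 "4/3" "real n"] rn by simp
  have muL: "real n*L^3 <= \<mu>/L"
  proof -
   have "real n*L^3 <= real n powr (4/3)*L^3" using n43 L by (intro mult_right_mono) auto
   also have "... = \<mu>/L" using L by (simp add: \<mu>_def eval_nat_numeral)
   finally show ?thesis .
  qed
  have L3: "L <= L^3" using L(1) self_le_power[of L 3] by simp
  have "L <= real n*L^3" using L3 rn L mult_mono[of 1 "real n" L "L^3"] by simp
  then have LmL: "L <= \<mu>/L" using muL by linarith
  have mu0: "\<mu> > 0" using n L by (simp add: \<mu>_def)
  have muL1: "L <= \<mu>"
  proof -
   have "\<mu>/L <= \<mu>" using mu0 L by (simp add: divide_le_eq)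
   then show ?thesis using LmL by linarith
  qed
  have m1: "real m >= 1" using mu muL1 L by linarith
  then have m: "m > 0" by simp
  define \<Lambda> where "\<Lambda> = ln (real n/sqrt (real m))"
  have nm: "real n/sqrt (real m) > 0" using n m by simp
  have eL: "exp \<Lambda> = real n/sqrt (real m)" using nm by (simp add: \<Lambda>_def)
  have LamL: "\<Lambda> <= L"
  proof -
   have "real n*1 <= real n* sqrt (real m)" using m1 by (intro mult_left_mono) auto
   then have "real n/sqrt (real m) <= real n" using m1 by (simp add: divide_le_eq)
   then show ?thesis unfolding \<Lambda>_def L_def using nm by (intro ln_mono) auto
  qed
  have "\<Lambda>0 <= \<Lambda>"
  proof -
   have "sqrt (real m) <= sqrt (\<delta>*real n^2)" using hi by simp
   also have "... = exp (- max 1 \<Lambda>0)*real n"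
   proof -
    have "\<delta> = (exp (- max 1 \<Lambda>0))^2" by (simp add: \<delta>_def flip: exp_of_nat_mult)
    then show ?thesis by (simp add: real_sqrt_mult)
   qed
   finally have "exp (max 1 \<Lambda>0)* sqrt (real m) <= real n" by (simp add: exp_minus field_simps)
   then have "exp (max 1 \<Lambda>0) <= exp \<Lambda>" unfolding eL using m by (simp add: le_divide_eq)
   then show ?thesis by simp
  qed
  then have La: "1 <= \<Lambda>" "(3/2*ln \<Lambda> + (5 + ln (S/\<eta>)))/\<Lambda> < \<eta>" "(1 + \<Lambda>)*exp (- \<Lambda>) < \<eta>/2" "\<Lambda>*exp (- \<Lambda>) < 1/(C*E)" "1/\<Lambda> < \<eta>"
   using Lam0 by blast+
  define r where "r = sqrt (real m/\<Lambda>)"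
  have r0: "r > 0" using m La by (simp add: r_def)
  have r2: "r^2 = real m/\<Lambda>" using La by (simp add: r_def)
  have r2L: "\<mu>/L <= r^2" unfolding r2 using mu mu0 LamL La by (intro frac_le) auto
  have Qr: "Q <= r^2" using r2L LmL L by linarith
  have QC: "C*E^2 <= Q" "1440*K/\<eta> <= Q" "(C*E)^2 <= Q" "4/\<eta>^2 <= Q" "E^2/\<xi>^2 <= Q" by (simp_all add: Q_def)
  have sqle: "x <= r" if "x^2 <= Q" for x using that Qr r0 by (meson order_trans less_imp_le power2_le_imp_le)
  have rC: "C*E <= r" "2/\<eta> <= r" "E/\<xi> <= r" by (rule sqle, use QC in \<open>simp add: power_divide\<close>)+
  have sqL: "sqrt \<Lambda> <= \<Lambda>" "1 <= sqrt \<Lambda>" using La real_le_lsqrt[of \<Lambda> \<Lambda>] by (auto simp: power2_eq_square)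
  have sm: "sqrt (real m) > 0" "sqrt (real m)* sqrt (real m) = real m" using m by auto
  have rs: "r = sqrt (real m)/sqrt \<Lambda>" by (simp add: r_def real_sqrt_divide)
  have rn1: "r/real n <= exp (- \<Lambda>)"
  proof -
   have "r <= sqrt (real m)" using sqL sm La by (simp add: rs divide_le_eq)
   then have "r/real n <= sqrt (real m)/real n" using n by (intro divide_right_mono) auto
   then show ?thesis using eL by (simp add: exp_minus)
  qed
  have mnr: "real m/(real n*r) <= \<Lambda>*exp (- \<Lambda>)"
  proof -
   have "real m/(real n*r) = sqrt \<Lambda>*(sqrt (real m)/real n)" using sm n La by (simp add: rs field_simps)
   also have "... <= \<Lambda>*(sqrt (real m)/real n)" using sqL by (intro mult_right_mono) auto
   finally show ?thesis using eL by (simp add: exp_minus)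
  qed
  define Xmin where "Xmin = exp (-2)* sqrt (real m/\<Lambda>)"
  have XE: "Xmin = r/E" by (simp add: Xmin_def r_def E1)
  have Xm0: "Xmin > 0" using r0 E1 by (simp add: XE)
  \<comment> \<open>All fingerprints together cost order \<open>\<kappa>*L^2*m\<close>, so \<kappa>
    must be of smaller order than \<open>L powr (-2)\<close>; in the other direction
    \<open>\<kappa>^4*m^3\<close> must exceed order \<open>n^4\<close>. For m at least
    \<open>n powr (4/3)*L^4\<close> the exponent -9/4 satisfies both.\<close>
  define \<kappa> where "\<kappa> = L powr (- 9/4)"
  have kap: "\<kappa> > 0" "\<kappa> <= 1" using L powr_mono[of "- 9/4" 0 L] by (auto simp: \<kappa>_def)
  have kL: "\<kappa>^2 = L powr (- 9/2)" "\<kappa>^4 = L powr (- 9)" using L by (simp_all add: \<kappa>_def powr_power)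
  \<comment> \<open>\<open>S\<close> is twice the constant \<open>18*K*3*2^29\<close> of the query
    cost, so the queries of all steps together cost at most \<open>\<eta>*m/2\<close>.\<close>
  define z where "z = \<eta>/(S*\<Lambda>)"
  have z: "z > 0" using eta S0 La by (simp add: z_def)
  have lnz: "ln z = - ln (S/\<eta>) - ln \<Lambda>"
  proof -
   have "z = 1/(S/\<eta>*\<Lambda>)" by (simp add: z_def)
   then have "ln z = - ln (S/\<eta>*\<Lambda>)" using eta S0 La by (simp add: ln_div)
   moreover have "ln (S/\<eta>*\<Lambda>) = ln (S/\<eta>) + ln \<Lambda>" using eta S0 La by (intro ln_mult_pos) auto
   ultimately show ?thesis by simp
  qed
  have zc: "(1 - \<eta>)*\<Lambda> <= \<Lambda> - ln \<Lambda>/2 - 5 + ln z"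
  proof -
   have "3/2*ln \<Lambda> + (5 + ln (S/\<eta>)) <= \<eta>*\<Lambda>" using La(1,2) by (simp add: divide_less_eq)
   then show ?thesis unfolding lnz by (simp add: algebra_simps)
  qed
  define k where "k = nat \<lceil>4*K*ln (real n/Xmin)\<rceil> + 1"
  have lnX: "ln (real n/Xmin) = 2 + \<Lambda> + ln \<Lambda>/2"
  proof -
   have "real n/Xmin = exp 2*exp \<Lambda>* sqrt \<Lambda>" unfolding eL XE using r0 n sm La by (simp add: E_def rs)
   also have "... = exp (2 + \<Lambda>)* sqrt \<Lambda>" by (simp add: exp_add)
   finally have "ln (real n/Xmin) = ln (exp (2 + \<Lambda>)) + ln (sqrt \<Lambda>)" using La by (simp only:) (rule ln_mult_pos, auto)
   then show ?thesis using La by (simp add: ln_sqrt)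
  qed
  have lnLam: "0 <= ln \<Lambda>" "ln \<Lambda> <= \<Lambda>" using La ln_le_minus_one[of \<Lambda>] by auto
  have kk: "4*cK \<xi>*ln (real n/Xmin) < real k" "real k <= 18*K*\<Lambda>"
  proof -
   have p: "0 <= 4*K*ln (real n/Xmin)" unfolding lnX using K1 La lnLam by simp
   show "4*cK \<xi>*ln (real n/Xmin) < real k" unfolding k_def K_def[symmetric] using real_nat_ceiling_ge[of "4*K*ln (real n/Xmin)"] by simp
   have "real k <= 4*K*ln (real n/Xmin) + 2" unfolding k_def using p by simp linarith
   also have "... <= 4*K*(4*\<Lambda>) + 2*K*\<Lambda>"
   proof (intro add_mono mult_left_mono)
    show "ln (real n/Xmin) <= 4*\<Lambda>" unfolding lnX using La lnLam by linarith
    show "2 <= 2*K*\<Lambda>" using mult_mono[of 1 K 1 \<Lambda>] K1 La by simp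
   qed (use K1 in simp)
   finally show "real k <= 18*K*\<Lambda>" by simp
  qed
  define P where "P = 2*\<kappa>*real m*ln (real n^2/(\<kappa>*real m)) + \<kappa>*real m"
  have L74: "L powr (- 9/4)*L^4 = L powr (7/4)"
  proof -
   have "L^4 = L powr 4" using L powr_realpow[of L 4] by simp
   then show ?thesis by (simp flip: powr_add)
  qed
  have km1: "1 <= \<kappa>*real m"
  proof -
   have "1 <= L powr (7/4)" using L by (simp add: ge_one_powr_ge_zero)
   also have "... = \<kappa>*(1*L^4)" using L74 by (simp add: \<kappa>_def)
   also have "... <= \<kappa>*\<mu>" unfolding \<mu>_def using kap n43 rn L by (intro mult_left_mono mult_right_mono) auto
   also have "... <= \<kappa>*real m" using mu kap by (intro mult_left_mono) auto
   finally show ?thesis .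
  qed
  have kmn: "\<kappa>*real m <= real n^2"
  proof -
   have "\<kappa>*real m <= 1*(1*real n^2)" using kap hi d0 by (intro mult_mono order_trans[OF hi]) auto
   then show ?thesis by simp
  qed
  have P1: "real (num_prints (dire (nsets {1..n} 2)) (\<kappa>*real m + 1)) <= exp P"
  proof -
   have fin: "finite (nsets {1..n} 2)" by (simp add: finite_imp_finite_nsets)
   have cd: "rcard (dire (nsets {1..n} 2)) <= real n^2"
    using finite_card_dire(2)[OF subset_refl fin] choose_two_le[of n] by simp
   have "real (num_prints (dire (nsets {1..n} 2)) (\<kappa>*real m + 1)) <= exp ((2*\<kappa>*real m)*ln (real n^2/(\<kappa>*real m)) + rcard (dire (nsets {1..n} 2))/(real n^2/(\<kappa>*real m)))"
    by (rule num_prints_le[OF finite_card_dire(1)[OF subset_refl fin]]) (use km1 kmn in \<open>auto simp: le_divide_eq\<close>)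
   also have "rcard (dire (nsets {1..n} 2))/(real n^2/(\<kappa>*real m)) <= real n^2/(real n^2/(\<kappa>*real m))"
    using cd km1 by (intro divide_right_mono) auto
   also have "... = \<kappa>*real m" using n by simp
   finally show ?thesis by (simp add: P_def)
  qed
  have P2: "P <= 10*\<kappa>*real m*L"
  proof -
   have "ln (real n^2/(\<kappa>*real m)) = 2*\<Lambda> + 9/4*ln L"
   proof -
    have "real n^2/(\<kappa>*real m) = exp \<Lambda>^2*L powr (9/4)"
     unfolding eL using L m by (simp add: \<kappa>_def power_divide powr_minus field_simps)
    also have "... = exp (2*\<Lambda>)*exp (9/4*ln L)" using L by (simp add: powr_def flip: exp_of_nat_mult)
    also have "... = exp (2*\<Lambda> + 9/4*ln L)" by (simp add: exp_add)
    finally show ?thesis by simp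
   qed
   moreover have "ln L <= L" using L ln_le_minus_one[of L] by simp
   ultimately have "2*ln (real n^2/(\<kappa>*real m)) + 1 <= 10*L" using LamL L by linarith
   then have "\<kappa>*real m*(2*ln (real n^2/(\<kappa>*real m)) + 1) <= \<kappa>*real m*(10*L)" using km1 by (intro mult_left_mono) auto
   then show ?thesis by (simp add: P_def algebra_simps)
  qed
  have cost: "real k*(3*2^29*real m*z + 4*P) <= \<eta>*real m"
  proof -
   have "real k*(3*2^29*real m*z) <= (18*K*\<Lambda>)*(3*2^29*real m*z)" using kk(2) z by (intro mult_right_mono) auto
   also have "... = \<eta>*real m/2" using K1 La by (simp add: z_def S_def)
   finally have 1: "real k*(3*2^29*real m*z) <= \<eta>*real m/2" .
   have "real k*(4*P) <= (18*K*L)*(4*(10*\<kappa>*real m*L))"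
   proof (rule mult_mono)
    have "18*K*\<Lambda> <= 18*K*L" using LamL K1 by (intro mult_left_mono) auto
    then show "real k <= 18*K*L" using kk(2) by linarith
    have "0 <= ln (real n^2/(\<kappa>*real m))" using km1 kmn by (intro ln_ge_zero) (simp add: le_divide_eq)
    then have "0 <= \<kappa>*real m*(2*ln (real n^2/(\<kappa>*real m)) + 1)" using kap by (intro mult_nonneg_nonneg) auto
    then show "0 <= 4*P" by (simp add: P_def algebra_simps)
    show "4*P <= 4*(10*\<kappa>*real m*L)" by (rule mult_left_mono[OF P2]) simp
   qed (use K1 L in auto)
   also have "... = 720*K*real m*(\<kappa>*L^2)" by (simp add: power2_eq_square)
   also have "\<kappa>*L^2 = L powr (- 1/4)"
   proof -
    have "L^2 = L powr 2" using L powr_realpow[of L 2] by simp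
    then show ?thesis by (simp add: \<kappa>_def flip: powr_add)
   qed
   also have "720*K*real m*L powr (- 1/4) <= \<eta>*real m/2"
   proof -
    have "1440*K/\<eta> <= L powr (1/4)" using QC(2) L(3) by linarith
    then have "1440*K <= \<eta>*L powr (1/4)" using eta by (simp add: divide_le_eq mult.commute)
    then have "1440*K*L powr (- 1/4) <= \<eta>*L powr (1/4)*L powr (- 1/4)" by (intro mult_right_mono) auto
    also have "... = \<eta>" using L by (simp add: mult.assoc flip: powr_add)
    finally have "real m*(1440*K*L powr (- 1/4)) <= real m*\<eta>" by (intro mult_left_mono) auto
    then show ?thesis by (simp add: algebra_simps)
   qed
   finally show ?thesis using 1 by (simp add: distrib_left)
  qed
  have adm: "admissible \<xi> \<kappa> n m X" if X: "Xmin <= X" "X <= real n" for X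
  proof (rule Cadm[OF n m kap])
   have CX: "C <= Xmin" unfolding XE using rC(1) E1 by (simp add: le_divide_eq)
   then show "C <= X" using X by linarith
   have "C*real m <= real n*Xmin"
   proof -
    have "real m/(real n*r) <= 1/(C*E)" using mnr La(4) by linarith
    then have "C*E*real m <= real n*r" using n r0 C16 E1 by (simp add: field_simps)
    then show ?thesis unfolding XE using E1 by (simp add: le_divide_eq mult_ac)
   qed
   also have "... <= real n*X" using X by (intro mult_left_mono) auto
   finally show "C*real m <= real n*X" .
   have L12: "L powr (3/2)*L powr (3/2) = L^3" using L powr_realpow[of L 3] by (simp flip: powr_add)
   have rlow: "real n powr (2/3)*L powr (3/2) <= r"
   proof -
    have "(real n powr (2/3)*L powr (3/2))^2 = real n powr (4/3)*L^3"
     using L12 by (simp add: power2_eq_square mult_ac flip: powr_add)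
    also have "... = \<mu>/L" using L by (simp add: \<mu>_def eval_nat_numeral)
    finally have "(real n powr (2/3)*L powr (3/2))^2 <= r^2" using r2L by simp
    then show ?thesis using r0 by (meson less_imp_le power2_le_imp_le)
   qed
   have "C*real n^2 <= \<kappa>^2*\<mu>*(real n powr (2/3)*L powr (3/2)/E)"
   proof -
    have "\<kappa>^2*\<mu>*(real n powr (2/3)*L powr (3/2)/E) = (real n powr (4/3)*real n powr (2/3))*(L powr (- 9/2)*L^4*L powr (3/2))/E"
     by (simp add: \<mu>_def kL)
    also have "real n powr (4/3)*real n powr (2/3) = real n^2" using n powr_realpow[of "real n" 2] by (simp flip: powr_add)
    also have "L powr (- 9/2)*L^4*L powr (3/2) = L"
    proof -
     have l4: "L^4 = L powr 4" using L powr_realpow[of L 4] by simp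
     have "L powr (- 9/2)*L^4*L powr (3/2) = L powr (- 9/2 + 4 + 3/2)" unfolding l4 by (simp only: powr_add)
     then show ?thesis using L by simp
    qed
    finally have e: "\<kappa>^2*\<mu>*(real n powr (2/3)*L powr (3/2)/E) = real n^2*L/E" .
    have "C*E*1 <= C*E*E" using C16 E1 by (intro mult_left_mono) auto
    then have "C*E <= L" using QC(1) L(4) by (simp add: power2_eq_square)
    then have "real n^2*(C*E) <= real n^2*L" by (intro mult_left_mono) auto
    then show ?thesis unfolding e using E1 by (simp add: le_divide_eq mult_ac)
   qed
   also have "... <= \<kappa>^2*real m*X"
   proof (intro mult_mono)
    have "real n powr (2/3)*L powr (3/2)/E <= r/E" using rlow E1 by (intro divide_right_mono) auto
    then show "real n powr (2/3)*L powr (3/2)/E <= X" using X XE by linarith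
   qed (use mu mu0 E1 in auto)
   finally show "C*real n^2 <= \<kappa>^2*real m*X" .
   have "C*real n^4 <= L^3*real n^4"
   proof (rule mult_right_mono)
    have "C*1 <= C*E^2" using C16 E1 by (intro mult_left_mono one_le_power) auto
    then show "C <= L^3" using QC(1) L(4) L3 by linarith
   qed simp
   also have "... = \<kappa>^4*\<mu>^3"
   proof -
    have "\<mu>^3 = real n^4*L powr 12"
     using n L powr_realpow[of L 12] powr_realpow[of "real n" 4] by (simp add: \<mu>_def power_mult_distrib powr_power flip: power_mult)
    moreover have "L powr (- 9)*L powr 12 = L^3"
    proof -
     have "L powr (- 9)*L powr 12 = L powr (- 9 + 12)" by (simp only: powr_add)
     then show ?thesis using L powr_realpow[of L 3] by (simp del: powr_numeral)
    qed
    ultimately show ?thesis unfolding kL by (simp add: mult_ac)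
   qed
   also have "... <= \<kappa>^4*real m^3" using mu mu0 kap by (intro mult_left_mono power_mono) auto
   finally show "C*real n^4 <= \<kappa>^4*real m^3" .
   have "C*real n <= \<kappa>*(\<mu>/L/E^2)"
   proof -
    have "C*E^2 <= L powr (3/4)" using QC(1) L(2) by linarith
    also have "... = \<kappa>*L^3"
    proof -
     have "L^3 = L powr 3" using L powr_realpow[of L 3] by simp
     then show ?thesis by (simp add: \<kappa>_def flip: powr_add)
    qed
    finally have "real n*(C*E^2) <= real n*(\<kappa>*L^3)" by (intro mult_left_mono) auto
    also have "... = \<kappa>*(real n*L^3)" by simp
    also have "... <= \<kappa>*(\<mu>/L)" using muL kap by (intro mult_left_mono) auto
    finally have h: "C*real n*E^2 <= \<kappa>*(\<mu>/L)" by (simp only: mult_ac)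
    have "E^2 > 0" using E1 by simp
    then have "C*real n <= \<kappa>*(\<mu>/L)/E^2" using h by (simp only: pos_le_divide_eq)
    then show ?thesis by simp
   qed
   also have "... <= \<kappa>*X^2"
   proof (rule mult_left_mono)
    have "\<mu>/L/E^2 <= r^2/E^2" using r2L by (intro divide_right_mono) auto
    also have "... = Xmin^2" by (simp add: XE power_divide)
    also have "... <= X^2" using X Xm0 by (intro power_mono) auto
    finally show "\<mu>/L/E^2 <= X^2" .
   qed (use kap in simp)
   finally show "C*real n <= \<kappa>*X^2" .
  qed
  have Xm1: "1 <= \<xi>*Xmin"
  proof -
   have "E <= \<xi>*r" using rC(3) xi by (simp add: divide_le_eq mult.commute)
   then show ?thesis unfolding XE using E1 by (simp add: le_divide_eq)
  qed
  have up: "rcard {G \<in> \<G> n m. \<not> close_to_split \<epsilon> {1..n} G}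
   <= exp (real m*(\<Lambda> - ln \<Lambda>/2 + 1/2 - b^2/2 + 2*\<eta>))"
   using card_not_close_le[OF n m eps b kap(1) La(1)[unfolded \<Lambda>_def] z, folded \<Lambda>_def \<eta>_def \<xi>_def, folded Xmin_def, OF zc adm Xm1 kk(1) P1 cost] .
  have low: "exp (real m*(\<Lambda> - ln \<Lambda>/2 + 1/2 - 4*\<eta>)) <= rcard (\<G> n m)"
  proof -
   have a: "1/r + r/real n + real m/(real n*r) <= \<eta>"
   proof -
    have "2 <= \<eta>*r" using rC(2) eta by (simp add: divide_le_eq mult.commute)
    then have "1/r <= \<eta>/2" using r0 by (simp add: field_simps)
    moreover have "exp (- \<Lambda>) + \<Lambda>*exp (- \<Lambda>) < \<eta>/2" using La(3) by (simp add: algebra_simps)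
    ultimately show ?thesis using rn1 mnr by linarith
   qed
   have b: "1/(2*\<Lambda>) <= \<eta>"
   proof -
    have "1/(2*\<Lambda>) <= 1/\<Lambda>" using La(1) by (simp add: field_simps)
    then show ?thesis using La(5) by linarith
   qed
   have c: "1 + ln (real m) <= \<eta>*real m"
   proof -
    have "(1 + ln (real m))/real m < \<eta>" using L(5) mu muL1 by simp
    then show ?thesis using m by (simp add: divide_less_eq)
   qed
   show ?thesis
    using card_induced_C4_free_ge[OF n m La(1)[unfolded \<Lambda>_def] eta, folded \<Lambda>_def, folded r_def, OF a b c] .
  qed
  have "exp (real m*(\<Lambda> - ln \<Lambda>/2 + 1/2 - b^2/2 + 2*\<eta>)) <= exp (- (b^2/4)*real m)*exp (real m*(\<Lambda> - ln \<Lambda>/2 + 1/2 - 4*\<eta>))"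
  proof -
   have "real m*(\<Lambda> - ln \<Lambda>/2 + 1/2 - b^2/2 + 2*\<eta>) <= real m*(- (b^2/4) + (\<Lambda> - ln \<Lambda>/2 + 1/2 - 4*\<eta>))"
    using b2 by (intro mult_left_mono) (auto simp: \<eta>_def)
   then show ?thesis by (simp add: algebra_simps flip: exp_add)
  qed
  also have "... <= exp (- (b^2/4)*real m)*rcard (\<G> n m)" using low by (intro mult_left_mono) auto
  finally have "rcard {G \<in> \<G> n m. \<not> close_to_split \<epsilon> {1..n} G} <= exp (- (b^2/4)*real m)*rcard (\<G> n m)"
   using up by linarith
  moreover have "0 < rcard (\<G> n m)" using low by (rule less_le_trans[OF exp_gt_zero])
  ultimately show ?thesis by simp
 qed
 show ?thesis
 proof (rule exI[of _ \<delta>], rule conjI[OF d0(1)], rule exI[of _ "b^2/4"], rule conjI)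
  show "0 < b\<^sup>2/4" using b2 by simp
  show "\<forall>\<^sub>F n in sequentially. \<forall>m. real n powr (4/3)*ln (real n)^4 <= real m --> real m <= \<delta>*real n^2 -->
   0 < card (\<G> n m) & rcard {G \<in> \<G> n m. \<not> close_to_split \<epsilon> {1..n} G} <= exp (- (b^2/4)*real m)*rcard (\<G> n m)"
   by (rule eventually_mono[OF ev]) (use main in blast)
 qed
qed

section \<open>Deletion and hypergeometric tails for part (a)\<close>

lemma two_choose_two: "2*(n choose 2) = n*(n - 1)"
proof -
 have "even (n*(n - 1))" by (cases n) auto
 then show ?thesis unfolding choose_two by simp
qed

text \<open>The chance that a fixed set of \<open>w\<close> elements lies in a uniform
  \<open>k\<close>-subset is a product of factors (k - i)/(N - i), each at most k/N.\<close>

lemma binomial_ratio_le: "w <= k ==> k <= N ==> real ((N - w) choose (k - w))*real N^w <= real (N choose k)*real k^w"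
proof (induction w)
 case (Suc w)
 have kw: "Suc (k - Suc w) = k - w" "Suc (N - Suc w) = N - w" "(N - w) - 1 = N - Suc w" using Suc.prems by auto
 have "(k - w)*((N - w) choose (k - w)) = (N - w)*((N - Suc w) choose (k - Suc w))"
  using binomial_absorption[of "k - Suc w" "N - w"] kw by simp
 then have "real ((k - w)*((N - w) choose (k - w))) = real ((N - w)*((N - Suc w) choose (k - Suc w)))" by (simp only:)
 then have e: "(real N - real w)*real ((N - Suc w) choose (k - Suc w)) = (real k - real w)*real ((N - w) choose (k - w))"
  using Suc.prems by (simp add: of_nat_diff)
 define B where "B = real ((N - Suc w) choose (k - Suc w))"
 have Nw: "real N - real w > 0" using Suc.prems by simp
 have "(real k - real w)*real N <= real k*(real N - real w)"
 proof -
  have "real w*real k <= real w*real N" using Suc.prems by (intro mult_left_mono) auto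
  then show ?thesis by (simp add: algebra_simps)
 qed
 then have "(real k - real w)*real N*(real ((N - w) choose (k - w))*real N^w)
   <= real k*(real N - real w)*(real ((N - w) choose (k - w))*real N^w)" by (intro mult_right_mono) auto
 also have "... <= real k*(real N - real w)*(real (N choose k)*real k^w)"
  using Suc Nw by (intro mult_left_mono) auto
 finally have le: "(real k - real w)*real N*(real ((N - w) choose (k - w))*real N^w) <= real k*(real N - real w)*(real (N choose k)*real k^w)" .
 have "(real N - real w)*(B*real N^Suc w) = ((real N - real w)*B)*(real N*real N^w)" by simp
 also have "... = ((real k - real w)*real ((N - w) choose (k - w)))*(real N*real N^w)" unfolding B_def e ..
 also have "... <= (real N - real w)*(real (N choose k)*real k^Suc w)" using le by (simp add: mult_ac)
 finally have "(real N - real w)*(B*real N^Suc w) <= (real N - real w)*(real (N choose k)*real k^Suc w)" .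
 then show ?case unfolding B_def[symmetric] using Nw by (rule mult_left_le_imp_le)
qed simp

lemma card_supersets:
 assumes U: "finite U" and W: "W <= U"
 shows "card {G. W <= G & G <= U & card G = card W + t} <= (card U - card W) choose t"
proof -
 have fW: "finite W" using U W finite_subset by blast
 have "card {G. W <= G & G <= U & card G = card W + t} <= card {S. S <= U - W & card S = t}"
 proof (rule card_inj_on_le[where f = "%G. G - W"])
  show "inj_on (%G. G - W) {G. W <= G & G <= U & card G = card W + t}" by (auto simp: inj_on_def)
  show "(%G. G - W) ` {G. W <= G & G <= U & card G = card W + t} <= {S. S <= U - W & card S = t}"
   using fW by (auto simp: card_Diff_subset)
  show "finite {S. S <= U - W & card S = t}" by (rule finite_subset[of _ "Pow U"]) (use U in auto)
 qed
 also have "... = (card U - card W) choose t" using U fW W by (simp add: n_subsets card_Diff_subset)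
 finally show ?thesis .
qed

lemma card_supersets_ratio:
 assumes U: "finite U" and W: "W <= U" and k: "k <= card U"
 shows "rcard {G. W <= G & G <= U & card G = k}*rcard U^card W <= real (card U choose k)*real k^card W"
proof (cases "card W <= k")
 case True
 then obtain t where t: "k = card W + t" using le_Suc_ex by blast
 have "rcard {G. W <= G & G <= U & card G = k}*rcard U^card W <= real ((card U - card W) choose (k - card W))*rcard U^card W"
  using card_supersets[OF U W, of t] unfolding t by (intro mult_right_mono) auto
 then show ?thesis using binomial_ratio_le[OF True k] by linarith
next
 case False
 have "card W <= card G" if "W <= G" "G <= U" for G using that U finite_subset by (metis card_mono)
 then have "{G. W <= G & G <= U & card G = k} = {}" using False by auto
 then show ?thesis by (simp only: card.empty) simp
qed

text \<open>One edge of each 4-cycle is removed, then further edges until exactly \<open>m\<close>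
  are left; removal creates no new 4-cycle because copies need not be induced.\<close>

lemma delete_cycles:
 assumes G: "finite G" "G <= nsets V 2" "finite V" and c: "card (cyc4 G) <= t" "card G = m + t"
 shows "\<exists>H\<subseteq>G. card H = m & cyc4 H = {}"
proof -
 define B where "B = (%s. {s ! 0, s ! 1}) ` cyc4 G"
 have fc: "finite (cyc4 G)" using finite_cyc4 G by blast
 have "card B <= t" unfolding B_def using card_image_le[OF fc] c(1) by (rule order_trans)
 moreover have "card G - card B <= card (G - B)" by (rule diff_card_le_card_Diff) (simp add: B_def fc)
 ultimately have "m <= card (G - B)" using c(2) by linarith
 then obtain H where H: "H <= G - B" "card H = m" by (meson obtain_subset_with_card_n)
 have "cyc4 H = {}"
 proof -
  have False if sH: "s \<in> cyc4 H" for s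
  proof -
   obtain a b c d where s: "s = [a, b, c, d]" "{a, b} \<in> H" using sH unfolding cyc4_def by blast
   have "s \<in> cyc4 G" using sH H(1) unfolding cyc4_def by blast
   then have "{a, b} \<in> B" unfolding B_def s(1) by (rule image_eqI[rotated]) simp
   then show False using s(2) H(1) by blast
  qed
  then show ?thesis by blast
 qed
 then show ?thesis using H by blast
qed

lemma no_cyc4_free:
 assumes "cyc4 H = {}" shows "\<not> contains_induced V H C4_verts C4_edges"
proof (rule no_C4_imp_no_induced)
 fix a b c d assume "distinct [a, b, c, d]" "{a, b} \<in> H" "{b, c} \<in> H" "{c, d} \<in> H" "{a, d} \<in> H"
 then have "[a, b, c, d] \<in> cyc4 H" unfolding cyc4_mem by blast
 then show False using assms by blast
qed

text \<open>By \<open>few\<close>, a random graph with \<open>m + t\<close> edges has on average at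
  most \<open>t/2\<close> ordered 4-cycles, so half of these graphs can be cleaned. A cleaned graph
  arises from at most \<open>(N - m) choose t\<close> of them, and \<open>choose_mult\<close> turns
  this into a loss of \<open>2*((m + t) choose m)\<close> only.\<close>

lemma card_induced_C4_free_deletion:
 fixes n m t :: nat
 defines "N \<equiv> n choose 2"
 assumes mt: "m + t <= N" and t: "1 <= t" and few: "2*real n^4*real (m + t)^4 <= real t*real N^4"
 shows "real (N choose m) <= 2*real ((m + t) choose m)*rcard (\<G> n m)"
proof -
 define V where "V = {1..n}"
 define U where "U = nsets V 2"
 have fV: "finite V" and fU: "finite U" and cU: "card U = N"
  by (simp_all add: V_def U_def N_def finite_imp_finite_nsets)
 have N0: "real N > 0" using mt t by simp
 define GG where "GG = {G. G <= U & card G = m + t}"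
 have fGG: "finite GG" unfolding GG_def by (rule finite_subset[of _ "Pow U"]) (use fU in auto)
 have cGG: "card GG = N choose (m + t)" using n_subsets[OF fU] cU by (simp add: GG_def)
 define Tp where "Tp = {xs. set xs <= V & length xs = 4 & distinct xs}"
 have fT: "finite Tp" unfolding Tp_def by (rule finite_subset[OF _ finite_lists_length_eq[OF fV, of 4]]) auto
 have cT: "card Tp <= n^4"
 proof -
  have "card Tp <= card {xs. set xs <= V & length xs = 4}" unfolding Tp_def by (intro card_mono finite_lists_length_eq fV) auto
  then show ?thesis by (simp add: card_lists_length_eq fV) (simp add: V_def)
 qed
 define es where "es xs = (case xs of [a, b, c, d] => {{a, b}, {b, c}, {c, d}, {a, d}} | _ => {})" for xs :: "nat list"
 have cyc: "cyc4 G = {xs\<in>Tp. es xs <= G}" if "G \<in> GG" for G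
 proof -
  have GU: "G <= nsets V 2" using that by (simp add: GG_def U_def)
  show ?thesis
  proof (intro equalityI subsetI)
   fix xs assume "xs \<in> cyc4 G"
   then obtain a b c d where x: "xs = [a, b, c, d]" "distinct [a, b, c, d]" "{a, b} \<in> G" "{b, c} \<in> G" "{c, d} \<in> G" "{a, d} \<in> G"
    unfolding cyc4_def by blast
   have "a \<in> V" "b \<in> V" "c \<in> V" "d \<in> V" using edge_in[OF GU] x by blast+
   then show "xs \<in> {xs\<in>Tp. es xs <= G}" using x by (simp add: Tp_def es_def)
  next
   fix xs assume xs: "xs \<in> {xs\<in>Tp. es xs <= G}"
   then have "length xs = 4" by (simp add: Tp_def)
   then obtain a b c d where x: "xs = [a, b, c, d]" by (auto simp: length_Suc_conv eval_nat_numeral)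
   show "xs \<in> cyc4 G" using xs unfolding x cyc4_mem by (simp add: Tp_def es_def)
  qed
 qed
 have es4: "es xs <= U & card (es xs) = 4" if "xs \<in> Tp" for xs
 proof -
  from that have "length xs = 4" by (simp add: Tp_def)
  then obtain a b c d where x: "xs = [a, b, c, d]" by (auto simp: length_Suc_conv eval_nat_numeral)
  have d: "distinct [a, b, c, d]" "{a, b, c, d} <= V" using that by (auto simp: x Tp_def)
  have "card (es xs) = 4" using d(1) by (simp add: x es_def doubleton_eq_iff)
  moreover have "es xs <= U" using d by (auto simp: x es_def U_def nsets_def)
  ultimately show ?thesis by blast
 qed
 have "(\<Sum>G\<in>GG. rcard (cyc4 G))*real N^4 <= real n^4*real (N choose (m + t))*real (m + t)^4"
 proof -
  have "(\<Sum>G\<in>GG. rcard (cyc4 G)) = (\<Sum>G\<in>GG. \<Sum>xs\<in>Tp. of_bool (es xs <= G))"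
  proof (rule sum.cong)
   fix G assume G: "G \<in> GG"
   show "rcard (cyc4 G) = (\<Sum>xs\<in>Tp. of_bool (es xs <= G))"
    unfolding cyc[OF G] using fT by (simp add: Int_def)
  qed simp
  also have "... = (\<Sum>xs\<in>Tp. \<Sum>G\<in>GG. of_bool (es xs <= G))" by (rule sum.swap)
  also have "... = (\<Sum>xs\<in>Tp. rcard {G. es xs <= G & G <= U & card G = m + t})"
  proof (rule sum.cong)
   fix xs
   have "{G. es xs <= G & G <= U & card G = m + t} = {G\<in>GG. es xs <= G}" by (auto simp: GG_def)
   then show "(\<Sum>G\<in>GG. of_bool (es xs <= G)) = rcard {G. es xs <= G & G <= U & card G = m + t}"
    using fGG by (simp add: Int_def)
  qed simp
  finally have "(\<Sum>G\<in>GG. rcard (cyc4 G))*real N^4 = (\<Sum>xs\<in>Tp. rcard {G. es xs <= G & G <= U & card G = m + t}*real N^4)"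
   by (simp add: sum_distrib_right)
  also have "... <= (\<Sum>xs\<in>Tp. real (N choose (m + t))*real (m + t)^4)"
  proof (rule sum_mono)
   fix xs assume "xs \<in> Tp"
   then show "rcard {G. es xs <= G & G <= U & card G = m + t}*real N^4 <= real (N choose (m + t))*real (m + t)^4"
    using card_supersets_ratio[OF fU, of "es xs" "m + t"] es4 mt cU by simp
  qed
  also have "... = rcard Tp*(real (N choose (m + t))*real (m + t)^4)" by simp
  also have "... <= real (n^4)*(real (N choose (m + t))*real (m + t)^4)" using cT by (intro mult_right_mono of_nat_mono) auto
  finally show ?thesis by (simp add: mult.assoc)
 qed
 also have "... <= real (N choose (m + t))*(real t*real N^4)/2"
 proof -
  have "real (N choose (m + t))*(2*real n^4*real (m + t)^4) <= real (N choose (m + t))*(real t*real N^4)"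
   using few by (intro mult_left_mono) auto
  then show ?thesis by (simp add: algebra_simps)
 qed
 finally have S: "(\<Sum>G\<in>GG. rcard (cyc4 G)) <= real (N choose (m + t))*real t/2"
  using N0 by (simp add: mult.assoc[symmetric])
 define good where "good = {G\<in>GG. card (cyc4 G) <= t}"
 have "real t*rcard (GG - good) <= (\<Sum>G\<in>GG - good. rcard (cyc4 G))"
 proof -
  have "(\<Sum>G\<in>GG - good. real t) <= (\<Sum>G\<in>GG - good. rcard (cyc4 G))" by (rule sum_mono) (auto simp: good_def)
  then show ?thesis by (simp add: mult.commute)
 qed
 also have "... <= (\<Sum>G\<in>GG. rcard (cyc4 G))" using fGG by (intro sum_mono2) auto
 finally have "real t*rcard (GG - good) <= (\<Sum>G\<in>GG. rcard (cyc4 G))" .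
 moreover have "real (N choose (m + t))*real t/2 = real t*(real (N choose (m + t))/2)" by simp
 ultimately have "real t*rcard (GG - good) <= real t*(real (N choose (m + t))/2)" using S by linarith
 then have "rcard (GG - good) <= real (N choose (m + t))/2" using t by simp
 moreover have "card (GG - good) = card GG - card good"
  using fGG by (intro card_Diff_subset) (auto simp: good_def)
 moreover have "card good <= card GG" using fGG by (intro card_mono) (auto simp: good_def)
 ultimately have g1: "real (N choose (m + t)) <= 2*rcard good" using cGG by (simp add: of_nat_diff)
 let ?F = "\<G> n m"
 have "good <= (\<Union>H\<in>?F. {G. H <= G & G <= U & card G = m + t})"
 proof
  fix G assume G: "G \<in> good"
  then have g: "G <= U" "card G = m + t" "card (cyc4 G) <= t" by (auto simp: good_def GG_def)
  have fG: "finite G" using g(1) fU finite_subset by blast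
  obtain H where H: "H <= G" "card H = m" "cyc4 H = {}"
   using delete_cycles[OF fG _ fV g(3,2)] g(1) unfolding U_def by blast
  have "H \<in> ?F" using H g(1) no_cyc4_free[OF H(3)] unfolding induced_C4_free_graphs_def U_def V_def by blast
  then show "G \<in> (\<Union>H\<in>?F. {G. H <= G & G <= U & card G = m + t})" using H(1) g(1,2) by blast
 qed
 then have "card good <= card (\<Union>H\<in>?F. {G. H <= G & G <= U & card G = m + t})"
  using finite_induced_C4_free fU by (intro card_mono finite_UN_I) (auto intro: finite_subset[of _ "Pow U"])
 also have "... <= (\<Sum>H\<in>?F. card {G. H <= G & G <= U & card G = m + t})" by (rule card_UN_le[OF finite_induced_C4_free])
 also have "... <= (\<Sum>H\<in>?F. (N - m) choose t)"
 proof (rule sum_mono)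
  fix H assume "H \<in> ?F"
  then have "H <= U" "card H = m" by (auto simp: induced_C4_free_graphs_def U_def V_def)
  then show "card {G. H <= G & G <= U & card G = m + t} <= (N - m) choose t" using card_supersets[OF fU, of H t] cU by simp
 qed
 finally have "rcard good <= real (card ?F*((N - m) choose t))" by (simp only: of_nat_le_iff sum_constant of_nat_id)
 then have g2: "real (N choose (m + t)) <= 2*(rcard ?F*real ((N - m) choose t))" using g1 by simp
 have "(N choose (m + t))*((m + t) choose m) = (N choose m)*((N - m) choose t)"
  using choose_mult[of m "m + t" N] mt by simp
 then have "real (N choose m)*real ((N - m) choose t) = real (N choose (m + t))*real ((m + t) choose m)"
  by (metis of_nat_mult)
 also have "... <= 2*(rcard ?F*real ((N - m) choose t))*real ((m + t) choose m)" using g2 by (intro mult_right_mono) auto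
 finally have "real (N choose m)*real ((N - m) choose t) <= 2*real ((m + t) choose m)*rcard ?F*real ((N - m) choose t)"
  by (simp add: mult_ac)
 moreover have "real ((N - m) choose t) > 0" using mt by simp
 ultimately show ?thesis by (rule mult_right_le_imp_le)
qed

text \<open>Exponential moment of \<open>card (G Int Y)\<close> with base
  \<open>1 + \<gamma>/4\<close>. Expanding over subsets \<open>W\<close> of \<open>Y\<close> and
  bounding each inclusion probability by \<open>(m/N)^card W\<close> reduces the hypergeometric law
  to the binomial one.\<close>

lemma hypergeometric_tail:
 assumes U: "finite U" "card U > 0" and Y: "Y <= U" and m: "m <= card U" and g: "0 <= \<gamma>" "\<gamma> <= 1"
 shows "rcard {G. G <= U & card G = m & (rcard Y/rcard U + \<gamma>)*real m <= rcard (G Int Y)}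
  <= real (card U choose m)*exp (- (\<gamma>^2/8)*real m)" (is "rcard ?S <= _")
proof -
 define N where "N = rcard U"
 define y where "y = rcard Y/N"
 define a where "a = \<gamma>/4"
 have N0: "N > 0" using U by (simp add: N_def)
 have fY: "finite Y" using U Y finite_subset by blast
 have yle: "0 <= y" "y <= 1" using U Y N0 by (auto simp: y_def N_def card_mono)
 have a: "0 <= a" "a <= 1" using g by (auto simp: a_def)
 let ?A = "{G. G <= U & card G = m}"
 have fA: "finite ?A" by (rule finite_subset[of _ "Pow U"]) (use U in auto)
 have "rcard ?S*exp ((y + \<gamma>)*real m*ln (1 + a)) = (\<Sum>G\<in>?S. exp ((y + \<gamma>)*real m*ln (1 + a)))" by simp
 also have "... <= (\<Sum>G\<in>?S. (1 + a)^card (G Int Y))"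
 proof (rule sum_mono)
  fix G assume "G \<in> ?S"
  then have "(y + \<gamma>)*real m*ln (1 + a) <= rcard (G Int Y)*ln (1 + a)"
   using a by (intro mult_right_mono) (auto simp: y_def N_def)
  then have "exp ((y + \<gamma>)*real m*ln (1 + a)) <= exp (rcard (G Int Y)*ln (1 + a))" by simp
  also have "... = (1 + a)^card (G Int Y)" using a by (simp add: exp_of_nat_mult)
  finally show "exp ((y + \<gamma>)*real m*ln (1 + a)) <= (1 + a)^card (G Int Y)" .
 qed
 also have "... <= (\<Sum>G\<in>?A. (1 + a)^card (G Int Y))" using fA a by (intro sum_mono2) auto
 also have "... = (\<Sum>G\<in>?A. \<Sum>W\<in>Pow Y. a^card W* of_bool (W <= G))"
 proof (rule sum.cong)
  fix G
  have "(1 + a)^card (G Int Y) = (\<Sum>W\<in>Pow (G Int Y). a^card W)"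
   using prod_add[of "G Int Y" "%_. a" "%_. 1"] fY by (simp add: add.commute)
  also have "... = (\<Sum>W\<in>Pow Y. a^card W* of_bool (W <= G))"
   using fY by (intro sum.mono_neutral_cong_left) auto
  finally show "(1 + a)^card (G Int Y) = (\<Sum>W\<in>Pow Y. a^card W* of_bool (W <= G))" .
 qed simp
 also have "... = (\<Sum>W\<in>Pow Y. a^card W*(\<Sum>G\<in>?A. of_bool (W <= G)))"
  by (subst sum.swap) (simp add: sum_distrib_left)
 also have "... <= (\<Sum>W\<in>Pow Y. a^card W*(real (card U choose m)*(real m/N)^card W))"
 proof (intro sum_mono mult_left_mono)
  fix W assume W: "W \<in> Pow Y"
  have "(\<Sum>G\<in>?A. of_bool (W <= G)) = rcard {G. W <= G & G <= U & card G = m}"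
  proof -
   have "{G. W <= G & G <= U & card G = m} = ?A Int {G. W <= G}" by auto
   then show ?thesis using fA by simp
  qed
  moreover have "rcard {G. W <= G & G <= U & card G = m}*N^card W <= real (card U choose m)*real m^card W"
   unfolding N_def by (rule card_supersets_ratio[OF U(1) _ m]) (use W Y in auto)
  ultimately show "(\<Sum>G\<in>?A. of_bool (W <= G)) <= real (card U choose m)*(real m/N)^card W"
   using N0 by (simp add: power_divide le_divide_eq)
 qed (use a in simp)
 also have "... = real (card U choose m)*(\<Sum>W\<in>Pow Y. (a*(real m/N))^card W)"
  by (simp only: sum_distrib_left power_mult_distrib mult_ac)
 also have "(\<Sum>W\<in>Pow Y. (a*(real m/N))^card W) = (a*(real m/N) + 1)^card Y"
  using prod_add[OF fY, of "%_. a*(real m/N)" "%_. 1"] by simp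
 also have "... <= exp (a*(real m/N))^card Y"
  using a N0 by (intro power_mono) (auto simp: add.commute exp_ge_add_one_self)
 also have "... = exp (y*real m*a)" by (simp add: y_def mult_ac flip: exp_of_nat_mult)
 finally have "rcard ?S*exp ((y + \<gamma>)*real m*ln (1 + a)) <= real (card U choose m)*exp (y*real m*a)"
  by (simp add: mult_left_mono)
 then have "rcard ?S <= real (card U choose m)*exp (y*real m*a)/exp ((y + \<gamma>)*real m*ln (1 + a))"
  by (simp add: le_divide_eq)
 also have "... = real (card U choose m)*exp (y*real m*a - (y + \<gamma>)*real m*ln (1 + a))" by (simp add: exp_diff)
 also have "... <= real (card U choose m)*exp (- (\<gamma>^2/8)*real m)"
 proof (intro mult_left_mono)
  have "a - a^2 <= ln (1 + a)" using a by (intro ln_one_plus_pos_lower_bound)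
  then have "(y + \<gamma>)*(a - a^2) <= (y + \<gamma>)*ln (1 + a)" using yle g by (intro mult_left_mono) auto
  moreover have "(y + \<gamma>)*a^2 <= 2*a^2" using yle g by (intro mult_right_mono) auto
  moreover have "2*a^2 - \<gamma>*a = - (\<gamma>^2/8)" by (simp add: a_def power2_eq_square)
  ultimately have "y*a - (y + \<gamma>)*ln (1 + a) <= - (\<gamma>^2/8)" by (simp add: algebra_simps)
  then have "(y*a - (y + \<gamma>)*ln (1 + a))*real m <= - (\<gamma>^2/8)*real m" by (intro mult_right_mono) auto
  then show "exp (y*real m*a - (y + \<gamma>)*real m*ln (1 + a)) <= exp (- (\<gamma>^2/8)*real m)" by (simp add: algebra_simps)
 qed simp
 finally show ?thesis by (simp add: y_def N_def)
qed

text \<open>Too few edges inside a set mean too many on the other pairs, so one upper tail serves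
  both cases. A set with more than \<open>\<epsilon>*n\<close> vertices spans at least the share
  \<open>\<epsilon>^2/2\<close> of all pairs, which turns the relative error \<epsilon> into the
  absolute error \<open>\<epsilon>^3/2\<close>; then a union bound over \<open>2^n\<close>
  sets.\<close>

lemma card_not_quasirandom_le:
 fixes n m :: nat
 defines "N \<equiv> n choose 2"
 assumes m: "m <= N" and eps: "0 < \<epsilon>" "\<epsilon> <= 1" and n: "2/\<epsilon> <= real n" "2 <= n"
 shows "rcard {G. G <= nsets {1..n} 2 & card G = m & \<not> quasirandom \<epsilon> {1..n} G}
  <= 2*2^n*real (N choose m)*exp (- (\<epsilon>^6/32)*real m)"
proof -
 define V where "V = {1..n}"
 define U where "U = nsets V 2"
 have fV: "finite V" "card V = n" and fU: "finite U" and cU: "card U = N"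
  by (simp_all add: V_def U_def N_def finite_imp_finite_nsets)
 have Nr: "real N = real n*(real n - 1)/2"
 proof -
  have "2*N = n*(n - 1)" unfolding N_def by (rule two_choose_two)
  then have "2*real N = real n*real (n - 1)" by (metis of_nat_mult of_nat_numeral)
  then show ?thesis using n(2) by (simp add: of_nat_diff)
 qed
 have N0: "real N > 0" unfolding Nr using n(2) by simp
 define \<gamma> where "\<gamma> = \<epsilon>^3/2"
 have g: "0 <= \<gamma>" "\<gamma> <= 1" using eps power_le_one[of \<epsilon> 3] by (auto simp: \<gamma>_def)
 have g2: "\<gamma>^2/8 = \<epsilon>^6/32" by (simp add: \<gamma>_def power_divide flip: power_mult)
 define bad where "bad Y = {G. G <= U & card G = m & (rcard Y/rcard U + \<gamma>)*real m <= rcard (G Int Y)}" for Y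
 have badc: "rcard (bad Y) <= real (N choose m)*exp (- (\<epsilon>^6/32)*real m)" if "Y <= U" for Y
  using hypergeometric_tail[OF fU _ that _ g, of m] m N0 cU unfolding bad_def g2 by simp
 let ?D = "%X. bad (nsets X 2) Un bad (U - nsets X 2)"
 have "{G. G <= U & card G = m & \<not> quasirandom \<epsilon> V G} <= (\<Union>X\<in>Pow V. ?D X)"
 proof
  fix G assume G: "G \<in> {G. G <= U & card G = m & \<not> quasirandom \<epsilon> V G}"
  then have GU: "G <= U" "card G = m" by auto
  have fG: "finite G" using GU fU finite_subset by blast
  from G obtain X where X: "X <= V" "rcard X > \<epsilon>*real n"
   and viol: "\<not> ((1 - \<epsilon>)*edge_density G V <= edge_density G X & edge_density G X <= (1 + \<epsilon>)*edge_density G V)"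
   using fV(2) unfolding quasirandom_def by auto
  define x where "x = rcard X"
  define q where "q = real (card X choose 2)/real N"
  have en: "2 <= \<epsilon>*real n" using n(1) eps by (simp add: divide_le_eq mult.commute)
  have x: "x > \<epsilon>*real n" using X by (simp add: x_def)
  have cx: "real (card X choose 2) = x*(x - 1)/2"
  proof -
   have "2*(card X choose 2) = card X*(card X - 1)" by (rule two_choose_two)
   then have "2*real (card X choose 2) = rcard X*real (card X - 1)" by (metis of_nat_mult of_nat_numeral)
   moreover have "1 <= card X" using x en unfolding x_def by linarith
   ultimately show ?thesis by (simp add: of_nat_diff x_def)
  qed
  have "\<epsilon>^2/2 <= q"
  proof -
   have "\<epsilon>/2*(real n - 1) = \<epsilon>*real n/2 - \<epsilon>/2" by (simp add: field_simps)
   then have "\<epsilon>/2*(real n - 1) <= x - 1" using x en eps by linarith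
   then have "\<epsilon>*real n*(\<epsilon>/2*(real n - 1)) <= x*(x - 1)" using x en eps n(2) by (intro mult_mono) auto
   then have "\<epsilon>^2/2*real N <= real (card X choose 2)" unfolding Nr cx by (simp add: algebra_simps power2_eq_square)
   then show ?thesis unfolding q_def using N0 by (simp add: le_divide_eq)
  qed
  then have eq: "\<gamma> <= \<epsilon>*q" using mult_left_mono[of "\<epsilon>^2/2" q \<epsilon>] eps by (simp add: \<gamma>_def power2_eq_square power3_eq_cube)
  have cX0: "real (card X choose 2) > 0"
  proof -
   have "x > 2" using x en by linarith
   then show ?thesis unfolding cx by simp
  qed
  have X2U: "nsets X 2 <= U" unfolding U_def using X(1) by (rule nsets_mono)
  have cX2: "card (nsets X 2) = card X choose 2" by simp
  have "{e\<in>G. e <= X} = G Int nsets X 2" using GU(1) by (auto simp: U_def nsets_def)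
  then have ew: "edges_within G X = card (G Int nsets X 2)" by (simp add: edges_within_def)
  have "{e\<in>G. e <= V} = G" using GU(1) by (auto simp: U_def nsets_def)
  then have eV: "edge_density G V = real m/real N" using GU fV by (simp add: edge_density_def edges_within_def N_def)
  have dX: "edge_density G X = rcard (G Int nsets X 2)/(q*real N)" using N0 by (simp add: edge_density_def ew q_def)
  have qN: "q*real N > 0" using cX0 N0 by (simp add: q_def)
  have "(1 + \<epsilon>)*q*real m <= rcard (G Int nsets X 2) \<or> rcard (G Int nsets X 2) <= (1 - \<epsilon>)*q*real m"
  proof (rule ccontr)
   assume "\<not> ?thesis"
   then have h: "rcard (G Int nsets X 2) <= (1 + \<epsilon>)*q*real m" "(1 - \<epsilon>)*q*real m <= rcard (G Int nsets X 2)" by auto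
   have "edge_density G X <= (1 + \<epsilon>)*edge_density G V"
    unfolding dX eV using h(1) qN N0 by (simp add: divide_le_eq mult_ac)
   moreover have "(1 - \<epsilon>)*edge_density G V <= edge_density G X"
    unfolding dX eV using h(2) qN N0 by (simp add: le_divide_eq mult_ac)
   ultimately show False using viol by blast
  qed
  then have "G \<in> ?D X"
  proof
   assume h: "(1 + \<epsilon>)*q*real m <= rcard (G Int nsets X 2)"
   have "(q + \<gamma>)*real m <= (1 + \<epsilon>)*q*real m" using eq by (intro mult_right_mono) (auto simp: algebra_simps)
   then have "G \<in> bad (nsets X 2)" using h GU cU unfolding bad_def cX2 q_def by simp
   then show ?thesis by blast
  next
   assume h: "rcard (G Int nsets X 2) <= (1 - \<epsilon>)*q*real m"
   have "card (G Int (U - nsets X 2)) + card (G Int nsets X 2) = m"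
   proof -
    have "card ((G Int (U - nsets X 2)) Un (G Int nsets X 2)) = card (G Int (U - nsets X 2)) + card (G Int nsets X 2)"
     using fG by (intro card_Un_disjoint) auto
    moreover have "(G Int (U - nsets X 2)) Un (G Int nsets X 2) = G" using GU(1) by auto
    ultimately show ?thesis using GU(2) by simp
   qed
   then have s: "rcard (G Int (U - nsets X 2)) + rcard (G Int nsets X 2) = real m" by linarith
   have fX2: "finite (nsets X 2)" using X2U fU finite_subset by blast
   have "rcard (U - nsets X 2)/rcard U = 1 - q"
    using X2U fX2 cU cX2 N0 card_mono[OF fU X2U] by (simp add: card_Diff_subset of_nat_diff q_def diff_divide_distrib)
   moreover have "(1 - q + \<gamma>)*real m <= real m - (1 - \<epsilon>)*q*real m"
   proof -
    have "(1 - q + \<gamma>)*real m <= (1 - q + \<epsilon>*q)*real m" using eq by (intro mult_right_mono) auto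
    then show ?thesis by (simp add: algebra_simps)
   qed
   ultimately have "G \<in> bad (U - nsets X 2)" using h s GU unfolding bad_def by simp
   then show ?thesis by blast
  qed
  then show "G \<in> (\<Union>X\<in>Pow V. ?D X)" using X(1) by blast
 qed
 moreover have finbad: "finite (bad Y)" for Y unfolding bad_def by (rule finite_subset[of _ "Pow U"]) (use fU in auto)
 ultimately have "card {G. G <= U & card G = m & \<not> quasirandom \<epsilon> V G} <= card (\<Union>X\<in>Pow V. ?D X)"
  using fV by (intro card_mono) auto
 also have "... <= (\<Sum>X\<in>Pow V. card (?D X))" using fV by (intro card_UN_le) auto
 finally have "rcard {G. G <= U & card G = m & \<not> quasirandom \<epsilon> V G} <= real (\<Sum>X\<in>Pow V. card (?D X))" by (simp only: of_nat_le_iff)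
 also have "... = (\<Sum>X\<in>Pow V. rcard (?D X))" by simp
 also have "... <= (\<Sum>X\<in>Pow V. 2*(real (N choose m)*exp (- (\<epsilon>^6/32)*real m)))"
 proof (rule sum_mono)
  fix X assume "X \<in> Pow V"
  then have X2U: "nsets X 2 <= U" unfolding U_def by (intro nsets_mono) auto
  have "card (?D X) <= card (bad (nsets X 2)) + card (bad (U - nsets X 2))" by (rule card_Un_le)
  then have "rcard (?D X) <= rcard (bad (nsets X 2)) + rcard (bad (U - nsets X 2))" by linarith
  then show "rcard (?D X) <= 2*(real (N choose m)*exp (- (\<epsilon>^6/32)*real m))"
   using badc[OF X2U] badc[of "U - nsets X 2"] by auto
 qed
 also have "... = 2^n*(2*(real (N choose m)*exp (- (\<epsilon>^6/32)*real m)))" using fV by (simp add: card_Pow)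
 finally show ?thesis by (simp add: U_def V_def mult_ac)
qed

lemma asymptotically_almost_surely_of_count:
 assumes "\<forall>\<^sub>F n in sequentially. finite (S n) & 0 < card (S n) & rcard {G \<in> S n. \<not> P n G} <= e n*rcard (S n)"
  and e: "e \<longlonglongrightarrow> 0"
 shows "asymptotically_almost_surely S P"
 unfolding asymptotically_almost_surely_def
proof (rule tendsto_sandwich)
 have p: "1 - e n <= measure_pmf.prob (pmf_of_set (S n)) {G. P n G}"
  if a: "finite (S n) & 0 < card (S n) & rcard {G \<in> S n. \<not> P n G} <= e n*rcard (S n)" for n
 proof -
  have ne: "S n ~= {}" "finite (S n)" using a by auto
  have "card (S n) = card (S n Int {G. P n G}) + card {G \<in> S n. \<not> P n G}"
   using ne(2) by (subst card_Un_disjoint[symmetric]) (auto intro: arg_cong[where f = card])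
  then have "rcard (S n)*(1 - e n) <= rcard (S n Int {G. P n G})" using a by (simp add: algebra_simps)
  then show ?thesis using a ne by (simp add: measure_pmf_of_set le_divide_eq mult.commute)
 qed
 show "\<forall>\<^sub>F n in sequentially. 1 - e n <= measure_pmf.prob (pmf_of_set (S n)) {G. P n G}"
  by (rule eventually_mono[OF assms(1) p])
 show "\<forall>\<^sub>F n in sequentially. measure_pmf.prob (pmf_of_set (S n)) {G. P n G} <= 1" by simp
 show "(%n. 1 - e n) \<longlonglongrightarrow> 1" using tendsto_diff[OF tendsto_const e, of 1] by simp
qed simp

lemma smallo_nat_eventually:
 assumes "(%n. real n) \<in> o(%n. real (m n))" "c > 0"
 shows "\<forall>\<^sub>F n in sequentially. real n <= c*real (m n)"
 using landau_o.smallD[OF assms] by simp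

text \<open>With \<open>t\<close> about \<open>\<eta>*m\<close> the deletion loss is at most
  exponential in \<open>2*\<eta>*(1 - ln \<eta>)*m\<close>, half of the tail exponent for small
  \<eta>. The union over \<open>2^n\<close> sets is harmless as n is of smaller order than
  m.\<close>

lemma quasirandom_aas:
 assumes eps: "0 < \<epsilon>" "\<epsilon> <= 1"
 shows "\<exists>\<delta>>0. \<forall>m. (%n. real n) \<in> o(%n. real (m n)) --> (\<forall>\<^sub>F n in sequentially. real (m n) <= \<delta>*real n powr (4/3)) -->
  asymptotically_almost_surely (%n. \<G> n (m n)) (%n G. quasirandom \<epsilon> {1..n} G)"
proof -
 define g where "g = \<epsilon>^6/32"
 have g0: "g > 0" using eps by (simp add: g_def)
 have "((%x::real. 2*x*(1 - ln x)) \<longlongrightarrow> 0) (at_right 0)" by real_asymp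
 then have "\<forall>\<^sub>F x in at_right 0. 2*x*(1 - ln x) < g/2" by (rule order_tendstoD) (use g0 in simp)
 then obtain e where e: "e > 0" "\<And>x. 0 < x ==> x < e ==> 2*x*(1 - ln x) < g/2"
  unfolding eventually_at_right_field by blast
 define \<eta> where "\<eta> = min (e/2) (1/2)"
 have eta: "0 < \<eta>" "\<eta> <= 1/2" "2*\<eta>*(1 - ln \<eta>) <= g/2" using e(1) e(2)[of \<eta>] by (auto simp: \<eta>_def min_def)
 \<comment> \<open>8192 is \<open>2*2^4*4^4\<close>, the factors lost in the condition
   \<open>few\<close> through \<open>m + t <= 2*m\<close> and \<open>N >= n^2/4\<close>.\<close>
 define \<delta> where "\<delta> = \<eta>/8192"
 have d0: "0 < \<delta>" "\<delta> <= 1" using eta by (auto simp: \<delta>_def)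
 have main: "0 < card (\<G> n m) & rcard {G \<in> \<G> n m. \<not> quasirandom \<epsilon> {1..n} G}
   <= 4*exp (- real n)*rcard (\<G> n m)"
  if hi: "real m <= \<delta>*real n powr (4/3)" and n: "2/\<epsilon> <= real n" "2 <= n" and nm: "real n <= min (g/4) \<eta>*real m" for n m
 proof -
  define N where "N = n choose 2"
  define t where "t = nat \<lceil>\<eta>*real m\<rceil>"
  have nm1: "real n <= g/4*real m" "real n <= \<eta>*real m"
   using order_trans[OF nm mult_right_mono[OF min.cobounded1]] order_trans[OF nm mult_right_mono[OF min.cobounded2]] by auto
  have em: "2 <= \<eta>*real m" using nm1 n(2) by linarith
  have t: "\<eta>*real m <= real t" "real t <= 2*\<eta>*real m" unfolding t_def using em by linarith+
  have t1: "1 <= t" using t em by linarith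
  have "2*\<eta>*real m <= 1*real m" using eta by (intro mult_right_mono) auto
  then have tm: "real t <= real m" using t by linarith
  have Nlow: "real n^2/4 <= real N"
  proof -
   have "2*real N = real n*real (n - 1)" unfolding N_def using two_choose_two[of n] by (metis of_nat_mult of_nat_numeral)
   moreover have "real n*(real n/2) <= real n*real (n - 1)" using n(2) by (intro mult_left_mono) (auto simp: of_nat_diff)
   ultimately show ?thesis by (simp add: power2_eq_square)
  qed
  have n1: "real n >= 1" using n(2) by simp
  have n43: "real n powr (4/3) <= real n^2" using powr_mono[of "4/3" 2 "real n"] n1 powr_realpow[of "real n" 2] by simp
  have "real (m + t) <= 2*real m" using tm by simp
  also have "... <= 2*(\<delta>*real n^2)"
  proof -
   have "\<delta>*real n powr (4/3) <= \<delta>*real n^2" using n43 d0 by (intro mult_left_mono) auto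
   then show ?thesis using hi by linarith
  qed
  also have "... <= real n^2/4"
  proof -
   have "\<delta>*real n^2 <= 1/8*real n^2" using eta by (intro mult_right_mono) (auto simp: \<delta>_def)
   then show ?thesis by simp
  qed
  finally have mtN: "m + t <= N" using Nlow by linarith
  have m3: "8192*real m^3 <= \<eta>*real n^4"
  proof -
   have "real m^3 <= (\<delta>*real n powr (4/3))^3" using hi by (intro power_mono) auto
   also have "... = \<delta>^3*real n^4" using n1 powr_realpow[of "real n" 4] by (simp add: power_mult_distrib powr_power)
   also have "... <= \<delta>*real n^4" using d0 power_decreasing[of 1 3 \<delta>] by (intro mult_right_mono) auto
   finally show ?thesis by (simp add: \<delta>_def)
  qed
  have few: "2*real n^4*real (m + t)^4 <= real t*real N^4"
  proof -
   have "2*real n^4*real (m + t)^4 <= 2*real n^4*(2*real m)^4" using tm by (intro mult_left_mono power_mono) auto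
   also have "... = (8192*real m^3)*(real m*real n^4/256)" by (simp add: power_mult_distrib eval_nat_numeral)
   also have "... <= (\<eta>*real n^4)*(real m*real n^4/256)" using m3 by (intro mult_right_mono) auto
   also have "... = (\<eta>*real m)*(real n^2/4)^4" by (simp add: power_divide eval_nat_numeral)
   also have "... <= real t*real N^4" using t Nlow by (intro mult_mono power_mono) auto
   finally show ?thesis .
  qed
  have low: "real (N choose m) <= 2*real ((m + t) choose m)*rcard (\<G> n m)"
   unfolding N_def by (rule card_induced_C4_free_deletion) (use mtN t1 few in \<open>auto simp: N_def\<close>)
  have "real ((m + t) choose m) = real ((m + t) choose t)" using binomial_symmetric[of m "m + t"] by simp
  also have "... <= exp (\<eta>*real (m + t) - real t*ln \<eta>)" by (rule binomial_exp_le[OF eta(1)])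
  also have "... <= exp (g/2*real m)"
  proof -
   have l0: "0 <= - ln \<eta>" using eta by simp
   have "\<eta>*real (m + t) <= \<eta>*(2*real m)" using tm eta by (intro mult_left_mono) auto
   moreover have "real t*(- ln \<eta>) <= 2*\<eta>*real m*(- ln \<eta>)" using t l0 by (intro mult_right_mono) auto
   ultimately have "\<eta>*real (m + t) - real t*ln \<eta> <= 2*\<eta>*(1 - ln \<eta>)*real m" by (simp add: algebra_simps)
   also have "... <= g/2*real m" using eta by (intro mult_right_mono) auto
   finally show ?thesis by simp
  qed
  finally have ch: "real ((m + t) choose m) <= exp (g/2*real m)" .
  have mN: "m <= N" using mtN by simp
  have "0 < real (N choose m)" using mN by simp
  then have pos: "0 < card (\<G> n m)" using low by (cases "card (\<G> n m)") auto
  have low2: "real (N choose m) <= 2*exp (g/2*real m)*rcard (\<G> n m)"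
  proof -
   have "2*real ((m + t) choose m)*rcard (\<G> n m) <= 2*exp (g/2*real m)*rcard (\<G> n m)"
    using ch by (intro mult_right_mono mult_left_mono) auto
   then show ?thesis using low by linarith
  qed
  have "rcard {G \<in> \<G> n m. \<not> quasirandom \<epsilon> {1..n} G}
   <= rcard {G. G <= nsets {1..n} 2 & card G = m & \<not> quasirandom \<epsilon> {1..n} G}"
  proof (intro of_nat_mono card_mono)
   show "finite {G. G <= nsets {1..n} 2 & card G = m & \<not> quasirandom \<epsilon> {1..n} G}"
    by (rule finite_subset[of _ "Pow (nsets {1..n} 2)"]) (auto intro: finite_imp_finite_nsets)
   show "{G \<in> \<G> n m. \<not> quasirandom \<epsilon> {1..n} G} <= {G. G <= nsets {1..n} 2 & card G = m & \<not> quasirandom \<epsilon> {1..n} G}"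
    unfolding induced_C4_free_graphs_def by blast
  qed
  also have "... <= 2*2^n*real (N choose m)*exp (- g*real m)"
   using card_not_quasirandom_le[OF _ eps n, of m] mN unfolding N_def g_def by simp
  also have "... <= 2*2^n*(2*exp (g/2*real m)*rcard (\<G> n m))*exp (- g*real m)"
   using low2 by (intro mult_right_mono mult_left_mono) auto
  also have "... = 4*(2^n*exp (- (g/2)*real m))*rcard (\<G> n m)"
  proof -
   have "exp (g/2*real m)*exp (- g*real m) = exp (- (g/2)*real m)" by (simp add: algebra_simps flip: exp_add)
   then show ?thesis by (simp add: mult_ac)
  qed
  also have "... <= 4*exp (- real n)*rcard (\<G> n m)"
  proof -
   have "(2::real)^n <= exp 1^n" using exp_ge_add_one_self[of 1] by (intro power_mono) auto
   then have "2^n*exp (- (g/2)*real m) <= exp (real n)*exp (- (g/2)*real m)"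
    by (intro mult_right_mono) (simp_all flip: exp_of_nat_mult)
   also have "... = exp (real n - g/2*real m)" by (simp flip: exp_add)
   also have "... <= exp (- real n)" using nm1 by simp
   finally have "2^n*exp (- (g/2)*real m) <= exp (- real n)" .
   then show ?thesis by (intro mult_right_mono mult_left_mono) auto
  qed
  finally show ?thesis using pos by blast
 qed
 show ?thesis
 proof (intro exI[of _ \<delta>] conjI allI impI d0)
  fix m :: "nat => nat"
  assume o: "(%n. real n) \<in> o(%n. real (m n))" and ev: "\<forall>\<^sub>F n in sequentially. real (m n) <= \<delta>*real n powr (4/3)"
  have "filterlim (%n. real n) at_top sequentially" by real_asymp
  then have ev2: "\<forall>\<^sub>F n in sequentially. 2/\<epsilon> <= real n" by (simp add: filterlim_at_top)
  show "asymptotically_almost_surely (%n. \<G> n (m n)) (%n G. quasirandom \<epsilon> {1..n} G)"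
  proof (rule asymptotically_almost_surely_of_count)
   show "\<forall>\<^sub>F n in sequentially. finite (\<G> n (m n)) & 0 < card (\<G> n (m n)) &
    rcard {G \<in> \<G> n (m n). \<not> quasirandom \<epsilon> {1..n} G} <= 4*exp (- real n)*rcard (\<G> n (m n))"
   proof -
    have ev3: "\<forall>\<^sub>F n in sequentially. real n <= min (g/4) \<eta>*real (m n)"
     by (rule smallo_nat_eventually[OF o]) (use g0 eta in simp)
    show ?thesis
     using ev ev2 ev3 eventually_ge_at_top[of "2 :: nat"]
    proof eventually_elim
     case (elim n)
     then show ?case using main[of "m n" n] finite_induced_C4_free by blast
    qed
   qed
   show "(%n. 4*exp (- real n)) \<longlonglongrightarrow> 0" by real_asymp
  qed
 qed
qed

section \<open>The hard-core model of bipartite graphs without 4-cycles\<close>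

definition grid_C4_free :: "(nat \<times> nat) set => bool" where
 "grid_C4_free G \<longleftrightarrow> (\<forall>u w x y. u ~= w --> x ~= y --> \<not> ((u, x) \<in> G & (u, y) \<in> G & (w, x) \<in> G & (w, y) \<in> G))"

text \<open>Edges between two copies of \<open>{..<k}\<close> are the sites and \<open>lam\<close>
  is the fugacity. The degree bound \<open>D\<close>, a constant multiple of the target average
  degree, keeps the number of short paths under control.\<close>

locale hard_core =
 fixes k D :: nat and lam :: real
 assumes k0: "k > 0" and D0: "D > 0" and lam0: "0 < lam" "lam <= 1"
begin

definition "K = {..<k}"

definition "rnb G u = {x. (u, x) \<in> G}" for G :: "(nat \<times> nat) set" and u :: nat
definition "lnb G x = {u. (u, x) \<in> G}" for G :: "(nat \<times> nat) set" and x :: nat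

definition \<F> :: "(nat \<times> nat) set set" where
 "\<F> = {G. G <= K \<times> K & grid_C4_free G & (\<forall>u. card (rnb G u) <= D) & (\<forall>x. card (lnb G x) <= D)}"

lemma finK: "finite K" "card K = k" by (simp_all add: K_def)

lemma finF: "finite \<F>"
 by (rule finite_subset[of _ "Pow (K \<times> K)"]) (auto simp: \<F>_def finK)

lemma finG: "G \<in> \<F> ==> finite G" unfolding \<F>_def using finK finite_subset[of G "K \<times> K"] by blast

lemma finnb: assumes "finite G" shows "finite (rnb G u)" "finite (lnb G x)"
proof -
 have "rnb G u <= snd ` G" "lnb G x <= fst ` G" by (force simp: rnb_def lnb_def)+
 then show "finite (rnb G u)" "finite (lnb G x)" using assms finite_subset by blast+
qed

lemma hereditary: assumes "G \<in> \<F>" "B <= G" shows "B \<in> \<F>"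
proof -
 have "card (rnb B u) <= card (rnb G u)" "card (lnb B x) <= card (lnb G x)" for u x
  using assms(2) finnb[OF finG[OF assms(1)]] by (auto intro!: card_mono simp: rnb_def lnb_def)
 moreover have "\<And>u. card (rnb G u) <= D" "\<And>x. card (lnb G x) <= D" using assms(1) by (auto simp: \<F>_def)
 ultimately have "\<And>u. card (rnb B u) <= D" "\<And>x. card (lnb B x) <= D" using order_trans by blast+
 then show ?thesis using assms unfolding \<F>_def grid_C4_free_def by blast
qed

text \<open>An unnormalised expectation; division by \<open>Z\<close> would give the expectation in
  the model.\<close>

definition "S f = (\<Sum>G\<in>\<F>. lam^card G*f G)" for f :: "(nat \<times> nat) set => real"
definition "Z = S (%_. 1)"

lemma S_mono: "(\<And>G. G \<in> \<F> ==> f G <= g G) ==> S f <= S g"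
 unfolding S_def using lam0 by (intro sum_mono mult_left_mono) auto

lemma S_add: "S (%G. f G + g G) = S f + S g" by (simp add: S_def distrib_left sum.distrib)
lemma S_diff: "S (%G. f G - g G) = S f - S g" by (simp add: S_def right_diff_distrib sum_subtractf)
lemma S_scale: "S (%G. c*f G) = c*S f" by (simp add: S_def sum_distrib_left mult_ac)
lemma S_sum: "S (%G. \<Sum>i\<in>A. f i G) = (\<Sum>i\<in>A. S (f i))"
 by (simp add: S_def sum_distrib_left) (rule sum.swap)
lemma S_nonneg: "(\<And>G. G \<in> \<F> ==> 0 <= f G) ==> 0 <= S f"
 unfolding S_def using lam0 by (intro sum_nonneg mult_nonneg_nonneg) auto

lemma Z1: "1 <= Z"
proof -
 have "{} \<in> \<F>" by (simp add: \<F>_def grid_C4_free_def rnb_def lnb_def)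
 then have "(\<Sum>G\<in>{{} :: (nat \<times> nat) set}. lam^card G) <= (\<Sum>G\<in>\<F>. lam^card G)" using finF lam0 by (intro sum_mono2) auto
 then show ?thesis by (simp add: Z_def S_def)
qed

text \<open>Erasing \<open>C\<close> maps the graphs containing it injectively into the hereditary
  family and changes the weight by \<open>lam^card C\<close>.\<close>

lemma S_superset: "S (%G. of_bool (C <= G)) <= lam^card C*Z"
proof (cases "\<exists>G\<in>\<F>. C <= G")
 case False
 then have "S (%G. of_bool (C <= G)) = 0" by (auto simp: S_def)
 then show ?thesis using lam0 Z1 by simp
next
 case True
 then have fC: "finite C" using finG finite_subset by blast
 have "S (%G. of_bool (C <= G)) = (\<Sum>G\<in>{G\<in>\<F>. C <= G}. lam^card G)"
  unfolding S_def using finF by (intro sum.mono_neutral_cong_right) auto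
 also have "... = (\<Sum>G\<in>{G\<in>\<F>. C <= G}. lam^card C*lam^card (G - C))"
 proof (rule sum.cong)
  fix G assume "G \<in> {G\<in>\<F>. C <= G}"
  then have "C <= G" "finite G" using finG by auto
  then have "card G = card C + card (G - C)" using fC by (simp add: card_Diff_subset card_mono)
  then show "lam^card G = lam^card C*lam^card (G - C)" by (simp add: power_add)
 qed simp
 also have "... = lam^card C*(\<Sum>B\<in>(%G. G - C) ` {G\<in>\<F>. C <= G}. lam^card B)"
  unfolding sum_distrib_left by (rule sum.reindex_cong[symmetric, where l = "%G. G - C"]) (auto simp: inj_on_def)
 also have "... <= lam^card C*(\<Sum>B\<in>\<F>. lam^card B)"
 proof (intro mult_left_mono sum_mono2)
  show "(%G. G - C) ` {G\<in>\<F>. C <= G} <= \<F>" using hereditary by blast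
 qed (use lam0 finF in auto)
 finally show ?thesis by (simp add: Z_def S_def)
qed

text \<open>Detailed balance: adding and removing \<open>e\<close> are inverse to each other and
  change the weight by \<open>lam\<close>.\<close>

lemma S_insert:
 assumes h: "\<And>G. h (insert e G) = h G"
 shows "S (%G. of_bool (e \<in> G)*h G) = lam*S (%G. of_bool (e ~: G & insert e G \<in> \<F>)*h G)"
proof -
 let ?A = "{G\<in>\<F>. e \<in> G}" and ?B = "{G\<in>\<F>. e ~: G & insert e G \<in> \<F>}"
 have "S (%G. of_bool (e \<in> G)*h G) = (\<Sum>G\<in>?A. lam^card G*h G)"
  unfolding S_def using finF by (intro sum.mono_neutral_cong_right) auto
 also have "... = (\<Sum>G\<in>?B. lam^card (insert e G)*h (insert e G))"
 proof (rule sum.reindex_cong[where l = "insert e"])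
  show "inj_on (insert e) ?B" by (auto simp: inj_on_def)
  show "?A = insert e ` ?B"
  proof (intro equalityI subsetI)
   fix G assume G: "G \<in> ?A"
   then have "G - {e} \<in> ?B" "G = insert e (G - {e})" using hereditary[of G "G - {e}"] by (auto simp: insert_absorb)
   then show "G \<in> insert e ` ?B" by blast
  qed auto
 qed simp
 also have "... = (\<Sum>G\<in>?B. lam*(lam^card G*h G))" using finG h by (intro sum.cong) auto
 also have "... = lam*S (%G. of_bool (e ~: G & insert e G \<in> \<F>)*h G)"
  unfolding S_def sum_distrib_left[symmetric] using finF by (intro arg_cong[of _ _ "(*) lam"] sum.mono_neutral_cong_left) auto
 finally show ?thesis .
qed

text \<open>\<open>P\<close> holds the partners of x as seen from u: (u, x) closes a 4-cycle exactly
  when u is joined to one of them. \<open>T\<close> are the partners joined to u, \<rho> erases the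
  edges to them, and \<open>U\<close> are the partners whose edge could be put back alone.\<close>

definition "P u x G = {y. y ~= x & (\<exists>w. w ~= u & (w, x) \<in> G & (w, y) \<in> G)}" for u x :: nat and G :: "(nat \<times> nat) set"
definition "T u x G = {y \<in> P u x G. (u, y) \<in> G}" for u x G
definition "\<rho> u x G = G - {(u, y) | y. y \<in> P u x G}" for u x G
definition "U u x G = {y \<in> P u x G. insert (u, y) (\<rho> u x G) \<in> \<F>}" for u x G
definition "ok u x G \<longleftrightarrow> card (rnb G u) < D & card (lnb G x) < D" for u x G
text \<open>Patterns in which u is joined to a second partner y' of x, while y and y' share a
  neighbour w'': then (u, y) is blocked in \<open>G\<close> by an edge that \<rho> erases.\<close>

definition "conf u x G = {y. \<exists>y' w w' w''. y ~= x & y' ~= x & y ~= y' & w ~= u & w' ~= u & w'' ~= u &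
 (w, x) \<in> G & (w, y) \<in> G & (w', x) \<in> G & (w', y') \<in> G & (w'', y) \<in> G & (w'', y') \<in> G & (u, y') \<in> G}" for u x G

lemma P_insert: "P u x (insert (u, y) G) = P u x G" by (auto simp: P_def)
lemma P_\<rho>: "P u x (\<rho> u x G) = P u x G" by (auto simp: P_def \<rho>_def)
lemma \<rho>_sub: "\<rho> u x G <= G" by (auto simp: \<rho>_def)
lemma \<rho>\<rho>: "\<rho> u x (\<rho> u x G) = \<rho> u x G" using P_\<rho>[of u x G] unfolding \<rho>_def[of u x "\<rho> u x G"] by (auto simp: \<rho>_def)
lemma U_\<rho>: "U u x (\<rho> u x G) = U u x G" by (simp add: U_def P_\<rho> \<rho>\<rho>)
lemma T_\<rho>: "T u x (\<rho> u x G) = {}" by (auto simp: T_def P_\<rho>) (auto simp: \<rho>_def)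

lemma PK: "G \<in> \<F> ==> P u x G <= K" by (auto simp: P_def \<F>_def)

lemma finP: assumes "G \<in> \<F>" shows "finite (P u x G)" "finite (T u x G)" "finite (U u x G)" "finite (conf u x G)"
proof -
 show "finite (P u x G)" using PK[OF assms] finK finite_subset by blast
 then show "finite (T u x G)" "finite (U u x G)" by (auto simp: T_def U_def)
 have "conf u x G <= P u x G" by (auto simp: conf_def P_def)
 then show "finite (conf u x G)" using \<open>finite (P u x G)\<close> finite_subset by blast
qed

text \<open>Group the graphs by \<rho>, which determines \<open>P\<close> and \<open>U\<close>. The
  erased part is a subset of \<open>U\<close>, so a fibre weighs at most
  \<open>(1 + lam)^card U\<close> times its base graph, in which \<open>T\<close> is empty.\<close>

lemma no_partner_lower:
 "S (%G. of_bool (ok u x G)*exp (- lam*rcard (U u x G))) <= S (%G. of_bool (T u x G = {} & ok u x G))"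
proof -
 let ?O = "{G\<in>\<F>. ok u x G}"
 let ?R = "{B\<in>\<F>. T u x B = {} & ok u x B}"
 have rok: "\<rho> u x G \<in> ?R" if "G \<in> ?O" for G
 proof -
  have G: "G \<in> \<F>" "ok u x G" using that by auto
  have "card (rnb (\<rho> u x G) u) <= card (rnb G u)" "card (lnb (\<rho> u x G) x) <= card (lnb G x)"
   using finnb[OF finG[OF G(1)]] \<rho>_sub[of u x G] by (auto intro!: card_mono simp: rnb_def lnb_def)
  then show ?thesis using G hereditary[OF G(1) \<rho>_sub] T_\<rho> by (auto simp: ok_def)
 qed
 have "S (%G. of_bool (ok u x G)*exp (- lam*rcard (U u x G))) = (\<Sum>G\<in>?O. lam^card G*exp (- lam*rcard (U u x G)))"
  unfolding S_def using finF by (intro sum.mono_neutral_cong_right) auto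
 also have "... = (\<Sum>B\<in>?R. \<Sum>G\<in>{G\<in>?O. \<rho> u x G = B}. lam^card G*exp (- lam*rcard (U u x G)))"
  using finF rok by (intro sum.group[symmetric]) auto
 also have "... <= (\<Sum>B\<in>?R. lam^card B)"
 proof (rule sum_mono)
  fix B assume B: "B \<in> ?R"
  have fB: "finite B" and fU: "finite (U u x B)" using B finG finP by auto
  let ?Fib = "{G\<in>?O. \<rho> u x G = B}"
  have U_eq: "U u x G = U u x B" if "G \<in> ?Fib" for G using that U_\<rho>[of u x G] by auto
  have "(\<Sum>G\<in>?Fib. lam^card G*exp (- lam*rcard (U u x G))) = exp (- lam*rcard (U u x B))*(\<Sum>G\<in>?Fib. lam^card G)"
   unfolding sum_distrib_left using U_eq by (intro sum.cong) (auto simp: mult.commute)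
  also have "(\<Sum>G\<in>?Fib. lam^card G) = (\<Sum>G\<in>?Fib. lam^card B*lam^card (T u x G))"
  proof (rule sum.cong)
   fix G assume G: "G \<in> ?Fib"
   then have GB: "G = B Un Pair u ` T u x G" "B Int Pair u ` T u x G = {}" by (auto simp: \<rho>_def T_def)
   have fT: "finite (T u x G)" using G finP by auto
   have "card G = card B + card (Pair u ` T u x G)" by (subst GB(1)) (rule card_Un_disjoint, use fB fT GB(2) in auto)
   also have "card (Pair u ` T u x G) = card (T u x G)" by (rule card_image) (auto simp: inj_on_def)
   finally show "lam^card G = lam^card B*lam^card (T u x G)" by (simp add: power_add)
  qed simp
  also have "... = lam^card B*(\<Sum>W\<in>T u x ` ?Fib. lam^card W)"
   unfolding sum_distrib_left
  proof (rule sum.reindex_cong[symmetric, where l = "T u x"])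
   show "inj_on (T u x) ?Fib"
   proof (rule inj_onI)
    fix G G' assume G: "G \<in> ?Fib" "G' \<in> ?Fib" "T u x G = T u x G'"
    have H: "B Un Pair u ` T u x H = H" if "H \<in> ?Fib" for H using that by (auto simp: \<rho>_def T_def)
    have "G = B Un Pair u ` T u x G'" using H[OF G(1)] unfolding G(3) by (rule sym)
    then show "G = G'" using H[OF G(2)] by (rule trans)
   qed
  qed auto
  also have "(\<Sum>W\<in>T u x ` ?Fib. lam^card W) <= (\<Sum>W\<in>Pow (U u x B). lam^card W)"
  proof (rule sum_mono2)
   show "T u x ` ?Fib <= Pow (U u x B)"
   proof (clarify)
    fix G y assume G: "G \<in> \<F>" "B = \<rho> u x G" and y: "y \<in> T u x G"
    have "insert (u, y) (\<rho> u x G) <= G" using y \<rho>_sub by (auto simp: T_def)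
    then have "insert (u, y) (\<rho> u x G) \<in> \<F>" using hereditary G by blast
    then have "y \<in> U u x G" using y by (auto simp: U_def T_def)
    then show "y \<in> U u x (\<rho> u x G)" by (simp add: U_\<rho>)
   qed
  qed (use fU lam0 in auto)
  also have "(\<Sum>W\<in>Pow (U u x B). lam^card W) = (lam + 1)^card (U u x B)"
   using prod_add[OF fU, of "%_. lam" "%_. 1"] by simp
  also have "... <= exp lam^card (U u x B)" using lam0 exp_ge_add_one_self[of lam] by (intro power_mono) (auto simp: add.commute)
  also have "... = exp (lam*rcard (U u x B))" by (simp add: mult.commute flip: exp_of_nat_mult)
  finally have "(\<Sum>G\<in>?Fib. lam^card G*exp (- lam*rcard (U u x G))) <= exp (- lam*rcard (U u x B))*(lam^card B*exp (lam*rcard (U u x B)))"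
   using lam0 by (simp add: mult_left_mono)
  also have "... = lam^card B" by (simp add: mult.left_commute flip: exp_add)
  finally show "(\<Sum>G\<in>?Fib. lam^card G*exp (- lam*rcard (U u x G))) <= lam^card B" .
 qed
 also have "... = S (%G. of_bool (T u x G = {} & ok u x G))"
  unfolding S_def using finF by (intro sum.mono_neutral_cong_left) auto
 finally show ?thesis .
qed

lemma insert_valid:
 assumes G: "G \<in> \<F>" "u \<in> K" "x \<in> K" "card (rnb G u) < D" "card (lnb G x) < D"
  and no: "\<And>w y. w ~= u ==> y ~= x ==> (w, x) \<in> G ==> (w, y) \<in> G ==> (u, y) \<in> G ==> False"
 shows "insert (u, x) G \<in> \<F>"
proof -
 have r: "rnb (insert (u, x) G) v <= (if v = u then insert x (rnb G v) else rnb G v)" "lnb (insert (u, x) G) y <= (if y = x then insert u (lnb G y) else lnb G y)" for v y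
  by (auto simp: rnb_def lnb_def)
 note fr = finnb[OF finG[OF G(1)]]
 have "card (rnb (insert (u, x) G) v) <= D" for v
 proof -
  have "card (rnb (insert (u, x) G) v) <= card (if v = u then insert x (rnb G v) else rnb G v)" using r(1) fr by (intro card_mono) auto
  also have "... <= D" using G(1,4) card_insert_le_m1[of D "rnb G u" x] D0 by (auto simp: \<F>_def)
  finally show ?thesis .
 qed
 moreover have "card (lnb (insert (u, x) G) y) <= D" for y
 proof -
  have "card (lnb (insert (u, x) G) y) <= card (if y = x then insert u (lnb G y) else lnb G y)" using r(2) fr by (intro card_mono) auto
  also have "... <= D" using G(1,5) card_insert_le_m1[of D "lnb G x" u] D0 by (auto simp: \<F>_def)
  finally show ?thesis .
 qed
 moreover have "grid_C4_free (insert (u, x) G)"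
  unfolding grid_C4_free_def
 proof (intro allI impI notI)
  fix a b p q assume d: "a ~= b" "p ~= q" and e: "(a, p) \<in> insert (u, x) G & (a, q) \<in> insert (u, x) G & (b, p) \<in> insert (u, x) G & (b, q) \<in> insert (u, x) G"
  have cf: "grid_C4_free G" using G(1) by (simp add: \<F>_def)
  consider "a = u" "p = x" | "a = u" "q = x" | "b = u" "p = x" | "b = u" "q = x" | "(a, p) \<in> G" "(a, q) \<in> G" "(b, p) \<in> G" "(b, q) \<in> G"
   using e by auto
  then show False
  proof cases
   case 1 then show False using e d no[of b q] by auto
  next
   case 2 then show False using e d no[of b p] by auto
  next
   case 3 then show False using e d no[of a q] by auto
  next
   case 4 then show False using e d no[of a p] by auto
  next
   case 5 then show False using cf d unfolding grid_C4_free_def by blast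
  qed
 qed
 ultimately show ?thesis using G(1,2,3) by (auto simp: \<F>_def)
qed

text \<open>If the edge to y fits after erasing but not into \<open>G\<close>, the 4-cycle that it
  closes in \<open>G\<close> must use an erased edge (u, y'); y' is another partner, which gives a
  pattern of \<open>conf\<close>.\<close>

lemma U_bound:
 assumes G: "G \<in> \<F>" and u: "u \<in> K" and deg: "card (rnb G u) < D"
 shows "card (U u x G) <= card (T u x G) + card {y \<in> P u x G. (u, y) ~: G & insert (u, y) G \<in> \<F>} + card (conf u x G)"
proof -
 have "U u x G <= (T u x G Un {y \<in> P u x G. (u, y) ~: G & insert (u, y) G \<in> \<F>}) Un conf u x G"
 proof
  fix y assume y: "y \<in> U u x G"
  then have yP: "y \<in> P u x G" and v: "insert (u, y) (\<rho> u x G) \<in> \<F>" by (auto simp: U_def)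
  show "y \<in> (T u x G Un {y \<in> P u x G. (u, y) ~: G & insert (u, y) G \<in> \<F>}) Un conf u x G"
  proof (cases "(u, y) \<in> G \<or> insert (u, y) G \<in> \<F>")
   case True
   then show ?thesis using yP by (auto simp: T_def)
  next
   case False
   have yK: "y \<in> K" using PK[OF G] yP by blast
   have cy: "card (lnb G y) < D"
   proof -
    have "lnb (insert (u, y) (\<rho> u x G)) y = insert u (lnb G y)" by (auto simp: lnb_def \<rho>_def)
    then have "card (insert u (lnb G y)) <= D" using v unfolding \<F>_def by (metis (mono_tags, lifting) mem_Collect_eq)
    moreover have "u ~: lnb G y" using False by (simp add: lnb_def)
    ultimately show ?thesis using finnb[OF finG[OF G]] by simp
   qed
   have "\<exists>w y'. w ~= u & y' ~= y & (w, y) \<in> G & (w, y') \<in> G & (u, y') \<in> G"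
    using insert_valid[OF G u yK deg cy] False by blast
   then obtain w'' y' where c: "w'' ~= u" "y' ~= y" "(w'', y) \<in> G" "(w'', y') \<in> G" "(u, y') \<in> G" by blast
   have "y' \<in> P u x G"
   proof (rule ccontr)
    assume "y' ~: P u x G"
    then have "(u, y') \<in> \<rho> u x G" using c by (auto simp: \<rho>_def)
    moreover have "(w'', y) \<in> \<rho> u x G" "(w'', y') \<in> \<rho> u x G" using c by (auto simp: \<rho>_def)
    ultimately show False using v c unfolding \<F>_def grid_C4_free_def by blast
   qed
   then obtain w' where "w' ~= u" "(w', x) \<in> G" "(w', y') \<in> G" "y' ~= x" by (auto simp: P_def)
   moreover obtain w where "w ~= u" "(w, x) \<in> G" "(w, y) \<in> G" "y ~= x" using yP by (auto simp: P_def)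
   ultimately have "y \<in> conf u x G" using c unfolding conf_def by blast
   then show ?thesis by blast
  qed
 qed
 then have "card (U u x G) <= card ((T u x G Un {y \<in> P u x G. (u, y) ~: G & insert (u, y) G \<in> \<F>}) Un conf u x G)"
  using finP[OF G] by (intro card_mono) auto
 also have "... <= card (T u x G Un {y \<in> P u x G. (u, y) ~: G & insert (u, y) G \<in> \<F>}) + card (conf u x G)" by (rule card_Un_le)
 also have "... <= card (T u x G) + card {y \<in> P u x G. (u, y) ~: G & insert (u, y) G \<in> \<F>} + card (conf u x G)"
  by (intro add_right_mono card_Un_le)
 finally show ?thesis .
qed

text \<open>A joined partner is the second vertex of a path u, y, w, x: its first edge is an edge of
  \<open>G\<close>, and each of the two further steps has at most \<open>D\<close> choices.\<close>

lemma sum_T: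
 assumes G: "G \<in> \<F>"
 shows "(\<Sum>(u, x)\<in>K \<times> K. rcard (T u x G)) <= rcard G*(real D)^2"
proof -
 have fG: "finite G" by (rule finG[OF G])
 have "(\<Sum>(u, x)\<in>K \<times> K. card (T u x G)) = card (SIGMA p:K \<times> K. T (fst p) (snd p) G)"
  using finK finP(2)[OF G] by (simp add: case_prod_beta)
 also have "... <= card (SIGMA e:G. SIGMA w:lnb G (snd e). rnb G w)"
 proof (rule surj_card_le[where f = "%(e, w, x). ((fst e, x), snd e)"])
  show "finite (SIGMA e:G. SIGMA w:lnb G (snd e). rnb G w)" using fG finnb[OF fG] by auto
  show "(SIGMA p:K \<times> K. T (fst p) (snd p) G) <= (%(e, w, x). ((fst e, x), snd e)) ` (SIGMA e:G. SIGMA w:lnb G (snd e). rnb G w)"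
  proof
   fix q assume "q \<in> (SIGMA p:K \<times> K. T (fst p) (snd p) G)"
   then obtain u x y where q: "q = ((u, x), y)" "y \<in> P u x G" "(u, y) \<in> G" by (auto simp: T_def)
   then obtain w where "(w, x) \<in> G" "(w, y) \<in> G" by (auto simp: P_def)
   then have "((u, y), w, x) \<in> (SIGMA e:G. SIGMA w:lnb G (snd e). rnb G w)" using q by (auto simp: rnb_def lnb_def)
   then show "q \<in> (%(e, w, x). ((fst e, x), snd e)) ` (SIGMA e:G. SIGMA w:lnb G (snd e). rnb G w)"
    by (rule rev_image_eqI) (simp add: q)
  qed
 qed
 also have "... = (\<Sum>e\<in>G. \<Sum>w\<in>lnb G (snd e). card (rnb G w))" using fG finnb[OF fG] by simp
 also have "... <= (\<Sum>e\<in>G. \<Sum>w\<in>lnb G (snd e). D)" using G by (intro sum_mono) (auto simp: \<F>_def)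
 also have "... <= (\<Sum>e\<in>G. D*D)" using G by (intro sum_mono) (auto simp: \<F>_def)
 finally have "(\<Sum>(u, x)\<in>K \<times> K. card (T u x G)) <= card G*(D*D)" by simp
 then have "real (\<Sum>(u, x)\<in>K \<times> K. card (T u x G)) <= real (card G*(D*D))" by (simp only: of_nat_le_iff)
 then show ?thesis by (simp add: case_prod_beta power2_eq_square)
qed

lemma S_configs:
 assumes "finite C" "\<And>t. t \<in> C ==> card (E t) = c"
 shows "S (%G. rcard {t\<in>C. E t <= G}) <= rcard C*lam^c*Z"
proof -
 have "S (%G. rcard {t\<in>C. E t <= G}) = S (%G. \<Sum>t\<in>C. of_bool (E t <= G))"
  using assms(1) by (simp add: S_def Int_def)
 also have "... = (\<Sum>t\<in>C. S (%G. of_bool (E t <= G)))" by (rule S_sum)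
 also have "... <= (\<Sum>t\<in>C. lam^c*Z)" using S_superset assms(2) by (intro sum_mono) fastforce
 finally show ?thesis by (simp add: mult.assoc)
qed

text \<open>Either w = w', and the pattern contains 4 edges on 5 vertices, or the three centres are
  distinct and it has 7 edges on 7 vertices; any other coincidence would close a 4-cycle.
  \<open>S_superset\<close> charges \<open>lam\<close> per edge.\<close>

lemma sum_conf: "S (%G. \<Sum>(u, x)\<in>K \<times> K. rcard (conf u x G)) <= (real k^5*lam^4 + real k^7*lam^7)*Z"
proof -
 define E4 :: "nat \<times> nat \<times> nat \<times> nat \<times> nat => (nat \<times> nat) set" where
  "E4 = (%(u, x, y, y', w). {(w, x), (w, y), (w, y'), (u, y')})"
 define E7 :: "nat \<times> nat \<times> nat \<times> nat \<times> nat \<times> nat \<times> nat => (nat \<times> nat) set" where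
  "E7 = (%(u, x, y, y', w, w', w''). {(w, x), (w, y), (w', x), (w', y'), (w'', y), (w'', y'), (u, y')})"
 define C4 where "C4 = {t \<in> K \<times> K \<times> K \<times> K \<times> K. card (E4 t) = 4}"
 define C7 where "C7 = {t \<in> K \<times> K \<times> K \<times> K \<times> K \<times> K \<times> K. card (E7 t) = 7}"
 have f4: "finite C4" "card C4 <= k^5"
 proof -
  show "finite C4" using finK by (simp add: C4_def)
  have "card C4 <= card (K \<times> K \<times> K \<times> K \<times> K)" unfolding C4_def using finK by (intro card_mono) auto
  then show "card C4 <= k^5" using finK by (simp add: card_cartesian_product eval_nat_numeral)
 qed
 have f7: "finite C7" "card C7 <= k^7"
 proof -
  show "finite C7" using finK by (simp add: C7_def)
  have "card C7 <= card (K \<times> K \<times> K \<times> K \<times> K \<times> K \<times> K)" unfolding C7_def using finK by (intro card_mono) auto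
  then show "card C7 <= k^7" using finK by (simp add: card_cartesian_product eval_nat_numeral)
 qed
 have "(\<Sum>(u, x)\<in>K \<times> K. rcard (conf u x G)) <= rcard {t\<in>C4. E4 t <= G} + rcard {t\<in>C7. E7 t <= G}" if G: "G \<in> \<F>" for G
 proof -
  have GK: "a \<in> K & b \<in> K" if "(a, b) \<in> G" for a b using G that by (auto simp: \<F>_def)
  have cf: "\<And>u w x y. u ~= w ==> x ~= y ==> (u, x) \<in> G ==> (u, y) \<in> G ==> (w, x) \<in> G ==> (w, y) \<in> G ==> False"
   using G unfolding \<F>_def grid_C4_free_def by blast
  let ?A = "(%(u, x, y, y', w). ((u, x), y)) ` {t\<in>C4. E4 t <= G}"
  let ?B = "(%(u, x, y, y', w, w', w''). ((u, x), y)) ` {t\<in>C7. E7 t <= G}"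
  have "(SIGMA p:K \<times> K. conf (fst p) (snd p) G) <= ?A Un ?B"
  proof
   fix q assume "q \<in> (SIGMA p:K \<times> K. conf (fst p) (snd p) G)"
   then obtain u x y where q: "q = ((u, x), y)" "u \<in> K" "x \<in> K" "y \<in> conf u x G" by auto
   from q(4) obtain y' w w' w'' where c: "y ~= x" "y' ~= x" "y ~= y'" "w ~= u" "w' ~= u" "w'' ~= u"
    "(w, x) \<in> G" "(w, y) \<in> G" "(w', x) \<in> G" "(w', y') \<in> G" "(w'', y) \<in> G" "(w'', y') \<in> G" "(u, y') \<in> G"
    unfolding conf_def by blast
   show "q \<in> ?A Un ?B"
   proof (cases "w = w' \<or> w = w'' \<or> w' = w''")
    case True
    have "w = w'"
    proof (rule ccontr)
     assume n: "w ~= w'"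
     then consider "w = w''" | "w' = w''" using True by blast
     then show False
     proof cases
      case 1 then show False using cf[OF n c(2)[symmetric] c(7) _ c(9) c(10)] c(12) by simp
     next
      case 2 then show False using cf[OF n c(1)[symmetric] c(7) c(8) c(9)] c(11) by simp
     qed
    qed
    then have "(w, y') \<in> G" using c by simp
    then have "(u, x, y, y', w) \<in> {t\<in>C4. E4 t <= G}" using c q GK by (auto simp: C4_def E4_def)
    then have "q \<in> ?A" by (rule rev_image_eqI) (simp add: q)
    then show ?thesis by blast
   next
    case False
    then have "(u, x, y, y', w, w', w'') \<in> {t\<in>C7. E7 t <= G}" using c q GK by (auto simp: C7_def E7_def)
    then have "q \<in> ?B" by (rule rev_image_eqI) (simp add: q)
    then show ?thesis by blast
   qed
  qed
  then have "card (SIGMA p:K \<times> K. conf (fst p) (snd p) G) <= card (?A Un ?B)"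
   using f4 f7 by (intro card_mono) auto
  also have "... <= card ?A + card ?B" by (rule card_Un_le)
  also have "... <= card {t\<in>C4. E4 t <= G} + card {t\<in>C7. E7 t <= G}" using f4 f7 by (intro add_mono card_image_le) auto
  finally have "(\<Sum>(u, x)\<in>K \<times> K. card (conf u x G)) <= card {t\<in>C4. E4 t <= G} + card {t\<in>C7. E7 t <= G}"
   using finK finP(4)[OF G] by (simp add: case_prod_beta)
  then have "real (\<Sum>(u, x)\<in>K \<times> K. card (conf u x G)) <= real (card {t\<in>C4. E4 t <= G} + card {t\<in>C7. E7 t <= G})" by (simp only: of_nat_le_iff)
  then show ?thesis by (simp add: case_prod_beta)
 qed
 then have "S (%G. \<Sum>(u, x)\<in>K \<times> K. rcard (conf u x G)) <= S (%G. rcard {t\<in>C4. E4 t <= G} + rcard {t\<in>C7. E7 t <= G})"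
  by (rule S_mono)
 also have "... <= rcard C4*lam^4*Z + rcard C7*lam^7*Z"
  unfolding S_add using f4 f7 by (intro add_mono S_configs) (auto simp: C4_def C7_def)
 also have "... <= real (k^5)*lam^4*Z + real (k^7)*lam^7*Z"
  using f4 f7 lam0 Z1 by (intro add_mono mult_right_mono of_nat_mono) auto
 finally show ?thesis by (simp add: algebra_simps)
qed

lemma S_card: "S (%G. rcard G) = (\<Sum>(u, x)\<in>K \<times> K. S (%G. of_bool ((u, x) \<in> G)))"
proof -
 have "S (%G. rcard G) = S (%G. \<Sum>e\<in>K \<times> K. of_bool (e \<in> G))"
  unfolding S_def
 proof (rule sum.cong)
  fix G assume "G \<in> \<F>"
  then have "(K \<times> K) Int {e. e \<in> G} = G" by (auto simp: \<F>_def)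
  then show "lam^card G*rcard G = lam^card G*(\<Sum>e\<in>K \<times> K. of_bool (e \<in> G))" using finK by simp
 qed simp
 also have "... = (\<Sum>e\<in>K \<times> K. S (%G. of_bool (e \<in> G)))" by (rule S_sum)
 finally show ?thesis by (simp add: case_prod_beta)
qed

lemma sum_not_ok:
 assumes G: "G \<in> \<F>"
 shows "(\<Sum>(u, x)\<in>K \<times> K. of_bool (\<not> ok u x G)) <= 2*real k*rcard G/real D"
proof -
 have fG: "finite G" by (rule finG[OF G])
 have r: "of_bool (D <= card (rnb G u)) <= rcard (rnb G u)/real D" "of_bool (D <= card (lnb G u)) <= rcard (lnb G u)/real D" for u
  using D0 by (auto simp: le_divide_eq)
 have sr: "(\<Sum>u\<in>K. card (rnb G u)) = card G"
 proof -
  have "G = (SIGMA u:K. rnb G u)" using G by (auto simp: \<F>_def rnb_def)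
  then have "card G = card (SIGMA u:K. rnb G u)" by simp
  then show ?thesis using finK finnb[OF fG] by simp
 qed
 have sc: "(\<Sum>x\<in>K. card (lnb G x)) = card G"
 proof -
  have "bij_betw (%(x, u). (u, x)) (SIGMA x:K. lnb G x) G"
   using G by (intro bij_betwI[where g = "%(u, x). (x, u)"]) (auto simp: \<F>_def lnb_def)
  then have "card (SIGMA x:K. lnb G x) = card G" by (rule bij_betw_same_card)
  then show ?thesis using finK finnb[OF fG] by simp
 qed
 have "(\<Sum>(u, x)\<in>K \<times> K. of_bool (\<not> ok u x G) :: real) <= (\<Sum>(u, x)\<in>K \<times> K. rcard (rnb G u)/real D + rcard (lnb G x)/real D)"
 proof (rule sum_mono, clarify)
  fix u x
  have "(of_bool (\<not> ok u x G) :: real) <= of_bool (D <= card (rnb G u)) + of_bool (D <= card (lnb G x))" by (auto simp: ok_def)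
  then show "(of_bool (\<not> ok u x G) :: real) <= rcard (rnb G u)/real D + rcard (lnb G x)/real D"
   using r(1)[of u] r(2)[of x] by linarith
 qed
 also have "... = (\<Sum>u\<in>K. \<Sum>x\<in>K. rcard (rnb G u)/real D + rcard (lnb G x)/real D)"
  by (rule sum.cartesian_product[symmetric])
 also have "... = real k*(rcard G/real D) + real k*(rcard G/real D)"
  using finK by (simp add: sum.distrib sum_divide_distrib[symmetric] sum_distrib_left[symmetric] flip: sr of_nat_sum) (simp add: sr sc flip: of_nat_sum)
 finally show ?thesis by simp
qed

text \<open>Suppose the average is too small. Then few vertices are full and \<open>lam\<close>
  times \<open>card U\<close> is below about \<open>c\<close> on average, so a typical pair has no
  joined partner with probability of order \<open>exp (- c)\<close>. Such pairs are present or can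
  be added, and detailed balance forces order \<open>lam*k^2*exp (- c)\<close> edges, against
  \<open>big\<close>.\<close>

lemma many_edges:
 assumes c: "2*(2*(real k*real D/16)*(real D)^2 + lam*(real k^5*lam^4 + real k^7*lam^7)) <= c*(real k)^2"
  and c0: "0 <= c" and big: "real D < 7*lam*real k*exp (- c)"
 shows "real k*real D/16*Z <= S (%G. rcard G)"
proof (rule ccontr)
 define EG where "EG = S (%G. rcard G)"
 assume "\<not> ?thesis"
 then have small: "EG < real k*real D/16*Z" by (simp add: EG_def)
 have EG0: "EG >= 0" unfolding EG_def by (rule S_nonneg) simp
 let ?KK = "K \<times> K"
 have cKK: "rcard ?KK = (real k)^2" using finK by (simp add: card_cartesian_product power2_eq_square)
 define Q where "Q = (\<Sum>(u, x)\<in>?KK. lam*S (%G. of_bool (ok u x G)*rcard (U u x G)))"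
 have Q: "Q <= 2*EG*(real D)^2 + lam*(real k^5*lam^4 + real k^7*lam^7)*Z"
 proof -
  \<comment> \<open>Detailed balance converts partner edges that could be added into partner edges
    that are present, which \<open>sum_T\<close> bounds.\<close>
  have open_eq: "lam*S (%G. rcard {y \<in> P u x G. (u, y) ~: G & insert (u, y) G \<in> \<F>}) = S (%G. rcard (T u x G))" for u x
  proof -
   have e1: "rcard {y \<in> P u x G. (u, y) ~: G & insert (u, y) G \<in> \<F>} = (\<Sum>y\<in>K. of_bool ((u, y) ~: G & insert (u, y) G \<in> \<F>)* of_bool (y \<in> P u x G))" if "G \<in> \<F>" for G
   proof -
    have "{y \<in> P u x G. (u, y) ~: G & insert (u, y) G \<in> \<F>} = K Int {y. ((u, y) ~: G & insert (u, y) G \<in> \<F>) & y \<in> P u x G}" using PK[OF that] by auto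
    then show ?thesis using finK by (simp flip: of_bool_conj)
   qed
   have e2: "rcard (T u x G) = (\<Sum>y\<in>K. of_bool ((u, y) \<in> G)* of_bool (y \<in> P u x G))" if "G \<in> \<F>" for G
   proof -
    have "T u x G = K Int {y. (u, y) \<in> G & y \<in> P u x G}" using PK[OF that] by (auto simp: T_def)
    then show ?thesis using finK by (simp flip: of_bool_conj)
   qed
   have "S (%G. rcard (T u x G)) = S (%G. \<Sum>y\<in>K. of_bool ((u, y) \<in> G)* of_bool (y \<in> P u x G))"
    unfolding S_def using e2 by (intro sum.cong) auto
   also have "... = (\<Sum>y\<in>K. lam*S (%G. of_bool ((u, y) ~: G & insert (u, y) G \<in> \<F>)* of_bool (y \<in> P u x G)))"
    unfolding S_sum by (intro sum.cong S_insert) (auto simp: P_insert)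
   also have "... = lam*S (%G. \<Sum>y\<in>K. of_bool ((u, y) ~: G & insert (u, y) G \<in> \<F>)* of_bool (y \<in> P u x G))"
    by (simp only: S_sum sum_distrib_left)
   also have "S (%G. \<Sum>y\<in>K. of_bool ((u, y) ~: G & insert (u, y) G \<in> \<F>)* of_bool (y \<in> P u x G)) = S (%G. rcard {y \<in> P u x G. (u, y) ~: G & insert (u, y) G \<in> \<F>})"
    unfolding S_def using e1 by (intro sum.cong) auto
   finally show ?thesis by simp
  qed
  have "lam*S (%G. of_bool (ok u x G)*rcard (U u x G)) <= 2*S (%G. rcard (T u x G)) + lam*S (%G. rcard (conf u x G))"
   if "u \<in> K" for u x
  proof -
   have "S (%G. of_bool (ok u x G)*rcard (U u x G)) <= S (%G. (rcard (T u x G) + rcard {y \<in> P u x G. (u, y) ~: G & insert (u, y) G \<in> \<F>}) + rcard (conf u x G))"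
   proof (rule S_mono)
    fix G assume G: "G \<in> \<F>"
    show "of_bool (ok u x G)*rcard (U u x G) <= (rcard (T u x G) + rcard {y \<in> P u x G. (u, y) ~: G & insert (u, y) G \<in> \<F>}) + rcard (conf u x G)"
    proof (cases "ok u x G")
     case True
     then have "card (U u x G) <= card (T u x G) + card {y \<in> P u x G. (u, y) ~: G & insert (u, y) G \<in> \<F>} + card (conf u x G)"
      using U_bound[OF G that] by (simp add: ok_def)
     then have "rcard (U u x G) <= real (card (T u x G) + card {y \<in> P u x G. (u, y) ~: G & insert (u, y) G \<in> \<F>} + card (conf u x G))" by (simp only: of_nat_le_iff)
     then show ?thesis using True by simp
    qed simp
   qed
   then have "lam*S (%G. of_bool (ok u x G)*rcard (U u x G)) <= lam*(S (%G. rcard (T u x G)) + S (%G. rcard {y \<in> P u x G. (u, y) ~: G & insert (u, y) G \<in> \<F>}) + S (%G. rcard (conf u x G)))"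
    unfolding S_add using lam0 by (intro mult_left_mono) auto
   also have "... = lam*S (%G. rcard (T u x G)) + S (%G. rcard (T u x G)) + lam*S (%G. rcard (conf u x G))"
    by (simp add: distrib_left open_eq)
   also have "lam*S (%G. rcard (T u x G)) <= 1*S (%G. rcard (T u x G))" using lam0 by (intro mult_right_mono S_nonneg) auto
   finally show ?thesis by simp
  qed
  then have "Q <= (\<Sum>(u, x)\<in>?KK. 2*S (%G. rcard (T u x G)) + lam*S (%G. rcard (conf u x G)))"
   unfolding Q_def by (intro sum_mono) auto
  also have "... = 2*S (%G. \<Sum>(u, x)\<in>?KK. rcard (T u x G)) + lam*S (%G. \<Sum>(u, x)\<in>?KK. rcard (conf u x G))"
   by (simp add: case_prod_beta sum.distrib sum_distrib_left S_sum)
  also have "... <= 2*(EG*(real D)^2) + lam*((real k^5*lam^4 + real k^7*lam^7)*Z)"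
  proof (intro add_mono mult_left_mono sum_conf)
   have "S (%G. \<Sum>(u, x)\<in>?KK. rcard (T u x G)) <= S (%G. (real D)\<^sup>2*rcard G)"
    using sum_T by (intro S_mono) (simp add: mult.commute)
   then show "S (%G. \<Sum>(u, x)\<in>?KK. rcard (T u x G)) <= EG*(real D)^2" unfolding S_scale EG_def[symmetric] by (simp only: mult.commute)
  qed (use lam0 in auto)
  finally show ?thesis by (simp add: mult_ac)
 qed
 have Qc: "Q <= c/2*(real k)^2*Z"
 proof -
  have "2*EG*(real D)^2 <= 2*(real k*real D/16*Z)*(real D)^2" using small by (intro mult_right_mono mult_left_mono) auto
  then have "Q <= (2*(real k*real D/16)*(real D)^2 + lam*(real k^5*lam^4 + real k^7*lam^7))*Z"
   using Q by (simp add: algebra_simps)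
  also have "... <= (c*(real k)^2/2)*Z" using c Z1 by (intro mult_right_mono) auto
  finally show ?thesis by simp
 qed
 define OK where "OK = (\<Sum>(u, x)\<in>?KK. S (%G. of_bool (ok u x G)))"
 have OK: "7/8*(real k)^2*Z <= OK"
 proof -
  have "S (%G. \<Sum>(u, x)\<in>?KK. of_bool (\<not> ok u x G)) <= S (%G. 2*real k/real D*rcard G)"
   using sum_not_ok by (intro S_mono) (simp add: mult_ac)
  also have "... = 2*real k/real D*EG" by (simp only: S_scale EG_def)
  also have "... <= 2*real k/real D*(real k*real D/16*Z)" using small by (intro mult_left_mono) auto
  also have "... = (real k)^2*Z/8" using D0 by (simp add: power2_eq_square)
  finally have n: "S (%G. \<Sum>(u, x)\<in>?KK. of_bool (\<not> ok u x G)) <= (real k)^2*Z/8" .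
  have "OK = S (%G. \<Sum>(u, x)\<in>?KK. of_bool (ok u x G))" unfolding OK_def by (simp add: case_prod_beta S_sum)
  also have "... = S (%G. (real k)\<^sup>2*1 - (\<Sum>(u, x)\<in>?KK. of_bool (\<not> ok u x G)))"
  proof -
   have "(\<Sum>(u, x)\<in>?KK. of_bool (ok u x G) :: real) = (real k)^2*1 - (\<Sum>(u, x)\<in>?KK. of_bool (\<not> ok u x G))" for G
   proof -
    have "(\<Sum>(u, x)\<in>?KK. of_bool (ok u x G) :: real) + (\<Sum>(u, x)\<in>?KK. of_bool (\<not> ok u x G)) = (\<Sum>(u, x)\<in>?KK. 1)"
     unfolding case_prod_beta sum.distrib[symmetric] by (rule sum.cong) auto
    then show ?thesis using cKK by (simp add: case_prod_beta)
   qed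
   then show ?thesis by (simp only:)
  qed
  also have "... = (real k)^2*Z - S (%G. \<Sum>(u, x)\<in>?KK. of_bool (\<not> ok u x G))" unfolding S_diff S_scale Z_def ..
  finally show ?thesis using n by linarith
 qed
 have "exp (- c)*(7/8*(real k)^2*Z) <= (\<Sum>(u, x)\<in>?KK. S (%G. of_bool (T u x G = {} & ok u x G)))"
 proof -
  \<comment> \<open>The tangent of \<open>exp (- y)\<close> at \<open>c\<close> takes the place of
    Jensen's inequality: it is linear and can be summed over all pairs.\<close>
  have "exp (- c)*((1 + c)*S (%G. of_bool (ok u x G)) - lam*S (%G. of_bool (ok u x G)*rcard (U u x G))) <= S (%G. of_bool (T u x G = {} & ok u x G))" for u x
  proof -
   have "exp (- c)*((1 + c)*S (%G. of_bool (ok u x G)) - lam*S (%G. of_bool (ok u x G)*rcard (U u x G))) =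
    S (%G. exp (- c)*((1 + c)* of_bool (ok u x G) - lam*(of_bool (ok u x G)*rcard (U u x G))))"
    unfolding S_scale S_diff ..
   also have "... <= S (%G. of_bool (ok u x G)*exp (- lam*rcard (U u x G)))"
   proof (rule S_mono)
    fix G
    have "exp (- c)*(1 + (c - lam*rcard (U u x G))) <= exp (- c)*exp (c - lam*rcard (U u x G))"
     by (intro mult_left_mono exp_ge_add_one_self) auto
    also have "... = exp (- lam*rcard (U u x G))" by (simp flip: exp_add)
    finally show "exp (- c)*((1 + c)* of_bool (ok u x G) - lam*(of_bool (ok u x G)*rcard (U u x G))) <= of_bool (ok u x G)*exp (- lam*rcard (U u x G))"
     by (cases "ok u x G") (auto simp: algebra_simps)
   qed
   also have "... <= S (%G. of_bool (T u x G = {} & ok u x G))" by (rule no_partner_lower)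
   finally show ?thesis .
  qed
  then have "(\<Sum>(u, x)\<in>?KK. exp (- c)*((1 + c)*S (%G. of_bool (ok u x G)) - lam*S (%G. of_bool (ok u x G)*rcard (U u x G)))) <= (\<Sum>(u, x)\<in>?KK. S (%G. of_bool (T u x G = {} & ok u x G)))"
   by (intro sum_mono) auto
  moreover have "(\<Sum>(u, x)\<in>?KK. exp (- c)*((1 + c)*S (%G. of_bool (ok u x G)) - lam*S (%G. of_bool (ok u x G)*rcard (U u x G)))) = exp (- c)*((1 + c)*OK - Q)"
   unfolding OK_def Q_def by (simp add: case_prod_beta sum_subtractf sum_distrib_left right_diff_distrib)
  moreover have "7/8*(real k)^2*Z <= (1 + c)*OK - Q"
  proof -
   have "(1 + c)*(7/8*(real k)^2*Z) <= (1 + c)*OK" using OK c0 by (intro mult_left_mono) auto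
   moreover have "0 <= c*((real k)^2*Z)" using c0 Z1 by simp
   ultimately show ?thesis using Qc by (simp add: algebra_simps)
  qed
  then have "exp (- c)*(7/8*(real k)^2*Z) <= exp (- c)*((1 + c)*OK - Q)" by (rule mult_left_mono) simp
  ultimately show ?thesis by linarith
 qed
 also have "... <= (\<Sum>(u, x)\<in>?KK. S (%G. of_bool ((u, x) ~: G & insert (u, x) G \<in> \<F>)) + S (%G. of_bool ((u, x) \<in> G)))"
 proof (rule sum_mono, clarify)
  fix u x assume ux: "u \<in> K" "x \<in> K"
  show "S (%G. of_bool (T u x G = {} & ok u x G)) <= S (%G. of_bool ((u, x) ~: G & insert (u, x) G \<in> \<F>)) + S (%G. of_bool ((u, x) \<in> G))"
   unfolding S_add[symmetric]
  proof (rule S_mono)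
   fix G assume G: "G \<in> \<F>"
   have "insert (u, x) G \<in> \<F>" if "T u x G = {}" "ok u x G"
    by (rule insert_valid[OF G ux]) (use that in \<open>auto simp: ok_def T_def P_def\<close>)
   then show "(of_bool (T u x G = {} & ok u x G) :: real) <= of_bool ((u, x) ~: G & insert (u, x) G \<in> \<F>) + of_bool ((u, x) \<in> G)" by auto
  qed
 qed
 also have "... = (\<Sum>(u, x)\<in>?KK. S (%G. of_bool ((u, x) ~: G & insert (u, x) G \<in> \<F>))) + EG"
  unfolding EG_def S_card by (simp add: case_prod_beta sum.distrib)
 finally have fin: "exp (- c)*(7/8*(real k)^2*Z) <= (\<Sum>(u, x)\<in>?KK. S (%G. of_bool ((u, x) ~: G & insert (u, x) G \<in> \<F>))) + EG" .
 have "EG = lam*(\<Sum>(u, x)\<in>?KK. S (%G. of_bool ((u, x) ~: G & insert (u, x) G \<in> \<F>)))"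
 proof -
  have "S (%G. of_bool ((u, x) \<in> G)) = lam*S (%G. of_bool ((u, x) ~: G & insert (u, x) G \<in> \<F>))" for u x
   using S_insert[of "%_. 1" "(u, x)"] by simp
  then show ?thesis unfolding EG_def S_card by (simp add: sum_distrib_left case_prod_beta)
 qed
 moreover have "lam*(exp (- c)*(7/8*(real k)^2*Z)) <= lam*((\<Sum>(u, x)\<in>?KK. S (%G. of_bool ((u, x) ~: G & insert (u, x) G \<in> \<F>))) + EG)"
  using fin lam0 by (intro mult_left_mono) auto
 ultimately have "lam*(exp (- c)*(7/8*(real k)^2*Z)) <= EG + lam*EG" by (simp add: distrib_left)
 also have "... <= 2*EG" using lam0 EG0 mult_right_mono[of lam 1 EG] by simp
 also have "... < 2*(real k*real D/16*Z)" by (rule mult_strict_left_mono[OF small]) simp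
 finally have "real k*Z/8*(7*lam*real k*exp (- c)) < real k*Z/8*real D" by (simp add: power2_eq_square mult_ac)
 moreover have "real k*Z/8 > 0" using k0 Z1 by simp
 ultimately have "7*lam*real k*exp (- c) < real D" by (meson less_imp_le mult_left_less_imp_less)
 then show False using big by linarith
qed

end

context hard_core begin

definition "layer e = {G \<in> \<F>. card G = e}"

lemma fin_layer: "finite (layer e)" using finF by (simp add: layer_def)

lemma card_le_kD: assumes "G \<in> \<F>" shows "card G <= k*D"
proof -
 have "G = (SIGMA u:K. rnb G u)" using assms by (auto simp: \<F>_def rnb_def)
 then have "card G = (\<Sum>u\<in>K. card (rnb G u))" using finK finnb[OF finG[OF assms]] by (metis card_SigmaI)
 also have "... <= (\<Sum>u\<in>K. D)" using assms by (intro sum_mono) (auto simp: \<F>_def)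
 finally show ?thesis using finK by simp
qed

text \<open>No graph has more than \<open>k*D\<close> edges, so the average \<open>k*D/16\<close>
  puts weight at least \<open>Z/32\<close> on graphs with \<open>k*D/32\<close> edges or more. One
  of at most \<open>k*D + 1\<close> layers carries its share of this, and \<open>Z\<close> is at
  least 1.\<close>

lemma large_layer:
 assumes "real k*real D/16*Z <= S (%G. rcard G)"
 shows "\<exists>e. real k*real D/32 <= real e & e <= k*D & 1 <= 32*(real (k*D) + 1)*(rcard (layer e)*lam^e)"
proof (rule ccontr)
 assume neg: "\<not> ?thesis"
 let ?kD = "real k*real D"
 let ?I = "{e. e <= k*D & ?kD/32 <= real e}"
 have kD0: "?kD > 0" using k0 D0 by simp
 have finI: "finite ?I" and cI: "card ?I <= k*D + 1"
 proof -
  have "?I <= {..k*D}" by auto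
  then show "finite ?I" "card ?I <= k*D + 1" using finite_subset[of ?I "{..k*D}"] card_mono[of "{..k*D}" ?I] by auto
 qed
 have "S (%G. rcard G) <= S (%G. ?kD/32*1 + ?kD* of_bool (?kD/32 <= rcard G))"
 proof (rule S_mono)
  fix G assume "G \<in> \<F>"
  then have "rcard G <= real (k*D)" using card_le_kD by (simp only: of_nat_le_iff)
  then have "rcard G <= ?kD" by simp
  then show "rcard G <= ?kD/32*1 + ?kD* of_bool (?kD/32 <= rcard G)"
  proof (cases "?kD/32 <= rcard G")
   case True
   then have ob: "of_bool (?kD/32 <= rcard G) = (1 :: real)" by simp
   show ?thesis unfolding ob using \<open>rcard G <= ?kD\<close> kD0 by linarith
  next
   case False
   then have ob: "of_bool (?kD/32 <= rcard G) = (0 :: real)" by simp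
   show ?thesis unfolding ob using False by linarith
  qed
 qed
 also have "... = ?kD/32*Z + ?kD*S (%G. of_bool (?kD/32 <= rcard G))"
  unfolding S_add S_scale Z_def ..
 finally have "?kD*(Z/32) <= ?kD*S (%G. of_bool (?kD/32 <= rcard G))" using assms by simp
 then have "Z/32 <= S (%G. of_bool (?kD/32 <= rcard G))" using kD0 by (simp only: mult_le_cancel_left_pos)
 then have "1/32 <= S (%G. of_bool (?kD/32 <= rcard G))" using Z1 by linarith
 also have "... = (\<Sum>G\<in>{G\<in>\<F>. ?kD/32 <= rcard G}. lam^card G)"
  unfolding S_def using finF by (intro sum.mono_neutral_cong_right) auto
 also have "... = (\<Sum>e\<in>?I. \<Sum>G\<in>{G\<in>{G\<in>\<F>. ?kD/32 <= rcard G}. card G = e}. lam^card G)"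
  using finF finI card_le_kD by (intro sum.group[symmetric]) auto
 also have "... = (\<Sum>e\<in>?I. rcard (layer e)*lam^e)"
 proof (rule sum.cong)
  fix e assume e: "e \<in> ?I"
  have "(\<Sum>G\<in>{G\<in>{G\<in>\<F>. ?kD/32 <= rcard G}. card G = e}. lam^card G) = (\<Sum>G\<in>layer e. lam^e)"
   using e by (intro sum.cong) (auto simp: layer_def)
  then show "(\<Sum>G\<in>{G\<in>{G\<in>\<F>. ?kD/32 <= rcard G}. card G = e}. lam^card G) = rcard (layer e)*lam^e" by simp
 qed simp
 finally have le: "1/32 <= (\<Sum>e\<in>?I. rcard (layer e)*lam^e)" .
 have lt: "rcard (layer e)*lam^e < 1/(32*(real (k*D) + 1))" if "e \<in> ?I" for e
 proof -
  have "32*(real (k*D) + 1)*(rcard (layer e)*lam^e) < 1" using neg that by auto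
  moreover have p: "0 < 32*(real (k*D) + 1)" by (simp add: add_nonneg_pos)
  ultimately show ?thesis unfolding pos_less_divide_eq[OF p] by (simp only: mult_ac)
 qed
 have "?I ~= {}" using le by auto
 then have "(\<Sum>e\<in>?I. rcard (layer e)*lam^e) < (\<Sum>e\<in>?I. 1/(32*(real (k*D) + 1)))"
  using finI lt by (intro sum_strict_mono)
 also have "... = rcard ?I*(1/(32*(real (k*D) + 1)))" by simp
 also have "... <= (real (k*D) + 1)*(1/(32*(real (k*D) + 1)))"
 proof (rule mult_right_mono)
  show "rcard ?I <= real (k*D) + 1" using cI by linarith
 qed simp
 also have "... = 1/32"
 proof -
  have "w*(1/(32*w)) = 1/32" if "0 < w" for w :: real using that by simp
  from this[of "real (k*D) + 1"] show ?thesis by (simp add: add_nonneg_pos)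
 qed
 finally show False using le by linarith
qed

lemma layer_prune:
 assumes "m <= e"
 shows "card (layer e) <= card (layer m)*((k*k - m) choose (e - m))"
proof -
 have fKK: "finite (K \<times> K)" "card (K \<times> K) = k*k" using finK by (simp_all add: card_cartesian_product)
 have "layer e <= (\<Union>H\<in>layer m. {G. H <= G & G <= K \<times> K & card G = card H + (e - m)})"
 proof
  fix G assume G: "G \<in> layer e"
  then obtain H where H: "H <= G" "card H = m" using assms obtain_subset_with_card_n[of m G] by (auto simp: layer_def)
  have "H \<in> layer m" using G H hereditary by (auto simp: layer_def)
  moreover have "G <= K \<times> K" "card G = m + (e - m)" using G assms by (auto simp: layer_def \<F>_def)
  ultimately show "G \<in> (\<Union>H\<in>layer m. {G. H <= G & G <= K \<times> K & card G = card H + (e - m)})" using H by blast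
 qed
 then have "card (layer e) <= card (\<Union>H\<in>layer m. {G. H <= G & G <= K \<times> K & card G = card H + (e - m)})"
  using fin_layer fKK by (intro card_mono finite_UN_I) (auto intro: finite_subset[of _ "Pow (K \<times> K)"])
 also have "... <= (\<Sum>H\<in>layer m. card {G. H <= G & G <= K \<times> K & card G = card H + (e - m)})" by (rule card_UN_le[OF fin_layer])
 also have "... <= (\<Sum>H\<in>layer m. (k*k - m) choose (e - m))"
 proof (rule sum_mono)
  fix H assume "H \<in> layer m"
  then have "H <= K \<times> K" "card H = m" by (auto simp: layer_def \<F>_def)
  then show "card {G. H <= G & G <= K \<times> K & card G = card H + (e - m)} <= (k*k - m) choose (e - m)"
   using card_supersets[OF fKK(1), of H "e - m"] fKK(2) by simp
 qed
 finally show ?thesis by simp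
qed

lemma layer_embed:
 assumes n: "2*k <= n"
 shows "card (layer m) <= card (\<G> n m)"
proof -
 define \<phi> where "\<phi> = (%(u, x). {u + 1, k + x + 1})"
 have inj: "inj_on \<phi> (K \<times> K)" by (auto simp: inj_on_def \<phi>_def K_def doubleton_eq_iff)
 show ?thesis
 proof (rule card_inj_on_le[OF _ _ finite_induced_C4_free])
  have "layer m <= Pow (K \<times> K)" by (auto simp: layer_def \<F>_def)
  then show "inj_on ((`) \<phi>) (layer m)" using inj_on_image_Pow[OF inj] inj_on_subset by blast
  show "(`) \<phi> ` layer m <= \<G> n m"
  proof clarify
   fix G assume G: "G \<in> layer m"
   have GK: "G <= K \<times> K" and cf: "grid_C4_free G" and cG: "card G = m" using G by (auto simp: layer_def \<F>_def)
   have mem: "{a, b} \<in> \<phi> ` G \<longleftrightarrow> (a, b) \<in> (%(u, x). (u + 1, k + x + 1)) ` G \<or> (b, a) \<in> (%(u, x). (u + 1, k + x + 1)) ` G" for a b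
    by (force simp: \<phi>_def doubleton_eq_iff)
   define L where "L = (%(u, x). (u + 1, k + x + 1)) ` G"
   have Lc: "a = c" if "a ~= c" "b ~= d" "(a, b) \<in> L" "(a, d) \<in> L" "(c, b) \<in> L" "(c, d) \<in> L" for a b c d
    using that cf unfolding L_def grid_C4_free_def by fastforce
   have side: "a <= k & k < b" if "(a, b) \<in> L" for a b using that GK by (auto simp: L_def K_def)
   have "\<phi> ` G <= nsets {1..n} 2" using GK n by (auto simp: \<phi>_def nsets_def K_def)
   moreover have "card (\<phi> ` G) = m" using cG card_image[OF inj_on_subset[OF inj GK]] by simp
   moreover have "\<not> contains_induced {1..n} (\<phi> ` G) C4_verts C4_edges"
   proof (rule no_C4_imp_no_induced)
    fix a b c d assume d: "distinct [a, b, c, d]" and e: "{a, b} \<in> \<phi> ` G" "{b, c} \<in> \<phi> ` G" "{c, d} \<in> \<phi> ` G" "{a, d} \<in> \<phi> ` G"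
    note e' = e[unfolded mem, folded L_def]
    show False
    proof (cases "a <= k")
     case True
     have 1: "(a, b) \<in> L" "(a, d) \<in> L" using e' side True by (meson not_le)+
     then have "k < b" "k < d" using side by blast+
     then have "(c, b) \<in> L" "(c, d) \<in> L" using e' side by (meson not_le)+
     then show False using Lc[of a c b d] 1 d by auto
    next
     case False
     have 1: "(b, a) \<in> L" "(d, a) \<in> L" using e' side False by blast+
     then have "b <= k" "d <= k" using side by blast+
     then have "(b, c) \<in> L" "(d, c) \<in> L" using e' side by (meson not_le)+
     then show False using Lc[of b d a c] 1 d by auto
    qed
   qed
   ultimately show "\<phi> ` G \<in> \<G> n m" by (simp add: induced_C4_free_graphs_def)
  qed
 qed
qed

text \<open>A heavy layer with \<open>e >= m\<close> edges is pruned to \<open>m\<close> edges. The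
  count of ways to put the edges back nearly cancels against \<open>lam^e\<close>:
  \<open>m*ln (k/D)\<close> remains, at a price of at most \<open>g + ln 32 + 1\<close> for each
  edge of the layer.\<close>

lemma card_induced_C4_free_hard_core:
 assumes n: "2*k <= n" and m: "0 < m" "32*real m <= real k*real D"
  and edges: "real k*real D/16*Z <= S (%G. rcard G)"
  and g: "0 <= g" "lam = exp g*(real D/real k)"
 shows "exp (real m*(ln (real k/real D) - g) - real (k*D)*(g + ln 32 + 1) - ln (32*(real (k*D) + 1)))
  <= rcard (\<G> n m)"
proof -
 obtain e where e: "real k*real D/32 <= real e" "e <= k*D" and le: "1 <= 32*(real (k*D) + 1)*(rcard (layer e)*lam^e)"
  using large_layer[OF edges] by blast
 have k1: "real k > 0" "real D > 0" using k0 D0 by auto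
 have me: "m <= e" using e(1) m(2) by linarith
 have e0: "real e > 0" using me m by simp
 have kk: "real (k*k) > 0" using k0 by simp
 define t where "t = real e/real (k*k)"
 have t0: "t > 0" using e0 kk by (simp add: t_def)
 have "rcard (layer e) <= real (card (layer m)*((k*k - m) choose (e - m)))" using layer_prune[OF me] by (simp only: of_nat_le_iff)
 also have "... = rcard (layer m)*real ((k*k - m) choose (e - m))" by simp
 also have "... <= rcard (layer m)*exp (t*real (k*k - m) - real (e - m)*ln t)"
  by (intro mult_left_mono binomial_exp_le t0) simp
 also have "... <= rcard (layer m)*exp (real e - (real e - real m)*ln t)"
 proof (intro mult_left_mono)
  have "t*real (k*k - m) <= t*real (k*k)" using t0 by (intro mult_left_mono of_nat_mono diff_le_self) simp
  also have "... = real e" using k0 by (simp add: t_def)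
  finally show "exp (t*real (k*k - m) - real (e - m)*ln t) <= exp (real e - (real e - real m)*ln t)"
   using me by (simp add: of_nat_diff)
 qed simp
 finally have pr: "rcard (layer e) <= rcard (layer m)*exp (real e - (real e - real m)*ln t)" .
 have lame: "lam^e = exp (real e*ln lam)" using lam0 by (simp add: exp_of_nat_mult)
 define q where "q = 32*(real (k*D) + 1)"
 have q0: "q > 0" by (simp add: q_def add_nonneg_pos)
 have "1 <= q*(rcard (layer m)*exp (real e - (real e - real m)*ln t)*exp (real e*ln lam))"
 proof -
  have "q*(rcard (layer e)*lam^e) <= q*(rcard (layer m)*exp (real e - (real e - real m)*ln t)*exp (real e*ln lam))"
   unfolding lame using pr q0 by (intro mult_left_mono mult_right_mono) auto
  then show ?thesis using le unfolding q_def by linarith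
 qed
 also have "... = rcard (layer m)*exp (ln q + (real e - (real e - real m)*ln t) + real e*ln lam)"
  using q0 by (simp add: exp_add)
 finally have E: "1 <= rcard (layer m)*exp (ln q + (real e - (real e - real m)*ln t) + real e*ln lam)" .
 have "exp (- (ln q + (real e - (real e - real m)*ln t) + real e*ln lam)) <= rcard (layer m)"
  using mult_left_mono[OF E, of "exp (- (ln q + (real e - (real e - real m)*ln t) + real e*ln lam))"]
  by (simp add: mult.left_commute flip: exp_add)
 moreover have "real m*(ln (real k/real D) - g) - real (k*D)*(g + ln 32 + 1) - ln q <= - (ln q + (real e - (real e - real m)*ln t) + real e*ln lam)"
 proof -
  have ll: "ln lam = g - ln (real k/real D)" unfolding g(2) using k1 by (simp add: ln_mult_pos ln_div)
  have "real D/(32*real k) <= t"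
   using e(1) k1 by (simp add: t_def field_simps)
  then have "ln (real D/(32*real k)) <= ln t" using k1 by (intro ln_mono) auto
  moreover have "ln (real D/(32*real k)) = - ln 32 - ln (real k/real D)" using k1 by (simp add: ln_div ln_mult_pos)
  ultimately have lt: "- ln 32 - g <= ln t - ln lam" using ll by linarith
  have "(real e - real m)*(- ln 32 - g) <= (real e - real m)*(ln t - ln lam)" using lt me by (intro mult_left_mono) auto
  moreover have "real e*(- ln 32 - g) <= (real e - real m)*(- ln 32 - g)"
  proof -
   have "0 <= real m*(ln 32 + g)" using g(1) by simp
   then show ?thesis by (simp add: algebra_simps)
  qed
  moreover have "real (k*D)*(g + ln 32 + 1) >= real e*(g + ln 32 + 1)" using e(2) g(1) by (intro mult_right_mono of_nat_mono) auto
  ultimately show ?thesis unfolding ll by (simp add: algebra_simps)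
 qed
 ultimately have "exp (real m*(ln (real k/real D) - g) - real (k*D)*(g + ln 32 + 1) - ln q) <= rcard (layer m)"
  by (meson exp_le_cancel_iff order_trans)
 then show ?thesis using layer_embed[OF n, of m] unfolding q_def by linarith
qed

end

section \<open>Few graphs are nearly split, and part (b)\<close>

lemma card_close_to_split_le:
 fixes n m :: nat
 assumes m: "4 <= m" "real m <= real n^2" and n: "0 < n"
 shows "rcard {G. G <= nsets {1..n} 2 & card G = m & close_to_split (1/4) {1..n} G}
  <= 2^n*exp (5/2*real m + 5/8*real m*ln (real n^2/real m))"
proof -
 define V where "V = {1..n}"
 define U where "U = nsets V 2"
 have fV: "finite V" "card V = n" and fU: "finite U" and cU: "card U = n choose 2"
  by (simp_all add: V_def U_def finite_imp_finite_nsets)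
 define \<theta> where "\<theta> = real m/real n^2"
 \<comment> \<open>The dense side has at most \<open>2* sqrt m\<close> vertices and meets three
   quarters of the edges, which thus lie among at most \<open>2*n* sqrt m\<close> pairs. The factor
   \<open>s\<close> on these keeps their total weight of order m and gains \<open>3/4*ln s\<close>
   per edge; as \<open>ln s\<close> is half of \<open>ln (n^2/m)\<close>, the coefficient 5/8
   remains.\<close>
 define s where "s = real n/sqrt (real m)"
 have sm: "sqrt (real m) > 0" "sqrt (real m)* sqrt (real m) = real m" using m by auto
 have t0: "\<theta> > 0" using m n by (simp add: \<theta>_def)
 have s1: "1 <= s"
 proof -
  have "sqrt (real m) <= real n" using m(2) by (simp add: real_le_lsqrt)
  then show ?thesis using sm by (simp add: s_def le_divide_eq)
 qed
 have lns: "ln s = ln (real n^2/real m)/2"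
 proof -
  have "s^2 = real n^2/real m" using m by (simp add: s_def power_divide)
  then have "ln (real n^2/real m) = ln (s^2)" by simp
  also have "... = 2*ln s" using s1 by (simp add: ln_realpow)
  finally show ?thesis by simp
 qed
 have lnt: "- ln \<theta> = ln (real n^2/real m)" using m n by (simp add: \<theta>_def ln_div)
 define Dd where "Dd A = {e. e Int A ~= ({} :: nat set)}" for A
 define small where "small = {A \<in> Pow V. rcard A <= 2* sqrt (real m)}"
 define cl where "cl A = {G. {} <= G & G <= U & card G = m & 3/4*real m <= rcard ((G - {}) Int Dd A)}" for A
 have bound: "rcard (cl A) <= exp (5/2*real m + 5/8*real m*ln (real n^2/real m))" if A: "A \<in> small" for A
 proof -
  have "rcard (cl A) <= exp (\<theta>*rcard U + \<theta>* s*rcard (U Int Dd A) - real (m - card ({} :: nat set set))*ln \<theta> - 3/4*real m*ln s)"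
   unfolding cl_def by (rule card_between_le[OF fU t0 s1]) simp
  also have "... <= exp (5/2*real m + 5/8*real m*ln (real n^2/real m))"
  proof -
   have 1: "\<theta>*rcard U <= real m/2"
   proof -
    have "\<theta>*rcard U <= \<theta>*((real n)^2/2)" unfolding cU using choose_two_le t0 by (intro mult_left_mono) auto
    then show ?thesis using n by (simp add: \<theta>_def)
   qed
   have "U Int Dd A <= (%(a, v). {a, v}) ` (A \<times> V)"
   proof
    fix e assume e: "e \<in> U Int Dd A"
    then obtain a where a: "a \<in> e" "a \<in> A" by (auto simp: Dd_def)
    have "card e = 2" "e <= V" using e by (auto simp: U_def nsets_def)
    then obtain p q where pq: "e = {p, q}" "p \<in> V" "q \<in> V" by (auto simp: card_2_iff)
    then show "e \<in> (%(a, v). {a, v}) ` (A \<times> V)" using a by (force simp: image_iff insert_commute)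
   qed
   then have "card (U Int Dd A) <= card (A \<times> V)"
    using fV A by (intro surj_card_le) (auto simp: small_def intro: finite_subset)
   then have "rcard (U Int Dd A) <= real (card A*n)" using fV by (simp only: card_cartesian_product of_nat_le_iff)
   also have "... <= 2* sqrt (real m)*real n" using A by (simp add: small_def mult_right_mono)
   finally have "\<theta>* s*rcard (U Int Dd A) <= \<theta>* s*(2* sqrt (real m)*real n)" using t0 s1 by (intro mult_left_mono) auto
   also have "... = 2*real m" using n sm by (simp add: \<theta>_def s_def power2_eq_square)
   finally have 2: "\<theta>* s*rcard (U Int Dd A) <= 2*real m" .
   have "real (m - card ({} :: nat set set))*ln \<theta> = - (real m*ln (real n^2/real m))" unfolding lnt[symmetric] by simp
   then show ?thesis using 1 2 unfolding lns by (simp add: algebra_simps)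
  qed
  finally show ?thesis .
 qed
 have "{G. G <= U & card G = m & close_to_split (1/4) V G} <= (\<Union>A\<in>small. cl A)"
 proof
  fix G assume G: "G \<in> {G. G <= U & card G = m & close_to_split (1/4) V G}"
  then have GU: "G <= U" "card G = m" by auto
  have fG: "finite G" using GU fU finite_subset by blast
  from G obtain A B where AB: "A Un B = V" "A Int B = {}" "real (edges_within G A) >= (1 - 1/4)*real (card A choose 2)" "real (edges_within G B) <= 1/4*real m"
   unfolding close_to_split_def by auto
  have "edges_within G A <= m" unfolding edges_within_def GU(2)[symmetric] using fG by (intro card_mono) auto
  then have ca: "3/4*real (card A choose 2) <= real m" using AB(3) by simp
  have "rcard A <= 2* sqrt (real m)"
  proof (rule ccontr)
   assume "\<not> ?thesis"
   then have big: "rcard A > 2* sqrt (real m)" by simp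
   have s2: "sqrt (real m) >= 2" using m(1) by (simp add: real_le_rsqrt)
   have "2*(card A choose 2) = card A*(card A - 1)" by (rule two_choose_two)
   then have "2*real (card A choose 2) = rcard A*real (card A - 1)" by (metis of_nat_mult of_nat_numeral)
   moreover have "1 <= card A" using big s2 by (cases "card A") auto
   ultimately have e: "2*real (card A choose 2) = rcard A*(rcard A - 1)" by (simp add: of_nat_diff)
   have "(2* sqrt (real m))*(3/2* sqrt (real m)) <= rcard A*(rcard A - 1)"
    using big s2 by (intro mult_mono) auto
   then have "3*real m <= 2*real (card A choose 2)" using sm(2) e by simp
   then show False using ca m(1) by linarith
  qed
  then have "A \<in> small" using AB(1) by (auto simp: small_def)
  moreover have "G \<in> cl A"
  proof -
   have "G = (G Int Dd A) Un {e\<in>G. e <= B}"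
   proof -
    have "e <= V" if "e \<in> G" for e using that GU(1) by (auto simp: U_def nsets_def)
    then show ?thesis using AB(1) by (auto simp: Dd_def)
   qed
   then have "card G <= card (G Int Dd A) + card {e\<in>G. e <= B}" by (metis card_Un_le)
   then have "real m <= rcard (G Int Dd A) + real (edges_within G B)" using GU(2) unfolding edges_within_def by linarith
   then show ?thesis using AB(4) GU by (simp add: cl_def)
  qed
  ultimately show "G \<in> (\<Union>A\<in>small. cl A)" by blast
 qed
 moreover have fs: "finite small" "finite (cl A)" for A
 proof -
  show "finite small" using fV by (simp add: small_def)
  show "finite (cl A)" unfolding cl_def by (rule finite_subset[of _ "Pow U"]) (use fU in auto)
 qed
 ultimately have "card {G. G <= U & card G = m & close_to_split (1/4) V G} <= card (\<Union>A\<in>small. cl A)" by (intro card_mono) auto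
 also have "... <= (\<Sum>A\<in>small. card (cl A))" by (rule card_UN_le[OF fs(1)])
 finally have "rcard {G. G <= U & card G = m & close_to_split (1/4) V G} <= real (\<Sum>A\<in>small. card (cl A))" by (simp only: of_nat_le_iff)
 also have "... = (\<Sum>A\<in>small. rcard (cl A))" by simp
 also have "... <= (\<Sum>A\<in>small. exp (5/2*real m + 5/8*real m*ln (real n^2/real m)))" by (intro sum_mono bound)
 also have "... = rcard small*exp (5/2*real m + 5/8*real m*ln (real n^2/real m))" by simp
 also have "... <= 2^n*exp (5/2*real m + 5/8*real m*ln (real n^2/real m))"
 proof (rule mult_right_mono)
  have "card small <= card (Pow V)" unfolding small_def using fV by (intro card_mono) auto
  then have "card small <= 2^n" using fV by (simp add: card_Pow)
  then have "rcard small <= real (2^n)" by (simp only: of_nat_le_iff)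
  then show "rcard small <= 2^n" by simp
 qed simp
 finally show ?thesis by (simp add: U_def V_def)
qed

text \<open>Per edge, the hard-core count has exponent about \<open>ln (n^2/m)\<close> and the
  nearly split count 5/8 of it. Since \<open>ln (n^2/m)\<close> is at least about
  \<open>2/3*ln n\<close>, the gain of \<open>1/4*ln n\<close> beats the cost \<open>34*g\<close> of
  the model, which is \<open>0.17*ln n\<close>.\<close>

lemma not_close_aas:
 "\<forall>m. (%n. real n) \<in> o(%n. real (m n)) --> (\<forall>\<^sub>F n in sequentially. real (m n) <= 1/1000*real n powr (4/3)*ln (real n) powr (1/3)) -->
  asymptotically_almost_surely (%n. \<G> n (m n)) (%n G. \<not> close_to_split (1/4) {1..n} G)"
proof (intro allI impI)
 fix mm :: "nat => nat"
 assume o: "(%n. real n) \<in> o(%n. real (mm n))" and ev: "\<forall>\<^sub>F n in sequentially. real (mm n) <= 1/1000*real n powr (4/3)*ln (real n) powr (1/3)"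
 define lb where "lb n = real n powr (1/200 - 2/3)*ln (real n) powr (1/3)" for n :: nat
 have "(%n. lb n) \<longlonglongrightarrow> 0" unfolding lb_def by real_asymp
 then have ev1: "\<forall>\<^sub>F n in sequentially. lb n < 1" by (rule order_tendstoD) simp
 have "(%n. real n^3*lb n^5) \<longlonglongrightarrow> 0" unfolding lb_def by real_asymp
 then have ev2: "\<forall>\<^sub>F n in sequentially. real n^3*lb n^5 < 1/4" by (rule order_tendstoD) simp
 have "(%n. real n^5*lb n^8) \<longlonglongrightarrow> 0" unfolding lb_def by real_asymp
 then have ev3: "\<forall>\<^sub>F n in sequentially. real n^5*lb n^8 < 1/4" by (rule order_tendstoD) simp
 have "filterlim (%n. 3/8*(2/3*ln (real n) - 1/3*ln (ln (real n))) - 34/200*ln (real n)) at_top sequentially" by real_asymp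
 then have ev4: "\<forall>\<^sub>F n in sequentially. 400 <= 3/8*(2/3*ln (real n) - 1/3*ln (ln (real n))) - 34/200*ln (real n)"
  by (simp add: filterlim_at_top)
 have "filterlim (%n. ln (real n)) at_top sequentially" by real_asymp
 then have ev5: "\<forall>\<^sub>F n in sequentially. 1 <= ln (real n)" by (simp add: filterlim_at_top)
 have ev6: "\<forall>\<^sub>F n in sequentially. real n <= 1*real (mm n)" by (rule smallo_nat_eventually[OF o]) simp
 have lin: "7/2 + 5/8*y <= - 1 + (y - 34*(x/200) - 320)"
  if "2/3*x - 1/3*w <= y" "400 <= 3/8*(2/3*x - 1/3*w) - 34/200*x" for x y w :: real
  using that by argo
 have main: "0 < card (\<G> n m) & rcard {G \<in> \<G> n m. \<not> \<not> close_to_split (1/4) {1..n} G}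
   <= exp (- real n)*rcard (\<G> n m)"
  if hi: "real m <= 1/1000*real n powr (4/3)*ln (real n) powr (1/3)" and l1: "lb n < 1" and l2: "real n^3*lb n^5 < 1/4" and l3: "real n^5*lb n^8 < 1/4"
   and l4: "400 <= 3/8*(2/3*ln (real n) - 1/3*ln (ln (real n))) - 34/200*ln (real n)" and l5: "1 <= ln (real n)" and nm: "real n <= real m" and n10: "10 <= n" for n m
 proof -
  define L where "L = ln (real n)"
  define k where "k = n div 2"
  \<comment> \<open>Ensures \<open>32*m <= k*D\<close>, so that the heavy layer, with at least
    \<open>k*D/32\<close> edges, can be pruned to \<open>m\<close>.\<close>
  define D where "D = nat \<lceil>32*real m/real k\<rceil>"
  have n0: "real n > 0" using n10 by simp
  have m0: "m > 0" "10 <= real m" using nm n10 by auto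
  have kn: "2*k <= n" "real n/3 <= real k" "real k <= real n" unfolding k_def using n10 by linarith+
  have k0: "real k > 0" "k > 0" using kn(2) n10 by auto
  have q32: "32*real m/real k > 0" using m0 k0 by simp
  have D: "32*real m/real k <= real D" "real D <= 32*real m/real k + 1" unfolding D_def using q32 by linarith+
  have D0: "real D > 0" "D > 0" using D(1) q32 by auto
  have kD: "32*real m <= real k*real D" "real k*real D <= 33*real m"
  proof -
   show "32*real m <= real k*real D" using D(1) k0 by (simp add: divide_le_eq mult.commute)
   have "real k*real D <= real k*(32*real m/real k + 1)" using D(2) k0 by (intro mult_left_mono) auto
   also have "... = 32*real m + real k" using k0 by (simp add: field_simps)
   finally show "real k*real D <= 33*real m" using kn nm by linarith
  qed
  have Dn: "real D <= 99*real m/real n"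
  proof -
   have "real D <= 33*real m/real k" using kD(2) k0 by (simp add: le_divide_eq mult.commute)
   also have "... <= 33*real m/(real n/3)" using kn n0 by (intro divide_left_mono) auto
   finally show ?thesis by simp
  qed
  have D13: "real D <= 99/1000*(real n powr (1/3)*L powr (1/3))"
  proof -
   have "99*real m/real n <= 99*(1/1000*real n powr (4/3)*L powr (1/3))/real n"
    using hi unfolding L_def by (intro divide_right_mono mult_left_mono) auto
   also have "... = 99/1000*(real n powr (4/3)/real n powr 1*L powr (1/3))" using n0 by simp
   also have "real n powr (4/3)/real n powr 1 = real n powr (1/3)" using powr_diff[of "real n" "4/3" 1] by simp
   finally show ?thesis using Dn by linarith
  qed
  \<comment> \<open>The constant \<open>c\<close> of \<open>many_edges\<close> is mainly
    \<open>D^3/(4*k)\<close> and has to stay below \<open>g + 1\<close>; so \<open>D^3\<close> may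
    be of order \<open>n*ln n\<close>, which is the factor \<open>ln n powr (1/3)\<close> in the
    range of m.\<close>
  define g where "g = L/200"
  define lam where "lam = exp g*(real D/real k)"
  have eg: "exp g = real n powr (1/200)" using n0 by (simp add: g_def L_def powr_def)
  have g0: "0 <= g" using l5 by (simp add: g_def L_def)
  have lam0: "lam > 0" using D0 k0 by (simp add: lam_def)
  have lamlb: "lam <= lb n"
  proof -
   have "real D/real k <= 99/1000*(real n powr (1/3)*L powr (1/3))/(real n/3)" using D13 kn n0 D0 by (intro frac_le) auto
   also have "... = 297/1000*(real n powr (1/3)/real n powr 1*L powr (1/3))" using n0 by simp
   also have "real n powr (1/3)/real n powr 1 = real n powr (- 2/3)" using powr_diff[of "real n" "1/3" 1] by simp
   also have "297/1000*(real n powr (- 2/3)*L powr (1/3)) <= 1*(real n powr (- 2/3)*L powr (1/3))" by (intro mult_right_mono) auto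
   finally have "lam <= real n powr (1/200)*(real n powr (- 2/3)*L powr (1/3))" unfolding lam_def eg by (intro mult_left_mono) auto
   also have "... = real n powr (1/200 + (- 2/3))*L powr (1/3)" by (simp only: powr_add mult.assoc)
   finally show ?thesis unfolding lb_def L_def by simp
  qed
  have lam1: "lam <= 1" using lamlb l1 by linarith
  interpret hard_core k D lam by standard (use k0 D0 lam0 lam1 in auto)
  define c where "c = real D^3/(4*real k) + 2*(real k^3*lam^5 + real k^5*lam^8)"
  have c0: "0 <= c" using lam0 by (simp add: c_def)
  have ceq: "2*(2*(real k*real D/16)*(real D)^2 + lam*(real k^5*lam^4 + real k^7*lam^7)) <= c*(real k)^2"
   using k0 by (simp add: c_def field_simps eval_nat_numeral)
  have cg: "c <= g + 1"
  proof -
   have "real D^3 <= (99/1000*(real n powr (1/3)*L powr (1/3)))^3" using D13 by (intro power_mono) auto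
   also have "... = (99/1000)^3*(real n*L)"
   proof -
    have L0: "0 < L" using l5 by (simp add: L_def)
    have c: "(x powr (1/3))^3 = x" if "0 < x" for x :: real using that by (simp add: powr_power)
    show ?thesis by (simp only: power_mult_distrib c[OF n0] c[OF L0])
   qed
   finally have d3: "real D^3 <= (99/1000)^3*(real n*L)" .
   have "real D^3/(4*real k) <= (99/1000)^3*(real n*L)/(4*(real n/3))"
    using d3 kn n0 l5 by (intro frac_le) (auto simp: L_def)
   also have "... = (99/1000)^3*3/4*L" using n0 by simp
   also have "... <= 1/200*L" using l5 by (intro mult_right_mono) (auto simp: L_def power_divide)
   finally have 1: "real D^3/(4*real k) <= g" by (simp add: g_def)
   have 2: "real k^3*lam^5 <= real n^3*lb n^5" using kn lamlb lam0 by (intro mult_mono power_mono) auto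
   have 3: "real k^5*lam^8 <= real n^5*lb n^8" using kn lamlb lam0 by (intro mult_mono power_mono) auto
   have "2*(x + y) <= 1" if "x <= 1/4" "y <= 1/4" for x y :: real
    using add_mono[OF that] by simp
   from this[OF order_trans[OF 2 less_imp_le[OF l2]] order_trans[OF 3 less_imp_le[OF l3]]]
   show ?thesis unfolding c_def by (rule add_mono[OF 1])
  qed
  have big: "real D < 7*lam*real k*exp (- c)"
  proof -
   have "exp c <= exp g*exp 1" using cg by (simp flip: exp_add)
   also have "... <= exp g*3" using exp_le by (intro mult_left_mono) auto
   finally have "real D*exp c <= real D*(exp g*3)" by (intro mult_left_mono) auto
   also have "... < 7*(real D*exp g)" using D0 by simp
   also have "... = 7*lam*real k" using k0 by (simp add: lam_def)
   finally have "real D*exp c*exp (- c) < 7*lam*real k*exp (- c)" by (intro mult_strict_right_mono) auto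
   then show ?thesis by (simp add: mult.assoc flip: exp_add)
  qed
  have low: "exp (real m*(ln (real k/real D) - g) - real (k*D)*(g + ln 32 + 1) - ln (32*(real (k*D) + 1))) <= rcard (\<G> n m)"
   by (rule card_induced_C4_free_hard_core[OF kn(1) m0(1) kD(1) many_edges[OF ceq c0 big] g0 lam_def])
  define Lm where "Lm = ln (real n^2/real m)"
  have lnkD: "Lm - 6 <= ln (real k/real D)"
  proof -
   have "real n^2/real m/297 <= real k/real D"
   proof -
    have "real n/3/(99*real m/real n) <= real k/real D" using kn Dn D0 m0 n0 by (intro frac_le) auto
    then show ?thesis by (simp add: power2_eq_square)
   qed
   then have "ln (real n^2/real m/297) <= ln (real k/real D)" using n0 m0 by (intro ln_mono) auto
   moreover have "ln (real n^2/real m/297) = Lm - ln 297" unfolding Lm_def using n0 m0 ln_div[of "real n^2/real m" 297] by simp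
   moreover have "ln 297 <= (6 :: real)"
   proof -
    have "ln (297 :: real) <= ln (exp 6)"
    proof (intro ln_mono)
     have "(1 + 6/real 60)^60 <= exp (6 :: real)" by (rule exp_ge_one_plus_x_over_n_power_n) auto
     moreover have "(297 :: real) <= (1 + 6/real 60)^60" by (simp add: power_divide)
     ultimately show "297 <= exp (6 :: real)" by linarith
    qed auto
    then show ?thesis by simp
   qed
   ultimately show ?thesis by linarith
  qed
  have ln32: "ln (32 :: real) <= 5"
  proof -
   have "ln (32 :: real) = 5*ln 2" using ln_realpow[of 2 5] by simp
   then show ?thesis using ln_2_less_1 by linarith
  qed
  have lowexp: "real m*(Lm - 34*g - 320) <= real m*(ln (real k/real D) - g) - real (k*D)*(g + ln 32 + 1) - ln (32*(real (k*D) + 1))"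
  proof -
   have 1: "real m*(Lm - 6 - g) <= real m*(ln (real k/real D) - g)" using lnkD by (intro mult_left_mono) auto
   have 2: "real (k*D)*(g + ln 32 + 1) <= (33*real m)*(g + 6)" using kD g0 ln32 by (intro mult_mono) auto
   have "ln (32*(real (k*D) + 1)) <= ln (32*(real (k*D) + 1)/(1088*real m)) + ln (1088*real m)"
    using m0 by (subst ln_mult_pos[symmetric]) (auto intro!: divide_pos_pos add_nonneg_pos mult_pos_pos)
   also have "ln (32*(real (k*D) + 1)/(1088*real m)) <= 0"
    using kD m0 by (subst ln_le_zero_iff) (auto intro!: divide_pos_pos add_nonneg_pos mult_pos_pos)
   also have "ln (1088*real m) = ln 1088 + ln (real m)" using m0 by (intro ln_mult_pos) auto
   also have "ln (real m) <= real m - 1" using m0 by (intro ln_le_minus_one) auto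
   also have "ln (1088 :: real) <= 1087" using ln_le_minus_one[of "1088 :: real"] by simp
   finally have 3: "ln (32*(real (k*D) + 1)) <= real m + 1086" by simp
   show ?thesis using 1 2 3 m0 by (simp add: algebra_simps)
  qed
  have mn2: "real m <= real n^2"
  proof -
   have "lb n*real n powr (2 - 1/200) = real n powr (4/3)*L powr (1/3)"
    by (simp add: lb_def L_def mult_ac flip: powr_add)
   moreover have "lb n*real n powr (2 - 1/200) <= 1*real n powr 2" using l1 n10 by (intro mult_mono powr_mono) auto
   moreover have "real n powr 2 = real n^2" using n0 by simp
   moreover have "0 <= real n powr (4/3)*L powr (1/3)" by simp
   ultimately show ?thesis using hi unfolding L_def by linarith
  qed
  have "rcard {G \<in> \<G> n m. \<not> \<not> close_to_split (1/4) {1..n} G}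
   <= rcard {G. G <= nsets {1..n} 2 & card G = m & close_to_split (1/4) {1..n} G}"
  proof (intro of_nat_mono card_mono)
   show "finite {G. G <= nsets {1..n} 2 & card G = m & close_to_split (1/4) {1..n} G}"
    by (rule finite_subset[of _ "Pow (nsets {1..n} 2)"]) (auto intro: finite_imp_finite_nsets)
   show "{G \<in> \<G> n m. \<not> \<not> close_to_split (1/4) {1..n} G} <= {G. G <= nsets {1..n} 2 & card G = m & close_to_split (1/4) {1..n} G}"
    unfolding induced_C4_free_graphs_def by blast
  qed
  also have "... <= 2^n*exp (5/2*real m + 5/8*real m*Lm)"
   unfolding Lm_def by (rule card_close_to_split_le) (use m0 mn2 n10 in auto)
  also have "... <= exp (real m)*exp (5/2*real m + 5/8*real m*Lm)"
  proof (rule mult_right_mono)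
   have "(2::real)^n <= exp 1^n" using exp_ge_add_one_self[of 1] by (intro power_mono) auto
   also have "... = exp (real n)" by (simp flip: exp_of_nat_mult)
   also have "... <= exp (real m)" using nm by simp
   finally show "(2::real)^n <= exp (real m)" .
  qed simp
  also have "... = exp (real m*(7/2 + 5/8*Lm))" by (simp add: algebra_simps flip: exp_add)
  also have "... <= exp (- real m + real m*(Lm - 34*g - 320))"
  proof -
   have "2/3*L - 1/3*ln L <= Lm"
   proof -
    have "real m <= 1*(real n powr (4/3)*L powr (1/3))" using hi mult_right_mono[of "1/1000" 1 "real n powr (4/3)*L powr (1/3)"] unfolding L_def by simp
    then have "ln (real m) <= ln (real n powr (4/3)*L powr (1/3))" using m0 by (intro ln_mono) auto
    also have "... = 4/3*L + 1/3*ln L" using n0 l5 by (subst ln_mult_pos) (auto simp: ln_powr L_def)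
    finally have "ln (real m) <= 4/3*L + 1/3*ln L" .
    moreover have "Lm = 2*L - ln (real m)" unfolding Lm_def L_def using n0 m0 by (simp add: ln_div ln_realpow)
    ultimately show ?thesis by linarith
   qed
   then have "7/2 + 5/8*Lm <= - 1 + (Lm - 34*g - 320)" using l4 unfolding g_def L_def by (rule lin)
   then have "real m*(7/2 + 5/8*Lm) <= real m*(- 1 + (Lm - 34*g - 320))" by (intro mult_left_mono) auto
   then show ?thesis by (simp add: algebra_simps)
  qed
  finally have up: "rcard {G \<in> \<G> n m. \<not> \<not> close_to_split (1/4) {1..n} G} <= exp (- real m + real m*(Lm - 34*g - 320))" .
  have low': "exp (real m*(Lm - 34*g - 320)) <= rcard (\<G> n m)"
   using lowexp low by (meson exp_le_cancel_iff order_trans)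
  then have pos: "0 < rcard (\<G> n m)" by (rule less_le_trans[OF exp_gt_zero])
  have "exp (- real m)*exp (real m*(Lm - 34*g - 320)) <= exp (- real n)*rcard (\<G> n m)"
   using nm low' by (intro mult_mono) auto
  moreover have "exp (- real m + real m*(Lm - 34*g - 320)) = exp (- real m)*exp (real m*(Lm - 34*g - 320))" by (rule exp_add)
  ultimately show ?thesis using up pos by simp
 qed
 show "asymptotically_almost_surely (%n. \<G> n (mm n)) (%n G. \<not> close_to_split (1/4) {1..n} G)"
 proof (rule asymptotically_almost_surely_of_count)
  show "\<forall>\<^sub>F n in sequentially. finite (\<G> n (mm n)) & 0 < card (\<G> n (mm n)) &
   rcard {G \<in> \<G> n (mm n). \<not> \<not> close_to_split (1/4) {1..n} G} <= exp (- real n)*rcard (\<G> n (mm n))"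
   using ev ev1 ev2 ev3 ev4 ev5 ev6 eventually_ge_at_top[of "10 :: nat"]
  proof eventually_elim
   case (elim n)
   then show ?case using main[of "mm n" n] finite_induced_C4_free by simp
  qed
  show "(%n. exp (- real n)) \<longlonglongrightarrow> 0" by real_asymp
 qed
qed

section \<open>Monotonicity in \<epsilon> and combination of the three parts\<close>

lemma quasirandom_mono:
 assumes "quasirandom \<epsilon>' V G" "\<epsilon>' <= \<epsilon>"
 shows "quasirandom \<epsilon> V G"
 unfolding quasirandom_def
proof (intro allI impI)
 fix X assume X: "X <= V & rcard X > \<epsilon>*rcard V"
 have "\<epsilon>'*rcard V <= \<epsilon>*rcard V" using assms(2) by (intro mult_right_mono) auto
 then have "(1 - \<epsilon>')*edge_density G V <= edge_density G X" "edge_density G X <= (1 + \<epsilon>')*edge_density G V"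
  using assms(1) X unfolding quasirandom_def by auto
 moreover have "0 <= edge_density G V" by (simp add: edge_density_def)
 then have "(1 - \<epsilon>)*edge_density G V <= (1 - \<epsilon>')*edge_density G V" "(1 + \<epsilon>')*edge_density G V <= (1 + \<epsilon>)*edge_density G V"
  using assms(2) by (auto intro!: mult_right_mono)
 ultimately show "(1 - \<epsilon>)*edge_density G V <= edge_density G X & edge_density G X <= (1 + \<epsilon>)*edge_density G V" by linarith
qed

lemma close_to_split_mono:
 assumes "close_to_split \<epsilon>' V G" "\<epsilon>' <= \<epsilon>"
 shows "close_to_split \<epsilon> V G"
proof -
 from assms(1) obtain A B where AB: "A Un B = V" "A Int B = {}" "real (edges_within G A) >= (1 - \<epsilon>')*real (card A choose 2)"
  "real (edges_within G B) <= \<epsilon>'*rcard G" unfolding close_to_split_def by blast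
 have "(1 - \<epsilon>)*real (card A choose 2) <= (1 - \<epsilon>')*real (card A choose 2)" "\<epsilon>'*rcard G <= \<epsilon>*rcard G"
  using assms(2) by (auto intro!: mult_right_mono)
 then have "real (edges_within G A) >= (1 - \<epsilon>)*real (card A choose 2)" "real (edges_within G B) <= \<epsilon>*rcard G"
  using AB(3,4) by linarith+
 then show ?thesis unfolding close_to_split_def using AB(1,2) by blast
qed

lemma asymptotically_almost_surely_mono:
 assumes "asymptotically_almost_surely S P" "\<And>n G. P n G ==> Q n G"
 shows "asymptotically_almost_surely S Q"
 using assms(1) unfolding asymptotically_almost_surely_def
proof (rule tendsto_sandwich[rotated 2])
 show "\<forall>\<^sub>F n in sequentially. measure_pmf.prob (pmf_of_set (S n)) {G. P n G} <= measure_pmf.prob (pmf_of_set (S n)) {G. Q n G}"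
  using assms(2) by (intro always_eventually allI measure_pmf.finite_measure_mono) auto
 show "\<forall>\<^sub>F n in sequentially. measure_pmf.prob (pmf_of_set (S n)) {G. Q n G} <= 1" by simp
qed simp

lemma close_to_split_aas:
 assumes eps: "0 < \<epsilon>" "\<epsilon> <= 1"
 shows "\<exists>\<delta>>0. \<forall>m. (\<forall>\<^sub>F n in sequentially. real n powr (4/3)*ln (real n)^4 <= real (m n) & real (m n) <= \<delta>*real n^2) -->
  asymptotically_almost_surely (%n. \<G> n (m n)) (%n G. close_to_split \<epsilon> {1..n} G)"
proof -
 obtain \<delta> c where d: "\<delta> > 0" "c > 0" and ev: "\<forall>\<^sub>F n in sequentially. \<forall>m. real n powr (4/3)*ln (real n)^4 <= real m --> real m <= \<delta>*real n^2 -->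
   0 < card (\<G> n m) &
   rcard {G \<in> \<G> n m. \<not> close_to_split \<epsilon> {1..n} G} <= exp (- c*real m)*rcard (\<G> n m)"
  using card_not_close_exp_small[OF eps] by blast
 show ?thesis
 proof (intro exI[of _ \<delta>] conjI allI impI d)
  fix m :: "nat => nat"
  assume m: "\<forall>\<^sub>F n in sequentially. real n powr (4/3)*ln (real n)^4 <= real (m n) & real (m n) <= \<delta>*real n^2"
  show "asymptotically_almost_surely (%n. \<G> n (m n)) (%n G. close_to_split \<epsilon> {1..n} G)"
  proof (rule asymptotically_almost_surely_of_count)
   show "\<forall>\<^sub>F n in sequentially. finite (\<G> n (m n)) & 0 < card (\<G> n (m n)) &
    rcard {G \<in> \<G> n (m n). \<not> close_to_split \<epsilon> {1..n} G}
     <= exp (- c*(real n powr (4/3)*ln (real n)^4))*rcard (\<G> n (m n))"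
    using m ev
   proof eventually_elim
    case (elim n)
    then have 1: "0 < card (\<G> n (m n))"
     "rcard {G \<in> \<G> n (m n). \<not> close_to_split \<epsilon> {1..n} G} <= exp (- c*real (m n))*rcard (\<G> n (m n))"
     by blast+
    have "exp (- c*real (m n)) <= exp (- c*(real n powr (4/3)*ln (real n)^4))" using elim(1) d(2) by simp
    then have "exp (- c*real (m n))*rcard (\<G> n (m n)) <= exp (- c*(real n powr (4/3)*ln (real n)^4))*rcard (\<G> n (m n))"
     by (rule mult_right_mono) simp
    then show ?case using 1 finite_induced_C4_free by (meson order_trans)
   qed
   show "(%n. exp (- c*(real n powr (4/3)*ln (real n)^4))) \<longlonglongrightarrow> 0" using d(2) by real_asymp
  qed
 qed
qed

theorem theorem1p2:
  fixes \<epsilon> :: real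
  assumes "\<epsilon> > 0"
  shows "\<exists>\<delta>::real. \<delta> > 0 \<and> (\<forall>m :: nat \<Rightarrow> nat.
    ((\<lambda>n. real n) \<in> o(\<lambda>n. real (m n)) \<and>
     (\<forall>\<^sub>F n in sequentially. real (m n) \<le> \<delta> * real n powr (4/3))
       \<longrightarrow> asymptotically_almost_surely (\<lambda>n. induced_C4_free_graphs n (m n))
             (\<lambda>n G. quasirandom \<epsilon> {1..n} G)) \<and>
    ((\<lambda>n. real n) \<in> o(\<lambda>n. real (m n)) \<and>
     (\<forall>\<^sub>F n in sequentially. real (m n) \<le> \<delta> * real n powr (4/3) * ln (real n) powr (1/3))
       \<longrightarrow> asymptotically_almost_surely (\<lambda>n. induced_C4_free_graphs n (m n))
             (\<lambda>n G. \<not> close_to_split (1/4) {1..n} G)) \<and>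
    ((\<forall>\<^sub>F n in sequentially. real n powr (4/3) * ln (real n) ^ 4 \<le> real (m n) \<and>
                           real (m n) \<le> \<delta> * real n ^ 2)
       \<longrightarrow> asymptotically_almost_surely (\<lambda>n. induced_C4_free_graphs n (m n))
             (\<lambda>n G. close_to_split \<epsilon> {1..n} G)))"
proof -
 \<comment> \<open>The estimates assume \<epsilon> at most 1; quasirandomness and closeness to split
   both weaken as \<epsilon> grows, so larger values reduce to 1.\<close>
 define \<epsilon>' where "\<epsilon>' = min \<epsilon> 1"
 have e: "0 < \<epsilon>'" "\<epsilon>' <= 1" "\<epsilon>' <= \<epsilon>" using assms by (auto simp: \<epsilon>'_def)
 obtain da where da: "da > 0" "\<And>m. (%n. real n) \<in> o(%n. real (m n)) ==> (\<forall>\<^sub>F n in sequentially. real (m n) <= da*real n powr (4/3)) ==>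
  asymptotically_almost_surely (%n. \<G> n (m n)) (%n G. quasirandom \<epsilon>' {1..n} G)"
  using quasirandom_aas[OF e(1,2)] by blast
 obtain dc where dc: "dc > 0" "\<And>m. (\<forall>\<^sub>F n in sequentially. real n powr (4/3)*ln (real n)^4 <= real (m n) & real (m n) <= dc*real n^2) ==>
  asymptotically_almost_surely (%n. \<G> n (m n)) (%n G. close_to_split \<epsilon>' {1..n} G)"
  using close_to_split_aas[OF e(1,2)] by blast
 define \<delta> where "\<delta> = min da (min (1/1000) dc)"
 have d: "\<delta> > 0" "\<delta> <= da" "\<delta> <= 1/1000" "\<delta> <= dc" using da(1) dc(1) by (auto simp: \<delta>_def)
 show ?thesis
 proof (intro exI[of _ \<delta>] conjI allI impI d(1); (elim conjE)?)
  fix m :: "nat => nat"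
  assume o: "(%n. real n) \<in> o(%n. real (m n))" and h: "\<forall>\<^sub>F n in sequentially. real (m n) <= \<delta>*real n powr (4/3)"
  have "\<forall>\<^sub>F n in sequentially. real (m n) <= da*real n powr (4/3)"
   using h
  proof eventually_elim
   case (elim n)
   have "\<delta>*real n powr (4/3) <= da*real n powr (4/3)" by (rule mult_right_mono[OF d(2)]) simp
   then show ?case using elim by linarith
  qed
  then show "asymptotically_almost_surely (%n. \<G> n (m n)) (%n G. quasirandom \<epsilon> {1..n} G)"
   by (rule asymptotically_almost_surely_mono[OF da(2)[OF o]]) (rule quasirandom_mono[OF _ e(3)])
 next
  fix m :: "nat => nat"
  assume o: "(%n. real n) \<in> o(%n. real (m n))" and h: "\<forall>\<^sub>F n in sequentially. real (m n) <= \<delta>*real n powr (4/3)*ln (real n) powr (1/3)"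
  have "\<forall>\<^sub>F n in sequentially. real (m n) <= 1/1000*real n powr (4/3)*ln (real n) powr (1/3)"
   using h
  proof eventually_elim
   case (elim n)
   have "\<delta>*(real n powr (4/3)*ln (real n) powr (1/3)) <= 1/1000*(real n powr (4/3)*ln (real n) powr (1/3))"
    by (rule mult_right_mono[OF d(3)]) simp
   then show ?case using elim by (simp add: mult.assoc)
  qed
  then show "asymptotically_almost_surely (%n. \<G> n (m n)) (%n G. \<not> close_to_split (1/4) {1..n} G)"
   using not_close_aas o by blast
 next
  fix m :: "nat => nat"
  assume h: "\<forall>\<^sub>F n in sequentially. real n powr (4/3)*ln (real n)^4 <= real (m n) & real (m n) <= \<delta>*real n^2"
  have "\<forall>\<^sub>F n in sequentially. real n powr (4/3)*ln (real n)^4 <= real (m n) & real (m n) <= dc*real n^2"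
   using h
  proof eventually_elim
   case (elim n)
   have "\<delta>*real n^2 <= dc*real n^2" by (rule mult_right_mono[OF d(4)]) simp
   then show ?case using elim by linarith
  qed
  then show "asymptotically_almost_surely (%n. \<G> n (m n)) (%n G. close_to_split \<epsilon> {1..n} G)"
   by (rule asymptotically_almost_surely_mono[OF dc(2)]) (rule close_to_split_mono[OF _ e(3)])
 qed
qed

end
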